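(* Let $k$ be a field of characteristic $0$, and let $\mathcal I\subset k\langle X\rangle$, $X=\{X_1,\dots,X_g\}$, be an ideal that is frr with rational resolvent $r$ with respect to a decomposition $X=X'\cup X''$. Then the coproduct of $k\langle X\rangle/\mathcal I$ and $k(\!\langle X'\rangle\!)_{h(r)}$ over $k\langle X'\rangle$ is faithful if at least one of the following holds: (a) $k\langle X\rangle/\mathcal I$ is a fir, or more generally, a Sylvester domain; or (b) $h(r)\le1$ and $k\langle X\rangle/\mathcal I$ embeds into a skew field.
   Context: $k\langle X\rangle$ is the free associative unital algebra over $k$ in the freely noncommuting variables $X_1,\dots,X_g$; "ideal" means two-sided ideal. Free skew field. An nc rational expression in $X$ is a formal expression built from elements of $k\langle X\rangle$ using addition, multiplication and inversion; its domain $\operatorname{dom} r$ is the set of all $g$-tuples of square matrices over $k$ (of all sizes) at which all the inverses occurring in $r$ exist. Only expressions with nonempty domain are considered. Expressions $r_1,r_2$ are equivalent if $r_1(A)=r_2(A)$ for all $A\in\operatorname{dom} r_1\cap\operatorname{dom} r_2$; equivalence classes are called (nc) rational functions, and they form a skew field $k(\!\langle X\rangle\!)$, the free skew field, which is the universal skew field of fractions of $k\langle X\rangle$. The height of an expression is the maximal number of nested inverses in it; the height of a rational function is the minimum of heights of the expressions representing it. $k(\!\langle X\rangle\!)_h$ is the subring of rational functions of height at most $h$; for a tuple $r$ of rational functions, $h(r)$ is the maximum of the heights of its components. Formal rational resolvability. Fix a partition $X=X'\cup X''=\{X'_1,\dots,X'_{g'}\}\cup\{X''_1,\dots,X''_{g''}\}$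 (a decomposition of $X$) and a tuple $r=(r_1,\dots,r_{g''})$ with $r_j\in k(\!\langle X'\rangle\!)$. Let $R_r$ be the subring of $k(\!\langle X\rangle\!)$ generated by $k(\!\langle X'\rangle\!)_{h(r)}$ and $k\langle X\rangle$, and let $\mathcal I_r$ be the ideal of $R_r$ generated by $\{X''_j-r_j(X')\}_j$. An ideal $\mathcal I\subset k\langle X\rangle$ is formally rationally resolvable (frr) with rational resolvent $r$ (with respect to the decomposition) if $\mathcal I\cap k\langle X'\rangle=0$ and $\mathcal I$ generates $\mathcal I_r$ as an ideal in $R_r$. Coproduct. If $S$ is a subring of rings $R_1$ and $R_2$, the coproduct $R_1*_SR_2$ is the pushout of $R_1$ and $R_2$ over $S$ in the category of rings; it is faithful if the canonical maps $R_1\to R_1*_SR_2$ and $R_2\to R_1*_SR_2$ are injective. Since $\mathcal I\cap k\langle X'\rangle=0$, $k\langle X'\rangle$ is regarded as a subring of both $k\langle X\rangle/\mathcal I$ and $k(\!\langle X'\rangle\!)_{h(r)}$. Rings. The inner rank $\rho(A)$ of an $m\times n$ matrix $A$ over a ring $R$ is the least $t$ such that $A=BC$ with $B$ of size $m\times t$ and $C$ of size $t\times n$ over $R$. A nonzero ring $R$ is a Sylvester domain if for all matrices $A$ ($m\times n$) and $B$ ($n\times p$) over $R$ with $AB=0$ one has $\rho(A)+\rho(B)\le n$. A ring is a free ideal ring (fir) if every left (right) ideal is a free left (right) module of unique rank. *)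

theory Defs
  imports
    "HOL-Library.Poly_Mapping"
    "HOL-Library.Equipollence"
    "HOL-Algebra.Algebra"
    "Jordan_Normal_Form.Gauss_Jordan_Elimination"
begin

section \<open>Free algebras\<close>

datatype 'x nc_word = NC_Word (letters: "'x list")

instantiation nc_word :: (type) monoid_add
begin

definition zero_nc_word :: "'x nc_word" where
  "zero_nc_word = NC_Word []"

definition plus_nc_word :: "'x nc_word \<Rightarrow> 'x nc_word \<Rightarrow> 'x nc_word" where
  "plus_nc_word u v = NC_Word (letters u @ letters v)"

instance
  by standard (auto simp: zero_nc_word_def plus_nc_word_def)

end

text \<open>
  The product of \<^typ>\<open>'x nc_word \<Rightarrow>\<^sub>0 'k::ring_1\<close> is convolution with respect to
  concatenation of words (the additive notation on words is forced by
  \<^theory>\<open>HOL-Library.Poly_Mapping\<close>), so this is the free associative unital algebra.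
\<close>

type_synonym ('x, 'k) nc_poly = "'x nc_word \<Rightarrow>\<^sub>0 'k"

definition nc_var :: "'x \<Rightarrow> ('x, 'k::ring_1) nc_poly" where
  "nc_var x = Poly_Mapping.single (NC_Word [x]) 1"

definition nc_poly_vars :: "('x, 'k::zero) nc_poly \<Rightarrow> 'x set" where
  "nc_poly_vars p = (\<Union>w\<in>Poly_Mapping.keys p. set (letters w))"

definition free_alg :: "'x set \<Rightarrow> ('x, 'k::ring_1) nc_poly ring" where
  "free_alg V = \<lparr>carrier = {p. nc_poly_vars p \<subseteq> V}, monoid.mult = (*), one = 1, ring.zero = 0, ring.add = (+)\<rparr>"


section \<open>Rational expressions and the free skew field\<close>

context notes [[typedef_overloaded]]
begin

datatype ('x, 'k::zero) nc_expr =
    NC_Poly "('x, 'k) nc_poly"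
  | NC_Add "('x, 'k) nc_expr" "('x, 'k) nc_expr"
  | NC_Mult "('x, 'k) nc_expr" "('x, 'k) nc_expr"
  | NC_Inv "('x, 'k) nc_expr"

end

primrec nc_expr_vars :: "('x, 'k::zero) nc_expr \<Rightarrow> 'x set" where
  "nc_expr_vars (NC_Poly p) = nc_poly_vars p"
| "nc_expr_vars (NC_Add a b) = nc_expr_vars a \<union> nc_expr_vars b"
| "nc_expr_vars (NC_Mult a b) = nc_expr_vars a \<union> nc_expr_vars b"
| "nc_expr_vars (NC_Inv a) = nc_expr_vars a"

primrec nc_expr_height :: "('x, 'k::zero) nc_expr \<Rightarrow> nat" where
  "nc_expr_height (NC_Poly p) = 0"
| "nc_expr_height (NC_Add a b) = max (nc_expr_height a) (nc_expr_height b)"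
| "nc_expr_height (NC_Mult a b) = max (nc_expr_height a) (nc_expr_height b)"
| "nc_expr_height (NC_Inv a) = Suc (nc_expr_height a)"

definition nc_word_eval :: "nat \<Rightarrow> ('x \<Rightarrow> 'k::field mat) \<Rightarrow> 'x nc_word \<Rightarrow> 'k mat" where
  "nc_word_eval n A w = foldr (\<lambda>x M. A x * M) (letters w) (1\<^sub>m n)"

definition nc_poly_eval :: "nat \<Rightarrow> ('x \<Rightarrow> 'k::field mat) \<Rightarrow> ('x, 'k) nc_poly \<Rightarrow> 'k mat" where
  "nc_poly_eval n A p = mat n n (\<lambda>(i, j).
     \<Sum>w\<in>Poly_Mapping.keys p. Poly_Mapping.lookup p w * nc_word_eval n A w $$ (i, j))"

text \<open>The value is \<^term>\<open>None\<close> iff some inverse occurring in the expression does not exist.\<close>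

primrec nc_expr_eval :: "nat \<Rightarrow> ('x \<Rightarrow> 'k::field mat) \<Rightarrow> ('x, 'k) nc_expr \<Rightarrow> 'k mat option" where
  "nc_expr_eval n A (NC_Poly p) = Some (nc_poly_eval n A p)"
| "nc_expr_eval n A (NC_Add a b) =
     (case (nc_expr_eval n A a, nc_expr_eval n A b) of
        (Some M, Some N) \<Rightarrow> Some (M + N) | _ \<Rightarrow> None)"
| "nc_expr_eval n A (NC_Mult a b) =
     (case (nc_expr_eval n A a, nc_expr_eval n A b) of
        (Some M, Some N) \<Rightarrow> Some (M * N) | _ \<Rightarrow> None)"
| "nc_expr_eval n A (NC_Inv a) =
     (case nc_expr_eval n A a of Some M \<Rightarrow> mat_inverse M | None \<Rightarrow> None)"

text \<open>
  Size \<open>0\<close> must be excluded: the empty matrix is invertible, so otherwise no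
  expression would have an empty domain.
\<close>

definition nc_dom :: "('x, 'k::field) nc_expr \<Rightarrow> (nat \<times> ('x \<Rightarrow> 'k mat)) set" where
  "nc_dom a = {(n, A). 0 < n \<and> (\<forall>x. A x \<in> carrier_mat n n) \<and> nc_expr_eval n A a \<noteq> None}"

definition nc_equiv :: "(('x, 'k::field) nc_expr \<times> ('x, 'k) nc_expr) set" where
  "nc_equiv = {(a, b). nc_dom a \<noteq> {} \<and> nc_dom b \<noteq> {} \<and>
     (\<forall>(n, A) \<in> nc_dom a \<inter> nc_dom b. nc_expr_eval n A a = nc_expr_eval n A b)}"

type_synonym ('x, 'k) nc_ratfun = "('x, 'k) nc_expr set"

definition ratfun_of :: "('x, 'k::field) nc_expr \<Rightarrow> ('x, 'k) nc_ratfun" where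
  "ratfun_of a = nc_equiv `` {a}"

text \<open>
  The free skew field in the variables \<open>V\<close>, realised inside the free skew field in all variables:
  an expression in \<open>V\<close> does not depend on the other entries of a tuple, so neither
  nonemptiness of its domain nor equivalence of two such expressions is affected.
\<close>

definition ratfuns :: "'x set \<Rightarrow> ('x, 'k::field) nc_ratfun set" where
  "ratfuns V = {ratfun_of a | a. nc_dom a \<noteq> {} \<and> nc_expr_vars a \<subseteq> V}"

definition free_skew_field :: "('x, 'k::field) nc_ratfun ring" where
  "free_skew_field = \<lparr>carrier = ratfuns UNIV,
     monoid.mult = (\<lambda>f g. \<Union>a\<in>f. \<Union>b\<in>g. ratfun_of (NC_Mult a b)),
     one = ratfun_of (NC_Poly 1),
     ring.zero = ratfun_of (NC_Poly 0),
     ring.add = (\<lambda>f g. \<Union>a\<in>f. \<Union>b\<in>g. ratfun_of (NC_Add a b))\<rparr>"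

text \<open>The height of an element of \<^term>\<open>ratfuns V\<close>, measured by expressions in \<open>V\<close>.\<close>

definition ratfun_height :: "'x set \<Rightarrow> ('x, 'k::field) nc_ratfun \<Rightarrow> nat" where
  "ratfun_height V f = (LEAST h. \<exists>a\<in>f. nc_expr_vars a \<subseteq> V \<and> nc_expr_height a = h)"

definition ratfuns_le :: "'x set \<Rightarrow> nat \<Rightarrow> ('x, 'k::field) nc_ratfun set" where
  "ratfuns_le V h = {f \<in> ratfuns V. ratfun_height V f \<le> h}"

abbreviation free_skew_field_le :: "'x set \<Rightarrow> nat \<Rightarrow> ('x, 'k::field) nc_ratfun ring" where
  "free_skew_field_le V h \<equiv> free_skew_field\<lparr>carrier := ratfuns_le V h\<rparr>"


section \<open>Formal rational resolvability\<close>

text \<open>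
  A decomposition of the finite set \<open>UNIV\<close> of variables is given by \<open>V\<close> (the \<open>X'\<close>) and its
  complement (the \<open>X''\<close>); only the values of \<open>r\<close> on \<^term>\<open>- V\<close> matter.
  The \<open>0\<close> inserted below is for the case that \<^term>\<open>- V\<close> is empty.
\<close>

definition resolvent_height :: "'x::finite set \<Rightarrow> ('x \<Rightarrow> ('x, 'k::field) nc_ratfun) \<Rightarrow> nat" where
  "resolvent_height V r = Max (insert 0 ((\<lambda>j. ratfun_height V (r j)) ` (- V)))"

definition resolvent_ring ::
    "'x::finite set \<Rightarrow> ('x \<Rightarrow> ('x, 'k::field) nc_ratfun) \<Rightarrow> ('x, 'k) nc_ratfun ring" where
  "resolvent_ring V r = free_skew_field\<lparr>carrier := generate_ring free_skew_field
     (ratfuns_le V (resolvent_height V r) \<union> range (\<lambda>p. ratfun_of (NC_Poly p)))\<rparr>"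

definition resolvent_ideal ::
    "'x::finite set \<Rightarrow> ('x \<Rightarrow> ('x, 'k::field) nc_ratfun) \<Rightarrow> ('x, 'k) nc_ratfun set" where
  "resolvent_ideal V r = genideal (resolvent_ring V r)
     {ratfun_of (NC_Poly (nc_var j)) \<ominus>\<^bsub>free_skew_field\<^esub> r j | j. j \<in> - V}"

definition frr ::
    "'x::finite set \<Rightarrow> ('x \<Rightarrow> ('x, 'k::field) nc_ratfun) \<Rightarrow> ('x, 'k) nc_poly set \<Rightarrow> bool" where
  "frr V r I \<longleftrightarrow>
     ideal I (free_alg UNIV) \<and>
     (\<forall>j\<in>- V. r j \<in> ratfuns V) \<and>
     I \<inter> carrier (free_alg V) = {0} \<and>
     genideal (resolvent_ring V r) ((\<lambda>p. ratfun_of (NC_Poly p)) ` I) = resolvent_ideal V r"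


section \<open>Sylvester domains, firs and skew fields\<close>

text \<open>
  An \<open>m \<times> n\<close> matrix over \<open>R\<close> is a function \<^typ>\<open>nat \<Rightarrow> nat \<Rightarrow> 'a\<close> of which only the entries
  with row index below \<open>m\<close> and column index below \<open>n\<close> are relevant.
\<close>

definition ring_matrix :: "('a, 'b) ring_scheme \<Rightarrow> nat \<Rightarrow> nat \<Rightarrow> (nat \<Rightarrow> nat \<Rightarrow> 'a) \<Rightarrow> bool" where
  "ring_matrix R m n A \<longleftrightarrow> (\<forall>i<m. \<forall>j<n. A i j \<in> carrier R)"

definition ring_matrix_mult ::
    "('a, 'b) ring_scheme \<Rightarrow> nat \<Rightarrow> (nat \<Rightarrow> nat \<Rightarrow> 'a) \<Rightarrow> (nat \<Rightarrow> nat \<Rightarrow> 'a) \<Rightarrow> nat \<Rightarrow> nat \<Rightarrow> 'a" where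
  "ring_matrix_mult R n A B i j = (\<Oplus>\<^bsub>R\<^esub>l\<in>{..<n}. A i l \<otimes>\<^bsub>R\<^esub> B l j)"

definition inner_rank :: "('a, 'b) ring_scheme \<Rightarrow> nat \<Rightarrow> nat \<Rightarrow> (nat \<Rightarrow> nat \<Rightarrow> 'a) \<Rightarrow> nat" where
  "inner_rank R m n A = (LEAST t. \<exists>B C. ring_matrix R m t B \<and> ring_matrix R t n C \<and>
     (\<forall>i<m. \<forall>j<n. A i j = ring_matrix_mult R t B C i j))"

definition sylvester_domain :: "('a, 'b) ring_scheme \<Rightarrow> bool" where
  "sylvester_domain R \<longleftrightarrow> ring R \<and> \<one>\<^bsub>R\<^esub> \<noteq> \<zero>\<^bsub>R\<^esub> \<and>
     (\<forall>m n p A B. ring_matrix R m n A \<and> ring_matrix R n p B \<and>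
        (\<forall>i<m. \<forall>j<p. ring_matrix_mult R n A B i j = \<zero>\<^bsub>R\<^esub>) \<longrightarrow>
        inner_rank R m n A + inner_rank R n p B \<le> n)"

definition left_ideal :: "('a, 'b) ring_scheme \<Rightarrow> 'a set \<Rightarrow> bool" where
  "left_ideal R L \<longleftrightarrow> additive_subgroup L R \<and> (\<forall>a\<in>carrier R. \<forall>x\<in>L. a \<otimes>\<^bsub>R\<^esub> x \<in> L)"

definition left_basis :: "('a, 'b) ring_scheme \<Rightarrow> 'a set \<Rightarrow> 'a set \<Rightarrow> bool" where
  "left_basis R L B \<longleftrightarrow> B \<subseteq> L \<and>
     (\<forall>x\<in>L. \<exists>F c. finite F \<and> F \<subseteq> B \<and> c \<in> F \<rightarrow> carrier R \<and> x = (\<Oplus>\<^bsub>R\<^esub>b\<in>F. c b \<otimes>\<^bsub>R\<^esub> b)) \<and>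
     (\<forall>F c. finite F \<and> F \<subseteq> B \<and> c \<in> F \<rightarrow> carrier R \<and> (\<Oplus>\<^bsub>R\<^esub>b\<in>F. c b \<otimes>\<^bsub>R\<^esub> b) = \<zero>\<^bsub>R\<^esub> \<longrightarrow>
        (\<forall>b\<in>F. c b = \<zero>\<^bsub>R\<^esub>))"

definition left_fir :: "('a, 'b) ring_scheme \<Rightarrow> bool" where
  "left_fir R \<longleftrightarrow> (\<forall>L. left_ideal R L \<longrightarrow>
     (\<exists>B. left_basis R L B) \<and> (\<forall>B B'. left_basis R L B \<and> left_basis R L B' \<longrightarrow> B \<approx> B'))"

definition opposite_ring :: "('a, 'b) ring_scheme \<Rightarrow> ('a, 'b) ring_scheme" where
  "opposite_ring R = R\<lparr>monoid.mult := \<lambda>x y. y \<otimes>\<^bsub>R\<^esub> x\<rparr>"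

definition fir :: "('a, 'b) ring_scheme \<Rightarrow> bool" where
  "fir R \<longleftrightarrow> ring R \<and> left_fir R \<and> left_fir (opposite_ring R)"

definition skew_field :: "('a, 'b) ring_scheme \<Rightarrow> bool" where
  "skew_field D \<longleftrightarrow> ring D \<and> Units D = carrier D - {\<zero>\<^bsub>D\<^esub>}"


section \<open>Coproducts\<close>

text \<open>
  The pushout of ring homomorphisms \<open>f1 : S \<rightarrow> R1\<close> and \<open>f2 : S \<rightarrow> R2\<close>, by
  generators (the disjoint union of the underlying sets) and relations. The universal property
  is proved below.
\<close>

definition hom_rels ::
    "('a, 'm) ring_scheme \<Rightarrow> ('a \<Rightarrow> 'c) \<Rightarrow> ('c, int) nc_poly set" where
  "hom_rels R i =
     {nc_var (i (a \<oplus>\<^bsub>R\<^esub> b)) - (nc_var (i a) + nc_var (i b)) | a b. a \<in> carrier R \<and> b \<in> carrier R} \<union>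
     {nc_var (i (a \<otimes>\<^bsub>R\<^esub> b)) - nc_var (i a) * nc_var (i b) | a b. a \<in> carrier R \<and> b \<in> carrier R} \<union>
     {nc_var (i \<one>\<^bsub>R\<^esub>) - 1}"

definition coproduct_free ::
    "('a, 'm) ring_scheme \<Rightarrow> ('b, 'n) ring_scheme \<Rightarrow> ('a + 'b, int) nc_poly ring" where
  "coproduct_free R1 R2 = free_alg (carrier R1 <+> carrier R2)"

definition coproduct_rels ::
    "('s, 'l) ring_scheme \<Rightarrow> ('s \<Rightarrow> 'a) \<Rightarrow> ('s \<Rightarrow> 'b) \<Rightarrow>
     ('a, 'm) ring_scheme \<Rightarrow> ('b, 'n) ring_scheme \<Rightarrow> ('a + 'b, int) nc_poly set" where
  "coproduct_rels S f1 f2 R1 R2 = hom_rels R1 Inl \<union> hom_rels R2 Inr \<union>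
     {nc_var (Inl (f1 s)) - nc_var (Inr (f2 s)) | s. s \<in> carrier S}"

definition coproduct_ideal ::
    "('s, 'l) ring_scheme \<Rightarrow> ('s \<Rightarrow> 'a) \<Rightarrow> ('s \<Rightarrow> 'b) \<Rightarrow>
     ('a, 'm) ring_scheme \<Rightarrow> ('b, 'n) ring_scheme \<Rightarrow> ('a + 'b, int) nc_poly set" where
  "coproduct_ideal S f1 f2 R1 R2 = genideal (coproduct_free R1 R2) (coproduct_rels S f1 f2 R1 R2)"

definition coproduct ::
    "('s, 'l) ring_scheme \<Rightarrow> ('s \<Rightarrow> 'a) \<Rightarrow> ('s \<Rightarrow> 'b) \<Rightarrow>
     ('a, 'm) ring_scheme \<Rightarrow> ('b, 'n) ring_scheme \<Rightarrow> ('a + 'b, int) nc_poly set ring" where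
  "coproduct S f1 f2 R1 R2 = coproduct_free R1 R2 Quot coproduct_ideal S f1 f2 R1 R2"

definition coproduct_in1 ::
    "('s, 'l) ring_scheme \<Rightarrow> ('s \<Rightarrow> 'a) \<Rightarrow> ('s \<Rightarrow> 'b) \<Rightarrow>
     ('a, 'm) ring_scheme \<Rightarrow> ('b, 'n) ring_scheme \<Rightarrow> 'a \<Rightarrow> ('a + 'b, int) nc_poly set" where
  "coproduct_in1 S f1 f2 R1 R2 a =
     coproduct_ideal S f1 f2 R1 R2 +>\<^bsub>coproduct_free R1 R2\<^esub> nc_var (Inl a)"

definition coproduct_in2 ::
    "('s, 'l) ring_scheme \<Rightarrow> ('s \<Rightarrow> 'a) \<Rightarrow> ('s \<Rightarrow> 'b) \<Rightarrow>
     ('a, 'm) ring_scheme \<Rightarrow> ('b, 'n) ring_scheme \<Rightarrow> 'b \<Rightarrow> ('a + 'b, int) nc_poly set" where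
  "coproduct_in2 S f1 f2 R1 R2 b =
     coproduct_ideal S f1 f2 R1 R2 +>\<^bsub>coproduct_free R1 R2\<^esub> nc_var (Inr b)"

definition faithful_coproduct ::
    "('s, 'l) ring_scheme \<Rightarrow> ('s \<Rightarrow> 'a) \<Rightarrow> ('s \<Rightarrow> 'b) \<Rightarrow>
     ('a, 'm) ring_scheme \<Rightarrow> ('b, 'n) ring_scheme \<Rightarrow> bool" where
  "faithful_coproduct S f1 f2 R1 R2 \<longleftrightarrow>
     inj_on (coproduct_in1 S f1 f2 R1 R2) (carrier R1) \<and>
     inj_on (coproduct_in2 S f1 f2 R1 R2) (carrier R2)"

subsection \<open>The universal property\<close>

lemma nc_poly_vars_simps [simp]:
  "nc_poly_vars 0 = {}" "nc_poly_vars (1 :: ('x, 'k::ring_1) nc_poly) = {}"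
  "nc_poly_vars (- p) = nc_poly_vars (p :: ('x, 'k) nc_poly)"
  "nc_poly_vars (nc_var x :: ('x, 'k) nc_poly) = {x}"
  by (auto simp: nc_poly_vars_def nc_var_def zero_nc_word_def)

lemma nc_poly_vars_add: "nc_poly_vars (p + q) \<subseteq> nc_poly_vars p \<union> nc_poly_vars q"
  for p q :: "('x, 'k::ring_1) nc_poly"
  using Poly_Mapping.keys_add[of p q] unfolding nc_poly_vars_def by blast

lemma nc_poly_vars_diff: "nc_poly_vars (p - q) \<subseteq> nc_poly_vars p \<union> nc_poly_vars q"
  for p q :: "('x, 'k::ring_1) nc_poly"
  using nc_poly_vars_add[of p "- q"] by simp

lemma nc_poly_vars_mult: "nc_poly_vars (p * q) \<subseteq> nc_poly_vars p \<union> nc_poly_vars q"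
  for p q :: "('x, 'k::ring_1) nc_poly"
proof
  fix x assume "x \<in> nc_poly_vars (p * q)"
  then obtain w where "w \<in> Poly_Mapping.keys (p * q)" "x \<in> set (letters w)"
    unfolding nc_poly_vars_def by blast
  moreover from this(1) obtain u v where "u \<in> Poly_Mapping.keys p" "v \<in> Poly_Mapping.keys q" "w = u + v"
    using keys_mult[of p q] by blast
  ultimately show "x \<in> nc_poly_vars p \<union> nc_poly_vars q"
    by (auto simp: nc_poly_vars_def plus_nc_word_def)
qed

lemma free_alg_simps [simp]:
  "p \<in> carrier (free_alg V) \<longleftrightarrow> nc_poly_vars p \<subseteq> V"
  "p \<otimes>\<^bsub>free_alg V\<^esub> q = p * q" "p \<oplus>\<^bsub>free_alg V\<^esub> q = p + q"
  "\<one>\<^bsub>free_alg V\<^esub> = 1" "\<zero>\<^bsub>free_alg V\<^esub> = 0"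
  by (simp_all add: free_alg_def)

lemma ring_free_alg: "ring (free_alg V :: ('x, 'k::ring_1) nc_poly ring)"
proof (intro ringI abelian_groupI monoidI)
  fix p :: "('x, 'k) nc_poly" assume "p \<in> carrier (free_alg V)"
  then show "\<exists>q\<in>carrier (free_alg V). q \<oplus>\<^bsub>free_alg V\<^esub> p = \<zero>\<^bsub>free_alg V\<^esub>"
    by (intro bexI[of _ "- p"]) auto
next
  fix p q :: "('x, 'k) nc_poly" assume pq: "p \<in> carrier (free_alg V)" "q \<in> carrier (free_alg V)"
  show "p \<oplus>\<^bsub>free_alg V\<^esub> q \<in> carrier (free_alg V)"
    using pq nc_poly_vars_add[of p q] by auto
  show "p \<otimes>\<^bsub>free_alg V\<^esub> q \<in> carrier (free_alg V)"
    using pq nc_poly_vars_mult[of p q] by auto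
qed (simp_all add: algebra_simps)

lemma a_inv_free_alg:
  assumes "nc_poly_vars p \<subseteq> V"
  shows "\<ominus>\<^bsub>free_alg V\<^esub> p = - (p :: ('x, 'k::ring_1) nc_poly)"
proof -
  interpret ring "free_alg V :: ('x, 'k) nc_poly ring" by (rule ring_free_alg)
  show ?thesis by (rule minus_equality) (use assms in auto)
qed

lemma a_minus_free_alg:
  assumes "nc_poly_vars q \<subseteq> V"
  shows "p \<ominus>\<^bsub>free_alg V\<^esub> q = p - (q :: ('x, 'k::ring_1) nc_poly)"
  by (simp add: a_minus_def a_inv_free_alg assms)

lemma nc_poly_sum_single:
  "(\<Sum>w\<in>Poly_Mapping.keys p. Poly_Mapping.single w (Poly_Mapping.lookup p w)) = p"
  for p :: "('x, 'k::ring_1) nc_poly"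
  by (rule poly_mapping_eqI)
     (simp add: lookup_sum lookup_single when_def in_keys_iff)

lemma nc_poly_induct [case_names zero single add]:
  fixes p :: "('x, 'k::ring_1) nc_poly"
  assumes zero: "P 0" and single: "\<And>w c. P (Poly_Mapping.single w c)"
    and add: "\<And>p q. P p \<Longrightarrow> P q \<Longrightarrow> P (p + q)"
  shows "P p"
proof -
  have "P (\<Sum>w\<in>W. Poly_Mapping.single w (Poly_Mapping.lookup p w))" if "finite W" for W
    using that by induction (simp_all add: zero single add)
  from this[of "Poly_Mapping.keys p"] show ?thesis
    by (simp add: nc_poly_sum_single)
qed

lemma free_alg_induct [consumes 1, case_names one var add uminus mult]:
  fixes p :: "('x, int) nc_poly"
  assumes p: "nc_poly_vars p \<subseteq> V"
    and one: "P 1" and var: "\<And>x. x \<in> V \<Longrightarrow> P (nc_var x)"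
    and add: "\<And>p q. nc_poly_vars p \<subseteq> V \<Longrightarrow> nc_poly_vars q \<subseteq> V \<Longrightarrow> P p \<Longrightarrow> P q \<Longrightarrow> P (p + q)"
    and uminus: "\<And>p. nc_poly_vars p \<subseteq> V \<Longrightarrow> P p \<Longrightarrow> P (- p)"
    and mult: "\<And>p q. nc_poly_vars p \<subseteq> V \<Longrightarrow> nc_poly_vars q \<subseteq> V \<Longrightarrow> P p \<Longrightarrow> P q \<Longrightarrow> P (p * q)"
  shows "P p"
proof -
  define Q where "Q = (\<lambda>p :: ('x, int) nc_poly. nc_poly_vars p \<subseteq> V \<and> P p)"
  have Qadd: "Q (p + q)" if "Q p" "Q q" for p q
    using that add nc_poly_vars_add[of p q] by (auto simp: Q_def)
  have Qmult: "Q (p * q)" if "Q p" "Q q" for p q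
    using that mult nc_poly_vars_mult[of p q] by (auto simp: Q_def)
  have Quminus: "Q (- p)" if "Q p" for p
    using that uminus by (auto simp: Q_def)
  have Q1: "Q 1" using one by (auto simp: Q_def)
  have Q0: "Q 0" using Qadd[OF Q1 Quminus[OF Q1]] by simp
  have Qint: "Q (of_int c)" for c
  proof (induction c rule: int_induct[of _ 0])
    case (step2 i) then show ?case using Qadd[OF _ Quminus[OF Q1]] by simp
  qed (use Q0 Q1 Qadd in auto)
  have Qword: "Q (Poly_Mapping.single (NC_Word xs) 1)" if "set xs \<subseteq> V" for xs
    using that
  proof (induction xs)
    case Nil then show ?case using Q1 by (simp flip: zero_nc_word_def)
  next
    case (Cons x xs)
    have "Poly_Mapping.single (NC_Word (x # xs)) (1::int) = nc_var x * Poly_Mapping.single (NC_Word xs) 1"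
      by (simp add: nc_var_def mult_single plus_nc_word_def)
    then show ?case using Cons Qmult var by (auto simp: Q_def)
  qed
  have Qsingle: "Q (Poly_Mapping.single w c)" if "set (letters w) \<subseteq> V" for w c
  proof -
    have "Poly_Mapping.single w c = of_int c * Poly_Mapping.single (NC_Word (letters w)) 1"
      by (simp add: single_of_int[symmetric] mult_single)
    then show ?thesis using Qmult[OF Qint Qword[OF that]] by simp
  qed
  have "Q (\<Sum>w\<in>W. Poly_Mapping.single w (Poly_Mapping.lookup p w))"
    if "finite W" "W \<subseteq> Poly_Mapping.keys p" for W
    using that
  proof (induction W)
    case (insert w W)
    then have "set (letters w) \<subseteq> V" using p by (auto simp: nc_poly_vars_def)
    then show ?case using insert Qadd Qsingle by simp
  qed (use Q0 in auto)
  from this[of "Poly_Mapping.keys p"] show ?thesis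
    by (simp add: nc_poly_sum_single Q_def)
qed

context
  fixes T :: "('c, 'n) ring_scheme" and g :: "'x \<Rightarrow> 'c"
  assumes T: "ring T" and g: "\<And>x. g x \<in> carrier T"
begin

interpretation T: ring T by (rule T)

definition lift_word :: "'x nc_word \<Rightarrow> 'c" where
  "lift_word w = foldr (\<lambda>x y. g x \<otimes>\<^bsub>T\<^esub> y) (letters w) \<one>\<^bsub>T\<^esub>"

definition lift_poly :: "('x, int) nc_poly \<Rightarrow> 'c" where
  "lift_poly p = (\<Oplus>\<^bsub>T\<^esub>w\<in>Poly_Mapping.keys p. add_pow T (Poly_Mapping.lookup p w) (lift_word w))"

lemma lift_word_closed [simp]: "lift_word w \<in> carrier T"
proof -
  have "foldr (\<lambda>x y. g x \<otimes>\<^bsub>T\<^esub> y) xs \<one>\<^bsub>T\<^esub> \<in> carrier T" for xs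
    by (induction xs) (simp_all add: g)
  then show ?thesis by (simp add: lift_word_def)
qed

lemma lift_word_add: "lift_word (u + v) = lift_word u \<otimes>\<^bsub>T\<^esub> lift_word v"
proof -
  have "foldr (\<lambda>x y. g x \<otimes>\<^bsub>T\<^esub> y) xs (lift_word v) =
    foldr (\<lambda>x y. g x \<otimes>\<^bsub>T\<^esub> y) xs \<one>\<^bsub>T\<^esub> \<otimes>\<^bsub>T\<^esub> lift_word v \<and>
    foldr (\<lambda>x y. g x \<otimes>\<^bsub>T\<^esub> y) xs \<one>\<^bsub>T\<^esub> \<in> carrier T" for xs
    by (induction xs) (simp_all add: g T.m_assoc)
  then show ?thesis 
    unfolding lift_word_def plus_nc_word_def foldr_append nc_word.sel comp_def by blast
qed

lemma lift_poly_closed [simp]: "lift_poly p \<in> carrier T"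
  unfolding lift_poly_def by (intro T.finsum_closed) auto

lemma lift_poly_superset:
  assumes "finite W" "Poly_Mapping.keys p \<subseteq> W"
  shows "lift_poly p = (\<Oplus>\<^bsub>T\<^esub>w\<in>W. add_pow T (Poly_Mapping.lookup p w) (lift_word w))"
  unfolding lift_poly_def
proof (rule T.add.finprod_mono_neutral_cong_left)
  fix w assume "w \<in> W - Poly_Mapping.keys p"
  then have "Poly_Mapping.lookup p w = 0" by (simp add: in_keys_iff)
  then show "add_pow T (Poly_Mapping.lookup p w) (lift_word w) = \<zero>\<^bsub>T\<^esub>"
    by (simp add: add_pow_def int_pow_def2)
qed (use assms in auto)

lemma lift_poly_add: "lift_poly (p + q) = lift_poly p \<oplus>\<^bsub>T\<^esub> lift_poly q"
proof -
  let ?W = "Poly_Mapping.keys p \<union> Poly_Mapping.keys q"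
  have "lift_poly (p + q) = (\<Oplus>\<^bsub>T\<^esub>w\<in>?W. add_pow T (Poly_Mapping.lookup (p + q) w) (lift_word w))"
    using Poly_Mapping.keys_add[of p q] by (intro lift_poly_superset) auto
  also have "\<dots> = (\<Oplus>\<^bsub>T\<^esub>w\<in>?W. add_pow T (Poly_Mapping.lookup p w) (lift_word w) \<oplus>\<^bsub>T\<^esub>
      add_pow T (Poly_Mapping.lookup q w) (lift_word w))"
    by (intro T.finsum_cong') (auto simp: lookup_add T.add.int_pow_mult)
  also have "\<dots> = lift_poly p \<oplus>\<^bsub>T\<^esub> lift_poly q"
    by (subst T.finsum_addf) (auto simp: lift_poly_superset[of ?W])
  finally show ?thesis .
qed

lemma lift_poly_single: "lift_poly (Poly_Mapping.single w c) = add_pow T c (lift_word w)"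
  by (subst lift_poly_superset[of "{w}"]) auto

lemma lift_poly_mult_single:
  "lift_poly (Poly_Mapping.single u a * Poly_Mapping.single v b) =
   lift_poly (Poly_Mapping.single u a) \<otimes>\<^bsub>T\<^esub> lift_poly (Poly_Mapping.single v b)"
proof -
  have "lift_poly (Poly_Mapping.single u a) \<otimes>\<^bsub>T\<^esub> lift_poly (Poly_Mapping.single v b) =
    add_pow T a (add_pow T b (lift_word (u + v)))"
    unfolding lift_poly_single lift_word_add
    by (subst T.add_pow_ldistr_int, simp, simp, subst T.add_pow_rdistr_int) simp_all
  also have "\<dots> = add_pow T (b * a) (lift_word (u + v))"
    by (rule T.add.int_pow_pow) simp
  finally show ?thesis
    by (simp only: mult_single lift_poly_single mult.commute)
qed

lemma lift_poly_0: "lift_poly 0 = \<zero>\<^bsub>T\<^esub>"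
  by (simp add: lift_poly_def)

lemma lift_poly_mult: "lift_poly (p * q) = lift_poly p \<otimes>\<^bsub>T\<^esub> lift_poly q"
proof (induction p rule: nc_poly_induct)
  case (single u a)
  show ?case
  proof (induction q rule: nc_poly_induct)
    case (single v b)
    show ?case by (rule lift_poly_mult_single)
  qed (simp_all add: lift_poly_0 distrib_left lift_poly_add T.r_distr)
qed (simp_all add: lift_poly_0 distrib_right lift_poly_add T.l_distr)

lemma lift_poly_hom: "lift_poly \<in> Ring.ring_hom (free_alg V) T"
proof (rule ring_hom_memI)
  show "lift_poly \<one>\<^bsub>free_alg V\<^esub> = \<one>\<^bsub>T\<^esub>"
    unfolding free_alg_simps single_one[symmetric] lift_poly_single
    by (simp add: lift_word_def zero_nc_word_def)
qed (auto simp: lift_poly_mult lift_poly_add)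

lemma lift_poly_var: "lift_poly (nc_var x) = g x"
  unfolding nc_var_def lift_poly_single using g by (simp add: lift_word_def)

end

context
  fixes S :: "('s, 'l) ring_scheme" and f1 :: "'s \<Rightarrow> 'a" and f2 :: "'s \<Rightarrow> 'b"
    and R1 :: "('a, 'm) ring_scheme" and R2 :: "('b, 'n) ring_scheme"
  assumes R1: "ring R1" and R2: "ring R2"
    and f1: "f1 \<in> Ring.ring_hom S R1" and f2: "f2 \<in> Ring.ring_hom S R2"
begin

interpretation F: ring "coproduct_free R1 R2"
  unfolding coproduct_free_def by (rule ring_free_alg)

lemma rels_subset: "coproduct_rels S f1 f2 R1 R2 \<subseteq> carrier (coproduct_free R1 R2)"
proof -
  interpret R1: ring R1 by (rule R1)
  interpret R2: ring R2 by (rule R2)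
  have D: "x \<in> nc_poly_vars p \<or> x \<in> nc_poly_vars q"
    if "x \<in> nc_poly_vars (p + q) \<or> x \<in> nc_poly_vars (p - q) \<or> x \<in> nc_poly_vars (p * q)"
    for x and p q :: "('a + 'b, int) nc_poly"
    using that nc_poly_vars_diff[of p q] nc_poly_vars_add[of p q] nc_poly_vars_mult[of p q]
    by blast
  note D = D[OF disjI1] D[OF disjI2, OF disjI1] D[OF disjI2, OF disjI2]
  show ?thesis
    unfolding coproduct_free_def coproduct_rels_def hom_rels_def
    by (intro Un_least subsetI)
       (auto simp: ring_hom_closed[OF f1] ring_hom_closed[OF f2] dest!: D)
qed

interpretation I: ideal "coproduct_ideal S f1 f2 R1 R2" "coproduct_free R1 R2"
  unfolding coproduct_ideal_def by (rule F.genideal_ideal[OF rels_subset])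

lemma ring_coproduct: "ring (coproduct S f1 f2 R1 R2)"
  unfolding coproduct_def by (rule I.quotient_is_ring)

lemma coproduct_proj_hom:
  "(+>\<^bsub>coproduct_free R1 R2\<^esub>) (coproduct_ideal S f1 f2 R1 R2)
     \<in> Ring.ring_hom (coproduct_free R1 R2) (coproduct S f1 f2 R1 R2)"
  unfolding coproduct_def by (rule I.rcos_ring_hom)

lemma coproduct_coset_eq:
  assumes "p - q \<in> coproduct_rels S f1 f2 R1 R2" "nc_poly_vars p \<subseteq> carrier R1 <+> carrier R2"
    "nc_poly_vars q \<subseteq> carrier R1 <+> carrier R2"
  shows "coproduct_ideal S f1 f2 R1 R2 +>\<^bsub>coproduct_free R1 R2\<^esub> p =
    coproduct_ideal S f1 f2 R1 R2 +>\<^bsub>coproduct_free R1 R2\<^esub> q"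
proof -
  have "p \<ominus>\<^bsub>coproduct_free R1 R2\<^esub> q \<in> coproduct_ideal S f1 f2 R1 R2"
    using assms F.genideal_self[OF rels_subset]
    by (auto simp: coproduct_ideal_def coproduct_free_def a_minus_free_alg)
  then show ?thesis
    using F.quotient_eq_iff_same_a_r_cos[OF I.is_ideal] assms(2,3)
    by (simp add: coproduct_free_def)
qed

lemma coproduct_in_hom:
  "coproduct_in1 S f1 f2 R1 R2 \<in> Ring.ring_hom R1 (coproduct S f1 f2 R1 R2)"
  "coproduct_in2 S f1 f2 R1 R2 \<in> Ring.ring_hom R2 (coproduct S f1 f2 R1 R2)"
proof -
  interpret R1: ring R1 by (rule R1)
  interpret R2: ring R2 by (rule R2)
  let ?c = "\<lambda>p. coproduct_ideal S f1 f2 R1 R2 +>\<^bsub>coproduct_free R1 R2\<^esub> p"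
  let ?P = "coproduct S f1 f2 R1 R2" and ?V = "carrier R1 <+> carrier R2"
  note h = coproduct_proj_hom
  have cl: "?c p \<in> carrier ?P" if "nc_poly_vars p \<subseteq> ?V" for p
    using ring_hom_closed[OF h] that by (simp add: coproduct_free_def)
  have add: "?c (p + q) = ?c p \<oplus>\<^bsub>?P\<^esub> ?c q" if "nc_poly_vars p \<subseteq> ?V" "nc_poly_vars q \<subseteq> ?V" for p q
    using ring_hom_add[OF h, of p q] that by (simp add: coproduct_free_def)
  have mul: "?c (p * q) = ?c p \<otimes>\<^bsub>?P\<^esub> ?c q" if "nc_poly_vars p \<subseteq> ?V" "nc_poly_vars q \<subseteq> ?V" for p q
    using ring_hom_mult[OF h, of p q] that by (simp add: coproduct_free_def)
  have one: "?c 1 = \<one>\<^bsub>?P\<^esub>"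
    using ring_hom_one[OF h] by (simp add: coproduct_free_def)
  have [simp]: "Inl a \<in> ?V \<longleftrightarrow> a \<in> carrier R1" "Inr b \<in> ?V \<longleftrightarrow> b \<in> carrier R2" for a b
    by auto
  have vars: "nc_poly_vars (p + q) \<subseteq> ?V" "nc_poly_vars (p * q) \<subseteq> ?V"
    if "nc_poly_vars p \<subseteq> ?V" "nc_poly_vars q \<subseteq> ?V" for p q :: "('a + 'b, int) nc_poly"
    using that nc_poly_vars_add[of p q] nc_poly_vars_mult[of p q] by auto
  show "coproduct_in1 S f1 f2 R1 R2 \<in> Ring.ring_hom R1 ?P"
  proof (rule ring_hom_memI; unfold coproduct_in1_def)
    fix x y assume xy: "x \<in> carrier R1" "y \<in> carrier R1"
    show "?c (nc_var (Inl x)) \<in> carrier ?P"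
      using xy by (intro cl) simp
    have "nc_var (Inl (x \<otimes>\<^bsub>R1\<^esub> y)) - (nc_var (Inl x) * nc_var (Inl y)) \<in> coproduct_rels S f1 f2 R1 R2"
      using xy unfolding coproduct_rels_def hom_rels_def by blast
    then have "?c (nc_var (Inl (x \<otimes>\<^bsub>R1\<^esub> y))) = ?c (nc_var (Inl x) * nc_var (Inl y))"
      using xy by (intro coproduct_coset_eq vars) simp_all
    then show "?c (nc_var (Inl (x \<otimes>\<^bsub>R1\<^esub> y))) = ?c (nc_var (Inl x)) \<otimes>\<^bsub>?P\<^esub> ?c (nc_var (Inl y))"
      using xy by (simp add: mul)
    have "nc_var (Inl (x \<oplus>\<^bsub>R1\<^esub> y)) - (nc_var (Inl x) + nc_var (Inl y)) \<in> coproduct_rels S f1 f2 R1 R2"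
      using xy unfolding coproduct_rels_def hom_rels_def by blast
    then have "?c (nc_var (Inl (x \<oplus>\<^bsub>R1\<^esub> y))) = ?c (nc_var (Inl x) + nc_var (Inl y))"
      using xy by (intro coproduct_coset_eq vars) simp_all
    then show "?c (nc_var (Inl (x \<oplus>\<^bsub>R1\<^esub> y))) = ?c (nc_var (Inl x)) \<oplus>\<^bsub>?P\<^esub> ?c (nc_var (Inl y))"
      using xy by (simp add: add)
  next
    have "nc_var (Inl \<one>\<^bsub>R1\<^esub>) - 1 \<in> coproduct_rels S f1 f2 R1 R2"
      unfolding coproduct_rels_def hom_rels_def by blast
    then have "?c (nc_var (Inl \<one>\<^bsub>R1\<^esub>)) = ?c 1"
      by (intro coproduct_coset_eq) simp_all
    then show "?c (nc_var (Inl \<one>\<^bsub>R1\<^esub>)) = \<one>\<^bsub>?P\<^esub>"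
      by (simp add: one)
  qed
  show "coproduct_in2 S f1 f2 R1 R2 \<in> Ring.ring_hom R2 ?P"
  proof (rule ring_hom_memI; unfold coproduct_in2_def)
    fix x y assume xy: "x \<in> carrier R2" "y \<in> carrier R2"
    show "?c (nc_var (Inr x)) \<in> carrier ?P"
      using xy by (intro cl) simp
    have "nc_var (Inr (x \<otimes>\<^bsub>R2\<^esub> y)) - (nc_var (Inr x) * nc_var (Inr y)) \<in> coproduct_rels S f1 f2 R1 R2"
      using xy unfolding coproduct_rels_def hom_rels_def by blast
    then have "?c (nc_var (Inr (x \<otimes>\<^bsub>R2\<^esub> y))) = ?c (nc_var (Inr x) * nc_var (Inr y))"
      using xy by (intro coproduct_coset_eq vars) simp_all
    then show "?c (nc_var (Inr (x \<otimes>\<^bsub>R2\<^esub> y))) = ?c (nc_var (Inr x)) \<otimes>\<^bsub>?P\<^esub> ?c (nc_var (Inr y))"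
      using xy by (simp add: mul)
    have "nc_var (Inr (x \<oplus>\<^bsub>R2\<^esub> y)) - (nc_var (Inr x) + nc_var (Inr y)) \<in> coproduct_rels S f1 f2 R1 R2"
      using xy unfolding coproduct_rels_def hom_rels_def by blast
    then have "?c (nc_var (Inr (x \<oplus>\<^bsub>R2\<^esub> y))) = ?c (nc_var (Inr x) + nc_var (Inr y))"
      using xy by (intro coproduct_coset_eq vars) simp_all
    then show "?c (nc_var (Inr (x \<oplus>\<^bsub>R2\<^esub> y))) = ?c (nc_var (Inr x)) \<oplus>\<^bsub>?P\<^esub> ?c (nc_var (Inr y))"
      using xy by (simp add: add)
  next
    have "nc_var (Inr \<one>\<^bsub>R2\<^esub>) - 1 \<in> coproduct_rels S f1 f2 R1 R2"
      unfolding coproduct_rels_def hom_rels_def by blast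
    then have "?c (nc_var (Inr \<one>\<^bsub>R2\<^esub>)) = ?c 1"
      by (intro coproduct_coset_eq) simp_all
    then show "?c (nc_var (Inr \<one>\<^bsub>R2\<^esub>)) = \<one>\<^bsub>?P\<^esub>"
      by (simp add: one)
  qed
qed

lemma coproduct_in_agree:
  assumes "s \<in> carrier S"
  shows "coproduct_in1 S f1 f2 R1 R2 (f1 s) = coproduct_in2 S f1 f2 R1 R2 (f2 s)"
  unfolding coproduct_in1_def coproduct_in2_def
  by (rule coproduct_coset_eq)
     (use assms in \<open>auto simp: coproduct_rels_def ring_hom_closed[OF f1] ring_hom_closed[OF f2]\<close>)

theorem coproduct_universal:
  fixes T :: "('c, 'k) ring_scheme"
  assumes T: "ring T" and g1: "g1 \<in> Ring.ring_hom R1 T" and g2: "g2 \<in> Ring.ring_hom R2 T"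
    and agree: "\<And>s. s \<in> carrier S \<Longrightarrow> g1 (f1 s) = g2 (f2 s)"
  shows "\<exists>h\<in>Ring.ring_hom (coproduct S f1 f2 R1 R2) T.
    (\<forall>a\<in>carrier R1. h (coproduct_in1 S f1 f2 R1 R2 a) = g1 a) \<and>
    (\<forall>b\<in>carrier R2. h (coproduct_in2 S f1 f2 R1 R2 b) = g2 b)"
proof -
  interpret T: ring T by (rule T)
  interpret R1: ring R1 by (rule R1)
  interpret R2: ring R2 by (rule R2)
  define g where "g = (\<lambda>x. case x of
      Inl a \<Rightarrow> if a \<in> carrier R1 then g1 a else \<zero>\<^bsub>T\<^esub>
    | Inr b \<Rightarrow> if b \<in> carrier R2 then g2 b else \<zero>\<^bsub>T\<^esub>)"
  have g: "g x \<in> carrier T" for x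
    using ring_hom_closed[OF g1] ring_hom_closed[OF g2] by (auto simp: g_def split: sum.splits)
  define \<phi> where "\<phi> = lift_poly T g"
  have \<phi>: "\<phi> \<in> Ring.ring_hom (free_alg V) T" for V
    unfolding \<phi>_def by (rule lift_poly_hom[OF T g])
  have \<phi>_add: "\<phi> (p + q) = \<phi> p \<oplus>\<^bsub>T\<^esub> \<phi> q" for p q
    using ring_hom_add[OF \<phi>[of UNIV], of p q] by simp
  have \<phi>_mult: "\<phi> (p * q) = \<phi> p \<otimes>\<^bsub>T\<^esub> \<phi> q" for p q
    using ring_hom_mult[OF \<phi>[of UNIV], of p q] by simp
  have \<phi>_closed [simp]: "\<phi> p \<in> carrier T" for p
    using ring_hom_closed[OF \<phi>[of UNIV], of p] by simp
  have \<phi>_1: "\<phi> 1 = \<one>\<^bsub>T\<^esub>"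
    using ring_hom_one[OF \<phi>[of UNIV]] by simp
  have \<phi>_var: "\<phi> (nc_var x) = g x" for x
    unfolding \<phi>_def by (rule lift_poly_var[OF T g])
  have \<phi>_diff: "\<phi> (p - q) = \<zero>\<^bsub>T\<^esub>" if "\<phi> p = \<phi> q" for p q
  proof -
    have "\<phi> (p - q) \<oplus>\<^bsub>T\<^esub> \<phi> q = \<zero>\<^bsub>T\<^esub> \<oplus>\<^bsub>T\<^esub> \<phi> q"
      using \<phi>_add[of "p - q" q] that by simp
    then show ?thesis by (subst (asm) T.add.right_cancel) simp_all
  qed
  have \<phi>_Inl: "\<phi> (nc_var (Inl a)) = g1 a" if "a \<in> carrier R1" for a
    using that by (simp add: \<phi>_var g_def)
  have \<phi>_Inr: "\<phi> (nc_var (Inr b)) = g2 b" if "b \<in> carrier R2" for b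
    using that by (simp add: \<phi>_var g_def)
  have \<phi>_rels1: "\<phi> x = \<zero>\<^bsub>T\<^esub>" if x: "x \<in> hom_rels R1 Inl" for x
  proof -
    consider a b where "a \<in> carrier R1" "b \<in> carrier R1"
        "x = nc_var (Inl (a \<oplus>\<^bsub>R1\<^esub> b)) - (nc_var (Inl a) + nc_var (Inl b))"
      | a b where "a \<in> carrier R1" "b \<in> carrier R1"
        "x = nc_var (Inl (a \<otimes>\<^bsub>R1\<^esub> b)) - nc_var (Inl a) * nc_var (Inl b)"
      | "x = nc_var (Inl \<one>\<^bsub>R1\<^esub>) - 1"
      using x unfolding hom_rels_def by blast
    then show ?thesis
    proof cases
      case (1 a b)
      then show ?thesis
        by (simp add: \<phi>_diff \<phi>_add \<phi>_Inl ring_hom_add[OF g1])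
    next
      case (2 a b)
      then show ?thesis
        by (simp add: \<phi>_diff \<phi>_mult \<phi>_Inl ring_hom_mult[OF g1])
    next
      case 3
      then show ?thesis
        by (simp add: \<phi>_diff \<phi>_1 \<phi>_Inl ring_hom_one[OF g1])
    qed
  qed
  have \<phi>_rels2: "\<phi> x = \<zero>\<^bsub>T\<^esub>" if x: "x \<in> hom_rels R2 Inr" for x
  proof -
    consider a b where "a \<in> carrier R2" "b \<in> carrier R2"
        "x = nc_var (Inr (a \<oplus>\<^bsub>R2\<^esub> b)) - (nc_var (Inr a) + nc_var (Inr b))"
      | a b where "a \<in> carrier R2" "b \<in> carrier R2"
        "x = nc_var (Inr (a \<otimes>\<^bsub>R2\<^esub> b)) - nc_var (Inr a) * nc_var (Inr b)"
      | "x = nc_var (Inr \<one>\<^bsub>R2\<^esub>) - 1"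
      using x unfolding hom_rels_def by blast
    then show ?thesis
    proof cases
      case (1 a b)
      then show ?thesis
        by (simp add: \<phi>_diff \<phi>_add \<phi>_Inr ring_hom_add[OF g2])
    next
      case (2 a b)
      then show ?thesis
        by (simp add: \<phi>_diff \<phi>_mult \<phi>_Inr ring_hom_mult[OF g2])
    next
      case 3
      then show ?thesis
        by (simp add: \<phi>_diff \<phi>_1 \<phi>_Inr ring_hom_one[OF g2])
    qed
  qed
  have \<phi>_rels: "\<phi> x = \<zero>\<^bsub>T\<^esub>" if x: "x \<in> coproduct_rels S f1 f2 R1 R2" for x
  proof -
    consider "x \<in> hom_rels R1 Inl" | "x \<in> hom_rels R2 Inr"
      | s where "s \<in> carrier S" "x = nc_var (Inl (f1 s)) - nc_var (Inr (f2 s))"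
      using x unfolding coproduct_rels_def by blast
    then show ?thesis
      by cases (simp_all add: \<phi>_rels1 \<phi>_rels2 \<phi>_diff \<phi>_Inl \<phi>_Inr agree
          ring_hom_closed[OF f1] ring_hom_closed[OF f2])
  qed
  interpret \<phi>: ring_hom_ring "coproduct_free R1 R2" T \<phi>
    using \<phi> unfolding coproduct_free_def
    by (intro ring_hom_ringI2 ring_free_alg T) auto
  have "coproduct_rels S f1 f2 R1 R2 \<subseteq> a_kernel (coproduct_free R1 R2) T \<phi>"
  proof (rule subsetI)
    fix x assume x: "x \<in> coproduct_rels S f1 f2 R1 R2"
    show "x \<in> a_kernel (coproduct_free R1 R2) T \<phi>"
      unfolding a_kernel_def'
      using \<phi>_rels[OF x] subsetD[OF rels_subset x] by (intro CollectI conjI)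
  qed
  then have ker: "coproduct_ideal S f1 f2 R1 R2 \<subseteq> a_kernel (coproduct_free R1 R2) T \<phi>"
    unfolding coproduct_ideal_def by (rule F.genideal_minimal[OF \<phi>.kernel_is_ideal])
  let ?c = "\<lambda>p. coproduct_ideal S f1 f2 R1 R2 +>\<^bsub>coproduct_free R1 R2\<^esub> p"
  define h where "h = (\<lambda>Z. the_elem (\<phi> ` Z))"
  have h: "h (?c p) = \<phi> p" if p: "p \<in> carrier (coproduct_free R1 R2)" for p
  proof -
    have "\<phi> y = \<phi> p" if y: "y \<in> ?c p" for y
    proof -
      from y obtain i where i: "i \<in> coproduct_ideal S f1 f2 R1 R2"
        and yi: "y = i \<oplus>\<^bsub>coproduct_free R1 R2\<^esub> p"
        unfolding a_r_coset_def' by blast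
      have "\<phi> i = \<zero>\<^bsub>T\<^esub>"
        using subsetD[OF ker i] unfolding a_kernel_def' by blast
      then have "\<phi> (i + p) = \<phi> p"
        by (simp add: \<phi>_add)
      then show ?thesis
        unfolding yi coproduct_free_def free_alg_simps .
    qed
    moreover have "p \<in> ?c p"
      by (rule I.a_rcos_self[OF p])
    ultimately have "\<phi> ` ?c p = {\<phi> p}"
      by blast
    then show ?thesis by (simp add: h_def)
  qed
  note proj = coproduct_proj_hom
  have carr: "carrier (coproduct S f1 f2 R1 R2) = ?c ` carrier (coproduct_free R1 R2)"
    by (auto simp: coproduct_def FactRing_def A_RCOSETS_def')
  have "h \<in> Ring.ring_hom (coproduct S f1 f2 R1 R2) T"
  proof (rule ring_hom_memI)
    fix Z Y assume "Z \<in> carrier (coproduct S f1 f2 R1 R2)" "Y \<in> carrier (coproduct S f1 f2 R1 R2)"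
    then obtain p q where pq: "p \<in> carrier (coproduct_free R1 R2)" "q \<in> carrier (coproduct_free R1 R2)"
      and ZY: "Z = ?c p" "Y = ?c q" unfolding carr by blast
    show "h Z \<in> carrier T" by (simp add: ZY(1) h[OF pq(1)])
    show "h (Z \<otimes>\<^bsub>coproduct S f1 f2 R1 R2\<^esub> Y) = h Z \<otimes>\<^bsub>T\<^esub> h Y"
      by (simp only: ring_hom_mult[OF proj pq, symmetric] h pq F.m_closed[OF pq] \<phi>.hom_mult[OF pq] ZY)
    show "h (Z \<oplus>\<^bsub>coproduct S f1 f2 R1 R2\<^esub> Y) = h Z \<oplus>\<^bsub>T\<^esub> h Y"
      by (simp only: ring_hom_add[OF proj pq, symmetric] h pq F.a_closed[OF pq] \<phi>.hom_add[OF pq] ZY)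
  next
    show "h \<one>\<^bsub>coproduct S f1 f2 R1 R2\<^esub> = \<one>\<^bsub>T\<^esub>"
      using ring_hom_one[OF proj] h[OF F.one_closed] by simp
  qed
  moreover have "h (coproduct_in1 S f1 f2 R1 R2 a) = g1 a" if "a \<in> carrier R1" for a
    unfolding coproduct_in1_def
    using that by (subst h) (auto simp: coproduct_free_def \<phi>_Inl)
  moreover have "h (coproduct_in2 S f1 f2 R1 R2 b) = g2 b" if "b \<in> carrier R2" for b
    unfolding coproduct_in2_def
    using that by (subst h) (auto simp: coproduct_free_def \<phi>_Inr)
  ultimately show ?thesis by blast
qed

theorem coproduct_unique:
  fixes T :: "('c, 'k) ring_scheme" and h k :: "('a + 'b, int) nc_poly set \<Rightarrow> 'c" and Z
  assumes T: "ring T"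
    and h: "h \<in> Ring.ring_hom (coproduct S f1 f2 R1 R2) T" "k \<in> Ring.ring_hom (coproduct S f1 f2 R1 R2) T"
    and a: "\<And>a. a \<in> carrier R1 \<Longrightarrow>
      h (coproduct_in1 S f1 f2 R1 R2 a) = k (coproduct_in1 S f1 f2 R1 R2 a)"
    and b: "\<And>b. b \<in> carrier R2 \<Longrightarrow>
      h (coproduct_in2 S f1 f2 R1 R2 b) = k (coproduct_in2 S f1 f2 R1 R2 b)"
    and Z: "Z \<in> carrier (coproduct S f1 f2 R1 R2)"
  shows "h Z = k Z"
proof -
  interpret T: ring T by (rule T)
  let ?c = "\<lambda>p. coproduct_ideal S f1 f2 R1 R2 +>\<^bsub>coproduct_free R1 R2\<^esub> p"
  let ?V = "carrier R1 <+> carrier R2"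
  have "carrier (coproduct S f1 f2 R1 R2) = ?c ` carrier (coproduct_free R1 R2)"
    by (auto simp: coproduct_def FactRing_def A_RCOSETS_def')
  with Z obtain p where "p \<in> carrier (coproduct_free R1 R2)" and Zp: "Z = ?c p"
    by blast
  then have p: "nc_poly_vars p \<subseteq> ?V"
    by (simp add: coproduct_free_def)
  have hom: "(\<lambda>p. h (?c p)) \<in> Ring.ring_hom (free_alg ?V) T"
    "(\<lambda>p. k (?c p)) \<in> Ring.ring_hom (free_alg ?V) T"
    using ring_hom_trans[OF coproduct_proj_hom h(1)] ring_hom_trans[OF coproduct_proj_hom h(2)]
    by (simp_all only: coproduct_free_def comp_def)
  interpret h: ring_hom_ring "free_alg ?V" T "\<lambda>p. h (?c p)"
    by (rule ring_hom_ringI2[OF ring_free_alg T hom(1)])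
  interpret k: ring_hom_ring "free_alg ?V" T "\<lambda>p. k (?c p)"
    by (rule ring_hom_ringI2[OF ring_free_alg T hom(2)])
  have "h (?c p) = k (?c p)"
    using p
  proof (induction p rule: free_alg_induct)
    case one
    show ?case using ring_hom_one[OF hom(1)] ring_hom_one[OF hom(2)] by simp
  next
    case (var x)
    then consider a where "x = Inl a" "a \<in> carrier R1" | b where "x = Inr b" "b \<in> carrier R2"
      by blast
    then show ?case
      by cases (simp_all add: a[unfolded coproduct_in1_def] b[unfolded coproduct_in2_def])
  next
    case (add p q)
    then show ?case
      using ring_hom_add[OF hom(1), of p q] ring_hom_add[OF hom(2), of p q] by simp
  next
    case (mult p q)
    then show ?case
      using ring_hom_mult[OF hom(1), of p q] ring_hom_mult[OF hom(2), of p q] by simp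
  next
    case (uminus p)
    then show ?case
      using h.hom_a_inv[of p] k.hom_a_inv[of p] by (simp add: a_inv_free_alg)
  qed
  then show ?thesis by (simp add: Zp)
qed

end

end

theory Submission
  imports Defs "HOL-Computational_Algebra.Formal_Laurent_Series" "HOL-Algebra.Algebraic_Closure_Type" "Jordan_Normal_Form.Determinant"
begin

text \<open>
  Let \<open>J\<close> be the ideal of the resolvent ring that is generated by \<open>I\<close>. The quotient by \<open>J\<close> receives both
  \<open>k\<langle>X\<rangle> / I\<close> and the ring of functions in \<open>V\<close> of bounded height, compatibly on \<open>k\<langle>V\<rangle>\<close>, and therefore
  also their coproduct. So it suffices that neither map has a kernel (\<open>faithful_of_contraction\<close>).

  For the functions in \<open>V\<close> this is a matter of evaluation. By hypothesis \<open>J\<close> is also generated by the differences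
  \<open>X\<^sub>j - r\<^sub>j\<close>, so its elements vanish on the graph of the resolvent, that is at the points with coordinates
  \<open>A\<^sub>j = r\<^sub>j(A)\<close> outside \<open>V\<close>. Every generic choice of the coordinates in \<open>V\<close> extends to such a point, and a
  function in \<open>V\<close> that vanishes at all of them is zero (\<open>J_ratfuns_le\<close>).

  The kernel of the other map consists of the \<open>p \<in> J \<inter> k\<langle>X\<rangle>\<close> modulo \<open>I\<close>. Every element of the resolvent
  ring has a realization \<open>w - c M\<^sup>-\<^sup>1 d\<close> with matrices over \<open>k\<langle>X\<rangle>\<close>. For an element of \<open>J\<close> it can be chosen such that,
  over a Sylvester domain \<open>Q\<close> that contains \<open>k\<langle>X\<rangle> / I\<close>, the matrix \<open>M\<close> is full and the bordered matrix
  \<open>[[M, d], [c, w]]\<close> is not, because such elements form an ideal that contains \<open>I\<close> (\<open>contraction\<close>). If the element is a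
  polynomial \<open>p\<close>, then the bordered matrix with \<open>w - p\<close> in place of \<open>w\<close> is singular at all matrix tuples, its Schur
  complement being the value \<open>0\<close> of \<open>w - c M\<^sup>-\<^sup>1 d - p\<close>. Such a matrix fails to be full even over \<open>k\<langle>X\<rangle>\<close>
  (\<open>singular_not_full\<close>), hence over \<open>Q\<close>. As the law of nullity admits only one value of the corner for which the
  bordered matrix degenerates (\<open>zero_realization_unique\<close>), \<open>p\<close> is zero in \<open>Q\<close>, that is \<open>p \<in> I\<close>.

  This argument needs that \<open>M\<close> remains full over \<open>Q\<close>. If \<open>Q\<close> is \<open>k\<langle>X\<rangle> / I\<close> itself, then a factorization modulo \<open>I\<close> can be
  evaluated on the graph, where \<open>M\<close> is invertible (\<open>full_of_graph\<close>). If \<open>Q\<close> is a skew field and the height is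
  at most \<open>1\<close>, then only nonzero polynomials in \<open>V\<close> are inverted, and these stay nonzero since
  \<open>I \<inter> k\<langle>V\<rangle> = 0\<close>. Firs and skew fields are Sylvester domains because a finitely generated submodule
  of a free module has a basis, which splits off the relations (\<open>sylvester_of_bases\<close>).

  The statement about singular matrices is the core. Linearization reduces it to linear pencils. The matrices of
  size \<open>2\<^sup>e\<close> over a large field contain a division algebra that spans them. At points of this algebra the rank of a pencil can be
  computed over the division algebra, so that the maximal rank is a multiple of \<open>2\<^sup>e\<close> (\<open>pencil_rank_divisible\<close>). The
  quotient by the size is then an integer and is stationary from some \<open>e\<close> on; at this point the kernel of a value of maximal rank
  yields a pair of subspaces between which all coefficients vanish and which are so large that the pencil factors
  through a smaller size (\<open>shrunk_subspace\<close>).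
\<close>


section \<open>Block matrices\<close>

definition vstack :: "'a mat => 'a mat => 'a mat" where
  "vstack A B = mat (dim_row A + dim_row B) (dim_col A)
     (\<lambda>(i, j). if i < dim_row A then A $$ (i, j) else B $$ (i - dim_row A, j))"

definition hstack :: "'a mat => 'a mat => 'a mat" where
  "hstack A B = mat (dim_row A) (dim_col A + dim_col B)
     (\<lambda>(i, j). if j < dim_col A then A $$ (i, j) else B $$ (i, j - dim_col A))"

lemma dim_stack [simp]:
  "dim_row (vstack A B) = dim_row A + dim_row B" "dim_col (vstack A B) = dim_col A"
  "dim_row (hstack A B) = dim_row A" "dim_col (hstack A B) = dim_col A + dim_col B"
  by (simp_all add: vstack_def hstack_def)

lemma stack_carrier [intro]:
  "A \<in> carrier_mat a n ==> B \<in> carrier_mat b n ==> vstack A B \<in> carrier_mat (a + b) n"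
  "C \<in> carrier_mat n a ==> D \<in> carrier_mat n b ==> hstack C D \<in> carrier_mat n (a + b)"
  by (auto intro!: carrier_matI)

lemma index_vstack [simp]:
  assumes "i < dim_row A + dim_row B" "j < dim_col A"
  shows "vstack A B $$ (i, j) = (if i < dim_row A then A $$ (i, j) else B $$ (i - dim_row A, j))"
  using assms by (simp add: vstack_def)

lemma index_hstack [simp]:
  assumes "i < dim_row A" "j < dim_col A + dim_col B"
  shows "hstack A B $$ (i, j) = (if j < dim_col A then A $$ (i, j) else B $$ (i, j - dim_col A))"
  using assms by (simp add: hstack_def)

lemma sum_split_add:
  "(\<Sum>i\<in>{0..<a + b}. f i) = (\<Sum>i\<in>{0..<a}. f i) + (\<Sum>i\<in>{0..<b}. f (a + i))" for a b :: nat
  by (simp add: sum.atLeastLessThan_concat[of 0 a "a + b", symmetric])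
     (metis (no_types, lifting) add.commute add.right_neutral sum.cong sum.shift_bounds_nat_ivl)

lemma mult_index: "i < dim_row A ==> j < dim_col B ==> dim_col A = dim_row B ==>
  (A * B) $$ (i, j) = (\<Sum>k\<in>{0..<dim_row B}. A $$ (i, k) * B $$ (k, j))"
  by (simp add: scalar_prod_def)

lemma vstack_mult:
  assumes "dim_col A = dim_col B" "dim_col A = dim_row Z"
  shows "vstack A B * Z = vstack (A * Z) (B * Z)"
  using assms by (intro eq_matI) (auto simp: scalar_prod_def)

lemma mult_hstack:
  assumes "dim_row A = dim_row B" "dim_col Z = dim_row A"
  shows "Z * hstack A B = hstack (Z * A) (Z * B)"
  using assms by (intro eq_matI) (auto simp: scalar_prod_def)

lemma hstack_vstack:
  assumes "dim_col A = dim_row C" "dim_col B = dim_row D" "dim_row A = dim_row B" "dim_col C = dim_col D"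
  shows "hstack A B * vstack C D = A * C + B * (D :: 'a :: semiring_0 mat)"
  using assms by (intro eq_matI) (auto simp: scalar_prod_def sum_split_add)

lemma vstack_hstack:
  assumes "dim_row A = dim_row B" "dim_row C = dim_row D" "dim_col A = dim_col C" "dim_col B = dim_col D"
  shows "vstack (hstack A B) (hstack C D) = four_block_mat A B C D"
  using assms by (intro eq_matI) auto

lemma hstack_vstack_blocks:
  assumes "dim_row A = dim_row B" "dim_row C = dim_row D" "dim_col A = dim_col C" "dim_col B = dim_col D"
  shows "hstack (vstack A C) (vstack B D) = four_block_mat A B C D"
  using assms by (intro eq_matI) auto

text \<open>Variants of the ring laws for matrices whose side conditions are equations of dimensions,
  so that the simplifier can discharge them for compound matrices.\<close>

lemma mat_assoc: "dim_col A = dim_row B ==> dim_col B = dim_row C ==> (A * B) * C = A * (B * C)"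
  for A :: "'a :: semiring_0 mat"
  by (rule assoc_mult_mat[of _ "dim_row A" "dim_row B" _ "dim_row C" _ "dim_col C"]) auto

lemma mat_distrib:
  fixes A :: "'a :: ring mat"
  shows "dim_row B = dim_row C ==> dim_col B = dim_col C ==> dim_col A = dim_row B ==> A * (B + C) = A * B + A * C"
    "dim_row B = dim_row C ==> dim_col B = dim_col C ==> dim_col B = dim_row A ==> (B + C) * A = B * A + C * A"
    "dim_row B = dim_row C ==> dim_col B = dim_col C ==> dim_col A = dim_row B ==> A * (B - C) = A * B - A * C"
    "dim_row B = dim_row C ==> dim_col B = dim_col C ==> dim_col B = dim_row A ==> (B - C) * A = B * A - C * A"
  by (rule mult_add_distrib_mat add_mult_distrib_mat mult_minus_distrib_mat minus_mult_distrib_mat; auto)+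

lemma mat_self_diff [simp]: "A - A = 0\<^sub>m (dim_row A) (dim_col A)" for A :: "'a :: group_add mat"
  by (intro eq_matI) auto

lemma mat_diff_zero [simp]:
  "dim_row A = n ==> dim_col A = m ==> A - 0\<^sub>m n m = A" for A :: "'a :: group_add mat"
  by (intro eq_matI) auto

lemma mat_add_zero [simp]:
  "dim_row A = n ==> dim_col A = m ==> A + 0\<^sub>m n m = A"
  "dim_row A = n ==> dim_col A = m ==> 0\<^sub>m n m + A = A" for A :: "'a :: group_add mat"
  by (intro eq_matI; auto)+

lemma stack_zero [simp]:
  "vstack (0\<^sub>m a n) (0\<^sub>m b n) = 0\<^sub>m (a + b) n" "hstack (0\<^sub>m n a) (0\<^sub>m n b) = 0\<^sub>m n (a + b)"
  by (intro eq_matI; auto)+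

lemma mat_diff_eq_0: "A - B = 0\<^sub>m (dim_row B) (dim_col B) \<longleftrightarrow> A = B" 
  if "dim_row A = dim_row B" "dim_col A = dim_col B" for A B :: "'a :: ab_group_add mat"
proof
  assume eq: "A - B = 0\<^sub>m (dim_row B) (dim_col B)"
  show "A = B"
  proof (rule eq_matI)
    fix i j assume ij: "i < dim_row B" "j < dim_col B"
    then have "(A - B) $$ (i, j) = 0" unfolding eq by simp
    then show "A $$ (i, j) = B $$ (i, j)" using ij that by simp
  qed (use that in auto)
qed (use that in simp)

lemma mat_nonzero_entry:
  assumes "A \<noteq> 0\<^sub>m n m" "dim_row A = n" "dim_col A = m"
  obtains i j where "i < n" "j < m" "A $$ (i, j) \<noteq> (0 :: 'a :: zero)"
proof -
  have "\<exists>i<n. \<exists>j<m. A $$ (i, j) \<noteq> 0"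
  proof (rule ccontr)
    assume "\<not> ?thesis"
    then have "A = 0\<^sub>m n m" using assms(2,3) by (intro eq_matI) auto
    then show False using assms(1) by simp
  qed
  then show thesis using that by blast
qed

section \<open>Ranks of matrices over a field\<close>

text \<open>The bound for one-sided inverses is the only place where commutativity of the field
  enters: a padded square matrix with a zero row cannot have a left inverse.\<close>

lemma left_inverse_dim_le:
  fixes Z Y :: "'a :: field mat"
  assumes Z: "Z \<in> carrier_mat a b" and Y: "Y \<in> carrier_mat b a" and XY: "Z * Y = 1\<^sub>m a"
  shows "a \<le> b"
proof (rule ccontr)
  assume "\<not> a \<le> b"
  then obtain d where d: "a = b + d" "d > 0" by (metis less_imp_add_positive not_le)
  let ?X = "hstack Z (0\<^sub>m a d)" and ?Y = "vstack Y (0\<^sub>m d a)"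
  have c: "?X \<in> carrier_mat a a" "?Y \<in> carrier_mat a a" using Z Y d by auto
  have "?X * ?Y = 1\<^sub>m a"
    using Z Y XY by (subst hstack_vstack) auto
  then have "?Y * ?X = 1\<^sub>m a" using mat_mult_left_right_inverse c by blast
  then have "(?Y * ?X) $$ (b, b) = 1" using d by simp
  moreover have "(?Y * ?X) $$ (b, b) = 0" using Z Y d
    by (subst mult_index) auto
  ultimately show False by simp
qed

definition rank_ge :: "'a :: field mat => nat => bool" where
  "rank_ge A r \<longleftrightarrow> (\<exists>P\<in>carrier_mat r (dim_row A). \<exists>Q\<in>carrier_mat (dim_col A) r. P * A * Q = 1\<^sub>m r)"

lemma rank_geI:
  "P \<in> carrier_mat r n ==> A \<in> carrier_mat n m ==> Q \<in> carrier_mat m r ==> P * A * Q = 1\<^sub>m r ==> rank_ge A r"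
  by (auto simp: rank_ge_def)

lemma rank_ge_mult:
  assumes "rank_ge (B * C) r" "B \<in> carrier_mat n t" "C \<in> carrier_mat t m"
  shows "r \<le> t"
proof -
  from assms(1) obtain P Q where PQ: "P \<in> carrier_mat r (dim_row (B * C))" "Q \<in> carrier_mat (dim_col (B * C)) r"
      "P * (B * C) * Q = 1\<^sub>m r" by (auto simp: rank_ge_def)
  then have "(P * B) * (C * Q) = 1\<^sub>m r" using assms(2,3) by (simp add: mat_assoc)
  then show ?thesis
    using PQ assms(2,3) by (intro left_inverse_dim_le[of "P * B" r t "C * Q"]) (auto intro!: carrier_matI)
qed

text \<open>The Schur complement step: if \<open>P A Q = 1\<close>, then any part of the defect
  \<open>A - A Q P A\<close> that can be inverted from both sides can be added to the identity block.
  The rows \<open>\<Phi>\<close> and columns \<open>\<Psi>\<close> come in blocks, since the step is also used for matrices that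
  consist of blocks from a division algebra.\<close>

lemma rank_extend:
  fixes A :: "'a :: ring_1 mat"
  assumes [simp]: "dim_row A = n" "dim_col A = m" "dim_row P = r" "dim_col P = n" "dim_row Q = m" "dim_col Q = r"
    "dim_row \<Phi> = s" "dim_col \<Phi> = n" "dim_row \<Psi> = m" "dim_col \<Psi> = s"
    and PAQ: "P * A * Q = 1\<^sub>m r" and \<Phi>\<Psi>: "\<Phi> * (A - A * Q * P * A) * \<Psi> = 1\<^sub>m s"
  shows "vstack P (\<Phi> - \<Phi> * A * Q * P) * A * hstack Q (\<Psi> - Q * P * A * \<Psi>) = 1\<^sub>m (r + s)"
proof -
  have PAQ': "P * (A * Q) = 1\<^sub>m r" using PAQ by (simp add: mat_assoc)
  have PAQX: "P * (A * (Q * Z)) = Z" if [simp]: "dim_row Z = r" for Z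
  proof -
    have "P * (A * (Q * Z)) = (P * (A * Q)) * Z" by (simp add: mat_assoc)
    then show ?thesis unfolding PAQ' by simp
  qed
  have 1: "P * (A * (\<Psi> - Q * P * A * \<Psi>)) = 0\<^sub>m r s"
    by (simp add: mat_assoc mat_distrib PAQX)
  have h1: "P * (A * (\<Psi> - Q * (P * (A * \<Psi>)))) = 0\<^sub>m r s"
    by (simp add: mat_assoc mat_distrib PAQX)
  have 2: "(\<Phi> - \<Phi> * A * Q * P) * (A * Q) = 0\<^sub>m s r"
    by (simp add: mat_assoc mat_distrib PAQX PAQ')
  have "(\<Phi> - \<Phi> * A * Q * P) * (A * (\<Psi> - Q * P * A * \<Psi>)) = \<Phi> * (A * (\<Psi> - Q * P * A * \<Psi>))"
    by (subst mat_distrib(4)) (simp_all add: mat_assoc h1)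
  also have "\<dots> = \<Phi> * (A - A * Q * P * A) * \<Psi>"
    by (simp add: mat_assoc mat_distrib)
  finally have 3: "(\<Phi> - \<Phi> * A * Q * P) * (A * (\<Psi> - Q * P * A * \<Psi>)) = 1\<^sub>m s" using \<Phi>\<Psi> by simp
  have "vstack P (\<Phi> - \<Phi> * A * Q * P) * A * hstack Q (\<Psi> - Q * P * A * \<Psi>)
    = vstack (hstack (P * (A * Q)) (P * (A * (\<Psi> - Q * P * A * \<Psi>))))
       (hstack ((\<Phi> - \<Phi> * A * Q * P) * (A * Q)) ((\<Phi> - \<Phi> * A * Q * P) * (A * (\<Psi> - Q * P * A * \<Psi>))))"
    by (simp add: vstack_mult mult_hstack mat_assoc vstack_hstack hstack_vstack_blocks)
  also have "\<dots> = 1\<^sub>m (r + s)"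
    unfolding 1 2 3 PAQ' by (subst vstack_hstack) simp_all
  finally show ?thesis .
qed

lemma max_rank_obtain:
  fixes A :: "'a :: field mat"
  assumes A: "A \<in> carrier_mat n m"
  obtains r P Q where "P \<in> carrier_mat r n" "Q \<in> carrier_mat m r" "P * A * Q = 1\<^sub>m r"
    "A * Q * P * A = A" "\<And>s. rank_ge A s ==> s \<le> r"
proof -
  have bound: "s \<le> m" if "rank_ge A s" for s
  proof -
    have "rank_ge (A * 1\<^sub>m m) s" using that A by simp
    then show ?thesis by (rule rank_ge_mult[of A "1\<^sub>m m" s n m m]) (use A in simp_all)
  qed
  have ex: "rank_ge A 0" using A by (intro rank_geI[of "0\<^sub>m 0 n" 0 n A m "0\<^sub>m m 0"]) auto
  define r where "r = (GREATEST r. rank_ge A r)"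
  have r: "rank_ge A r" unfolding r_def by (rule GreatestI_nat[of "rank_ge A" 0 m]) (use bound ex in auto)
  have max: "s \<le> r" if "rank_ge A s" for s
    unfolding r_def by (rule Greatest_le_nat[of "rank_ge A" s m]) (use bound that in auto)
  from r A obtain P Q where PQ: "P \<in> carrier_mat r n" "Q \<in> carrier_mat m r" and PAQ: "P * A * Q = 1\<^sub>m r"
    by (auto simp: rank_ge_def)
  have eq: "A = A * Q * P * A"
  proof (rule ccontr)
    assume neq: "A \<noteq> A * Q * P * A"
    let ?Z = "A - A * Q * P * A"
    have "?Z \<noteq> 0\<^sub>m n m" using neq mat_diff_eq_0[of A "A * Q * P * A"] A PQ by auto
    then obtain i j where ij: "i < n" "j < m" "?Z $$ (i, j) \<noteq> 0"
      by (rule mat_nonzero_entry) (use A PQ in simp_all)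
    define \<Phi> where "\<Phi> = mat 1 n (\<lambda>(_, k). if k = i then 1 / ?Z $$ (i, j) else 0)"
    define \<Psi> where "\<Psi> = mat m 1 (\<lambda>(k, _). if k = j then 1 else (0::'a))"
    have "(\<Phi> * ?Z) $$ (0, k) = (1 / ?Z $$ (i, j)) * ?Z $$ (i, k)" if "k < m" for k
      using that ij A PQ
      by (subst mult_index) (auto simp: \<Phi>_def if_distrib[of "\<lambda>x. x * _"] sum.delta cong: if_cong simp del: index_mult_mat(1) index_minus_mat(1))
    then have "(\<Phi> * ?Z * \<Psi>) $$ (0, 0) = 1"
      using ij A PQ
      by (subst mult_index) (auto simp: \<Phi>_def \<Psi>_def if_distrib[of "\<lambda>x. _ * x"] sum.delta cong: if_cong simp del: index_mult_mat(1) index_minus_mat(1))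
    then have "\<Phi> * ?Z * \<Psi> = 1\<^sub>m 1" by (intro eq_matI) (auto simp: \<Phi>_def \<Psi>_def simp del: index_mult_mat(1))
    then have "vstack P (\<Phi> - \<Phi> * A * Q * P) * A * hstack Q (\<Psi> - Q * P * A * \<Psi>) = 1\<^sub>m (r + 1)"
      using A PQ PAQ by (intro rank_extend[of A n m]) (auto simp: \<Phi>_def \<Psi>_def)
    then have "rank_ge A (r + 1)"
      using A PQ by (intro rank_geI[of "vstack P (\<Phi> - \<Phi> * A * Q * P)" _ n A m]) (auto simp: \<Phi>_def \<Psi>_def intro!: carrier_matI)
    then show False using max by fastforce
  qed
  show thesis by (rule that[OF PQ PAQ eq[symmetric] max])
qed

text \<open>A set of column vectors has a basis: the columns of \<open>B\<close>. That they lie in the span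
  of the set is expressed by duality, which is how it is used.\<close>

lemma span_basis:
  fixes S :: "'a :: field mat set"
  assumes S: "\<And>x. x \<in> S ==> x \<in> carrier_mat n 1"
  obtains c B B' where "B \<in> carrier_mat n c" "B' \<in> carrier_mat c n" "B' * B = 1\<^sub>m c"
    "\<And>x. x \<in> S ==> B * (B' * x) = x"
    "\<And>Y k. Y \<in> carrier_mat k n ==> (\<And>x. x \<in> S ==> Y * x = 0\<^sub>m k 1) ==> Y * B = 0\<^sub>m k c"
proof -
  define P where "P = (\<lambda>c. \<exists>B\<in>carrier_mat n c. \<exists>B'\<in>carrier_mat c n. B' * B = 1\<^sub>m c \<and>
    (\<forall>k. \<forall>Y\<in>carrier_mat k n. (\<forall>x\<in>S. Y * x = 0\<^sub>m k 1) --> Y * B = 0\<^sub>m k c))"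
  have bound: "c \<le> n" if "P c" for c using that left_inverse_dim_le unfolding P_def by blast
  have "P 0" unfolding P_def
    by (rule bexI[of _ "0\<^sub>m n 0"], rule bexI[of _ "0\<^sub>m 0 n"]) auto
  define c where "c = (GREATEST c. P c)"
  have "P c" unfolding c_def by (rule GreatestI_nat[of P 0 n]) (use bound \<open>P 0\<close> in auto)
  have max: "s \<le> c" if "P s" for s
    unfolding c_def by (rule Greatest_le_nat[of P s n]) (use bound that in auto)
  from \<open>P c\<close>[unfolded P_def] obtain B B' where
    B: "B \<in> carrier_mat n c" "B' \<in> carrier_mat c n" "B' * B = 1\<^sub>m c" and
    Y0: "\<forall>k. \<forall>Y\<in>carrier_mat k n. (\<forall>x\<in>S. Y * x = 0\<^sub>m k 1) --> Y * B = 0\<^sub>m k c"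
    by (elim bexE conjE) (rule that)
  have Y: "Y * B = 0\<^sub>m k c" if "Y \<in> carrier_mat k n" "\<And>x. x \<in> S ==> Y * x = 0\<^sub>m k 1" for k Y
    using Y0 that by simp
  have "B * (B' * x) = x" if x: "x \<in> S" for x
  proof (rule ccontr)
    assume neq: "B * (B' * x) \<noteq> x"
    note [simp] = carrier_matD[OF S[OF x]] carrier_matD[OF B(1)] carrier_matD[OF B(2)]
    let ?z = "x - B * (B' * x)"
    have "?z \<noteq> 0\<^sub>m n 1" using neq mat_diff_eq_0[of x "B * (B' * x)"] by auto
    then obtain i j where "i < n" "j < 1" "?z $$ (i, j) \<noteq> 0"
      by (rule mat_nonzero_entry) auto
    then have i: "i < n" "?z $$ (i, 0) \<noteq> 0" by auto
    define f where "f = mat 1 n (\<lambda>(_, k). if k = i then 1 / ?z $$ (i, 0) else 0)"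
    have [simp]: "dim_row f = 1" "dim_col f = n" by (simp_all add: f_def)
    have "(f * ?z) $$ (0, 0) = 1" using i
      by (subst mult_index) (auto simp: f_def if_distrib[of "\<lambda>x. x * _"] sum.delta cong: if_cong simp del: index_mult_mat(1) index_minus_mat(1))
    then have fz: "f * ?z = 1\<^sub>m 1" by (intro eq_matI) (auto simp del: index_mult_mat(1))
    define g where "g = f - f * B * B'"
    have [simp]: "dim_row g = 1" "dim_col g = n" by (simp_all add: g_def)
    have BB: "B' * (B * Z) = Z" if "dim_row Z = c" for Z
      using that B(3) by (simp flip: mat_assoc)
    have gB: "g * B = 0\<^sub>m 1 c"
      unfolding g_def by (simp add: mat_distrib mat_assoc B(3))
    have gx: "g * x = 1\<^sub>m 1" using fz by (simp add: g_def mat_distrib mat_assoc)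
    let ?B = "hstack B x" and ?B' = "vstack (B' - B' * x * g) g"
    have h1: "(B' - B' * x * g) * B = 1\<^sub>m c" by (simp add: mat_distrib mat_assoc gB B(3))
    have h2: "(B' - B' * x * g) * x = 0\<^sub>m c 1" by (simp add: mat_distrib mat_assoc gx)
    have "?B' * ?B = vstack (hstack ((B' - B' * x * g) * B) ((B' - B' * x * g) * x)) (hstack (g * B) (g * x))"
      by (simp add: vstack_mult mult_hstack vstack_hstack hstack_vstack_blocks)
    then have 1: "?B' * ?B = 1\<^sub>m (c + 1)"
      unfolding h1 h2 gB gx by (simp add: vstack_hstack)
    have "P (c + 1)" unfolding P_def
    proof (rule bexI[of _ ?B], rule bexI[of _ ?B'], intro conjI allI ballI impI)
      fix k Y assume a: "Y \<in> carrier_mat k n" "\<forall>x\<in>S. Y * x = 0\<^sub>m k 1"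
      then have "Y * B = 0\<^sub>m k c" using Y by blast
      with a x show "Y * ?B = 0\<^sub>m k (c + 1)" by (simp add: mult_hstack)
    qed (use 1 in \<open>auto intro!: carrier_matI\<close>)
    then show False using max by fastforce
  qed
  then show thesis using that B Y by blast
qed

lemma complement_basis:
  fixes B B' :: "'a :: field mat"
  assumes B: "B \<in> carrier_mat n c" "B' \<in> carrier_mat c n" "B' * B = 1\<^sub>m c"
  obtains F F' where "c \<le> n" "F \<in> carrier_mat n (n - c)" "F' \<in> carrier_mat (n - c) n" "F' * F = 1\<^sub>m (n - c)"
    "F' * B = 0\<^sub>m (n - c) c" "B' * F = 0\<^sub>m c (n - c)" "F * F' = 1\<^sub>m n - B * B'"
proof -
  note [simp] = carrier_matD[OF B(1)] carrier_matD[OF B(2)]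
  define E where "E = 1\<^sub>m n - B * B'"
  have E [simp]: "dim_row E = n" "dim_col E = n" by (simp_all add: E_def)
  have BB: "B' * (B * Z) = Z" if "dim_row Z = c" for Z
    using that B(3) by (simp flip: mat_assoc)
  have EB: "E * B = 0\<^sub>m n c" by (simp add: E_def mat_distrib mat_assoc B(3))
  have BE: "B' * E = 0\<^sub>m c n" by (simp add: E_def mat_distrib BB)
  have EE: "E * E = E"
  proof -
    have "E * (1\<^sub>m n - B * B') = E - E * B * B'" by (simp add: mat_distrib mat_assoc)
    then show ?thesis using EB by (simp flip: E_def)
  qed
  obtain d P Q where PQ: "P \<in> carrier_mat d n" "Q \<in> carrier_mat n d" "P * E * Q = 1\<^sub>m d" "E * Q * P * E = E"
    by (rule max_rank_obtain[of E n n]) (auto intro: carrier_matI)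
  note [simp] = carrier_matD[OF PQ(1)] carrier_matD[OF PQ(2)]
  define F where "F = E * Q" define F' where "F' = P * E"
  have [simp]: "dim_row F = n" "dim_col F = d" "dim_row F' = d" "dim_col F' = n" by (simp_all add: F_def F'_def)
  have "E * (E * Q) = E * Q" using EE by (simp flip: mat_assoc)
  then have 1: "F' * F = 1\<^sub>m d" using PQ(3) by (simp add: F_def F'_def mat_assoc)
  have 2: "F * F' = E" using PQ(4) by (simp add: F_def F'_def mat_assoc)
  have 3: "F' * B = 0\<^sub>m d c" by (simp add: F'_def mat_assoc EB)
  have 4: "B' * F = 0\<^sub>m c d" using BE by (simp add: F_def flip: mat_assoc)
  have "vstack B' F' * hstack B F = 1\<^sub>m (c + d)"
    by (simp add: vstack_mult mult_hstack 1 3 4 B(3) vstack_hstack hstack_vstack_blocks)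
  then have "c + d \<le> n" by (intro left_inverse_dim_le[of "vstack B' F'" _ _ "hstack B F"]) (auto intro!: carrier_matI)
  have "hstack B F * vstack B' F' = 1\<^sub>m n"
    by (simp add: hstack_vstack 2) (auto simp: E_def intro!: eq_matI)
  then have "n \<le> c + d" by (intro left_inverse_dim_le[of "hstack B F" _ _ "vstack B' F'"]) (auto intro!: carrier_matI)
  with \<open>c + d \<le> n\<close> have d: "d = n - c" "c \<le> n" by auto
  show thesis
    by (rule that[of F F']) (use d 1 2 3 4 in \<open>auto simp: E_def intro!: carrier_matI\<close>)
qed


section \<open>Kronecker sums\<close>

lemma sum_divmod:
  "(\<Sum>k\<in>{0..<p * q}. f (k div q) (k mod q)) = (\<Sum>s\<in>{0..<p}. \<Sum>a\<in>{0..<q}. f s a)" for p q :: nat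
proof (induction p)
  case (Suc p)
  have "(\<Sum>k\<in>{0..<Suc p * q}. f (k div q) (k mod q)) =
    (\<Sum>k\<in>{0..<p * q}. f (k div q) (k mod q)) + (\<Sum>a\<in>{0..<q}. f ((p * q + a) div q) ((p * q + a) mod q))"
    by (subst sum_split_add[symmetric]) (simp add: add.commute)
  also have "(\<Sum>a\<in>{0..<q}. f ((p * q + a) div q) ((p * q + a) mod q)) = (\<Sum>a\<in>{0..<q}. f p a)"
    by (intro sum.cong) auto
  finally show ?case using Suc by simp
qed simp

lemma divmod_less: "i < p * q ==> i div q < p" "i < p * q ==> i mod q < (q :: nat)"
  by (simp add: less_mult_imp_div_less) (metis mod_less_divisor mult_0_right not_gr_zero not_less_zero)

definition kron :: "'a :: times mat => 'a mat => 'a mat" where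
  "kron A B = mat (dim_row A * dim_row B) (dim_col A * dim_col B)
     (\<lambda>(i, j). A $$ (i div dim_row B, j div dim_col B) * B $$ (i mod dim_row B, j mod dim_col B))"

lemma kron_dim [simp]:
  "dim_row (kron A B) = dim_row A * dim_row B" "dim_col (kron A B) = dim_col A * dim_col B"
  by (simp_all add: kron_def)

lemma kron_index:
  "i < dim_row A * dim_row B ==> j < dim_col A * dim_col B ==>
   kron A B $$ (i, j) = A $$ (i div dim_row B, j div dim_col B) * B $$ (i mod dim_row B, j mod dim_col B)"
  by (simp add: kron_def)

lemma kron_mult:
  fixes A B C D :: "'a :: comm_ring_1 mat"
  assumes "dim_col A = dim_row C" "dim_col B = dim_row D"
  shows "kron A B * kron C D = kron (A * C) (B * D)"
proof (rule eq_matI)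
  fix i j assume "i < dim_row (kron (A * C) (B * D))" "j < dim_col (kron (A * C) (B * D))"
  then have ij: "i < dim_row A * dim_row B" "j < dim_col C * dim_col D" by simp_all
  let ?i = "i div dim_row B" and ?i' = "i mod dim_row B" and ?j = "j div dim_col D" and ?j' = "j mod dim_col D"
  have "(kron A B * kron C D) $$ (i, j) =
    (\<Sum>k\<in>{0..<dim_row C * dim_row D}. (A $$ (?i, k div dim_row D) * B $$ (?i', k mod dim_row D)) *
       (C $$ (k div dim_row D, ?j) * D $$ (k mod dim_row D, ?j')))"
    using ij assms by (subst mult_index) (auto simp: kron_index intro!: sum.cong)
  also have "\<dots> = (\<Sum>s\<in>{0..<dim_row C}. \<Sum>a\<in>{0..<dim_row D}. (A $$ (?i, s) * B $$ (?i', a)) * (C $$ (s, ?j) * D $$ (a, ?j')))"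
    by (rule sum_divmod)
  also have "\<dots> = (\<Sum>s\<in>{0..<dim_row C}. A $$ (?i, s) * C $$ (s, ?j)) * (\<Sum>a\<in>{0..<dim_row D}. B $$ (?i', a) * D $$ (a, ?j'))"
    by (simp add: sum_product ac_simps)
  also have "\<dots> = kron (A * C) (B * D) $$ (i, j)"
    using ij assms divmod_less[OF ij(1)] divmod_less[OF ij(2)] by (simp add: kron_index mult_index del: index_mult_mat(1))
  finally show "(kron A B * kron C D) $$ (i, j) = kron (A * C) (B * D) $$ (i, j)" .
qed (simp_all)

lemma kron_one: "kron (1\<^sub>m p) (1\<^sub>m q) = (1\<^sub>m (p * q) :: 'a :: comm_ring_1 mat)"
proof (rule eq_matI)
  fix i j assume "i < dim_row (1\<^sub>m (p * q))" "j < dim_col (1\<^sub>m (p * q))"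
  then have ij: "i < p * q" "j < p * q" by simp_all
  have "i div q = j div q \<and> i mod q = j mod q \<longleftrightarrow> i = j"
    by (metis div_mult_mod_eq)
  then show "kron (1\<^sub>m p) (1\<^sub>m q) $$ (i, j) = (1\<^sub>m (p * q) :: 'a mat) $$ (i, j)"
    using ij divmod_less[OF ij(1)] divmod_less[OF ij(2)] by (auto simp: kron_index)
qed simp_all

text \<open>The value \<open>\<Sum>\<^sub>l U\<^sub>l \<otimes> L\<^sub>l\<close> of the pencil with coefficients \<open>L\<^sub>l\<close> of size \<open>n\<close>
  at a tuple of \<open>m \<times> m'\<close> matrices.\<close>

definition ksum :: "'l set => nat => nat => nat => ('l => 'a mat) => ('l => 'a mat) => 'a :: comm_ring_1 mat" where
  "ksum G m m' n U L = mat (m * n) (m' * n)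
     (\<lambda>(i, j). \<Sum>l\<in>G. U l $$ (i div n, j div n) * L l $$ (i mod n, j mod n))"

lemma ksum_dim [simp]: "dim_row (ksum G m m' n U L) = m * n" "dim_col (ksum G m m' n U L) = m' * n"
  by (simp_all add: ksum_def)

lemma ksum_carrier [simp]: "ksum G m m' n U L \<in> carrier_mat (m * n) (m' * n)"
  by (simp add: ksum_def)

lemma ksum_index:
  "i < m * n ==> j < m' * n ==>
   ksum G m m' n U L $$ (i, j) = (\<Sum>l\<in>G. U l $$ (i div n, j div n) * L l $$ (i mod n, j mod n))"
  by (simp add: ksum_def)

lemma ksum_zero: "(\<And>l. l \<in> G ==> U l = 0\<^sub>m m m') ==> ksum G m m' n U L = 0\<^sub>m (m * n) (m' * n)"
  using divmod_less by (intro eq_matI) (auto simp: ksum_index intro!: sum.neutral)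

lemma ksum_four_block:
  assumes [simp]: "\<And>l. U1 l \<in> carrier_mat m1 m1'" "\<And>l. U2 l \<in> carrier_mat m1 m2'"
    "\<And>l. U3 l \<in> carrier_mat m2 m1'" "\<And>l. U4 l \<in> carrier_mat m2 m2'"
  shows "ksum G (m1 + m2) (m1' + m2') n (\<lambda>l. four_block_mat (U1 l) (U2 l) (U3 l) (U4 l)) L =
    four_block_mat (ksum G m1 m1' n U1 L) (ksum G m1 m2' n U2 L) (ksum G m2 m1' n U3 L) (ksum G m2 m2' n U4 L)"
proof (rule eq_matI; (simp add: algebra_simps; fail)?)
  fix i j
  assume "i < dim_row (four_block_mat (ksum G m1 m1' n U1 L) (ksum G m1 m2' n U2 L) (ksum G m2 m1' n U3 L) (ksum G m2 m2' n U4 L))"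
    and "j < dim_col (four_block_mat (ksum G m1 m1' n U1 L) (ksum G m1 m2' n U2 L) (ksum G m2 m1' n U3 L) (ksum G m2 m2' n U4 L))"
  then have ij: "i < m1 * n + m2 * n" "j < m1' * n + m2' * n" by simp_all
  have split: "k div n < a \<and> k < (a + b) * n \<or>
      k div n < a + b \<and> \<not> k div n < a \<and> k mod n = (k - a * n) mod n \<and> k div n - a = (k - a * n) div n \<and> k - a * n < b * n \<and> k < (a + b) * n"
    if k: "k < a * n + b * n" for k a b
  proof (cases "k < a * n")
    case True
    then show ?thesis using k divmod_less[OF True] by (simp add: algebra_simps)
  next
    case False
    then obtain k' where k': "k = a * n + k'" using le_Suc_ex by (metis not_less)
    then have "k' < b * n" using k by simp
    then have "n > 0" by (cases "n = 0") auto
    then show ?thesis using k k' divmod_less[OF \<open>k' < b * n\<close>] by (simp add: algebra_simps)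
  qed
  have lt: "k < a * n \<longleftrightarrow> k div n < a" if "k < a * n + b * n" for k a b
    using that by (metis add_is_0 div_less_iff_less_mult mult_0_right not_gr_zero not_less_zero)
  show "ksum G (m1 + m2) (m1' + m2') n (\<lambda>l. four_block_mat (U1 l) (U2 l) (U3 l) (U4 l)) L $$ (i, j) =
    four_block_mat (ksum G m1 m1' n U1 L) (ksum G m1 m2' n U2 L) (ksum G m2 m1' n U3 L) (ksum G m2 m2' n U4 L) $$ (i, j)"
    using ij split[OF ij(1)] split[OF ij(2)] carrier_matD[OF assms(1)] carrier_matD[OF assms(4)]
    by (auto simp: lt[OF ij(1)] lt[OF ij(2)] ksum_index)
qed

lemma four_block_mult_vstack:
  fixes A :: "'a :: ring mat"
  assumes "dim_row A = dim_row B" "dim_row C = dim_row D" "dim_col A = dim_col C" "dim_col B = dim_col D"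
    "dim_row S = dim_col A" "dim_row T = dim_col B" "dim_col S = dim_col T"
  shows "four_block_mat A B C D * vstack S T = vstack (A * S + B * T) (C * S + D * T)"
  using assms by (simp add: vstack_mult hstack_vstack flip: vstack_hstack)

lemma hstack_mult_four_block:
  fixes A :: "'a :: ring mat"
  assumes "dim_row A = dim_row B" "dim_row C = dim_row D" "dim_col A = dim_col C" "dim_col B = dim_col D"
    "dim_col S = dim_row A" "dim_col T = dim_row C" "dim_row S = dim_row T"
  shows "hstack S T * four_block_mat A B C D = hstack (S * A + T * C) (S * B + T * D)"
  using assms by (simp add: mult_hstack hstack_vstack flip: hstack_vstack_blocks)

lemma four_block_mult:
  fixes A :: "'a :: ring mat"
  assumes "dim_row A = dim_row B" "dim_row C = dim_row D" "dim_col A = dim_col C" "dim_col B = dim_col D"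
    "dim_row A' = dim_row B'" "dim_row C' = dim_row D'" "dim_col A' = dim_col C'" "dim_col B' = dim_col D'"
    "dim_col A = dim_row A'" "dim_col B = dim_row C'"
  shows "four_block_mat A B C D * four_block_mat A' B' C' D' =
    four_block_mat (A * A' + B * C') (A * B' + B * D') (C * A' + D * C') (C * B' + D * D')"
  using assms by (intro mult_four_block_mat[of _ "dim_row A" "dim_col A" _ "dim_col B" _ "dim_row C"]) auto

section \<open>Shrunk subspaces from bounded ranks\<close>

text \<open>Ranks of block triangular matrices are superadditive, and strictly so as soon as the upper right
  block maps some kernel vector of the lower block outside the image of the upper block.\<close>

context
  fixes A B D :: "'a :: field mat" and p q r s :: nat and P Q P2 Q2 :: "'a mat"
  assumes [simp]: "dim_row A = p" "dim_col A = p" "dim_row B = p" "dim_col B = q" "dim_row D = q" "dim_col D = q"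
    "dim_row P = r" "dim_col P = p" "dim_row Q = p" "dim_col Q = r"
    "dim_row P2 = s" "dim_col P2 = q" "dim_row Q2 = q" "dim_col Q2 = s"
    and PAQ: "P * A * Q = 1\<^sub>m r" and PDQ: "P2 * D * Q2 = 1\<^sub>m s"
begin

private definition "T = four_block_mat A B (0\<^sub>m q p) D"
private definition "PT = four_block_mat P (0\<^sub>m r q - P * B * Q2 * P2) (0\<^sub>m s p) P2"
private definition "QT = four_block_mat Q (0\<^sub>m p s) (0\<^sub>m q r) Q2"

private lemma dims [simp]: "dim_row T = p + q" "dim_col T = p + q" "dim_row PT = r + s" "dim_col PT = p + q"
  "dim_row QT = p + q" "dim_col QT = r + s"
  by (simp_all add: T_def PT_def QT_def)

private lemma PTQ: "PT * T * QT = 1\<^sub>m (r + s)"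
proof -
  have PAQ': "P * (A * Q) = 1\<^sub>m r" "P2 * (D * Q2) = 1\<^sub>m s" using PAQ PDQ by (simp_all add: mat_assoc)
  show ?thesis
    by (simp add: PT_def T_def QT_def four_block_mult mat_assoc mat_distrib PAQ') (auto intro!: eq_matI)
qed

lemma block_rank: "rank_ge (four_block_mat A B (0\<^sub>m q p) D) (r + s)"
  using PTQ unfolding T_def[symmetric]
  by (intro rank_geI[of PT _ "p + q" _ "p + q" QT]) (auto intro!: carrier_matI)

lemma block_rank_Suc:
  assumes [simp]: "dim_row w = q" "dim_col w = 1" "dim_row \<phi> = 1" "dim_col \<phi> = p"
    and Dw: "D * w = 0\<^sub>m q 1" and \<phi>A: "\<phi> * A = 0\<^sub>m 1 p" and \<phi>Bw: "\<phi> * (B * w) = 1\<^sub>m 1"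
  shows "rank_ge (four_block_mat A B (0\<^sub>m q p) D) (r + s + 1)"
proof -
  let ?\<Phi> = "hstack \<phi> (0\<^sub>m 1 q)" and ?\<Psi> = "vstack (0\<^sub>m p 1) w"
  have 1: "T * ?\<Psi> = vstack (B * w) (0\<^sub>m q 1)"
    by (simp add: T_def four_block_mult_vstack Dw)
  have 2: "?\<Phi> * T = hstack (0\<^sub>m 1 p) (\<phi> * B)"
    by (simp add: T_def hstack_mult_four_block \<phi>A)
  have 3: "?\<Phi> * (T * ?\<Psi>) = 1\<^sub>m 1"
    unfolding 1 by (simp add: hstack_vstack \<phi>Bw)
  have 4: "PT * (T * ?\<Psi>) = vstack (P * (B * w)) (0\<^sub>m s 1)"
    unfolding 1 by (simp add: PT_def four_block_mult_vstack)
  have 5: "?\<Phi> * T * QT = hstack (0\<^sub>m 1 r) (\<phi> * B * Q2)"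
    unfolding 2 by (simp add: QT_def hstack_mult_four_block)
  have "(?\<Phi> * T * QT) * (PT * (T * ?\<Psi>)) = 0\<^sub>m 1 1"
    unfolding 4 5 by (simp add: hstack_vstack)
  then have 6: "?\<Phi> * (T * (QT * (PT * (T * ?\<Psi>)))) = 0\<^sub>m 1 1"
    by (simp add: mat_assoc)
  have "?\<Phi> * (T - T * QT * PT * T) * ?\<Psi> = 1\<^sub>m 1"
    by (simp add: mat_assoc mat_distrib 3 6 del: One_nat_def)
  then have "vstack PT (?\<Phi> - ?\<Phi> * T * QT * PT) * T * hstack QT (?\<Psi> - QT * PT * T * ?\<Psi>) = 1\<^sub>m (r + s + 1)"
    by (intro rank_extend[of T "p + q" "p + q"]) (auto simp: PTQ)
  then show ?thesis unfolding T_def[symmetric]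
    by (intro rank_geI[of "vstack PT (?\<Phi> - ?\<Phi> * T * QT * PT)" _ "p + q" _ "p + q"]) (auto intro!: carrier_matI)
qed

end


definition ucol :: "nat => nat => 'a :: zero_neq_one mat" where
  "ucol n j = mat n 1 (\<lambda>(i, _). if i = j then 1 else 0)"

lemma ucol_carrier [simp]: "ucol n j \<in> carrier_mat n 1" "dim_row (ucol n j) = n" "dim_col (ucol n j) = 1"
  by (simp_all add: ucol_def)

lemma mult_ucol_index:
  fixes M :: "'a :: ring_1 mat"
  shows "i < dim_row M ==> j < dim_col M ==> (M * ucol (dim_col M) j) $$ (i, 0) = M $$ (i, j)"
  by (subst mult_index) (auto simp: ucol_def if_distrib[of "\<lambda>x. _ * x"] cong: if_cong)

lemma mat_eq_by_columns:
  fixes M :: "'a :: ring_1 mat"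
  assumes "dim_row M = r" "dim_col M = c" "dim_row M' = r" "dim_col M' = c"
    and "\<And>j. j < c ==> M * ucol c j = M' * ucol c j"
  shows "M = M'"
  using assms by (intro eq_matI) (metis mult_ucol_index, auto)

lemma div_mod_iff: "k < n ==> j = t * n + k \<longleftrightarrow> t = j div n \<and> k = j mod n" for j k n t :: nat
  by auto

text \<open>Multiplication by this matrix selects the rows \<open>t n, \<dots>, t n + n - 1\<close>.\<close>

definition slice :: "nat => nat => nat => 'a :: comm_ring_1 mat" where
  "slice m n t = mat n (m * n) (\<lambda>(a, k). if k = t * n + a then 1 else 0)"

lemma slice_dim [simp]: "dim_row (slice m n t) = n" "dim_col (slice m n t) = m * n"
  by (simp_all add: slice_def)

lemma slice_less: "t < m ==> a < n ==> t * n + a < m * (n :: nat)"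
  by (metis add.commute less_le_trans mult.commute mult_Suc_right mult_le_mono2 nat_add_left_cancel_less Suc_leI)

lemma slice_mult_index:
  assumes "t < m" "a < n" "dim_row Z = m * n" "j < dim_col Z"
  shows "(slice m n t * Z) $$ (a, j) = Z $$ (t * n + a, j)"
  using assms slice_less[OF assms(1,2)]
  by (subst mult_index) (auto simp: slice_def if_distrib[of "\<lambda>x. x * _"] cong: if_cong)

lemma slices_eq:
  assumes [simp]: "dim_row Z = m * n" "dim_row Z' = m * n" "dim_col Z = dim_col Z'"
    and eq: "\<And>t. t < m ==> slice m n t * Z = slice m n t * Z'"
  shows "Z = Z'"
proof (rule eq_matI)
  fix i j assume "i < dim_row Z'" "j < dim_col Z'"
  then have ij: "i < m * n" "j < dim_col Z'" by simp_all
  note dm = divmod_less[OF ij(1)]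
  have "Z $$ (i, j) = (slice m n (i div n) * Z) $$ (i mod n, j)"
    using ij dm by (subst slice_mult_index) auto
  also have "\<dots> = Z' $$ (i, j)"
    unfolding eq[OF dm(1)] using ij dm by (subst slice_mult_index) auto
  finally show "Z $$ (i, j) = Z' $$ (i, j)" .
qed simp_all

lemma slice_kron:
  fixes E :: "'a :: comm_ring_1 mat"
  assumes t: "t < m" and [simp]: "dim_row E = n" "dim_col E = n"
  shows "slice m n t * kron (1\<^sub>m m) E = E * slice m n t"
proof (rule eq_matI)
  fix a j assume "a < dim_row (E * slice m n t)" "j < dim_col (E * slice m n t)"
  then have aj: "a < n" "j < m * n" by simp_all
  note dm = divmod_less[OF aj(2)]
  have "(E * slice m n t) $$ (a, j) = (if t = j div n then E $$ (a, j mod n) else 0)"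
    using aj dm by (subst mult_index) (auto simp: slice_def div_mod_iff if_distrib[of "\<lambda>x. _ * x"] cong: if_cong)
  also have "\<dots> = (slice m n t * kron (1\<^sub>m m) E) $$ (a, j)"
    using aj t dm slice_less[OF t aj(1)] by (subst slice_mult_index) (auto simp: kron_index)
  finally show "(slice m n t * kron (1\<^sub>m m) E) $$ (a, j) = (E * slice m n t) $$ (a, j)" by simp
qed simp_all

lemma ksum_unit:
  fixes L :: "'l => 'a :: comm_ring_1 mat"
  assumes "finite G" "l \<in> G" and [simp]: "L l \<in> carrier_mat n n"
    and st: "s < m" "t < m"
  shows "ksum G m m n (\<lambda>l'. if l' = l then mat m m (\<lambda>(i, j). if i = s \<and> j = t then 1 else 0) else 0\<^sub>m m m) L =
    transpose_mat (slice m n s) * (L l * slice m n t)" (is "?L = ?R")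
proof (rule eq_matI)
  note [simp] = carrier_matD[OF assms(3)]
  fix i j assume "i < dim_row ?R" "j < dim_col ?R"
  then have ij: "i < m * n" "j < m * n" by simp_all
  note dm = divmod_less[OF ij(1)] divmod_less[OF ij(2)]
  have 1: "(L l * slice m n t) $$ (a, j) = (if t = j div n then L l $$ (a, j mod n) else 0)" if "a < n" for a
    using ij dm that by (subst mult_index) (auto simp: slice_def div_mod_iff if_distrib[of "\<lambda>x. _ * x"] cong: if_cong)
  have 2: "slice m n s $$ (k, i) = (if s = i div n \<and> k = i mod n then 1 else 0 :: 'a)" if "k < n" for k
    using ij that by (auto simp: slice_def div_mod_iff)
  have "?R $$ (i, j) = (\<Sum>k\<in>{0..<n}. if s = i div n \<and> k = i mod n then (L l * slice m n t) $$ (k, j) else 0)"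
    using ij by (subst mult_index) (auto simp: 2 simp del: index_mult_mat(1) intro!: sum.cong)
  also have "\<dots> = (if s = i div n then (L l * slice m n t) $$ (i mod n, j) else 0)"
    using dm by (cases "s = i div n") (simp_all del: index_mult_mat(1))
  also have "\<dots> = (if i div n = s \<and> j div n = t then L l $$ (i mod n, j mod n) else 0)"
    using dm by (auto simp: 1 simp del: index_mult_mat(1))
  also have "\<dots> = (\<Sum>l'\<in>G. if l' = l then (if i div n = s \<and> j div n = t then L l $$ (i mod n, j mod n) else 0) else 0)"
    using assms(1,2) by simp
  also have "\<dots> = ?L $$ (i, j)"
    using ij dm by (auto simp: ksum_index intro!: sum.cong sum.neutral)
  finally show "?L $$ (i, j) = ?R $$ (i, j)" by simp
qed simp_all

text \<open>Passing from the columns of \<open>Z\<close> to the span of all their slices: the slices span a space of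
  dimension at least the number of independent columns of \<open>Z\<close> divided by \<open>m\<close>.\<close>

lemma slices_span:
  fixes Z :: "'a :: field mat"
  assumes Z: "Z \<in> carrier_mat (m * n) q" "Z' \<in> carrier_mat q (m * n)" "Z' * Z = 1\<^sub>m q"
  obtains w B B' where "B \<in> carrier_mat n w" "B' \<in> carrier_mat w n" "B' * B = 1\<^sub>m w" "q \<le> m * w"
    "\<And>Y k. Y \<in> carrier_mat k n ==> (\<And>t. t < m ==> Y * (slice m n t * Z) = 0\<^sub>m k q) ==> Y * B = 0\<^sub>m k w"
proof -
  note [simp] = carrier_matD[OF Z(1)] carrier_matD[OF Z(2)]
  define S where "S = {slice m n t * Z * ucol q j | t j. t < m \<and> j < q}"
  have "x \<in> carrier_mat n 1" if "x \<in> S" for x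
    using that unfolding S_def by (auto intro!: carrier_matI)
  then obtain w B B' where B: "B \<in> carrier_mat n w" "B' \<in> carrier_mat w n" "B' * B = 1\<^sub>m w"
    and BB: "\<And>x. x \<in> S ==> B * (B' * x) = x"
    and Y: "\<And>Y k. Y \<in> carrier_mat k n ==> (\<And>x. x \<in> S ==> Y * x = 0\<^sub>m k 1) ==> Y * B = 0\<^sub>m k w"
    using span_basis[of S n thesis] by blast
  note [simp] = carrier_matD[OF B(1)] carrier_matD[OF B(2)]
  have eq: "B * (B' * (slice m n t * Z)) = slice m n t * Z" if "t < m" for t
  proof (rule mat_eq_by_columns[of _ n q])
    fix j assume "j < q"
    then have "slice m n t * Z * ucol q j \<in> S" using that unfolding S_def by blast
    from BB[OF this] show "B * (B' * (slice m n t * Z)) * ucol q j = slice m n t * Z * ucol q j"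
      by (simp add: mat_assoc)
  qed simp_all
  have "kron (1\<^sub>m m) (B * B') * Z = Z"
  proof (rule slices_eq[of _ m n])
    fix t assume t: "t < m"
    have "slice m n t * (kron (1\<^sub>m m) (B * B') * Z) = B * (B' * (slice m n t * Z))"
      by (simp add: slice_kron[OF t] mat_assoc flip: mat_assoc[of "slice m n t"])
    then show "slice m n t * (kron (1\<^sub>m m) (B * B') * Z) = slice m n t * Z" using eq[OF t] by simp
  qed simp_all
  then have "kron (1\<^sub>m m) B * (kron (1\<^sub>m m) B' * Z) = Z"
    using kron_mult[of "1\<^sub>m m" "1\<^sub>m m" B B'] by (simp flip: mat_assoc)
  then have "(Z' * kron (1\<^sub>m m) B) * (kron (1\<^sub>m m) B' * Z) = 1\<^sub>m q"
    using Z(3) by (simp add: mat_assoc)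
  then have "q \<le> m * w" by (rule left_inverse_dim_le[rotated 2]) (auto intro!: carrier_matI)
  moreover have "Y * B = 0\<^sub>m k w" if "Y \<in> carrier_mat k n" "\<And>t. t < m ==> Y * (slice m n t * Z) = 0\<^sub>m k q" for Y k
  proof (rule Y[OF that(1)])
    fix x assume "x \<in> S"
    then obtain t j where x: "x = slice m n t * Z * ucol q j" "t < m" "j < q" unfolding S_def by blast
    have "Y * x = (Y * (slice m n t * Z)) * ucol q j" using that(1) x by (simp add: mat_assoc)
    then show "Y * x = 0\<^sub>m k 1" using that(2)[OF x(2)] by simp
  qed
  ultimately show thesis using that[OF B] by blast
qed

text \<open>Let \<open>A\<close> be a value of the pencil of maximal rank \<open>R\<close> among the matrices of size \<open>m\<close>, and
  suppose that no value at size \<open>2\<^sup>e m\<close> has rank above \<open>2\<^sup>e R\<close>. The idea is to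
  follow kernel vectors of points of maximal rank. If \<open>x\<close> is the first
  block of such a kernel vector, then every value \<open>L(d)\<close> must map \<open>x\<close> into the image of \<open>A\<close>:
  otherwise a block triangular point of twice the size would have too large a rank. In turn, the
  preimage of \<open>L(d) x\<close> is again the first block of a kernel vector, at that larger point.\<close>

lemma two_power_Suc: "2 ^ Suc e * k = 2 ^ e * k + 2 ^ e * k" for k :: nat
  by simp

locale max_rank_point =
  fixes G :: "'l set" and L :: "'l => 'a :: field mat" and n m R :: nat and a0 :: "'l => 'a mat"
    and P Q :: "'a mat"
  assumes a0: "\<And>l. a0 l \<in> carrier_mat m m"
    and P: "P \<in> carrier_mat R (m * n)" and Q: "Q \<in> carrier_mat (m * n) R"
    and PAQ: "P * ksum G m m n a0 L * Q = 1\<^sub>m R"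
    and AQPA: "ksum G m m n a0 L * Q * P * ksum G m m n a0 L = ksum G m m n a0 L"
    and max: "\<And>e u. (\<And>l. u l \<in> carrier_mat (2 ^ e * m) (2 ^ e * m)) ==>
      \<not> rank_ge (ksum G (2 ^ e * m) (2 ^ e * m) n u L) (2 ^ e * R + 1)"
begin

abbreviation "ev k u \<equiv> ksum G k k n u L"
abbreviation "A \<equiv> ev m a0"

primrec dbl :: "nat => 'l => 'a mat" where
  "dbl 0 = a0"
| "dbl (Suc e) = (\<lambda>l. four_block_mat (dbl e l) (0\<^sub>m (2 ^ e * m) (2 ^ e * m)) (0\<^sub>m (2 ^ e * m) (2 ^ e * m)) (dbl e l))"

definition emb :: "nat => ('l => 'a mat) => 'l => 'a mat" where
  "emb e d = (\<lambda>l. mat (2 ^ e * m) (2 ^ e * m) (\<lambda>(i, j). if i < m \<and> j < m then d l $$ (i, j) else 0))"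

definition top :: "'a mat => 'a mat" where
  "top w = mat (m * n) 1 (\<lambda>(i, _). w $$ (i, 0))"

definition pad :: "nat => 'a mat => 'a mat" where
  "pad e x = mat (2 ^ e * m * n) 1 (\<lambda>(i, _). if i < m * n then x $$ (i, 0) else 0)"

lemma dbl_carrier: "dbl e l \<in> carrier_mat (2 ^ e * m) (2 ^ e * m)"
proof (induction e)
  case (Suc e)
  then show ?case unfolding two_power_Suc by simp
qed (use a0 in simp)

lemma ev_dbl_Suc:
  "ev (2 ^ Suc e * m) (dbl (Suc e)) = four_block_mat (ev (2 ^ e * m) (dbl e)) (0\<^sub>m (2 ^ e * m * n) (2 ^ e * m * n))
     (0\<^sub>m (2 ^ e * m * n) (2 ^ e * m * n)) (ev (2 ^ e * m) (dbl e))"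
  unfolding two_power_Suc dbl.simps
  by (subst ksum_four_block[where ?m1.0 = "2 ^ e * m" and ?m2.0 = "2 ^ e * m" and ?m1'.0 = "2 ^ e * m" and ?m2'.0 = "2 ^ e * m"])
     (simp_all add: dbl_carrier ksum_zero)

lemma ev_dbl_rank: "rank_ge (ev (2 ^ e * m) (dbl e)) (2 ^ e * R)"
proof (induction e)
  case 0
  show ?case using rank_geI[OF P ksum_carrier Q PAQ] by simp
next
  case (Suc e)
  then obtain P' Q' where "P' \<in> carrier_mat (2 ^ e * R) (2 ^ e * m * n)" "Q' \<in> carrier_mat (2 ^ e * m * n) (2 ^ e * R)"
    "P' * ev (2 ^ e * m) (dbl e) * Q' = 1\<^sub>m (2 ^ e * R)" by (auto simp: rank_ge_def)
  then show ?case unfolding ev_dbl_Suc two_power_Suc[of e R]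
    by (intro block_rank[where P = P' and Q = Q' and ?P2.0 = P' and ?Q2.0 = Q']) auto
qed

lemma le_dbl: "m * n \<le> 2 ^ e * m * n" by simp

text \<open>The three facts about the repeated point that are needed: it acts on padded vectors
  blockwise, and padded rows and vectors interact with the embedded direction as expected.\<close>

lemma dbl_pad: "x \<in> carrier_mat (m * n) 1 ==> ev (2 ^ e * m) (dbl e) * pad e x = pad e (A * x)"
proof (induction e)
  case 0
  have "pad 0 y = y" if "y \<in> carrier_mat (m * n) 1" for y
    using that by (intro eq_matI) (auto simp: pad_def)
  moreover have "A * x \<in> carrier_mat (m * n) 1" using 0 by (auto intro!: carrier_matI)
  ultimately show ?case using 0 by (simp del: One_nat_def)
next
  case (Suc e)
  have pad: "pad (Suc e) y = vstack (pad e y) (0\<^sub>m (2 ^ e * m * n) 1)" for y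
    by (intro eq_matI) (auto simp: pad_def dest: less_le_trans[OF _ le_dbl[of e]])
  have [simp]: "dim_row (pad e y) = 2 ^ e * m * n" "dim_col (pad e y) = 1" for y by (simp_all add: pad_def)
  show ?case unfolding ev_dbl_Suc pad
    using Suc by (simp add: four_block_mult_vstack del: One_nat_def)
qed

lemma dbl_pad_row:
  assumes "f \<in> carrier_mat 1 (m * n)" "f * A = 0\<^sub>m 1 (m * n)"
  shows "transpose_mat (pad e (transpose_mat f)) * ev (2 ^ e * m) (dbl e) = 0\<^sub>m 1 (2 ^ e * m * n)"
proof (induction e)
  case 0
  have "transpose_mat (pad 0 (transpose_mat f)) = f"
    using assms by (intro eq_matI) (auto simp: pad_def)
  then show ?case using assms by (simp del: One_nat_def)
next
  case (Suc e)
  have pad: "transpose_mat (pad (Suc e) y) = hstack (transpose_mat (pad e y)) (0\<^sub>m 1 (2 ^ e * m * n))" for y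
    by (intro eq_matI) (auto simp: pad_def dest: less_le_trans[OF _ le_dbl[of e]])
  have [simp]: "dim_row (pad e y) = 2 ^ e * m * n" "dim_col (pad e y) = 1" for y by (simp_all add: pad_def)
  have e2: "2 ^ Suc e * m * n = 2 ^ e * m * n + 2 ^ e * m * n" by simp
  show ?case unfolding ev_dbl_Suc pad e2
    using Suc by (simp add: hstack_mult_four_block del: One_nat_def power_Suc)
qed

lemma pad_dim [simp]: "dim_row (pad e y) = 2 ^ e * m * n" "dim_col (pad e y) = 1"
  by (simp_all add: pad_def)

lemma emb_mult:
  assumes w: "w \<in> carrier_mat (2 ^ e * m * n) 1"
  shows "ev (2 ^ e * m) (emb e d) * w = pad e (ev m d * top w)"
proof (rule eq_matI)
  fix i j assume "i < dim_row (pad e (ev m d * top w))" "j < dim_col (pad e (ev m d * top w))"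
  then have i: "i < 2 ^ e * m * n" and j: "j = 0" by simp_all
  have lt: "k < m * n \<longleftrightarrow> k div n < m" if "k < 2 ^ e * m * n" for k
    using that by (metis div_less_iff_less_mult mult_0_right not_gr_zero not_less_zero)
  have entry: "ev (2 ^ e * m) (emb e d) $$ (i, k) = (if i < m * n \<and> k < m * n then ev m d $$ (i, k) else 0)"
    if k: "k < 2 ^ e * m * n" for k
    using i k divmod_less[OF i] divmod_less[OF k]
    by (auto simp: ksum_index emb_def lt intro!: sum.cong sum.neutral)
  have "(ev (2 ^ e * m) (emb e d) * w) $$ (i, 0) =
    (\<Sum>k\<in>{0..<2 ^ e * m * n}. (if i < m * n \<and> k < m * n then ev m d $$ (i, k) else 0) * w $$ (k, 0))"
    using i w by (subst mult_index) (auto simp: entry intro!: sum.cong)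
  also have "\<dots> = (\<Sum>k\<in>{0..<m * n}. (if i < m * n then ev m d $$ (i, k) else 0) * w $$ (k, 0))"
    using le_dbl[of e] by (intro sum.mono_neutral_cong_right) auto
  also have "\<dots> = pad e (ev m d * top w) $$ (i, 0)"
    using i by (auto simp: pad_def top_def scalar_prod_def)
  finally show "(ev (2 ^ e * m) (emb e d) * w) $$ (i, j) = pad e (ev m d * top w) $$ (i, j)"
    using j by simp
qed (use w in auto)

lemma pad_row_mult:
  assumes "f \<in> carrier_mat 1 (m * n)" "x \<in> carrier_mat (m * n) 1"
  shows "transpose_mat (pad e (transpose_mat f)) * pad e x = f * x"
proof (rule eq_matI)
  fix i j assume "i < dim_row (f * x)" "j < dim_col (f * x)"
  then have ij: "i = 0" "j = 0" using assms by auto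
  have "(\<Sum>k\<in>{0..<2 ^ e * m * n}. (if k < m * n then transpose_mat f $$ (k, 0) else 0) * (if k < m * n then x $$ (k, 0) else 0))
    = (\<Sum>k\<in>{0..<m * n}. f $$ (0, k) * x $$ (k, 0))"
    using le_dbl[of e] assms by (intro sum.mono_neutral_cong_right) auto
  then show "(transpose_mat (pad e (transpose_mat f)) * pad e x) $$ (i, j) = (f * x) $$ (i, j)"
    using ij assms by (simp add: scalar_prod_def pad_def)
qed (use assms in auto)

definition chain :: "'a mat => bool" where
  "chain x \<longleftrightarrow> (\<exists>e a w. (\<forall>l. a l \<in> carrier_mat (2 ^ e * m) (2 ^ e * m)) \<and> rank_ge (ev (2 ^ e * m) a) (2 ^ e * R) \<and>
     w \<in> carrier_mat (2 ^ e * m * n) 1 \<and> ev (2 ^ e * m) a * w = 0\<^sub>m (2 ^ e * m * n) 1 \<and> x = top w)"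

lemma chain_carrier: "chain x ==> x \<in> carrier_mat (m * n) 1"
  by (auto simp: chain_def top_def)

lemma chain_kernel:
  assumes "x \<in> carrier_mat (m * n) 1" "A * x = 0\<^sub>m (m * n) 1"
  shows "chain x"
proof -
  have "x = top x" using assms by (intro eq_matI) (auto simp: top_def)
  moreover have "rank_ge A R" using ev_dbl_rank[of 0] by simp
  ultimately show ?thesis unfolding chain_def using assms a0
    by (intro exI[of _ "0::nat"] exI[of _ a0] exI[of _ x]) simp
qed

lemma chain_step:
  assumes x: "chain x" and d: "\<And>l. d l \<in> carrier_mat m m"
  shows "A * (Q * (P * (ev m d * x))) = ev m d * x" and "chain (- (Q * (P * (ev m d * x))))"
proof -
  note [simp] = carrier_matD[OF P] carrier_matD[OF Q] carrier_matD[OF chain_carrier[OF x]]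
  from x obtain e a w where a: "\<And>l. a l \<in> carrier_mat (2 ^ e * m) (2 ^ e * m)"
    and rank: "rank_ge (ev (2 ^ e * m) a) (2 ^ e * R)"
    and w: "w \<in> carrier_mat (2 ^ e * m * n) 1" "ev (2 ^ e * m) a * w = 0\<^sub>m (2 ^ e * m * n) 1"
    and xw: "x = top w" unfolding chain_def by blast
  let ?M = "2 ^ e * m" let ?N = "?M * n"
  define b where "b = (\<lambda>l. four_block_mat (dbl e l) (emb e d l) (0\<^sub>m ?M ?M) (a l))"
  have b: "b l \<in> carrier_mat (2 ^ Suc e * m) (2 ^ Suc e * m)" for l
    unfolding b_def two_power_Suc using dbl_carrier a by (intro four_block_carrier_mat)
  have ev_b: "ev (2 ^ Suc e * m) b = four_block_mat (ev ?M (dbl e)) (ev ?M (emb e d)) (0\<^sub>m ?N ?N) (ev ?M a)"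
    unfolding two_power_Suc b_def
    by (subst ksum_four_block[where ?m1.0 = ?M and ?m2.0 = ?M and ?m1'.0 = ?M and ?m2'.0 = ?M])
       (simp_all add: dbl_carrier ksum_zero a emb_def)
  from ev_dbl_rank[of e] obtain P1 Q1 where PQ1: "P1 \<in> carrier_mat (2 ^ e * R) ?N" "Q1 \<in> carrier_mat ?N (2 ^ e * R)"
    "P1 * ev ?M (dbl e) * Q1 = 1\<^sub>m (2 ^ e * R)" by (auto simp: rank_ge_def)
  from rank obtain P2 Q2 where PQ2: "P2 \<in> carrier_mat (2 ^ e * R) ?N" "Q2 \<in> carrier_mat ?N (2 ^ e * R)"
    "P2 * ev ?M a * Q2 = 1\<^sub>m (2 ^ e * R)" by (auto simp: rank_ge_def)
  let ?z = "ev m d * x"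
  show eq: "A * (Q * (P * ?z)) = ?z"
  proof (rule ccontr)
    assume neq: "A * (Q * (P * ?z)) \<noteq> ?z"
    let ?y = "?z - A * (Q * (P * ?z))"
    have "?y \<noteq> 0\<^sub>m (m * n) 1" using neq mat_diff_eq_0[of ?z "A * (Q * (P * ?z))"] by auto
    then obtain i j where "i < m * n" "j < 1" "?y $$ (i, j) \<noteq> 0"
      by (rule mat_nonzero_entry) auto
    then have i: "i < m * n" "?y $$ (i, 0) \<noteq> 0" by auto
    define g where "g = mat 1 (m * n) (\<lambda>(_, k). if k = i then 1 / ?y $$ (i, 0) else 0)"
    have [simp]: "dim_row g = 1" "dim_col g = m * n" by (simp_all add: g_def)
    have "(g * ?y) $$ (0, 0) = 1" using i
      by (subst mult_index) (auto simp: g_def if_distrib[of "\<lambda>x. x * _"] sum.delta cong: if_cong simp del: index_mult_mat(1) index_minus_mat(1))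
    then have gy: "g * ?y = 1\<^sub>m 1" by (intro eq_matI) (auto simp del: index_mult_mat(1))
    define f where "f = g - g * (A * (Q * P))"
    have f: "f \<in> carrier_mat 1 (m * n)" by (auto simp: f_def intro!: carrier_matI)
    have "A * (Q * (P * A)) = A" using AQPA by (simp add: mat_assoc)
    then have fA: "f * A = 0\<^sub>m 1 (m * n)" by (simp add: f_def mat_distrib mat_assoc)
    have fz: "f * ?z = 1\<^sub>m 1" using gy by (simp add: f_def mat_distrib mat_assoc)
    let ?f = "transpose_mat (pad e (transpose_mat f))"
    have zc: "?z \<in> carrier_mat (m * n) 1" by (auto intro!: carrier_matI)
    have fBw: "?f * (ev ?M (emb e d) * w) = 1\<^sub>m 1"
      by (simp add: emb_mult[OF w(1)] xw[symmetric] pad_row_mult[OF f zc] fz del: One_nat_def)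
    have "rank_ge (ev (2 ^ Suc e * m) b) (2 ^ e * R + 2 ^ e * R + 1)"
      unfolding ev_b
      by (rule block_rank_Suc[of _ ?N _ _ _ P1 _ Q1 P2 _ Q2 w ?f])
         (use PQ1 PQ2 w dbl_pad_row[OF f fA] fBw in auto)
    moreover have "2 ^ Suc e * R + 1 = 2 ^ e * R + 2 ^ e * R + 1" by simp
    ultimately show False using max[of b "Suc e", OF b] by metis
  qed
  show "chain (- (Q * (P * ?z)))"
    unfolding chain_def
  proof (intro exI conjI allI)
    show "b l \<in> carrier_mat (2 ^ Suc e * m) (2 ^ Suc e * m)" for l by (rule b)
    show "rank_ge (ev (2 ^ Suc e * m) b) (2 ^ Suc e * R)" unfolding ev_b two_power_Suc[of e R]
      by (rule block_rank[of _ ?N _ _ _ P1 _ Q1 P2 _ Q2]) (use PQ1 PQ2 in auto)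
    let ?w = "vstack (- pad e (Q * (P * ?z))) w"
    show "?w \<in> carrier_mat (2 ^ Suc e * m * n) 1"
      using w by (auto intro!: carrier_matI simp: algebra_simps)
    have c: "Q * (P * ?z) \<in> carrier_mat (m * n) 1" by (auto intro!: carrier_matI)
    have "ev ?M (dbl e) * pad e (Q * (P * ?z)) = pad e ?z" using dbl_pad[OF c] eq by simp
    then have "ev (2 ^ Suc e * m) b * ?w = vstack (- pad e ?z + pad e ?z) (0\<^sub>m ?N 1)"
      unfolding ev_b using w(2) carrier_matD[OF w(1)] 
      by (subst four_block_mult_vstack) (auto simp: emb_mult[OF w(1)] xw[symmetric])
    also have "- pad e ?z + pad e ?z = 0\<^sub>m ?N 1" by (intro eq_matI) auto
    also have "vstack (0\<^sub>m ?N 1) (0\<^sub>m ?N 1) = (0\<^sub>m (2 ^ Suc e * m * n) 1 :: 'a mat)"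
      by (simp add: mult_2[symmetric] mult.assoc)
    finally show "ev (2 ^ Suc e * m) b * ?w = 0\<^sub>m (2 ^ Suc e * m * n) 1" .
    show "- (Q * (P * ?z)) = top ?w"
    proof (rule eq_matI)
      fix i j assume "i < dim_row (top ?w)" "j < dim_col (top ?w)"
      then have i: "i < m * n" "j = 0" by (simp_all add: top_def)
      then have "i < ?N" using less_le_trans[OF _ le_dbl[of e]] by blast
      then show "(- (Q * (P * ?z))) $$ (i, j) = top ?w $$ (i, j)"
        using i w by (simp add: top_def pad_def del: index_mult_mat(1))
    qed (simp_all add: top_def)
  qed
qed

text \<open>The chain vectors span a subspace that contains the kernel of \<open>A\<close> and is mapped by every value
  of the pencil into its own image under \<open>A\<close>, which is smaller by the defect of \<open>A\<close>. The
  slices of this subspace, and those of the annihilator of the image, give subspaces over the base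
  field between which every \<open>L\<^sub>l\<close> vanishes.\<close>

theorem shrunk_subspace:
  assumes L: "\<And>l. L l \<in> carrier_mat n n" and G: "finite G" and R: "R < m * n"
  obtains v w P0 P0' Q0 Q0' where "P0 \<in> carrier_mat v n" "P0' \<in> carrier_mat n v" "P0 * P0' = 1\<^sub>m v"
    "Q0 \<in> carrier_mat n w" "Q0' \<in> carrier_mat w n" "Q0' * Q0 = 1\<^sub>m w"
    "\<And>l. l \<in> G ==> P0 * (L l * Q0) = 0\<^sub>m v w" "n < v + w"
proof -
  let ?N = "m * n"
  note [simp] = carrier_matD[OF P] carrier_matD[OF Q] carrier_matD[OF L]
  define S where "S = {P * (A * x) | x. chain x}"
  have "y \<in> carrier_mat R 1" if "y \<in> S" for y
    using that unfolding S_def by (auto intro!: carrier_matI dest: chain_carrier)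
  then obtain c B B' where B: "B \<in> carrier_mat R c" "B' \<in> carrier_mat c R" "B' * B = 1\<^sub>m c"
    and BB: "\<And>x. x \<in> S ==> B * (B' * x) = x"
    and Y: "\<And>Y k. Y \<in> carrier_mat k R ==> (\<And>x. x \<in> S ==> Y * x = 0\<^sub>m k 1) ==> Y * B = 0\<^sub>m k c"
    using span_basis[of S R thesis] by blast
  note [simp] = carrier_matD[OF B(1)] carrier_matD[OF B(2)]
  have PAQ': "P * (A * Q) = 1\<^sub>m R" using PAQ by (simp add: mat_assoc)
  have PAQZ: "P * (A * (Q * Z)) = Z" if "dim_row Z = R" for Z
  proof -
    have "P * (A * (Q * Z)) = P * (A * Q) * Z" using that by (simp add: mat_assoc)
    then show ?thesis using PAQ' that by simp
  qed
  have AQPAZ: "A * (Q * (P * (A * Z))) = A * Z" if "dim_row Z = ?N" for Z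
  proof -
    have "A * (Q * (P * (A * Z))) = A * Q * P * A * Z" using that by (simp add: mat_assoc)
    then show ?thesis using AQPA by simp
  qed
  have c1: "P * A \<in> carrier_mat R ?N" by (auto intro!: carrier_matI)
  obtain F F' where "R \<le> ?N" and F: "F \<in> carrier_mat ?N (?N - R)" "F' \<in> carrier_mat (?N - R) ?N"
    "F' * F = 1\<^sub>m (?N - R)" "F' * Q = 0\<^sub>m (?N - R) R" "P * A * F = 0\<^sub>m R (?N - R)"
    "F * F' = 1\<^sub>m ?N - Q * (P * A)"
    by (rule complement_basis[OF Q c1 PAQ])
  note [simp] = carrier_matD[OF F(1)] carrier_matD[OF F(2)]
  have PAF: "P * (A * F) = 0\<^sub>m R (?N - R)" using F(5) by (simp add: mat_assoc)
  have AF: "A * F = 0\<^sub>m ?N (?N - R)" using AQPAZ[of F] by (simp add: PAF)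
  have c2: "A * (Q * B) \<in> carrier_mat ?N c" "B' * P \<in> carrier_mat c ?N" "B' * P * (A * (Q * B)) = 1\<^sub>m c"
    by (auto intro!: carrier_matI simp: mat_assoc PAQZ B(3))
  obtain H H' where "c \<le> ?N" and H: "H \<in> carrier_mat ?N (?N - c)" "H' \<in> carrier_mat (?N - c) ?N"
    "H' * H = 1\<^sub>m (?N - c)" "H' * (A * (Q * B)) = 0\<^sub>m (?N - c) c"
    by (rule complement_basis[OF c2])
  note [simp] = carrier_matD[OF H(1)] carrier_matD[OF H(2)]
  have key: "H' * (ev m d * x) = 0\<^sub>m (?N - c) 1" if x: "chain x" and d: "\<And>l. d l \<in> carrier_mat m m" for x d
  proof -
    note [simp] = carrier_matD[OF chain_carrier[OF x]]
    let ?x = "- (Q * (P * (ev m d * x)))"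
    have "P * (A * ?x) \<in> S" unfolding S_def using chain_step(2)[of x d, OF x d] by blast
    from BB[OF this] have "A * (Q * (B * (B' * (P * (A * ?x))))) = A * ?x" by (simp add: AQPAZ)
    then have "A * (Q * (B * (B' * (P * (ev m d * x))))) = ev m d * x"
      by (simp add: chain_step(1)[of x d, OF x d] PAQZ)
    then have "H' * (ev m d * x) = (H' * (A * (Q * B))) * (B' * (P * (ev m d * x)))"
      by (simp add: mat_assoc)
    then show ?thesis unfolding H(4) by simp
  qed
  have keyF: "H' * (ev m d * F) = 0\<^sub>m (?N - c) (?N - R)" if d: "\<And>l. d l \<in> carrier_mat m m" for d
  proof (rule mat_eq_by_columns[of _ "?N - c" "?N - R"])
    fix j assume "j < ?N - R"
    have "A * (F * ucol (?N - R) j) = (A * F) * ucol (?N - R) j" by (simp add: mat_assoc)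
    then have "A * (F * ucol (?N - R) j) = 0\<^sub>m ?N 1" unfolding AF by simp
    then have "chain (F * ucol (?N - R) j)" by (intro chain_kernel) (auto intro!: carrier_matI)
    from key[OF this d] show "H' * (ev m d * F) * ucol (?N - R) j = 0\<^sub>m (?N - c) (?N - R) * ucol (?N - R) j"
      by (simp add: mat_assoc)
  qed simp_all
  have keyQ: "H' * (ev m d * (Q * B)) = 0\<^sub>m (?N - c) c" if d: "\<And>l. d l \<in> carrier_mat m m" for d
  proof -
    have "H' * (ev m d * Q) * B = 0\<^sub>m (?N - c) c"
    proof (rule Y)
      fix y assume "y \<in> S"
      then obtain x where x: "chain x" and y: "y = P * (A * x)" unfolding S_def by blast
      note [simp] = carrier_matD[OF chain_carrier[OF x]]
      have "(1\<^sub>m ?N - Q * (P * A)) * x = x - Q * (P * (A * x))" by (simp add: mat_distrib mat_assoc)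
      then have Qy: "x - Q * y = F * (F' * x)" unfolding y F(6)[symmetric] by (simp add: mat_assoc)
      have "H' * (ev m d * (x - Q * y)) = H' * (ev m d * F) * (F' * x)" unfolding Qy by (simp add: mat_assoc)
      then have 1: "H' * (ev m d * (x - Q * y)) = 0\<^sub>m (?N - c) 1" unfolding keyF[OF d] by simp
      have [simp]: "dim_row y = R" "dim_col y = 1" by (simp_all add: y)
      have "H' * (ev m d * x) - H' * (ev m d * (Q * y)) = 0\<^sub>m (?N - c) 1"
        using 1 by (simp add: mat_distrib)
      then have "H' * (ev m d * x) = H' * (ev m d * (Q * y))"
        using mat_diff_eq_0[of "H' * (ev m d * x)" "H' * (ev m d * (Q * y))"] by simp
      then show "H' * (ev m d * Q) * y = 0\<^sub>m (?N - c) 1"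
        using key[OF x d] by (simp add: mat_assoc)
    qed (auto intro!: carrier_matI)
    then show ?thesis by (simp add: mat_assoc)
  qed
  let ?Z = "hstack F (Q * B)" and ?Z' = "vstack F' (B' * (P * A))"
  have FQB: "F' * (Q * B) = 0\<^sub>m (?N - R) c" 
  proof -
    have "F' * (Q * B) = F' * Q * B" by (simp add: mat_assoc)
    then show ?thesis unfolding F(4) by simp
  qed
  have ZZ: "?Z' * ?Z = 1\<^sub>m (?N - R + c)"
    by (simp add: vstack_mult mult_hstack mat_assoc F(3) FQB PAF PAQZ B(3) vstack_hstack hstack_vstack_blocks)
  have keyZ: "H' * (ev m d * ?Z) = 0\<^sub>m (?N - c) (?N - R + c)" if "\<And>l. d l \<in> carrier_mat m m" for d
    by (simp add: mult_hstack keyF[OF that] keyQ[OF that])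
  obtain w Q0 Q0' where Q0: "Q0 \<in> carrier_mat n w" "Q0' \<in> carrier_mat w n" "Q0' * Q0 = 1\<^sub>m w" "?N - R + c \<le> m * w"
    and Q0Y: "\<And>Y k. Y \<in> carrier_mat k n ==> (\<And>t. t < m ==> Y * (slice m n t * ?Z) = 0\<^sub>m k (?N - R + c)) ==> Y * Q0 = 0\<^sub>m k w"
    by (rule slices_span[of ?Z m n _ ?Z', OF _ _ ZZ]) (auto intro!: carrier_matI)
  note [simp] = carrier_matD[OF Q0(1)] carrier_matD[OF Q0(2)]
  have HH: "transpose_mat H * transpose_mat H' = 1\<^sub>m (?N - c)"
    using H(3) transpose_mult[OF H(2,1)] by simp
  obtain v V V' where V: "V \<in> carrier_mat n v" "V' \<in> carrier_mat v n" "V' * V = 1\<^sub>m v" "?N - c \<le> m * v"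
    and VY: "\<And>Y k. Y \<in> carrier_mat k n ==> (\<And>t. t < m ==> Y * (slice m n t * transpose_mat H') = 0\<^sub>m k (?N - c)) ==> Y * V = 0\<^sub>m k v"
    by (rule slices_span[of "transpose_mat H'" m n _ "transpose_mat H", OF _ _ HH]) (use H in auto)
  note [simp] = carrier_matD[OF V(1)] carrier_matD[OF V(2)]
  have tr: "transpose_mat (S * T) = transpose_mat T * transpose_mat S" if "dim_col S = dim_row T" for S T :: "'a mat"
    using that by (intro transpose_mult) auto
  have zero: "transpose_mat V * (L l * Q0) = 0\<^sub>m v w" if l: "l \<in> G" for l
  proof -
    have "transpose_mat Q0 * transpose_mat (L l) * V = 0\<^sub>m w v"
    proof (rule VY)
      fix s assume s: "s < m"
      have "H' * transpose_mat (slice m n s) * L l * Q0 = 0\<^sub>m (?N - c) w"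
      proof (rule Q0Y)
        fix t assume t: "t < m"
        let ?d = "\<lambda>l'. if l' = l then mat m m (\<lambda>(i, j). if i = s \<and> j = t then 1 else 0) else 0\<^sub>m m m"
        have "H' * (ev m ?d * ?Z) = 0\<^sub>m (?N - c) (?N - R + c)" by (rule keyZ) simp
        then show "H' * transpose_mat (slice m n s) * L l * (slice m n t * ?Z) = 0\<^sub>m (?N - c) (?N - R + c)"
          unfolding ksum_unit[OF G l L s t] by (simp add: mat_assoc)
      qed (auto intro!: carrier_matI)
      from arg_cong[OF this, of transpose_mat]
      show "transpose_mat Q0 * transpose_mat (L l) * (slice m n s * transpose_mat H') = 0\<^sub>m w (?N - c)"
        by (simp add: tr mat_assoc)
    qed (auto intro!: carrier_matI)
    from arg_cong[OF this, of transpose_mat] show ?thesis by (simp add: tr mat_assoc)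
  qed
  have "transpose_mat V * transpose_mat V' = 1\<^sub>m v" using V(3) tr[of V' V] by simp
  moreover have "n < v + w"
  proof -
    have "m * n < m * (v + w)" using V(4) Q0(4) R \<open>R \<le> ?N\<close> \<open>c \<le> ?N\<close> by (simp add: distrib_left)
    then show ?thesis by simp
  qed
  ultimately show thesis
    by (intro that[of "transpose_mat V" v "transpose_mat V'" Q0 w Q0']) (use V(1,2) Q0(1-3) zero in auto)
qed

end


section \<open>Generic points\<close>

lemma det_nonzero_inverse:
  fixes A :: "'a :: field mat"
  assumes A: "A \<in> carrier_mat n n" and det: "det A \<noteq> 0"
  obtains B where "B \<in> carrier_mat n n" "A * B = 1\<^sub>m n" "B * A = 1\<^sub>m n"
proof -
  let ?B = "(1 / det A) \<cdot>\<^sub>m adj_mat A"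
  note adj = adj_mat[OF A]
  have "A * ?B = 1\<^sub>m n" "?B * A = 1\<^sub>m n"
    using A det adj by (auto simp: mult_smult_distrib[OF A adj(1)] mult_smult_assoc_mat[OF adj(1) A] intro!: eq_matI)
  then show thesis using that[of ?B] adj(1) by simp
qed

lemma inverse_det_nonzero:
  fixes A :: "'a :: field mat"
  assumes "A \<in> carrier_mat n n" "B \<in> carrier_mat n n" "A * B = 1\<^sub>m n"
  shows "det A \<noteq> 0"
  using det_mult[OF assms(1,2)] assms(3) by auto

lemma rank_geI_det:
  fixes A :: "'a :: field mat"
  assumes P: "P \<in> carrier_mat r n" and A: "A \<in> carrier_mat n m" and Q: "Q \<in> carrier_mat m r" and det: "det (P * A * Q) \<noteq> 0"
  shows "rank_ge A r"
proof -
  have "P * A * Q \<in> carrier_mat r r" using assms by simp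
  then obtain B where B: "B \<in> carrier_mat r r" "B * (P * A * Q) = 1\<^sub>m r"
    using det_nonzero_inverse[OF _ det] by metis
  then show ?thesis using P A Q by (intro rank_geI[of "B * P" r n A m Q]) (auto simp: mat_assoc)
qed

lemma rank_ge_mono:
  fixes A :: "'a :: field mat"
  assumes "rank_ge A r" "s \<le> r"
  shows "rank_ge A s"
proof -
  from assms(1) obtain P Q where PQ: "P \<in> carrier_mat r (dim_row A)" "Q \<in> carrier_mat (dim_col A) r" "P * A * Q = 1\<^sub>m r"
    by (auto simp: rank_ge_def)
  let ?E = "hstack (1\<^sub>m s) (0\<^sub>m s (r - s))" and ?E' = "vstack (1\<^sub>m s) (0\<^sub>m (r - s) s)"
  have [simp]: "s + (r - s) = r" using assms(2) by simp
  have PAQ: "P * (A * Q) = 1\<^sub>m r" using PQ by (simp add: mat_assoc)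
  have PAQE: "P * (A * (Q * ?E')) = ?E'"
  proof -
    have "P * (A * (Q * ?E')) = P * (A * Q) * ?E'" using PQ(1,2) by (simp add: mat_assoc)
    then show ?thesis using PAQ by simp
  qed
  have "?E * P * A * (Q * ?E') = ?E * (P * (A * (Q * ?E')))" using PQ(1,2) by (simp add: mat_assoc)
  also have "\<dots> = 1\<^sub>m s" unfolding PAQE by (simp add: hstack_vstack)
  finally show ?thesis using PQ(1,2)
    by (intro rank_geI[of "?E * P" s "dim_row A" A "dim_col A" "Q * ?E'"]) (auto intro!: carrier_matI)
qed

lemma det_line_poly:
  fixes A B :: "'a :: field mat"
  assumes "A \<in> carrier_mat n n" "B \<in> carrier_mat n n"
  obtains p where "\<And>x. det (A + x \<cdot>\<^sub>m B) = poly p x"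
proof -
  define M where "M = mat n n (\<lambda>ij. [:A $$ ij, B $$ ij:])"
  have "det (A + x \<cdot>\<^sub>m B) = poly (det M) x" for x
  proof -
    interpret comm_ring_hom "\<lambda>p. poly p x" by unfold_locales auto
    have "map_mat (\<lambda>p. poly p x) M = A + x \<cdot>\<^sub>m B"
      using assms by (intro eq_matI) (auto simp: M_def)
    then show ?thesis using hom_det[of M] by simp
  qed
  then show thesis using that by blast
qed

definition lincomb :: "nat => nat => 'j set => ('j => 'a) => ('j => 'a mat) => 'a :: comm_ring_1 mat" where
  "lincomb n m J c C = mat n m (\<lambda>ij. \<Sum>j\<in>J. c j * C j $$ ij)"

lemma lincomb_dim [simp]: "dim_row (lincomb n m J c C) = n" "dim_col (lincomb n m J c C) = m"
  by (simp_all add: lincomb_def)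

lemma lincomb_carrier [simp]: "lincomb n m J c C \<in> carrier_mat n m"
  by (simp add: lincomb_def)

text \<open>A rank that is attained in a linear family of matrices is attained at parameters
  from any given infinite set, since one parameter after the other can be moved there.\<close>

lemma generic_rank:
  fixes C :: "'j => 'a :: field mat"
  assumes J: "finite J" and S: "infinite S" and C: "\<And>j. C j \<in> carrier_mat n m"
    and rank: "rank_ge (lincomb n m J c C) r"
  obtains c' where "\<And>j. c' j \<in> S" "rank_ge (lincomb n m J c' C) r"
proof -
  from rank obtain P Q where PQ: "P \<in> carrier_mat r n" "Q \<in> carrier_mat m r" "P * lincomb n m J c C * Q = 1\<^sub>m r"
    by (auto simp: rank_ge_def)
  note [simp] = carrier_matD[OF PQ(1)] carrier_matD[OF PQ(2)] carrier_matD[OF C]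
  have "\<exists>c'. (\<forall>j\<in>F. c' j \<in> S) \<and> det (P * lincomb n m J c' C * Q) \<noteq> 0" if "finite F" "F \<subseteq> J" for F
    using that
  proof (induction F)
    case empty
    show ?case using PQ(3) by (intro exI[of _ c]) simp
  next
    case (insert i F)
    then obtain c' where c': "\<forall>j\<in>F. c' j \<in> S" "det (P * lincomb n m J c' C * Q) \<noteq> 0" by auto
    let ?A = "P * lincomb n m J (c'(i := 0)) C * Q" and ?B = "P * C i * Q"
    have line: "P * lincomb n m J (c'(i := x)) C * Q = ?A + x \<cdot>\<^sub>m ?B" for x
    proof -
      have "lincomb n m J (c'(i := x)) C = lincomb n m J (c'(i := 0)) C + x \<cdot>\<^sub>m C i"
      proof (rule eq_matI)
        fix k l assume "k < dim_row (lincomb n m J (c'(i := 0)) C + x \<cdot>\<^sub>m C i)" "l < dim_col (lincomb n m J (c'(i := 0)) C + x \<cdot>\<^sub>m C i)"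
        then have kl: "k < n" "l < m" by simp_all
        have "(\<Sum>j\<in>J. (c'(i := x)) j * C j $$ (k, l)) = (\<Sum>j\<in>J. (c'(i := 0)) j * C j $$ (k, l) + (if j = i then x * C i $$ (k, l) else 0))"
          by (intro sum.cong) auto
        also have "\<dots> = (\<Sum>j\<in>J. (c'(i := 0)) j * C j $$ (k, l)) + x * C i $$ (k, l)"
          using J insert.prems by (simp add: sum.distrib)
        finally show "lincomb n m J (c'(i := x)) C $$ (k, l) = (lincomb n m J (c'(i := 0)) C + x \<cdot>\<^sub>m C i) $$ (k, l)"
          using kl by (simp add: lincomb_def)
      qed simp_all
      moreover have "P * (x \<cdot>\<^sub>m C i) * Q = x \<cdot>\<^sub>m (P * C i * Q)"
        using mult_smult_distrib[OF PQ(1) C] mult_smult_assoc_mat[OF mult_carrier_mat[OF PQ(1) C] PQ(2)] by simp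
      ultimately show ?thesis by (simp add: mat_distrib)
    qed
    obtain p where p: "\<And>x. det (?A + x \<cdot>\<^sub>m ?B) = poly p x"
      by (rule det_line_poly[of ?A r ?B]) auto
    have "poly p (c' i) \<noteq> 0" using c'(2) by (simp flip: p line)
    then have "p \<noteq> 0" by auto
    then have "\<not> S \<subseteq> {x. poly p x = 0}" using S poly_roots_finite finite_subset by blast
    then obtain x where x: "x \<in> S" "poly p x \<noteq> 0" by blast
    have "det (P * lincomb n m J (c'(i := x)) C * Q) \<noteq> 0" using x(2) by (subst line, subst p)
    moreover have "\<forall>j\<in>insert i F. (c'(i := x)) j \<in> S" using c'(1) x(1) by simp
    ultimately show ?case by blast
  qed
  from this[OF J order.refl] obtain c' where c': "\<forall>j\<in>J. c' j \<in> S" "det (P * lincomb n m J c' C * Q) \<noteq> 0" by blast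
  from S obtain s where "s \<in> S" by (meson finite.emptyI subsetI finite_subset ex_in_conv)
  let ?c = "\<lambda>j. if j \<in> J then c' j else s"
  have "lincomb n m J ?c C = lincomb n m J c' C"
    by (intro eq_matI) (auto simp: lincomb_def intro!: sum.cong)
  moreover have "rank_ge (lincomb n m J c' C) r"
    by (rule rank_geI_det[OF PQ(1) _ PQ(2) c'(2)]) simp
  ultimately show thesis using that[of ?c] c'(1) \<open>s \<in> S\<close> by auto
qed

section \<open>Matrices over a division algebra inside a matrix ring\<close>

text \<open>The \<open>m \<times> m\<close> matrices fixed by two commuting semilinear automorphisms: the field automorphism
  \<open>g\<close> followed by a cyclic shift of the indices, and the field automorphism \<open>d\<close> followed by conjugation with the diagonal
  matrix of the powers of \<open>z\<close>. For suitable data they form a cyclic division algebra of degree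
  \<open>m\<close>. Matrices over this algebra are those whose \<open>m \<times> m\<close> blocks are of this kind, and they are again the
  fixed points of two automorphisms.\<close>

locale cyclic_algebra =
  fixes g d :: "'a :: field => 'a" and z :: 'a and m :: nat
  assumes g: "g 0 = 0" "g 1 = 1" "\<And>x y. g (x + y) = g x + g y" "\<And>x y. g (x * y) = g x * g y"
    and d: "d 0 = 0" "d 1 = 1" "\<And>x y. d (x + y) = d x + d y" "\<And>x y. d (x * y) = d x * d y"
    and z: "z ^ m = 1" and m: "m > 0"
begin

definition sh :: "nat => nat" where
  "sh i = (i div m) * m + (i + 1) mod m"

definition fixed :: "'a mat => bool" where
  "fixed M \<longleftrightarrow> (\<forall>i<dim_row M. \<forall>j<dim_col M. M $$ (sh i, sh j) = g (M $$ (i, j)) \<and>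
     z ^ i * d (M $$ (i, j)) = z ^ j * M $$ (i, j))"

lemma z_nonzero: "z \<noteq> 0" using z m by (metis power_0_left not_gr_zero zero_neq_one)

lemma z_power_mod: "z ^ (i mod m) = z ^ i"
proof -
  have "z ^ i = z ^ (m * (i div m) + i mod m)" by simp
  also have "\<dots> = z ^ (i mod m)" unfolding power_add power_mult z by simp
  finally show ?thesis ..
qed

lemma sh_less: "i < q * m ==> sh i < q * m"
proof -
  assume i: "i < q * m"
  have "i div m < q" using divmod_less[OF i] by simp
  then show ?thesis unfolding sh_def by (intro slice_less) (use m in auto)
qed

lemma sh_div: "sh i div m = i div m" and sh_mod: "sh i mod m = (i + 1) mod m"
  using m by (simp_all add: sh_def)

lemma sh_bij: "bij_betw sh {0..<q * m} {0..<q * m}"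
proof -
  have "inj_on sh {0..<q * m}"
  proof (rule inj_onI)
    fix i j assume eq: "sh i = sh j"
    have 1: "i div m = j div m" using arg_cong[OF eq, of "\<lambda>k. k div m"] by (simp add: sh_div)
    have "(i mod m + 1) mod m = (j mod m + 1) mod m"
      using arg_cong[OF eq, of "\<lambda>k. k mod m"] by (simp add: sh_mod mod_Suc_eq)
    moreover have "i mod m < m" "j mod m < m" using m by simp_all
    ultimately have "i mod m = j mod m" by (metis Suc_eq_plus1 Suc_lessI Suc_mod_eq_add3_mod mod_Suc mod_less nat.inject nat.distinct(1) less_Suc_eq)
    with 1 show "i = j" by (metis div_mult_mod_eq)
  qed
  then show ?thesis using sh_less endo_inj_surj[of "{0..<q * m}" sh] by (force simp: bij_betw_def)
qed

lemma g_sum: "g (\<Sum>k\<in>S. f k) = (\<Sum>k\<in>S. g (f k))"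
  by (induction S rule: infinite_finite_induct) (simp_all add: g)

lemma d_sum: "d (\<Sum>k\<in>S. f k) = (\<Sum>k\<in>S. d (f k))"
  by (induction S rule: infinite_finite_induct) (simp_all add: d)

lemma g_minus: "g (x - y) = g x - g y"
  using g(3)[of "x - y" y] by simp

lemma d_minus: "d (x - y) = d x - d y"
  using d(3)[of "x - y" y] by simp

lemma fixed_mult:
  assumes A: "fixed A" and B: "fixed B" and "dim_col A = dim_row B" and q: "dim_row B = q * m"
    and p: "dim_row A = p * m" "dim_col B = r * m"
  shows "fixed (A * B)"
  unfolding fixed_def
proof (intro allI impI conjI)
  note dims = assms(3-)
  fix i j assume "i < dim_row (A * B)" "j < dim_col (A * B)"
  then have ij: "i < p * m" "j < r * m" using dims by simp_all
  have "(A * B) $$ (sh i, sh j) = (\<Sum>k\<in>{0..<q * m}. A $$ (sh i, k) * B $$ (k, sh j))"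
    using sh_less[OF ij(1)] sh_less[OF ij(2)] dims by (subst mult_index) auto
  also have "\<dots> = (\<Sum>k\<in>{0..<q * m}. A $$ (sh i, sh k) * B $$ (sh k, sh j))"
    by (rule sum.reindex_bij_betw[OF sh_bij, symmetric])
  also have "\<dots> = (\<Sum>k\<in>{0..<q * m}. g (A $$ (i, k) * B $$ (k, j)))"
    using A B ij dims by (intro sum.cong) (auto simp: fixed_def g)
  also have "\<dots> = g ((A * B) $$ (i, j))"
    using ij dims by (subst mult_index) (auto simp: g_sum)
  finally show "(A * B) $$ (sh i, sh j) = g ((A * B) $$ (i, j))" .
  have "z ^ i * d ((A * B) $$ (i, j)) = (\<Sum>k\<in>{0..<q * m}. (z ^ i * d (A $$ (i, k))) * d (B $$ (k, j)))"
    using ij dims by (subst mult_index) (auto simp: d_sum d sum_distrib_left mult.assoc)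
  also have "\<dots> = (\<Sum>k\<in>{0..<q * m}. A $$ (i, k) * (z ^ k * d (B $$ (k, j))))"
    using A ij dims by (intro sum.cong) (auto simp: fixed_def mult_ac)
  also have "\<dots> = (\<Sum>k\<in>{0..<q * m}. z ^ j * (A $$ (i, k) * B $$ (k, j)))"
    using B ij dims by (intro sum.cong) (auto simp: fixed_def mult_ac)
  also have "\<dots> = z ^ j * (A * B) $$ (i, j)"
    using ij dims by (subst mult_index) (auto simp: sum_distrib_left)
  finally show "z ^ i * d ((A * B) $$ (i, j)) = z ^ j * (A * B) $$ (i, j)" .
qed

lemma fixed_minus:
  assumes "fixed A" "fixed B" "dim_row A = dim_row B" "dim_col A = dim_col B" "dim_row B = p * m" "dim_col B = q * m"
  shows "fixed (A - B)"
  unfolding fixed_def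
proof (intro allI impI)
  fix i j assume "i < dim_row (A - B)" "j < dim_col (A - B)"
  then have ij: "i < p * m" "j < q * m" using assms by simp_all
  then show "(A - B) $$ (sh i, sh j) = g ((A - B) $$ (i, j)) \<and> z ^ i * d ((A - B) $$ (i, j)) = z ^ j * (A - B) $$ (i, j)"
    using assms sh_less[OF ij(1)] sh_less[OF ij(2)]
    by (simp add: fixed_def g_minus d_minus right_diff_distrib)
qed

lemma sh_add: "sh (p * m + i) = p * m + sh i"
proof -
  have "(p * m + i + 1) mod m = (i + 1) mod m"
    using mod_mult_self1[of "i + 1" p m] by (simp add: ac_simps)
  moreover have "(p * m + i) div m = p + i div m" using m by simp
  ultimately show ?thesis by (simp add: sh_def distrib_right)
qed

lemma sh_less_iff: "sh i < p * m \<longleftrightarrow> i < p * m"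
  using div_less_iff_less_mult[OF m, of "sh i" p] div_less_iff_less_mult[OF m, of i p] by (simp add: sh_div)

lemma
  assumes "\<not> i < p * m"
  shows sh_diff: "sh (i - p * m) = sh i - p * m" and z_diff: "z ^ (i - p * m) = z ^ i"
proof -
  from assms obtain k where i: "i = p * m + k" by (metis le_add_diff_inverse not_less)
  show "sh (i - p * m) = sh i - p * m" unfolding i by (simp add: sh_add)
  show "z ^ (i - p * m) = z ^ i" unfolding i by (simp add: power_add mult.commute[of p] power_mult z)
qed

lemma fixed_vstack:
  assumes "fixed A" "fixed B" and [simp]: "dim_row A = p * m" "dim_row B = q * m" "dim_col A = r * m" "dim_col B = r * m"
  shows "fixed (vstack A B)"
  unfolding fixed_def
proof (intro allI impI)
  fix i j assume "i < dim_row (vstack A B)" "j < dim_col (vstack A B)"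
  then have ij: "i < (p + q) * m" "j < r * m" by (simp_all add: distrib_right)
  then have ij': "i < p * m + q * m" "sh i < p * m + q * m" "sh j < r * m"
    using sh_less[of i "p + q"] sh_less[of j r] by (simp_all add: distrib_right)
  have "i - p * m < q * m" if "\<not> i < p * m" using ij' that by simp
  then show "vstack A B $$ (sh i, sh j) = g (vstack A B $$ (i, j)) \<and> z ^ i * d (vstack A B $$ (i, j)) = z ^ j * vstack A B $$ (i, j)"
    using assms(1,2) ij ij' unfolding fixed_def
    by (cases "i < p * m") (simp_all add: sh_less_iff sh_diff[symmetric], metis z_diff)
qed

lemma fixed_hstack:
  assumes "fixed A" "fixed B" and [simp]: "dim_col A = p * m" "dim_col B = q * m" "dim_row A = r * m" "dim_row B = r * m"
  shows "fixed (hstack A B)"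
  unfolding fixed_def
proof (intro allI impI)
  fix j i assume "j < dim_row (hstack A B)" "i < dim_col (hstack A B)"
  then have ij: "i < (p + q) * m" "j < r * m" by (simp_all add: distrib_right)
  then have ij': "i < p * m + q * m" "sh i < p * m + q * m" "sh j < r * m"
    using sh_less[of i "p + q"] sh_less[of j r] by (simp_all add: distrib_right)
  have "i - p * m < q * m" if "\<not> i < p * m" using ij' that by simp
  then show "hstack A B $$ (sh j, sh i) = g (hstack A B $$ (j, i)) \<and> z ^ j * d (hstack A B $$ (j, i)) = z ^ i * hstack A B $$ (j, i)"
    using assms(1,2) ij ij' unfolding fixed_def
    by (cases "i < p * m") (simp_all add: sh_less_iff sh_diff[symmetric], metis z_diff)
qed

lemma fixed_slice:
  assumes a: "a < n"
  shows "fixed (slice n m a)" "fixed (transpose_mat (slice n m a))"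
proof -
  have eq: "sh k = a * m + sh s \<longleftrightarrow> k = a * m + s" if "k < n * m" "s < m" for k s
  proof -
    have "a * m + s < n * m" by (rule slice_less[OF a that(2)])
    then show ?thesis using inj_onD[OF bij_betw_imp_inj_on[OF sh_bij[of n]], of k "a * m + s"] that
      by (auto simp: sh_add)
  qed
  have zz: "z ^ (a * m + s) = z ^ s" for s by (simp add: power_add mult.commute[of a] power_mult z)
  have sl: "slice n m a $$ (sh s, sh k) = g (slice n m a $$ (s, k)) \<and>
      z ^ s * d (slice n m a $$ (s, k)) = z ^ k * slice n m a $$ (s, k) \<and>
      z ^ k * d (slice n m a $$ (s, k)) = z ^ s * slice n m a $$ (s, k)" if "s < m" "k < n * m" for s k
    using that sh_less[of s 1] sh_less[of k n] by (simp add: slice_def eq zz g d)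
  show "fixed (slice n m a)" using sl by (simp add: fixed_def)
  have "sh s < m" if "s < m" for s using that sh_less[of s 1] by simp
  then show "fixed (transpose_mat (slice n m a))" using sl sh_less[of _ n] by (simp add: fixed_def)
qed

lemma fixed_inverse:
  assumes A: "fixed A" "A \<in> carrier_mat m m" and B: "B \<in> carrier_mat m m" "A * B = 1\<^sub>m m" "B * A = 1\<^sub>m m"
  shows "fixed B"
proof -
  note [simp] = carrier_matD[OF A(2)] carrier_matD[OF B(1)]
  have unique: "f B = h B"
    if f: "\<And>M N. M \<in> carrier_mat m m ==> N \<in> carrier_mat m m ==> f (M * N) = f M * f N" "f (1\<^sub>m m) = 1\<^sub>m m"
      and h: "\<And>M N. M \<in> carrier_mat m m ==> N \<in> carrier_mat m m ==> h (M * N) = h M * h N" "h (1\<^sub>m m) = 1\<^sub>m m"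
      and c: "\<And>M. f M \<in> carrier_mat m m" "\<And>M. h M \<in> carrier_mat m m" and fh: "f A = h A" for f h :: "'a mat => 'a mat"
  proof -
    have "f B * h A = 1\<^sub>m m" using f(1)[OF B(1) A(2)] f(2) B(3) fh by simp
    moreover have "h A * h B = 1\<^sub>m m" using h(1)[OF A(2) B(1)] h(2) B(2) by simp
    moreover have "f B * (h A * h B) = f B * h A * h B" by (rule assoc_mult_mat[OF c(1,2,2), symmetric])
    ultimately have "f B * 1\<^sub>m m = 1\<^sub>m m * h B" by simp
    then have "f B = h B" using carrier_matD[OF c(1)[of B]] carrier_matD[OF c(2)[of B]] by simp
    then show ?thesis by simp
  qed
  have sh1: "i < m ==> sh i < m" for i using sh_less[of i 1] by simp
  define shm where "shm = (\<lambda>M :: 'a mat. mat m m (\<lambda>(i, j). M $$ (sh i, sh j)))"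
  define dm where "dm = (\<lambda>M :: 'a mat. mat m m (\<lambda>(i, j). d (M $$ (i, j))))"
  define gm where "gm = (\<lambda>M :: 'a mat. mat m m (\<lambda>(i, j). g (M $$ (i, j))))"
  define zm where "zm = (\<lambda>M :: 'a mat. mat m m (\<lambda>(i, j). z ^ j * M $$ (i, j) / z ^ i))"
  have "shm B = gm B"
  proof (rule unique)
    show "shm (M * N) = shm M * shm N" if "M \<in> carrier_mat m m" "N \<in> carrier_mat m m" for M N
    proof (rule eq_matI)
      fix i j assume "i < dim_row (shm M * shm N)" "j < dim_col (shm M * shm N)"
      then have ij: "i < m" "j < m" by (simp_all add: shm_def)
      have "(\<Sum>k\<in>{0..<m}. M $$ (sh i, k) * N $$ (k, sh j)) = (\<Sum>k\<in>{0..<m}. M $$ (sh i, sh k) * N $$ (sh k, sh j))"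
        using sum.reindex_bij_betw[OF sh_bij[of 1], symmetric] by simp
      then show "shm (M * N) $$ (i, j) = (shm M * shm N) $$ (i, j)"
        using ij that sh1 by (simp add: shm_def scalar_prod_def)
    qed (simp_all add: shm_def)
    have "sh i = sh j \<longleftrightarrow> i = j" if "i < m" "j < m" for i j
      using inj_onD[OF bij_betw_imp_inj_on[OF sh_bij[of 1]], of i j] that by auto
    then show "shm (1\<^sub>m m) = 1\<^sub>m m" using sh1 by (intro eq_matI) (auto simp: shm_def)
    show "shm A = gm A" using A(1) by (intro eq_matI) (auto simp: shm_def gm_def fixed_def)
  qed (auto simp: gm_def shm_def g g_sum scalar_prod_def intro!: eq_matI)
  moreover have "dm B = zm B"
  proof (rule unique)
    show "zm (M * N) = zm M * zm N" if "M \<in> carrier_mat m m" "N \<in> carrier_mat m m" for M N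
      using that z_nonzero by (intro eq_matI) (auto simp: zm_def scalar_prod_def sum_distrib_left sum_divide_distrib intro!: sum.cong)
    have "z ^ i * d (A $$ (i, j)) = z ^ j * A $$ (i, j)" if "i < m" "j < m" for i j
      using A(1) that by (simp add: fixed_def)
    then show "dm A = zm A" using z_nonzero by (intro eq_matI) (auto simp: dm_def zm_def field_simps)
  qed (auto simp: dm_def zm_def d d_sum scalar_prod_def z_nonzero intro!: eq_matI)
  ultimately have eqs: "shm B = gm B" "dm B = zm B" by simp_all
  have "B $$ (sh i, sh j) = g (B $$ (i, j)) \<and> z ^ i * d (B $$ (i, j)) = z ^ j * B $$ (i, j)" if ij: "i < m" "j < m" for i j
  proof -
    have "B $$ (sh i, sh j) = shm B $$ (i, j)" using ij by (simp add: shm_def)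
    also have "\<dots> = g (B $$ (i, j))" unfolding eqs using ij by (simp add: gm_def)
    finally have 1: "B $$ (sh i, sh j) = g (B $$ (i, j))" .
    have "d (B $$ (i, j)) = dm B $$ (i, j)" using ij by (simp add: dm_def)
    also have "\<dots> = z ^ j * B $$ (i, j) / z ^ i" unfolding eqs using ij by (simp add: zm_def)
    finally show ?thesis using 1 z_nonzero by simp
  qed
  then show ?thesis by (simp add: fixed_def)
qed

text \<open>Gaussian elimination over the division algebra: each step raises the rank over the field by
  \<open>m\<close>, so that the final rank is a multiple of \<open>m\<close>.\<close>

lemma fixed_max_rank:
  assumes inv: "\<And>M. M \<in> carrier_mat m m ==> fixed M ==> M \<noteq> 0\<^sub>m m m ==> det M \<noteq> 0"
    and A: "A \<in> carrier_mat (n * m) (n' * m)" "fixed A"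
  obtains r where "rank_ge A (r * m)" "\<And>s. rank_ge A s ==> s \<le> r * m"
proof -
  define R where "R = (\<lambda>r. \<exists>P Q. P \<in> carrier_mat (r * m) (n * m) \<and> Q \<in> carrier_mat (n' * m) (r * m) \<and>
    fixed P \<and> fixed Q \<and> P * A * Q = 1\<^sub>m (r * m))"
  note [simp] = carrier_matD[OF A(1)]
  have bound: "r \<le> n" if "R r" for r
  proof -
    from that obtain P Q where "P \<in> carrier_mat (r * m) (n * m)" "Q \<in> carrier_mat (n' * m) (r * m)" "P * (A * Q) = 1\<^sub>m (r * m)"
      using A(1) by (auto simp: R_def mat_assoc)
    then have "r * m \<le> n * m" using A(1) by (intro left_inverse_dim_le[of P _ _ "A * Q"]) auto
    then show ?thesis using m by simp
  qed
  have "R 0" unfolding R_def by (intro exI[of _ "0\<^sub>m 0 (n * m)"] exI[of _ "0\<^sub>m (n' * m) 0"]) (auto simp: fixed_def)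
  define r where "r = (GREATEST r. R r)"
  have "R r" unfolding r_def by (rule GreatestI_nat[of R 0 n]) (use bound \<open>R 0\<close> in auto)
  have max: "s \<le> r" if "R s" for s
    unfolding r_def by (rule Greatest_le_nat[of R s n]) (use bound that in auto)
  from \<open>R r\<close>[unfolded R_def] obtain P Q where PQ: "P \<in> carrier_mat (r * m) (n * m)" "Q \<in> carrier_mat (n' * m) (r * m)"
    "fixed P" "fixed Q" and PAQ: "P * A * Q = 1\<^sub>m (r * m)" by (elim exE conjE) (rule that)
  note [simp] = carrier_matD[OF PQ(1)] carrier_matD[OF PQ(2)]
  have fAQP: "fixed (A * Q * P)"
    by (intro fixed_mult[of _ _ r] fixed_mult[of _ _ n'] PQ A) auto
  have fQPA: "fixed (Q * P * A)"
    by (intro fixed_mult[of _ _ n] fixed_mult[of _ _ r] PQ A) auto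
  have eq: "A = A * Q * P * A"
  proof (rule ccontr)
    assume neq: "A \<noteq> A * Q * P * A"
    let ?Z = "A - A * Q * P * A"
    have fZ: "fixed ?Z" by (intro fixed_minus[of _ _ n n'] fixed_mult[of "A * Q * P" _ n] A fAQP) auto
    have "?Z \<noteq> 0\<^sub>m (n * m) (n' * m)" using neq mat_diff_eq_0[of A "A * Q * P * A"] by auto
    then obtain i j where ij: "i < n * m" "j < n' * m" "?Z $$ (i, j) \<noteq> 0"
      by (rule mat_nonzero_entry) auto
    let ?a = "i div m" and ?b = "j div m"
    note dm = divmod_less[OF ij(1)] divmod_less[OF ij(2)]
    let ?S = "slice n m ?a :: 'a mat" and ?T = "transpose_mat (slice n' m ?b) :: 'a mat"
    define M where "M = ?S * ?Z * ?T"
    have M: "M \<in> carrier_mat m m" by (auto simp: M_def intro!: carrier_matI)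
    have fM: "fixed M" unfolding M_def
      by (rule fixed_mult[of _ _ n' 1 1], rule fixed_mult[of _ _ n 1 n']) (use dm fZ in \<open>auto intro: fixed_slice\<close>)
    have "M $$ (i mod m, j mod m) = ?Z $$ (i, j)"
    proof -
      have "transpose_mat M = slice n' m ?b * (transpose_mat (?S * ?Z))"
        unfolding M_def by (subst transpose_mult[of _ m "n' * m" _ m]) (auto intro!: carrier_matI)
      then have "M $$ (i mod m, j mod m) = (slice n' m ?b * (transpose_mat (?S * ?Z))) $$ (j mod m, i mod m)"
        using dm M by (metis carrier_matD index_transpose_mat(1))
      also have "\<dots> = (?S * ?Z) $$ (i mod m, j)"
        using dm ij slice_less[OF dm(3,4)] by (subst slice_mult_index) (auto simp del: index_mult_mat(1))
      also have "\<dots> = ?Z $$ (i, j)" using dm ij by (subst slice_mult_index) auto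
      finally show ?thesis .
    qed
    then have "M \<noteq> 0\<^sub>m m m" using ij dm by auto
    then have "det M \<noteq> 0" using inv M fM by blast
    then obtain y where y: "y \<in> carrier_mat m m" "M * y = 1\<^sub>m m" "y * M = 1\<^sub>m m"
      by (rule det_nonzero_inverse[OF M])
    have fy: "fixed y" by (rule fixed_inverse[OF fM M y])
    note [simp] = carrier_matD[OF y(1)]
    let ?\<Phi> = "y * ?S"
    have f\<Phi>: "fixed ?\<Phi>" by (intro fixed_mult[of _ _ 1 1 n] fy fixed_slice dm) auto
    have 1: "?\<Phi> * ?Z * ?T = 1\<^sub>m m" using y(3) by (simp add: M_def mat_assoc)
    have "vstack P (?\<Phi> - ?\<Phi> * A * Q * P) * A * hstack Q (?T - Q * P * A * ?T) = 1\<^sub>m (r * m + m)"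
      by (rule rank_extend[of A "n * m" "n' * m", OF _ _ _ _ _ _ _ _ _ _ PAQ 1]) auto
    moreover have "fixed (vstack P (?\<Phi> - ?\<Phi> * A * Q * P))"
    proof -
      have "fixed (?\<Phi> * (A * Q * P))" by (intro fixed_mult[of _ _ n 1 n] f\<Phi> fAQP) auto
      then have "fixed (?\<Phi> - ?\<Phi> * A * Q * P)" by (intro fixed_minus[of _ _ 1 n] f\<Phi>) (auto simp: mat_assoc)
      then show ?thesis by (intro fixed_vstack[of _ _ r 1 n] PQ) auto
    qed
    moreover have "fixed (hstack Q (?T - Q * P * A * ?T))"
    proof -
      have "fixed (Q * P * A * ?T)" by (intro fixed_mult[of _ _ n' n' 1] fQPA fixed_slice dm) auto
      then have "fixed (?T - Q * P * A * ?T)" by (intro fixed_minus[of _ _ n' 1] fixed_slice dm) auto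
      then show ?thesis by (intro fixed_hstack[of _ _ r 1 n'] PQ) auto
    qed
    ultimately have "R (r + 1)" unfolding R_def
      by (intro exI[of _ "vstack P (?\<Phi> - ?\<Phi> * A * Q * P)"] exI[of _ "hstack Q (?T - Q * P * A * ?T)"])
         (auto intro!: carrier_matI simp: add.commute)
    then show False using max by fastforce
  qed
  have "rank_ge A (r * m)" by (rule rank_geI[OF PQ(1) A(1) PQ(2) PAQ])
  moreover have "s \<le> r * m" if "rank_ge A s" for s
  proof -
    have "rank_ge ((A * Q) * (P * A)) s" using that eq by (simp add: mat_assoc)
    then show ?thesis by (rule rank_ge_mult[of _ _ _ "n * m" _ "n' * m"]) (auto intro!: carrier_matI)
  qed
  ultimately show thesis using that by blast
qed

end


section \<open>A cyclic division algebra over iterated Laurent series\<close>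

definition fls_twist :: "(int => 'a => 'a) => 'a :: zero fls => 'a fls" where
  "fls_twist f s = Abs_fls (\<lambda>n. f n (fls_nth s n))"

lemma fls_times_nth_range:
  fixes s t :: "'a :: semiring_0 fls"
  assumes s: "\<And>i. i < a ==> fls_nth s i = 0" and t: "\<And>i. i < b ==> fls_nth t i = 0"
  shows "fls_nth (s * t) n = (\<Sum>i=a..n - b. fls_nth s i * fls_nth t (n - i))"
proof (cases "s = 0 \<or> t = 0")
  case True
  then show ?thesis by auto
next
  case False
  then have "a \<le> fls_subdegree s" "b \<le> fls_subdegree t"
    using s t nth_fls_subdegree_nonzero by (metis not_less)+
  then have "(\<Sum>i=fls_subdegree s..n - fls_subdegree t. fls_nth s i * fls_nth t (n - i)) =
    (\<Sum>i=a..n - b. fls_nth s i * fls_nth t (n - i))"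
    by (intro sum.mono_neutral_left) (auto simp: not_le)
  then show ?thesis by (simp add: fls_times_nth(2))
qed

lemma fls_times_nth_lowest:
  fixes s t :: "'a :: semiring_0 fls"
  assumes "\<And>i. i < a ==> fls_nth s i = 0" and "\<And>i. i < b ==> fls_nth t i = 0"
  shows "fls_nth (s * t) (a + b) = fls_nth s a * fls_nth t b"
  using fls_times_nth_range[of a s b t "a + b"] assms by simp

context
  fixes f :: "int => 'a :: comm_ring_1 => 'a"
  assumes f0: "\<And>n. f n 0 = 0" and f1: "f 0 1 = 1"
    and add: "\<And>n x y. f n (x + y) = f n x + f n y"
    and mult: "\<And>i j x y. f (i + j) (x * y) = f i x * f j y"
begin

lemma fls_twist_nth: "fls_nth (fls_twist f s) n = f n (fls_nth s n)"
  unfolding fls_twist_def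
  by (rule nth_Abs_fls_lower_bound[of "fls_subdegree s"]) (simp add: f0)

lemma fls_twist_hom:
  "fls_twist f 0 = 0" "fls_twist f 1 = 1" "fls_twist f (s + t) = fls_twist f s + fls_twist f t"
  "fls_twist f (s * t) = fls_twist f s * fls_twist f t"
proof -
  show "fls_twist f 0 = 0" "fls_twist f 1 = 1" "fls_twist f (s + t) = fls_twist f s + fls_twist f t"
    by (simp_all add: fls_eq_iff fls_twist_nth f0 f1 add)
  have f_sum: "f n (\<Sum>i\<in>S. h i) = (\<Sum>i\<in>S. f n (h i))" for n S and h :: "int => 'a"
    by (induction S rule: infinite_finite_induct) (simp_all add: f0 add)
  have "fls_nth (fls_twist f (s * t)) n = fls_nth (fls_twist f s * fls_twist f t) n" for n
  proof -
    have "fls_nth (fls_twist f (s * t)) n = (\<Sum>i=fls_subdegree s..n - fls_subdegree t. f (i + (n - i)) (fls_nth s i * fls_nth t (n - i)))"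
      by (simp add: fls_twist_nth fls_times_nth(2) f_sum)
    also have "\<dots> = fls_nth (fls_twist f s * fls_twist f t) n"
      unfolding mult by (subst fls_times_nth_range[of "fls_subdegree s" _ "fls_subdegree t"]) (simp_all add: fls_twist_nth f0)
    finally show ?thesis .
  qed
  then show "fls_twist f (s * t) = fls_twist f s * fls_twist f t" by (simp add: fls_eq_iff)
qed

end

text \<open>An element of order exactly \<open>2\<^sup>e\<close> in the multiplicative group, by repeated square roots of \<open>-1\<close>.\<close>

lemma primitive_root_exists:
  obtains z :: "'a :: {alg_closed_field, field_char_0}" where "z ^ (2 ^ e) = 1" "\<And>i. 0 < i ==> i < 2 ^ e ==> z ^ i \<noteq> 1"
proof (cases e)
  case 0
  then show thesis using that[of 1] by auto
next
  case (Suc e')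
  have "(2::nat) ^ e' > 0" by simp
  from nth_root_exists[OF this, of "-1 :: 'a"] obtain z :: 'a where z: "z ^ (2 ^ e') = -1" by blast
  have z1: "z ^ (2 ^ e) = 1" unfolding Suc power_Suc2 power_mult z by simp
  have "z ^ i \<noteq> 1" if i: "0 < i" "i < 2 ^ e" for i
  proof
    assume zi: "z ^ i = 1"
    obtain a q where a: "i = 2 ^ a * q" "odd q" 
      using i(1) by (metis multiplicity_decompose' not_gr_zero nat_dvd_1_iff_1 numeral_eq_one_iff semiring_norm(85) even_numeral)
    have "2 ^ a \<le> i" using a i by (cases "q = 0") auto
    then have "(2::nat) ^ a < 2 ^ e" using i(2) by (rule le_less_trans)
    then have "a < e" by (rule power_less_imp_less_exp[rotated]) simp
    then have "a \<le> e'" using Suc by simp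
    have "z ^ (i * 2 ^ (e' - a)) = (z ^ (2 ^ e')) ^ q"
    proof -
      have "i * 2 ^ (e' - a) = q * (2 ^ a * 2 ^ (e' - a))" using a by simp
      also have "2 ^ a * 2 ^ (e' - a) = (2::nat) ^ e'" using \<open>a \<le> e'\<close> by (simp flip: power_add)
      finally show ?thesis by (simp add: power_mult[symmetric] mult.commute)
    qed
    also have "\<dots> = -1" unfolding z using a(2) by simp
    finally have "(z ^ i) ^ (2 ^ (e' - a)) = -1" by (simp add: power_mult)
    then show False using zi by simp
  qed
  then show thesis using that z1 by blast
qed

context
  fixes \<zeta> :: "'b :: field_char_0" and m :: nat
  assumes root: "\<zeta> ^ m = 1" and prim: "\<And>i. 0 < i ==> i < m ==> \<zeta> ^ i \<noteq> 1" and m: "m > 0"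
begin

lemma root_nonzero: "\<zeta> \<noteq> 0"
  using root m by (metis power_0_left not_gr_zero zero_neq_one)

lemma root_inj: "i < m ==> j < m ==> \<zeta> ^ i = \<zeta> ^ j ==> i = j"
proof (induction i j rule: linorder_wlog)
  case (le i j)
  have "\<zeta> ^ i * \<zeta> ^ (j - i) = \<zeta> ^ (i + (j - i))" by (rule power_add[symmetric])
  also have "\<dots> = \<zeta> ^ i" using le by simp
  finally have "\<zeta> ^ i * \<zeta> ^ (j - i) = \<zeta> ^ i" .
  then have "\<zeta> ^ (j - i) = 1" using root_nonzero by simp
  then show ?case using prim[of "j - i"] le by (cases "i = j") auto
qed metis

definition scale :: "'b fls => 'b fls" where
  "scale = fls_twist (\<lambda>n c. c * \<zeta> powi n)"

definition gal :: "'b fls fls => 'b fls fls" where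
  "gal = fls_twist (\<lambda>_. scale)"

definition dual :: "'b fls fls => 'b fls fls" where
  "dual = fls_twist (\<lambda>n c. c * fls_const (\<zeta> powi n))"

definition emb2 :: "'b => 'b fls fls" where
  "emb2 c = fls_const (fls_const c)"

lemma scale_nth: "fls_nth (scale s) n = fls_nth s n * \<zeta> powi n"
  unfolding scale_def by (rule fls_twist_nth) (auto simp: power_int_add root_nonzero algebra_simps)

lemma scale_hom: "scale 0 = 0" "scale 1 = 1" "scale (s + t) = scale s + scale t" "scale (s * t) = scale s * scale t"
  unfolding scale_def by (rule fls_twist_hom; auto simp: power_int_add root_nonzero algebra_simps)+

lemma gal_nth: "fls_nth (gal s) n = scale (fls_nth s n)"
  unfolding gal_def by (rule fls_twist_nth) (simp_all add: scale_hom)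

lemma gal_hom: "gal 0 = 0" "gal 1 = 1" "gal (s + t) = gal s + gal t" "gal (s * t) = gal s * gal t"
  unfolding gal_def by (rule fls_twist_hom; simp add: scale_hom)+

lemma dual_nth: "fls_nth (dual s) n = fls_nth s n * fls_const (\<zeta> powi n)"
  unfolding dual_def by (rule fls_twist_nth) (auto simp: power_int_add root_nonzero algebra_simps)

lemma dual_hom: "dual 0 = 0" "dual 1 = 1" "dual (s + t) = dual s + dual t" "dual (s * t) = dual s * dual t"
  unfolding dual_def by (rule fls_twist_hom; auto simp: power_int_add root_nonzero algebra_simps)+

lemma emb2_hom: "emb2 0 = 0" "emb2 1 = 1" "emb2 (a + b) = emb2 a + emb2 b" "emb2 (a * b) = emb2 a * emb2 b"
  "emb2 (a ^ n) = emb2 a ^ n"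
proof -
  show m: "emb2 0 = 0" "emb2 1 = 1" "emb2 (a + b) = emb2 a + emb2 b" "emb2 (a * b) = emb2 a * emb2 b" for a b
    by (simp_all add: emb2_def) (auto simp: fls_eq_iff)
  show "emb2 (a ^ n) = emb2 a ^ n" by (induction n) (simp_all add: m)
qed

lemma emb2_inj: "emb2 a = emb2 b \<longleftrightarrow> a = b"
  by (auto simp: emb2_def fls_eq_iff split: if_splits)

lemma gal_emb2: "gal (emb2 c) = emb2 c" and dual_emb2: "dual (emb2 c) = emb2 c"
  by (auto simp: emb2_def fls_eq_iff gal_nth dual_nth scale_nth)

lemma cyclic_algebra: "cyclic_algebra gal dual (emb2 \<zeta>) m"
  by unfold_locales (simp_all add: gal_hom dual_hom m emb2_hom(2) root flip: emb2_hom(5))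

interpretation cyclic_algebra gal dual "emb2 \<zeta>" m by (rule cyclic_algebra)

text \<open>The division property. The lowest coefficient of a nonzero fixed matrix with respect
  to the outer variable is a monomial matrix, by the second condition, and its nonzero entries form
  a complete orbit, by the first one. Such a matrix kills no vector, and neither does the whole series.\<close>

lemma fixed_nonsingular:
  assumes M: "M \<in> carrier_mat m m" "fixed M" "M \<noteq> 0\<^sub>m m m"
  shows "det M \<noteq> 0"
proof
  assume "det M = 0"
  then obtain v where v: "v \<in> carrier_vec m" "v \<noteq> 0\<^sub>v m" "M *\<^sub>v v = 0\<^sub>v m"
    using det_0_iff_vec_prod_zero_field[OF M(1)] by blast
  note [simp] = carrier_matD[OF M(1)] carrier_vecD[OF v(1)]
  have sh1: "sh i = (i + 1) mod m" if "i < m" for i using that by (simp add: sh_def)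
  have g: "M $$ ((i + 1) mod m, (j + 1) mod m) = gal (M $$ (i, j))" if "i < m" "j < m" for i j
    using M(2) that sh1 by (auto simp: fixed_def)
  obtain i1 j1 where ij1: "i1 < m" "j1 < m" "M $$ (i1, j1) \<noteq> 0"
    using M by (elim mat_nonzero_entry) auto
  define I where "I = {(i, j). i < m \<and> j < m \<and> M $$ (i, j) \<noteq> 0}"
  have fin: "finite I" by (rule finite_subset[of _ "{..<m} \<times> {..<m}"]) (auto simp: I_def)
  have ne: "I \<noteq> {}" using ij1 by (auto simp: I_def)
  define b where "b = Min ((\<lambda>ij. fls_subdegree (M $$ ij)) ` I)"
  have "b \<in> (\<lambda>ij. fls_subdegree (M $$ ij)) ` I" unfolding b_def using fin ne by (intro Min_in) auto
  then obtain i0 j0 where ij0: "i0 < m" "j0 < m" "M $$ (i0, j0) \<noteq> 0" "b = fls_subdegree (M $$ (i0, j0))"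
    by (auto simp: I_def)
  have low: "fls_nth (M $$ (i, j)) k = 0" if "i < m" "j < m" "k < b" for i j k
  proof (cases "M $$ (i, j) = 0")
    case False
    then have "b \<le> fls_subdegree (M $$ (i, j))" unfolding b_def using that fin by (intro Min_le) (auto simp: I_def)
    then show ?thesis using that by simp
  qed simp
  define c where "c = (\<lambda>i j. fls_nth (M $$ (i, j)) b)"
  have c0: "c i0 j0 \<noteq> 0" using ij0 by (simp add: c_def)
  have scale0: "scale s = 0 \<longleftrightarrow> s = 0" for s by (auto simp: fls_eq_iff scale_nth root_nonzero)
  have orbit: "c ((i0 + l) mod m) ((j0 + l) mod m) \<noteq> 0" for l
  proof (induction l)
    case (Suc l)
    have "M $$ ((i0 + Suc l) mod m, (j0 + Suc l) mod m) = gal (M $$ ((i0 + l) mod m, (j0 + l) mod m))"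
      using g[of "(i0 + l) mod m" "(j0 + l) mod m"] m by (simp add: mod_Suc_eq)
    then show ?case using Suc by (simp add: c_def gal_nth scale0)
  qed (use ij0 c0 in simp)
  have c_unique: "j = j'" if "i < m" "j < m" "j' < m" "c i j \<noteq> 0" "c i j' \<noteq> 0" for i j j'
  proof -
    have "fls_const (\<zeta> ^ i * \<zeta> powi b) = (fls_const (\<zeta> ^ k) :: 'b fls)" if "k < m" "c i k \<noteq> 0" for k
    proof -
      have "emb2 \<zeta> ^ i * dual (M $$ (i, k)) = emb2 \<zeta> ^ k * M $$ (i, k)"
        using M(2) that \<open>i < m\<close> by (simp add: fixed_def)
      then have "fls_nth (emb2 (\<zeta> ^ i) * dual (M $$ (i, k))) b = fls_nth (emb2 (\<zeta> ^ k) * M $$ (i, k)) b"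
        by (simp add: emb2_hom)
      then have "fls_const (\<zeta> ^ i * \<zeta> powi b) * c i k = fls_const (\<zeta> ^ k) * c i k"
        by (simp add: emb2_def dual_nth c_def mult_ac flip: fls_const_mult_const)
      then show ?thesis using that by simp
    qed
    then have "fls_const (\<zeta> ^ j) = (fls_const (\<zeta> ^ j') :: 'b fls)" using that by metis
    then have "\<zeta> ^ j = \<zeta> ^ j'" by (auto simp: fls_eq_iff split: if_splits)
    then show ?thesis using root_inj that by blast
  qed
  define J where "J = {j. j < m \<and> v $ j \<noteq> 0}"
  have finJ: "finite J" by (rule finite_subset[of _ "{..<m}"]) (auto simp: J_def)
  have neJ: "J \<noteq> {}"
  proof
    assume "J = {}"
    then have "v = 0\<^sub>v m" by (intro eq_vecI) (auto simp: J_def)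
    then show False using v by simp
  qed
  define e where "e = Min ((\<lambda>j. fls_subdegree (v $ j)) ` J)"
  have "e \<in> (\<lambda>j. fls_subdegree (v $ j)) ` J" unfolding e_def using finJ neJ by (intro Min_in) auto
  then obtain t where t: "t < m" "v $ t \<noteq> 0" "e = fls_subdegree (v $ t)" by (auto simp: J_def)
  have lowv: "fls_nth (v $ j) k = 0" if "j < m" "k < e" for j k
  proof (cases "v $ j = 0")
    case False
    then have "e \<le> fls_subdegree (v $ j)" unfolding e_def using that finJ by (intro Min_le) (auto simp: J_def)
    then show ?thesis using that by simp
  qed simp
  define s where "s = (i0 + (t + (m - j0))) mod m"
  have "(j0 + (t + (m - j0))) mod m = t" using t ij0 by simp
  then have cst: "c s t \<noteq> 0" using orbit[of "t + (m - j0)"] by (simp add: s_def)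
  have s: "s < m" using m by (simp add: s_def)
  have "0 = fls_nth ((M *\<^sub>v v) $ s) (b + e)" using v(3) s by simp
  also have "\<dots> = (\<Sum>j\<in>{0..<m}. fls_nth (M $$ (s, j) * v $ j) (b + e))"
    using s by (simp add: scalar_prod_def fls_nth_sum)
  also have "\<dots> = (\<Sum>j\<in>{0..<m}. c s j * fls_nth (v $ j) e)"
    using s low lowv by (intro sum.cong) (auto simp: c_def intro!: fls_times_nth_lowest)
  also have "\<dots> = (\<Sum>j\<in>{0..<m}. if j = t then c s t * fls_nth (v $ t) e else 0)"
    using c_unique[OF s t(1) _ cst] by (intro sum.cong) auto
  also have "\<dots> = c s t * fls_nth (v $ t) e" using t by simp
  also have "\<dots> \<noteq> 0" using cst t by simp
  finally show False by simp
qed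

text \<open>The elements \<open>u\<^sup>p v\<^sup>q\<close> of the algebra form a basis of the full matrix ring over the big field.\<close>

definition cyc :: "nat \<times> nat => 'b fls fls mat" where
  "cyc = (\<lambda>(p, q). mat m m (\<lambda>(s, t). if t = (s + q) mod m then emb2 (\<zeta> ^ (s * p)) * fls_const fls_X ^ p * fls_X ^ q else 0))"

lemma cyc_carrier: "cyc b \<in> carrier_mat m m"
  by (auto simp: cyc_def split: prod.splits)

lemma gal_power: "gal (s ^ n) = gal s ^ n" and dual_power: "dual (s ^ n) = dual s ^ n"
  by (induction n) (simp_all add: gal_hom dual_hom)

lemma gal_vars: "gal (fls_const fls_X) = emb2 \<zeta> * fls_const fls_X" "gal fls_X = fls_X"
  and dual_vars: "dual (fls_const fls_X) = fls_const fls_X" "dual fls_X = emb2 \<zeta> * fls_X"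
proof -
  have 1: "scale fls_X = fls_const \<zeta> * fls_X" "scale 1 = 1" "scale 0 = 0" by (auto simp: fls_eq_iff scale_nth scale_hom)
  show "gal (fls_const fls_X) = emb2 \<zeta> * fls_const fls_X" "gal fls_X = fls_X"
    "dual (fls_const fls_X) = fls_const fls_X" "dual fls_X = emb2 \<zeta> * fls_X"
    by (auto simp: fls_eq_iff[where ?'a = "'b fls"] gal_nth dual_nth emb2_def 1)
qed

lemma cyc_fixed: "fixed (cyc b)"
proof -
  obtain p q where b: "b = (p, q)" by (cases b)
  have zz: "emb2 \<zeta> ^ (p * (Suc s mod m)) = emb2 \<zeta> ^ p * emb2 \<zeta> ^ (p * s)" for s
    by (simp add: mult.commute[of p] power_mult z_power_mod power_mult_distrib)
  have m1: "(t + 1) mod m = ((s + 1) mod m + q) mod m \<longleftrightarrow> t = (s + q) mod m" if "s < m" "t < m" for s t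
  proof -
    have "((s + 1) mod m + q) mod m = ((s + q) mod m + 1) mod m" by (simp add: mod_simps)
    moreover have "(a + 1) mod m = (b + 1) mod m \<longleftrightarrow> a = b" if "a < m" "b < m" for a b
      using inj_onD[OF bij_betw_imp_inj_on[OF sh_bij[of 1]], of a b] that by (auto simp: sh_def)
    ultimately show ?thesis using that m by simp
  qed
  have dz: "emb2 \<zeta> ^ s * (emb2 \<zeta>) ^ q = emb2 \<zeta> ^ ((s + q) mod m)" for s
    unfolding z_power_mod by (simp add: power_add)
  show ?thesis unfolding fixed_def
  proof (intro allI impI)
    fix s t assume "s < dim_row (cyc b)" "t < dim_col (cyc b)"
    then have st: "s < m" "t < m" using cyc_carrier[of b] by simp_all
    have sh1: "sh s = (s + 1) mod m" "sh t = (t + 1) mod m" using st by (simp_all add: sh_def)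
    have "cyc b $$ (sh s, sh t) = gal (cyc b $$ (s, t))"
      unfolding sh1 using st m
      by (simp add: b cyc_def m1[OF st, simplified] gal_hom gal_power gal_vars gal_emb2 power_mult_distrib zz emb2_hom mult_ac)
    moreover have "emb2 \<zeta> ^ s * dual (cyc b $$ (s, t)) = emb2 \<zeta> ^ t * cyc b $$ (s, t)"
      using st by (auto simp: b cyc_def dual_hom dual_power dual_vars dual_emb2 power_mult_distrib dz[symmetric] mult_ac)
    ultimately show "cyc b $$ (sh s, sh t) = gal (cyc b $$ (s, t)) \<and>
        emb2 \<zeta> ^ s * dual (cyc b $$ (s, t)) = emb2 \<zeta> ^ t * cyc b $$ (s, t)" by blast
  qed
qed

lemma cyc_span:
  fixes U :: "'b fls fls mat"
  assumes U: "U \<in> carrier_mat m m"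
  obtains c where "U = lincomb m m ({0..<m} \<times> {0..<m}) c cyc"
proof -
  let ?a = "fls_const fls_X :: 'b fls fls" and ?x = "fls_X :: 'b fls fls" and ?z = "emb2 \<zeta>"
  have nz: "?a \<noteq> 0" "?x \<noteq> 0" "?z \<noteq> 0" using z_nonzero by (auto simp: fls_eq_iff[where ?'a = "'b fls"])
  have orth: "(\<Sum>p\<in>{0..<m}. ?z ^ (s' * p) / ?z ^ (s * p)) = (if s' = s then of_nat m else 0)" if "s < m" "s' < m" for s s'
  proof (cases "s' = s")
    case False
    let ?w = "?z ^ s' / ?z ^ s"
    have "\<zeta> ^ s' \<noteq> \<zeta> ^ s" using root_inj False that by blast
    then have "?w \<noteq> 1" using nz by (simp add: emb2_inj flip: emb2_hom(5))
    have "(?z ^ k) ^ m = 1" for k by (metis mult.commute power_mult power_one z)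
    then have "?w ^ m = 1" by (simp add: power_divide)
    have "?z ^ (s' * p) / ?z ^ (s * p) = ?w ^ p" for p by (simp add: power_divide power_mult)
    then have "(\<Sum>p\<in>{0..<m}. ?z ^ (s' * p) / ?z ^ (s * p)) = (\<Sum>p<m. ?w ^ p)"
      by (simp add: atLeast0LessThan)
    also have "\<dots> = 0" using geometric_sum[OF \<open>?w \<noteq> 1\<close>, of m] \<open>?w ^ m = 1\<close> by simp
    finally show ?thesis using False by simp
  qed (use nz in simp)
  define c where "c = (\<lambda>(p, q). \<Sum>s\<in>{0..<m}. U $$ (s, (s + q) mod m) / (of_nat m * ?z ^ (s * p) * ?a ^ p * ?x ^ q))"
  have "U $$ (s', t') = (\<Sum>b\<in>{0..<m} \<times> {0..<m}. c b * cyc b $$ (s', t'))" if st: "s' < m" "t' < m" for s' t'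
  proof -
    define q' where "q' = (t' + (m - s')) mod m"
    have q': "q' < m" using m by (simp add: q'_def)
    have "(s' + q') mod m = t'" using st by (simp add: q'_def mod_simps)
    moreover have "q = q'" if "q < m" "t' = (s' + q) mod m" for q
    proof -
      have "q' = (s' + q + (m - s')) mod m" unfolding q'_def that(2) by (simp add: mod_simps)
      also have "s' + q + (m - s') = q + m" using st by simp
      finally show ?thesis using that by simp
    qed
    ultimately have q_iff: "t' = (s' + q) mod m \<longleftrightarrow> q = q'" if "q < m" for q using that by auto
    have "(\<Sum>b\<in>{0..<m} \<times> {0..<m}. c b * cyc b $$ (s', t')) = (\<Sum>p\<in>{0..<m}. \<Sum>q\<in>{0..<m}. c (p, q) * cyc (p, q) $$ (s', t'))"
      by (simp add: sum.cartesian_product)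
    also have "\<dots> = (\<Sum>p\<in>{0..<m}. \<Sum>q\<in>{0..<m}. if q = q' then c (p, q) * (?z ^ (s' * p) * ?a ^ p * ?x ^ q) else 0)"
      using st by (intro sum.cong refl) (auto simp: cyc_def q_iff emb2_hom)
    also have "\<dots> = (\<Sum>p\<in>{0..<m}. c (p, q') * (?z ^ (s' * p) * ?a ^ p * ?x ^ q'))"
      using q' by simp
    also have "\<dots> = (\<Sum>p\<in>{0..<m}. \<Sum>s\<in>{0..<m}. U $$ (s, (s + q') mod m) / of_nat m * (?z ^ (s' * p) / ?z ^ (s * p)))"
      by (intro sum.cong refl, simp only: c_def prod.case sum_distrib_right, intro sum.cong refl, simp add: nz)
    also have "\<dots> = (\<Sum>s\<in>{0..<m}. U $$ (s, (s + q') mod m) / of_nat m * (\<Sum>p\<in>{0..<m}. ?z ^ (s' * p) / ?z ^ (s * p)))"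
      by (subst sum.swap) (simp add: sum_distrib_left)
    also have "\<dots> = (\<Sum>s\<in>{0..<m}. if s = s' then U $$ (s', (s' + q') mod m) else 0)"
      using st m by (intro sum.cong refl) (simp add: orth)
    also have "\<dots> = U $$ (s', t')" using st \<open>(s' + q') mod m = t'\<close> by simp
    finally show ?thesis ..
  qed
  then have "U = lincomb m m ({0..<m} \<times> {0..<m}) c cyc"
    using U by (intro eq_matI) (auto simp: lincomb_def)
  then show thesis using that by blast
qed

end

section \<open>Ranks of pencils are divisible by the size of the point\<close>

lemma ksum_map:
  fixes h :: "'a :: comm_ring_1 => 'b :: comm_ring_1"
  assumes h: "h 0 = 0" "\<And>x y. h (x + y) = h x + h y" "\<And>x y. h (x * y) = h x * h y"
    and "\<And>l. U l \<in> carrier_mat m m'" "\<And>l. L l \<in> carrier_mat n n"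
  shows "ksum G m m' n (\<lambda>l. map_mat h (U l)) (\<lambda>l. map_mat h (L l)) = map_mat h (ksum G m m' n U L)"
proof -
  have "h (\<Sum>l\<in>S. f l) = (\<Sum>l\<in>S. h (f l))" for S :: "'c set" and f
    by (induction S rule: infinite_finite_induct) (simp_all add: h)
  then show ?thesis
    using carrier_matD[OF assms(4)] carrier_matD[OF assms(5)] divmod_less
    by (intro eq_matI) (simp_all add: ksum_index h)
qed

text \<open>Exchanging the factors of all Kronecker products is a permutation of rows and columns.\<close>

lemma ksum_swap_rank:
  fixes U L :: "'l => 'a :: field mat"
  assumes "rank_ge (ksum G m m n U L) r"
  shows "rank_ge (ksum G n n m L U) r"
proof -
  define \<pi> where "\<pi> = (\<lambda>i. (i mod n) * m + i div n)"
  have less: "\<pi> i < n * m" if "i < m * n" for i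
    unfolding \<pi>_def using divmod_less[OF that] by (intro slice_less)
  have inj: "inj_on \<pi> {0..<m * n}"
  proof (rule inj_onI)
    fix i j assume ij: "i \<in> {0..<m * n}" "j \<in> {0..<m * n}" and eq: "\<pi> i = \<pi> j"
    have lt: "i div n < m" "j div n < m" using ij divmod_less[of _ m n] by auto
    have "i mod n = j mod n" "i div n = j div n"
      using arg_cong[OF eq, of "\<lambda>k. k div m"] arg_cong[OF eq, of "\<lambda>k. k mod m"] lt by (simp_all add: \<pi>_def)
    then show "i = j" by (metis div_mult_mod_eq)
  qed
  have bij: "bij_betw \<pi> {0..<m * n} {0..<m * n}"
    using inj less endo_inj_surj[of "{0..<m * n}" \<pi>] by (force simp: bij_betw_def mult.commute)
  have entry: "ksum G n n m L U $$ (\<pi> i, \<pi> j) = ksum G m m n U L $$ (i, j)" if "i < m * n" "j < m * n" for i j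
  proof -
    have "\<pi> i div m = i mod n" "\<pi> i mod m = i div n" if "i < m * n" for i
      using divmod_less[OF that] by (simp_all add: \<pi>_def)
    then show ?thesis using that less by (simp add: ksum_index mult.commute)
  qed
  from assms obtain P Q where PQ: "P \<in> carrier_mat r (m * n)" "Q \<in> carrier_mat (m * n) r"
    "P * ksum G m m n U L * Q = 1\<^sub>m r" by (auto simp: rank_ge_def)
  define \<sigma> where "\<sigma> = the_inv_into {0..<m * n} \<pi>"
  have \<sigma>: "\<sigma> (\<pi> i) = i" if "i < m * n" for i
    unfolding \<sigma>_def using inj that by (intro the_inv_into_f_f) auto
  define P' where "P' = mat r (n * m) (\<lambda>(i, j). P $$ (i, \<sigma> j))"
  define Q' where "Q' = mat (n * m) r (\<lambda>(i, j). Q $$ (\<sigma> i, j))"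
  have "P' * (ksum G n n m L U * Q') = P * (ksum G m m n U L * Q)"
  proof (rule eq_matI)
    fix i j assume "i < dim_row (P * (ksum G m m n U L * Q))" "j < dim_col (P * (ksum G m m n U L * Q))"
    then have ij: "i < r" "j < r" using PQ by simp_all
    have 1: "(ksum G n n m L U * Q') $$ (\<pi> k, j) = (ksum G m m n U L * Q) $$ (k, j)" if k: "k < m * n" for k
    proof -
      have "(ksum G n n m L U * Q') $$ (\<pi> k, j) = (\<Sum>l\<in>{0..<m * n}. ksum G n n m L U $$ (\<pi> k, l) * Q' $$ (l, j))"
        using ij less[OF k] by (subst mult_index) (auto simp: Q'_def mult.commute)
      also have "\<dots> = (\<Sum>l\<in>{0..<m * n}. ksum G n n m L U $$ (\<pi> k, \<pi> l) * Q' $$ (\<pi> l, j))"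
        by (rule sum.reindex_bij_betw[OF bij, symmetric])
      also have "\<dots> = (\<Sum>l\<in>{0..<m * n}. ksum G m m n U L $$ (k, l) * Q $$ (l, j))"
        using ij k less by (intro sum.cong) (auto simp: entry Q'_def \<sigma>)
      also have "\<dots> = (ksum G m m n U L * Q) $$ (k, j)" using ij k PQ by (subst mult_index) auto
      finally show ?thesis .
    qed
    have "(P' * (ksum G n n m L U * Q')) $$ (i, j) = (\<Sum>k\<in>{0..<m * n}. P' $$ (i, k) * (ksum G n n m L U * Q') $$ (k, j))"
      using ij by (subst mult_index) (auto simp: P'_def Q'_def mult.commute simp del: index_mult_mat(1))
    also have "\<dots> = (\<Sum>k\<in>{0..<m * n}. P' $$ (i, \<pi> k) * (ksum G n n m L U * Q') $$ (\<pi> k, j))"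
      by (rule sum.reindex_bij_betw[OF bij, symmetric])
    also have "\<dots> = (\<Sum>k\<in>{0..<m * n}. P $$ (i, k) * (ksum G m m n U L * Q) $$ (k, j))"
      using ij less by (intro sum.cong) (auto simp: 1 P'_def \<sigma> simp del: index_mult_mat(1))
    also have "\<dots> = (P * (ksum G m m n U L * Q)) $$ (i, j)"
      using ij PQ by (subst mult_index) (auto simp del: index_mult_mat(1))
    finally show "(P' * (ksum G n n m L U * Q')) $$ (i, j) = (P * (ksum G m m n U L * Q)) $$ (i, j)" .
  qed (use PQ in \<open>simp_all add: P'_def Q'_def\<close>)
  then have "P' * ksum G n n m L U * Q' = 1\<^sub>m r"
    using PQ by (simp add: mat_assoc P'_def Q'_def)
  then show ?thesis
    by (intro rank_geI[of P' r "n * m" _ "n * m" Q']) (auto simp: P'_def Q'_def)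
qed

lemma generic_pencil_rank:
  fixes L :: "'l => 'a :: field mat"
  assumes G: "finite G" and B: "finite B" and S: "infinite S" and Y: "\<And>b. Y b \<in> carrier_mat m m"
    and rank: "rank_ge (ksum G m m n (\<lambda>l. lincomb m m B (c l) Y) L) r"
  obtains c' where "\<And>l b. c' l b \<in> S" "rank_ge (ksum G m m n (\<lambda>l. lincomb m m B (c' l) Y) L) r"
proof -
  define C where "C = (\<lambda>(l, b). mat (m * n) (m * n) (\<lambda>(i, j). Y b $$ (i div n, j div n) * L l $$ (i mod n, j mod n)))"
  have eq: "ksum G m m n (\<lambda>l. lincomb m m B (c l) Y) L = lincomb (m * n) (m * n) (G \<times> B) (\<lambda>(l, b). c l b) C" for c
    using divmod_less
    by (intro eq_matI) (auto simp: ksum_index lincomb_def C_def sum_distrib_right sum.cartesian_product case_prod_unfold mult.assoc)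
  have "C j \<in> carrier_mat (m * n) (m * n)" for j by (auto simp: C_def split: prod.splits)
  from generic_rank[OF finite_cartesian_product[OF G B] S this rank[unfolded eq]]
  obtain c' where c': "\<And>j. c' j \<in> S" "rank_ge (lincomb (m * n) (m * n) (G \<times> B) c' C) r" by blast
  show thesis
    by (rule that[of "\<lambda>l b. c' (l, b)"]) (use c' in \<open>auto simp: eq\<close>)
qed

theorem pencil_rank_divisible:
  fixes L :: "'l => 'k :: field_char_0 mat"
  assumes G: "finite G" and L: "\<And>l. L l \<in> carrier_mat n n" and U: "\<And>l. U l \<in> carrier_mat (2 ^ e) (2 ^ e)"
    and rank: "rank_ge (ksum G (2 ^ e) (2 ^ e) n U L) s"
  obtains r U' where "\<And>l. U' l \<in> carrier_mat (2 ^ e) (2 ^ e)" "s \<le> r * 2 ^ e" "rank_ge (ksum G (2 ^ e) (2 ^ e) n U' L) (r * 2 ^ e)"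
proof -
  define m where "m = (2 :: nat) ^ e"
  obtain \<zeta> :: "'k alg_closure" where \<zeta>: "\<zeta> ^ m = 1" "\<And>i. 0 < i ==> i < m ==> \<zeta> ^ i \<noteq> 1"
    unfolding m_def by (rule primitive_root_exists) blast
  have m: "m > 0" by (simp add: m_def)
  note U = U[folded m_def] and rank = rank[folded m_def]
  note facts = \<zeta> m
  interpret cyclic_algebra "gal \<zeta>" "dual \<zeta>" "emb2 \<zeta>" m by (rule cyclic_algebra[OF facts])
  define \<iota> :: "'k => 'k alg_closure fls fls" where "\<iota> = (\<lambda>c. emb2 (to_ac c))"
  have \<iota>: "\<iota> 0 = 0" "\<iota> 1 = 1" "\<iota> (x + y) = \<iota> x + \<iota> y" "\<iota> (x * y) = \<iota> x * \<iota> y" "\<iota> x = \<iota> y \<longleftrightarrow> x = y" for x y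
    by (simp_all add: \<iota>_def emb2_hom[OF facts] emb2_inj[OF facts])
  interpret \<iota>: comm_ring_hom \<iota> by unfold_locales (simp_all add: \<iota>)
  have inf: "infinite (range \<iota>)"
    using infinite_UNIV_char_0[where ?'a = 'k] by (auto dest!: finite_imageD simp: inj_on_def \<iota>)
  let ?L = "\<lambda>l. map_mat \<iota> (L l)"
  have up: "rank_ge (map_mat \<iota> A) t" if "rank_ge A t" for A t
  proof -
    from that obtain P Q where PQ: "P \<in> carrier_mat t (dim_row A)" "Q \<in> carrier_mat (dim_col A) t" "P * A * Q = 1\<^sub>m t"
      by (auto simp: rank_ge_def)
    have "map_mat \<iota> (P * A * Q) = map_mat \<iota> (P * A) * map_mat \<iota> Q"
      by (rule \<iota>.mat_hom_mult[of _ t "dim_col A" _ t]) (use PQ in auto)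
    also have "map_mat \<iota> (P * A) = map_mat \<iota> P * map_mat \<iota> A"
      by (rule \<iota>.mat_hom_mult[of _ t "dim_row A" _ "dim_col A"]) (use PQ in auto)
    finally have "map_mat \<iota> P * map_mat \<iota> A * map_mat \<iota> Q = map_mat \<iota> (1\<^sub>m t)" unfolding PQ(3) ..
    then show ?thesis using PQ
      by (intro rank_geI[of "map_mat \<iota> P" t "dim_row A" _ "dim_col A" "map_mat \<iota> Q"]) (auto simp: \<iota>.mat_hom_one)
  qed
  have down: "rank_ge A t" if "rank_ge (map_mat \<iota> A) t" for A t
  proof -
    obtain r0 P Q where PQ: "P \<in> carrier_mat r0 (dim_row A)" "Q \<in> carrier_mat (dim_col A) r0" "P * A * Q = 1\<^sub>m r0"
      "A * Q * P * A = A" by (rule max_rank_obtain[of A "dim_row A" "dim_col A"]) auto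
    have "map_mat \<iota> A = map_mat \<iota> ((A * Q) * (P * A))" using PQ by (simp add: mat_assoc)
    also have "\<dots> = map_mat \<iota> (A * Q) * map_mat \<iota> (P * A)"
      using PQ by (intro \<iota>.mat_hom_mult[of _ "dim_row A" r0 _ "dim_col A"]) (auto intro!: carrier_matI)
    finally have "t \<le> r0" using that PQ by (intro rank_ge_mult[of "map_mat \<iota> (A * Q)" "map_mat \<iota> (P * A)" t "dim_row A" r0 "dim_col A"]) (auto intro!: carrier_matI)
    moreover have "rank_ge A r0" using PQ by (intro rank_geI[of P r0 "dim_row A" A "dim_col A" Q]) auto
    ultimately show ?thesis using rank_ge_mono by blast
  qed
  define B where "B = {0..<m} \<times> {0..<m}"
  have B: "finite B" by (simp add: B_def)
  have span: "\<exists>c. W = lincomb m m B c (cyc \<zeta> m)" if "W \<in> carrier_mat m m" for W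
    using cyc_span[OF facts that] unfolding B_def by metis
  have "\<exists>c. \<forall>l. map_mat \<iota> (U l) = lincomb m m B (c l) (cyc \<zeta> m)"
    using span U by (intro choice allI) simp
  then obtain c where c: "\<And>l. map_mat \<iota> (U l) = lincomb m m B (c l) (cyc \<zeta> m)" by blast
  have "rank_ge (ksum G m m n (\<lambda>l. lincomb m m B (c l) (cyc \<zeta> m)) ?L) s"
    using up[OF rank] by (simp add: ksum_map[OF \<iota>(1,3,4) U L] flip: c)
  from generic_pencil_rank[OF G B inf cyc_carrier[OF facts] this]
  obtain c1 where c1: "\<And>l b. c1 l b \<in> range \<iota>" "rank_ge (ksum G m m n (\<lambda>l. lincomb m m B (c1 l) (cyc \<zeta> m)) ?L) s" by blast
  let ?A = "ksum G n n m ?L (\<lambda>l. lincomb m m B (c1 l) (cyc \<zeta> m))"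
  have rankA: "rank_ge ?A s" by (rule ksum_swap_rank[OF c1(2)])
  have const: "gal \<zeta> (\<iota> x) = \<iota> x" "dual \<zeta> (\<iota> x) = \<iota> x" for x
    by (simp_all add: \<iota>_def gal_emb2[OF facts] dual_emb2[OF facts])
  have "fixed ?A" unfolding fixed_def
  proof (intro allI impI)
    fix i j assume "i < dim_row ?A" "j < dim_col ?A"
    then have ij: "i < n * m" "j < n * m" by simp_all
    note dm = divmod_less[OF ij(1)] divmod_less[OF ij(2)]
    have lt: "sh k < m" if "k < m" for k using sh_less[of k 1] that by simp
    have shmod: "sh k mod m = sh (k mod m)" for k using m by (simp add: sh_def mod_Suc_eq)
    have c1': "gal \<zeta> (c1 l b) = c1 l b" "dual \<zeta> (c1 l b) = c1 l b" for l b
      using c1(1)[of l b] const by auto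
    have Y: "lincomb m m B (c1 l) (cyc \<zeta> m) $$ (sh s, sh t) = gal \<zeta> (lincomb m m B (c1 l) (cyc \<zeta> m) $$ (s, t))"
      "emb2 \<zeta> ^ s * dual \<zeta> (lincomb m m B (c1 l) (cyc \<zeta> m) $$ (s, t)) = emb2 \<zeta> ^ t * lincomb m m B (c1 l) (cyc \<zeta> m) $$ (s, t)"
      if "s < m" "t < m" for s t l
    proof -
      note fx = cyc_fixed[OF facts, unfolded fixed_def, rule_format, of s _ t]
      have fx1: "cyc \<zeta> m b $$ (sh s, sh t) = gal \<zeta> (cyc \<zeta> m b $$ (s, t))"
        "emb2 \<zeta> ^ s * dual \<zeta> (cyc \<zeta> m b $$ (s, t)) = emb2 \<zeta> ^ t * cyc \<zeta> m b $$ (s, t)" for b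
        using fx[of b] that carrier_matD[OF cyc_carrier[OF facts, of b]] by simp_all
      show "lincomb m m B (c1 l) (cyc \<zeta> m) $$ (sh s, sh t) = gal \<zeta> (lincomb m m B (c1 l) (cyc \<zeta> m) $$ (s, t))"
        using that lt by (simp add: lincomb_def g_sum g c1' fx1)
      have e1: "emb2 \<zeta> ^ s * (c1 l b * dual \<zeta> (cyc \<zeta> m b $$ (s, t))) = emb2 \<zeta> ^ t * (c1 l b * cyc \<zeta> m b $$ (s, t))" for b
        using fx1(2)[of b] by (metis mult.left_commute)
      show "emb2 \<zeta> ^ s * dual \<zeta> (lincomb m m B (c1 l) (cyc \<zeta> m) $$ (s, t)) = emb2 \<zeta> ^ t * lincomb m m B (c1 l) (cyc \<zeta> m) $$ (s, t)"
        using that by (simp add: lincomb_def d_sum d c1' sum_distrib_left e1)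
    qed
    have Lc: "gal \<zeta> (?L l $$ (a, b)) = ?L l $$ (a, b)" "dual \<zeta> (?L l $$ (a, b)) = ?L l $$ (a, b)" if "a < n" "b < n" for l a b
      using that carrier_matD[OF L] const by simp_all
    have "?A $$ (sh i, sh j) = gal \<zeta> (?A $$ (i, j))"
      using ij dm sh_less[OF ij(1)] sh_less[OF ij(2)]
      by (simp add: ksum_index sh_div shmod Y(1) g_sum g Lc del: index_map_mat)
    moreover have "emb2 \<zeta> ^ i * dual \<zeta> (?A $$ (i, j)) = emb2 \<zeta> ^ j * ?A $$ (i, j)"
    proof -
      have "emb2 \<zeta> ^ (i mod m) * dual \<zeta> (?A $$ (i, j)) = (\<Sum>l\<in>G. ?L l $$ (i div m, j div m) *
          (emb2 \<zeta> ^ (i mod m) * dual \<zeta> (lincomb m m B (c1 l) (cyc \<zeta> m) $$ (i mod m, j mod m))))"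
        using ij dm by (simp add: ksum_index d_sum d Lc sum_distrib_left mult.left_commute del: index_map_mat)
      also have "\<dots> = emb2 \<zeta> ^ (j mod m) * ?A $$ (i, j)"
        using ij dm by (simp add: ksum_index Y(2) sum_distrib_left mult.left_commute del: index_map_mat)
      finally show ?thesis by (simp only: z_power_mod)
    qed
    ultimately show "?A $$ (sh i, sh j) = gal \<zeta> (?A $$ (i, j)) \<and> emb2 \<zeta> ^ i * dual \<zeta> (?A $$ (i, j)) = emb2 \<zeta> ^ j * ?A $$ (i, j)" by blast
  qed
  from fixed_max_rank[OF fixed_nonsingular[OF facts] ksum_carrier this]
  obtain r where r: "rank_ge ?A (r * m)" "\<And>t. rank_ge ?A t ==> t \<le> r * m" by blast
  have "rank_ge (ksum G m m n (\<lambda>l. lincomb m m B (c1 l) (cyc \<zeta> m)) ?L) (r * m)" by (rule ksum_swap_rank[OF r(1)])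
  moreover define E :: "nat \<times> nat => 'k alg_closure fls fls mat" where
    "E = (\<lambda>b. mat m m (\<lambda>ij. if ij = b then 1 else 0))"
  have E: "E b \<in> carrier_mat m m" for b by (simp add: E_def)
  have units: "W = lincomb m m B (\<lambda>ij. W $$ ij) E" if "W \<in> carrier_mat m m" for W
    using that by (intro eq_matI) (auto simp: lincomb_def E_def B_def if_distrib[of "\<lambda>x. _ * x"] cong: if_cong)
  ultimately have "rank_ge (ksum G m m n (\<lambda>l. lincomb m m B (\<lambda>ij. lincomb m m B (c1 l) (cyc \<zeta> m) $$ ij) E) ?L) (r * m)"
    using units[OF lincomb_carrier] by simp
  from generic_pencil_rank[OF G B inf E this]
  obtain c2 where c2: "\<And>l b. c2 l b \<in> range \<iota>" "rank_ge (ksum G m m n (\<lambda>l. lincomb m m B (c2 l) E) ?L) (r * m)" by blast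
  have "\<exists>y. c2 (fst lb) (snd lb) = \<iota> y" for lb using c2(1)[of "fst lb" "snd lb"] by auto
  then obtain x where "\<And>lb. c2 (fst lb) (snd lb) = \<iota> (x lb)" by metis
  then have x: "c2 l b = \<iota> (x (l, b))" for l b by (metis fst_conv snd_conv)
  define U' where "U' = (\<lambda>l. mat m m (\<lambda>ij. x (l, ij)))"
  have U': "U' l \<in> carrier_mat m m" for l by (simp add: U'_def)
  have "lincomb m m B (c2 l) E = map_mat \<iota> (U' l)" for l
    by (intro eq_matI) (auto simp: lincomb_def E_def B_def U'_def x if_distrib[of "\<lambda>x. _ * x"] cong: if_cong)
  then have "rank_ge (map_mat \<iota> (ksum G m m n U' L)) (r * m)"
    using c2(2) by (simp add: ksum_map[OF \<iota>(1,3,4) U' L])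
  from down[OF this] have "rank_ge (ksum G m m n U' L) (r * m)" .
  moreover have "s \<le> r * m" by (rule r(2)[OF rankA])
  ultimately show thesis using that[of U' r] U' unfolding m_def by blast
qed


section \<open>Evaluation of matrices over the free algebra\<close>

lemma nc_poly_eval_carrier [simp]: "nc_poly_eval n A p \<in> carrier_mat n n"
  "dim_row (nc_poly_eval n A p) = n" "dim_col (nc_poly_eval n A p) = n"
  by (simp_all add: nc_poly_eval_def)

context
  fixes n :: nat and A :: "'x => 'k :: field mat"
  assumes A: "\<And>x. A x \<in> carrier_mat n n"
begin

lemma nc_word_eval_carrier: "nc_word_eval n A w \<in> carrier_mat n n"
proof -
  have "foldr (\<lambda>x M. A x * M) xs (1\<^sub>m n) \<in> carrier_mat n n" for xs
    by (induction xs) (auto intro!: mult_carrier_mat[OF A])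
  then show ?thesis by (simp add: nc_word_eval_def)
qed

lemma nc_word_eval_add: "nc_word_eval n A (u + v) = nc_word_eval n A u * nc_word_eval n A v"
proof -
  have c: "foldr (\<lambda>x M. A x * M) xs (1\<^sub>m n) \<in> carrier_mat n n" for xs
    by (induction xs) (auto intro!: mult_carrier_mat[OF A])
  have "foldr (\<lambda>x M. A x * M) xs (nc_word_eval n A v) = foldr (\<lambda>x M. A x * M) xs (1\<^sub>m n) * nc_word_eval n A v" for xs
  proof (induction xs)
    case (Cons x xs)
    then show ?case using A[of x] c[of xs] nc_word_eval_carrier[of v] by (simp add: mat_assoc)
  qed (simp add: left_mult_one_mat[OF nc_word_eval_carrier])
  then show ?thesis by (simp add: nc_word_eval_def plus_nc_word_def)
qed

lemma nc_word_eval_simps: "nc_word_eval n A 0 = 1\<^sub>m n" "nc_word_eval n A (NC_Word [x]) = A x"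
  using A[of x] by (simp_all add: nc_word_eval_def zero_nc_word_def)

lemma nc_poly_eval_index:
  assumes "i < n" "j < n" "finite W" "Poly_Mapping.keys p \<subseteq> W"
  shows "nc_poly_eval n A p $$ (i, j) = (\<Sum>w\<in>W. Poly_Mapping.lookup p w * nc_word_eval n A w $$ (i, j))"
proof -
  have "(\<Sum>w\<in>Poly_Mapping.keys p. Poly_Mapping.lookup p w * nc_word_eval n A w $$ (i, j)) =
    (\<Sum>w\<in>W. Poly_Mapping.lookup p w * nc_word_eval n A w $$ (i, j))"
    using assms by (intro sum.mono_neutral_left) (auto simp: in_keys_iff)
  then show ?thesis using assms by (simp add: nc_poly_eval_def)
qed

lemma nc_poly_eval_add: "nc_poly_eval n A (p + q) = nc_poly_eval n A p + nc_poly_eval n A q"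
proof (rule eq_matI)
  fix i j assume "i < dim_row (nc_poly_eval n A p + nc_poly_eval n A q)" "j < dim_col (nc_poly_eval n A p + nc_poly_eval n A q)"
  then have ij: "i < n" "j < n" by simp_all
  let ?W = "Poly_Mapping.keys p \<union> Poly_Mapping.keys q"
  show "nc_poly_eval n A (p + q) $$ (i, j) = (nc_poly_eval n A p + nc_poly_eval n A q) $$ (i, j)"
    using ij keys_add[of p q]
    by (simp add: nc_poly_eval_index[of _ _ ?W] lookup_add sum.distrib distrib_right)
qed simp_all

lemma nc_poly_eval_single: "nc_poly_eval n A (Poly_Mapping.single w c) = c \<cdot>\<^sub>m nc_word_eval n A w"
  using nc_word_eval_carrier[of w] by (intro eq_matI) (auto simp: nc_poly_eval_index[of _ _ "{w}"])

lemma nc_poly_eval_0 [simp]: "nc_poly_eval n A 0 = 0\<^sub>m n n"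
  by (intro eq_matI) (auto simp: nc_poly_eval_def)

lemma nc_poly_eval_1 [simp]: "nc_poly_eval n A 1 = 1\<^sub>m n"
  using nc_poly_eval_single[of 0 1] by (simp add: nc_word_eval_simps) (auto intro!: eq_matI)

lemma nc_poly_eval_var: "nc_poly_eval n A (nc_var x) = A x"
  using A[of x] by (simp add: nc_var_def nc_poly_eval_single nc_word_eval_simps) (auto intro!: eq_matI)

lemma nc_poly_eval_mult: "nc_poly_eval n A (p * q) = nc_poly_eval n A p * nc_poly_eval n A q"
proof (induction p rule: nc_poly_induct)
  case (single u a)
  show ?case
  proof (induction q rule: nc_poly_induct)
    case (single v b)
    have "a \<cdot>\<^sub>m nc_word_eval n A u * (b \<cdot>\<^sub>m nc_word_eval n A v) = (a * b) \<cdot>\<^sub>m (nc_word_eval n A u * nc_word_eval n A v)"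
      using nc_word_eval_carrier[of u] nc_word_eval_carrier[of v]
      by (intro eq_matI) (auto simp: scalar_prod_def sum_distrib_left mult_ac)
    then show ?case by (simp add: mult_single nc_poly_eval_single nc_word_eval_add)
  next
    case (add q r)
    then show ?case by (simp add: distrib_left nc_poly_eval_add mat_distrib)
  qed simp
next
  case (add p q)
  then show ?case by (simp add: distrib_right nc_poly_eval_add mat_distrib)
qed simp

lemma nc_poly_eval_uminus: "nc_poly_eval n A (- p) = - nc_poly_eval n A p"
proof -
  have "nc_poly_eval n A p + nc_poly_eval n A (- p) = 0\<^sub>m n n"
    by (simp flip: nc_poly_eval_add)
  then have "(nc_poly_eval n A p + nc_poly_eval n A (- p)) $$ (i, j) = 0" if "i < n" "j < n" for i j
    using that by simp
  then show ?thesis by (intro eq_matI) (auto simp: add_eq_0_iff)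
qed

lemma nc_poly_eval_diff: "nc_poly_eval n A (p - q) = nc_poly_eval n A p - nc_poly_eval n A q"
proof -
  have "nc_poly_eval n A (p - q) = nc_poly_eval n A p + - nc_poly_eval n A q"
    using nc_poly_eval_add[of p "- q"] by (simp add: nc_poly_eval_uminus)
  also have "\<dots> = nc_poly_eval n A p - nc_poly_eval n A q" by (intro eq_matI) auto
  finally show ?thesis .
qed

lemma nc_poly_eval_sum_index:
  "i < n ==> j < n ==> nc_poly_eval n A (\<Sum>s\<in>S. f s) $$ (i, j) = (\<Sum>s\<in>S. nc_poly_eval n A (f s) $$ (i, j))"
  by (induction S rule: infinite_finite_induct) (simp_all add: nc_poly_eval_add)

end

definition mev :: "nat => ('x => 'k :: field mat) => ('x, 'k) nc_poly mat => 'k mat" where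
  "mev n A M = mat (dim_row M * n) (dim_col M * n)
     (\<lambda>(i, j). nc_poly_eval n A (M $$ (i div n, j div n)) $$ (i mod n, j mod n))"

lemma mev_dim [simp]: "dim_row (mev n A M) = dim_row M * n" "dim_col (mev n A M) = dim_col M * n"
  by (simp_all add: mev_def)

lemma mev_index: "i < dim_row M * n ==> j < dim_col M * n ==>
  mev n A M $$ (i, j) = nc_poly_eval n A (M $$ (i div n, j div n)) $$ (i mod n, j mod n)"
  by (simp add: mev_def)

lemma less_mult_iff_div: "k < a * n \<longleftrightarrow> k div n < a" if "k < b * n" for k a b n :: nat
  using that by (metis div_less_iff_less_mult mult_0_right not_gr_zero not_less_zero)

lemma mev_vstack: "dim_col M = dim_col N ==> mev n A (vstack M N) = vstack (mev n A M) (mev n A N)"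
proof (rule eq_matI)
  assume dc: "dim_col M = dim_col N"
  fix i j assume "i < dim_row (vstack (mev n A M) (mev n A N))" "j < dim_col (vstack (mev n A M) (mev n A N))"
  then have ij: "i < (dim_row M + dim_row N) * n" "j < dim_col M * n" by (simp_all add: distrib_right)
  note dm = divmod_less[OF ij(1)] divmod_less[OF ij(2)]
  have n: "n > 0" using dm by auto
  show "mev n A (vstack M N) $$ (i, j) = vstack (mev n A M) (mev n A N) $$ (i, j)"
  proof (cases "i < dim_row M * n")
    case True
    then show ?thesis using ij dm dc less_mult_iff_div[OF ij(1)] by (simp add: mev_index distrib_right)
  next
    case False
    then obtain k where k: "i = dim_row M * n + k" by (metis le_add_diff_inverse not_less)
    then have "k < dim_row N * n" using ij by (simp add: distrib_right)
    then show ?thesis using ij dm dc k n by (simp add: mev_index distrib_right)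
  qed
qed (simp_all add: distrib_right)

lemma mev_hstack: "dim_row M = dim_row N ==> mev n A (hstack M N) = hstack (mev n A M) (mev n A N)"
proof (rule eq_matI)
  assume dc: "dim_row M = dim_row N"
  fix i j assume "i < dim_row (hstack (mev n A M) (mev n A N))" "j < dim_col (hstack (mev n A M) (mev n A N))"
  then have ij: "i < dim_row M * n" "j < (dim_col M + dim_col N) * n" by (simp_all add: distrib_right)
  note dm = divmod_less[OF ij(1)] divmod_less[OF ij(2)]
  have n: "n > 0" using dm by auto
  show "mev n A (hstack M N) $$ (i, j) = hstack (mev n A M) (mev n A N) $$ (i, j)"
  proof (cases "j < dim_col M * n")
    case True
    then show ?thesis using ij dm dc less_mult_iff_div[OF ij(2)] by (simp add: mev_index distrib_right)
  next
    case False
    then obtain k where k: "j = dim_col M * n + k" by (metis le_add_diff_inverse not_less)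
    then have "k < dim_col N * n" using ij by (simp add: distrib_right)
    then show ?thesis using ij dm dc k n by (simp add: mev_index distrib_right)
  qed
qed (simp_all add: distrib_right)

lemma mev_four_block:
  assumes "dim_row M1 = dim_row M2" "dim_row M3 = dim_row M4" "dim_col M1 = dim_col M3" "dim_col M2 = dim_col M4"
  shows "mev n A (four_block_mat M1 M2 M3 M4) = four_block_mat (mev n A M1) (mev n A M2) (mev n A M3) (mev n A M4)"
  using assms by (simp add: mev_vstack mev_hstack flip: vstack_hstack)

lemma mev_zero [simp]: "mev n A (0\<^sub>m p q) = 0\<^sub>m (p * n) (q * n)"
  using divmod_less by (intro eq_matI) (auto simp: mev_index nc_poly_eval_def)

context
  fixes n :: nat and A :: "'x => 'k :: field mat"
  assumes A: "\<And>x. A x \<in> carrier_mat n n"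
begin

lemma mev_mult:
  assumes "dim_col M = dim_row N"
  shows "mev n A (M * N) = mev n A M * mev n A N"
proof (rule eq_matI)
  fix i j assume "i < dim_row (mev n A M * mev n A N)" "j < dim_col (mev n A M * mev n A N)"
  then have ij: "i < dim_row M * n" "j < dim_col N * n" by simp_all
  note dm = divmod_less[OF ij(1)] divmod_less[OF ij(2)]
  let ?e = "nc_poly_eval n A"
  have "(mev n A M * mev n A N) $$ (i, j) = (\<Sum>k\<in>{0..<dim_row N * n}. ?e (M $$ (i div n, k div n)) $$ (i mod n, k mod n) *
      ?e (N $$ (k div n, j div n)) $$ (k mod n, j mod n))"
    using ij assms by (subst mult_index) (auto simp: mev_index intro!: sum.cong)
  also have "\<dots> = (\<Sum>s\<in>{0..<dim_row N}. \<Sum>a\<in>{0..<n}. ?e (M $$ (i div n, s)) $$ (i mod n, a) * ?e (N $$ (s, j div n)) $$ (a, j mod n))"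
    by (rule sum_divmod)
  also have "\<dots> = (\<Sum>s\<in>{0..<dim_row N}. (?e (M $$ (i div n, s)) * ?e (N $$ (s, j div n))) $$ (i mod n, j mod n))"
    using dm by (intro sum.cong) (auto simp: scalar_prod_def)
  also have "\<dots> = ?e (\<Sum>s\<in>{0..<dim_row N}. M $$ (i div n, s) * N $$ (s, j div n)) $$ (i mod n, j mod n)"
    using dm by (simp add: nc_poly_eval_sum_index[OF A] nc_poly_eval_mult[OF A] del: index_mult_mat(1))
  also have "\<dots> = mev n A (M * N) $$ (i, j)"
    using ij dm assms by (simp add: mev_index scalar_prod_def)
  finally show "mev n A (M * N) $$ (i, j) = (mev n A M * mev n A N) $$ (i, j)" ..
qed simp_all

lemma mev_one: "mev n A (1\<^sub>m p) = 1\<^sub>m (p * n)"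
proof (rule eq_matI)
  fix i j assume "i < dim_row (1\<^sub>m (p * n))" "j < dim_col (1\<^sub>m (p * n))"
  then have ij: "i < p * n" "j < p * n" by simp_all
  note dm = divmod_less[OF ij(1)] divmod_less[OF ij(2)]
  have "i div n = j div n \<and> i mod n = j mod n \<longleftrightarrow> i = j" by (metis div_mult_mod_eq)
  then show "mev n A (1\<^sub>m p) $$ (i, j) = (1\<^sub>m (p * n) :: 'k mat) $$ (i, j)"
    using ij dm by (auto simp: mev_index nc_poly_eval_1[OF A] nc_poly_eval_0[OF A])
qed simp_all

lemma mev_diff:
  assumes "dim_row M = dim_row N" "dim_col M = dim_col N"
  shows "mev n A (M - N) = mev n A M - mev n A N"
  using assms divmod_less by (intro eq_matI) (auto simp: mev_index nc_poly_eval_diff[OF A])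

lemma mev_add:
  assumes "dim_row M = dim_row N" "dim_col M = dim_col N"
  shows "mev n A (M + N) = mev n A M + mev n A N"
  using assms divmod_less by (intro eq_matI) (auto simp: mev_index nc_poly_eval_add[OF A])

end

section \<open>Linearization\<close>

definition term_mat :: "nat => (nat \<times> nat \<times> 'k \<times> 'x list) list => ('x, 'k :: ring_1) nc_poly mat" where
  "term_mat p ts = mat p p (\<lambda>(i, j). \<Sum>(i', j', c, w)\<leftarrow>ts. if i' = i \<and> j' = j then Poly_Mapping.single (NC_Word w) c else 0)"

definition linear_mat :: "('x, 'k :: zero) nc_poly mat => bool" where
  "linear_mat L \<longleftrightarrow> (\<forall>i<dim_row L. \<forall>j<dim_col L. \<forall>w\<in>Poly_Mapping.keys (L $$ (i, j)). length (letters w) \<le> 1)"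

lemma four_block_one_assoc:
  assumes "W \<in> carrier_mat p p"
  shows "four_block_mat (four_block_mat W (0\<^sub>m p s) (0\<^sub>m s p) (1\<^sub>m s)) (0\<^sub>m (p + s) t) (0\<^sub>m t (p + s)) (1\<^sub>m t) =
    four_block_mat W (0\<^sub>m p (s + t)) (0\<^sub>m (s + t) p) (1\<^sub>m (s + t))"
  using assms by (intro eq_matI) auto

text \<open>Higman's trick: a product \<open>u v\<close> in an entry is replaced by the border \<open>u\<close>, \<open>- v\<close>, \<open>1\<close>,
  until every entry has degree at most one.\<close>

lemma term_mat_linearize:
  fixes ts :: "(nat \<times> nat \<times> 'k :: ring_1 \<times> 'x list) list"
  assumes "\<forall>(i, j, c, w)\<in>set ts. i < p \<and> j < p"
  shows "\<exists>s L P P' Q Q'. linear_mat L \<and> {L, P, P', Q, Q'} \<subseteq> carrier_mat (p + s) (p + s) \<and>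
    P * P' = 1\<^sub>m (p + s) \<and> Q * Q' = 1\<^sub>m (p + s) \<and>
    four_block_mat (term_mat p ts) (0\<^sub>m p s) (0\<^sub>m s p) (1\<^sub>m s) = P * L * Q"
  using assms
proof (induction "\<Sum>(i, j, c, w)\<leftarrow>ts. length w - 1" arbitrary: ts p rule: less_induct)
  case less
  show ?case
  proof (cases "\<forall>(i, j, c, w)\<in>set ts. length w \<le> 1")
    case True
    have "Poly_Mapping.keys (\<Sum>(i', j', c, w)\<leftarrow>us. if i' = i \<and> j' = j then Poly_Mapping.single (NC_Word w) c else 0) \<subseteq> {w. length (letters w) \<le> 1}"
      if "set us \<subseteq> set ts" for i j us
      using that
    proof (induction us)
      case (Cons t us)
      obtain a b c w where t: "t = (a, b, c, w)" by (cases t)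
      have "length w \<le> 1" using True Cons.prems t by auto
      then have "Poly_Mapping.keys (if a = i \<and> b = j then Poly_Mapping.single (NC_Word w) c else 0) \<subseteq> {w. length (letters w) \<le> 1}"
        by (auto split: if_splits)
      moreover have "Poly_Mapping.keys (\<Sum>(i', j', c, w)\<leftarrow>us. if i' = i \<and> j' = j then Poly_Mapping.single (NC_Word w) c else 0) \<subseteq> {w. length (letters w) \<le> 1}"
        using Cons by simp
      ultimately show ?case unfolding t
        by (simp only: list.map sum_list.Cons prod.case) (blast dest: keys_add[THEN subsetD])
    qed simp
    from this[OF order.refl] have "linear_mat (term_mat p ts)" by (auto simp: linear_mat_def term_mat_def)
    moreover have "four_block_mat (term_mat p ts) (0\<^sub>m p 0) (0\<^sub>m 0 p) (1\<^sub>m 0) = term_mat p ts"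
      by (intro eq_matI) (auto simp: term_mat_def)
    ultimately show ?thesis
      by (intro exI[of _ "0::nat"] exI[of _ "term_mat p ts"] exI[of _ "1\<^sub>m p"]) (auto simp: term_mat_def)
  next
    case False
    then obtain i j c w where t: "(i, j, c, w) \<in> set ts" "\<not> length w \<le> 1" by auto
    then obtain us vs where ts: "ts = us @ (i, j, c, w) # vs" by (meson split_list)
    from t(2) obtain x w' where w: "w = x # w'" "w' \<noteq> []" by (cases w) auto
    have ij: "i < p" "j < p" using less.prems t(1) by auto
    define W' where "W' = term_mat p (us @ vs)"
    define U where "U = mat p 1 (\<lambda>(a, _). if a = i then Poly_Mapping.single (NC_Word [x]) c else 0)"
    define V where "V = mat 1 p (\<lambda>(_, b). if b = j then Poly_Mapping.single (NC_Word w') (1 :: 'k) else 0)"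
    have [simp]: "dim_row W' = p" "dim_col W' = p" "dim_row U = p" "dim_col U = 1" "dim_row V = 1" "dim_col V = p"
      by (simp_all add: W'_def U_def V_def term_mat_def)
    have UV: "term_mat p ts = W' + U * V"
    proof (rule eq_matI)
      fix a b assume "a < dim_row (W' + U * V)" "b < dim_col (W' + U * V)"
      then have ab: "a < p" "b < p" by simp_all
      have "(U * V) $$ (a, b) = (if a = i \<and> b = j then Poly_Mapping.single (NC_Word w) c else 0)"
        using ab by (auto simp: U_def V_def scalar_prod_def mult_single plus_nc_word_def w)
      then show "term_mat p ts $$ (a, b) = (W' + U * V) $$ (a, b)"
        using ab by (simp add: W'_def term_mat_def ts eq_commute[of i] eq_commute[of j] add_ac)
    qed (simp_all add: term_mat_def)
    let ?ts = "(i, p, c, [x]) # (p, j, - 1, w') # (p, p, 1, []) # us @ vs"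
    have bnd: "i' < p \<and> j' < p" if "(i', j', c', v) \<in> set us \<or> (i', j', c', v) \<in> set vs" for i' j' c' v
      using bspec[OF less.prems, of "(i', j', c', v)"] that ts by auto
    have old: "(\<Sum>(i', j', c, w)\<leftarrow>us @ vs. if i' = a \<and> j' = b then Poly_Mapping.single (NC_Word w) c else 0) = 0"
      if "\<not> a < p \<or> \<not> b < p" for a b
    proof -
      have eq: "map (\<lambda>(i', j', c, w). if i' = a \<and> j' = b then Poly_Mapping.single (NC_Word w) c else 0) (us @ vs) =
        map (\<lambda>_. 0) (us @ vs)" using that by (intro map_cong refl) (auto split: prod.splits dest: bnd[OF disjI1] bnd[OF disjI2])
      show ?thesis unfolding eq by (rule sum_list_0)
    qed
    have border: "term_mat (p + 1) ?ts = four_block_mat W' U (- V) (1\<^sub>m 1)"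
    proof (rule eq_matI)
      fix a b assume "a < dim_row (four_block_mat W' U (- V) (1\<^sub>m 1))" "b < dim_col (four_block_mat W' U (- V) (1\<^sub>m 1))"
      then have ab: "a < p + 1" "b < p + 1" by simp_all
      have 1: "Poly_Mapping.single (NC_Word []) 1 = (1 :: ('x, 'k) nc_poly)"
        unfolding zero_nc_word_def[symmetric] by (rule single_one)
      have 2: "Poly_Mapping.single v (- 1) = - Poly_Mapping.single v (1 :: 'k)" for v :: "'x nc_word" by (rule single_uminus)
      consider "a < p" "b < p" | "a < p" "b = p" | "a = p" "b < p" | "a = p" "b = p" using ab by linarith
      then show "term_mat (p + 1) ?ts $$ (a, b) = four_block_mat W' U (- V) (1\<^sub>m 1) $$ (a, b)"
        using ij ab by cases (auto simp: term_mat_def W'_def U_def V_def old[simplified] 1 2)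
    qed (simp_all add: term_mat_def)
    have lt: "(\<Sum>(i, j, c, w)\<leftarrow>?ts. length w - 1) < (\<Sum>(i, j, c, w)\<leftarrow>ts. length w - 1)"
      using w by (cases w') (simp_all add: ts)
    have bnd': "\<forall>(i, j, c, w)\<in>set ?ts. i < p + 1 \<and> j < p + 1"
      using ij by (auto dest: bnd[OF disjI1] bnd[OF disjI2])
    from less.hyps[of ?ts "p + 1", OF lt bnd']
    obtain s L P P' Q Q' where IH: "linear_mat L" "{L, P, P', Q, Q'} \<subseteq> carrier_mat (p + 1 + s) (p + 1 + s)"
      "P * P' = 1\<^sub>m (p + 1 + s)" "Q * Q' = 1\<^sub>m (p + 1 + s)"
      "four_block_mat (term_mat (p + 1) ?ts) (0\<^sub>m (p + 1) s) (0\<^sub>m s (p + 1)) (1\<^sub>m s) = P * L * Q"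
      by (elim exE conjE) (rule that)
    have IHd [simp]: "dim_row L = p + 1 + s" "dim_col L = p + 1 + s" "dim_row P = p + 1 + s" "dim_col P = p + 1 + s"
      "dim_row P' = p + 1 + s" "dim_col P' = p + 1 + s" "dim_row Q = p + 1 + s" "dim_col Q = p + 1 + s" "dim_row Q' = p + 1 + s" "dim_col Q' = p + 1 + s"
      using IH(2) by auto
    let ?E = "\<lambda>U. four_block_mat (1\<^sub>m p) U (0\<^sub>m 1 p) (1\<^sub>m 1)"
    let ?F = "\<lambda>V. four_block_mat (1\<^sub>m p) (0\<^sub>m p 1) V (1\<^sub>m 1)"
    let ?D = "\<lambda>M. four_block_mat M (0\<^sub>m (p + 1) s) (0\<^sub>m s (p + 1)) (1\<^sub>m s)"
    have D: "?D (M * N) = ?D M * ?D N" if "M \<in> carrier_mat (p + 1) (p + 1)" "N \<in> carrier_mat (p + 1) (p + 1)"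
      for M N :: "('x, 'k) nc_poly mat"
      using that by (subst four_block_mult) auto
    have D1: "?D (1\<^sub>m (p + 1)) = 1\<^sub>m (p + 1 + s)" by simp
    have c: "?E Y \<in> carrier_mat (p + 1) (p + 1)" "?F Z \<in> carrier_mat (p + 1) (p + 1)"
      for Y Z :: "('x, 'k) nc_poly mat" by (auto intro!: carrier_matI)
    have EE: "?E (- U) * ?E U = 1\<^sub>m (p + 1)" "?F V * ?F (- V) = 1\<^sub>m (p + 1)"
      by (subst four_block_mult; (simp; fail)?; auto intro!: eq_matI)+
    have VV: "- V + V = 0\<^sub>m 1 p" by (intro eq_matI) auto
    have UU: "U + - U = 0\<^sub>m p 1" by (intro eq_matI) auto
    have WUV: "four_block_mat (W' + U * V) (0\<^sub>m p 1) (0\<^sub>m 1 p) (1\<^sub>m 1) = ?E (- U) * (four_block_mat W' U (- V) (1\<^sub>m 1)) * ?F V"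
    proof -
      have "?E (- U) * (four_block_mat W' U (- V) (1\<^sub>m 1)) = four_block_mat (W' + U * V) (0\<^sub>m p 1) (- V) (1\<^sub>m 1)"
        by (subst four_block_mult) (auto simp: UU intro!: eq_matI)
      then show ?thesis
        by (simp add: four_block_mult VV del: One_nat_def) 
    qed
    have "four_block_mat (term_mat p ts) (0\<^sub>m p (1 + s)) (0\<^sub>m (1 + s) p) (1\<^sub>m (1 + s)) =
      ?D (four_block_mat (W' + U * V) (0\<^sub>m p 1) (0\<^sub>m 1 p) (1\<^sub>m 1))"
      unfolding UV by (rule four_block_one_assoc[symmetric]) (auto intro!: carrier_matI)
    also have "\<dots> = ?D (?E (- U)) * ?D (term_mat (p + 1) ?ts) * ?D (?F V)"
      unfolding WUV border by (subst D, (auto intro!: carrier_matI)[2], subst D, (auto intro!: carrier_matI)[2], rule refl)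
    also have "\<dots> = (?D (?E (- U)) * P) * L * (Q * ?D (?F V))"
      unfolding IH(5) by (simp add: mat_assoc)
    finally have main: "four_block_mat (term_mat p ts) (0\<^sub>m p (1 + s)) (0\<^sub>m (1 + s) p) (1\<^sub>m (1 + s)) =
      (?D (?E (- U)) * P) * L * (Q * ?D (?F V))" .
    have PZ: "P * (P' * Z) = Z" if "dim_row Z = p + 1 + s" for Z :: "('x, 'k) nc_poly mat"
      using that IH(3) by (simp flip: mat_assoc)
    have "(?D (?E (- U)) * P) * (P' * ?D (?E U)) = ?D (?E (- U)) * ?D (?E U)"
      by (simp add: mat_assoc PZ)
    also have "\<dots> = 1\<^sub>m (p + 1 + s)" unfolding D[OF c(1) c(1), symmetric] EE(1) by (rule D1)
    finally have P1: "(?D (?E (- U)) * P) * (P' * ?D (?E U)) = 1\<^sub>m (p + (1 + s))" by simp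
    have FF: "?D (?F V) * (?D (?F (- V)) * Q') = Q'"
    proof -
      have "?D (?F V) * (?D (?F (- V)) * Q') = ?D (?F V * ?F (- V)) * Q'"
        by (subst D[OF c(2,2)]) (simp add: mat_assoc)
      then show ?thesis unfolding EE(2) D1 by simp
    qed
    have Q1: "(Q * ?D (?F V)) * (?D (?F (- V)) * Q') = 1\<^sub>m (p + (1 + s))"
      using FF IH(4) by (simp add: mat_assoc)
    show ?thesis
    proof (rule exI[of _ "1 + s"], rule exI[of _ L], rule exI[of _ "?D (?E (- U)) * P"], rule exI[of _ "P' * ?D (?E U)"],
        rule exI[of _ "Q * ?D (?F V)"], rule exI[of _ "?D (?F (- V)) * Q'"], intro conjI)
      show "{L, ?D (?E (- U)) * P, P' * ?D (?E U), Q * ?D (?F V), ?D (?F (- V)) * Q'} \<subseteq> carrier_mat (p + (1 + s)) (p + (1 + s))"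
        by (auto intro!: carrier_matI)
    qed (rule IH(1) P1 Q1 main)+
  qed
qed

lemma linearize:
  fixes W :: "('x, 'k :: ring_1) nc_poly mat"
  assumes W: "W \<in> carrier_mat p p"
  obtains s L P P' Q Q' where "linear_mat L" "{L, P, P', Q, Q'} \<subseteq> carrier_mat (p + s) (p + s)"
    "P * P' = 1\<^sub>m (p + s)" "Q * Q' = 1\<^sub>m (p + s)" "four_block_mat W (0\<^sub>m p s) (0\<^sub>m s p) (1\<^sub>m s) = P * L * Q"
proof -
  define T where "T = (SIGMA ij:{..<p} \<times> {..<p}. Poly_Mapping.keys (W $$ ij))"
  have fin: "finite T" by (auto simp: T_def)
  then obtain xs where xs: "set xs = T" "distinct xs" using finite_distinct_list by blast
  define ts where "ts = map (\<lambda>(ij, w). (fst ij, snd ij, Poly_Mapping.lookup (W $$ ij) w, letters w)) xs"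
  have eq: "W = term_mat p ts"
  proof (rule eq_matI)
    fix i j assume "i < dim_row (term_mat p ts)" "j < dim_col (term_mat p ts)"
    then have ij: "i < p" "j < p" by (simp_all add: term_mat_def)
    have "term_mat p ts $$ (i, j) = (\<Sum>(kl, w)\<leftarrow>xs. if kl = (i, j) then Poly_Mapping.single w (Poly_Mapping.lookup (W $$ (i, j)) w) else 0)"
      using ij by (auto simp: term_mat_def ts_def o_def case_prod_unfold prod_eq_iff intro!: arg_cong[where f = sum_list] map_cong)
    also have "\<dots> = (\<Sum>(kl, w)\<in>T. if kl = (i, j) then Poly_Mapping.single w (Poly_Mapping.lookup (W $$ (i, j)) w) else 0)"
      using xs by (simp add: sum_list_distinct_conv_sum_set)
    also have "\<dots> = (\<Sum>kl\<in>{..<p} \<times> {..<p}. \<Sum>w\<in>Poly_Mapping.keys (W $$ kl). if kl = (i, j) then Poly_Mapping.single w (Poly_Mapping.lookup (W $$ (i, j)) w) else 0)"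
      unfolding T_def by (subst sum.Sigma) auto
    also have "\<dots> = (\<Sum>kl\<in>{..<p} \<times> {..<p}. if kl = (i, j) then (\<Sum>w\<in>Poly_Mapping.keys (W $$ (i, j)). Poly_Mapping.single w (Poly_Mapping.lookup (W $$ (i, j)) w)) else 0)"
      by (intro sum.cong) auto
    also have "\<dots> = W $$ (i, j)" using ij by (simp add: nc_poly_sum_single)
    finally show "W $$ (i, j) = term_mat p ts $$ (i, j)" ..
  qed (use W in \<open>simp_all add: term_mat_def\<close>)
  have bnd: "\<forall>(i, j, c, w)\<in>set ts. i < p \<and> j < p"
    using xs by (auto simp: ts_def T_def)
  from term_mat_linearize[of ts p, OF bnd] show thesis
    unfolding eq[symmetric] by (elim exE conjE) (rule that)
qed


section \<open>Matrices over the free algebra that are singular everywhere\<close>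

lemma det_rank_full:
  fixes M :: "'a :: field mat"
  assumes M: "M \<in> carrier_mat n n"
  shows "rank_ge M n \<longleftrightarrow> det M \<noteq> 0"
proof
  assume "rank_ge M n"
  then obtain P Q where PQ: "P \<in> carrier_mat n n" "Q \<in> carrier_mat n n" "P * M * Q = 1\<^sub>m n"
    using M by (auto simp: rank_ge_def)
  then have "det P * det M * det Q = 1"
    using M det_mult[of P n M] det_mult[of "P * M" n Q] by simp
  then show "det M \<noteq> 0" by auto
next
  assume "det M \<noteq> 0"
  then show "rank_ge M n" using M by (intro rank_geI_det[of "1\<^sub>m n" n n M n "1\<^sub>m n"]) auto
qed

lemma ksum_kron:
  fixes U L :: "'l => 'a :: comm_ring_1 mat"
  assumes C: "C \<in> carrier_mat m m" and U: "\<And>l. U l \<in> carrier_mat m m"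
  shows "kron C (1\<^sub>m n) * ksum G m m n U L = ksum G m m n (\<lambda>l. C * U l) L"
proof (rule eq_matI)
  note [simp] = carrier_matD[OF C] carrier_matD[OF U]
  fix i j assume "i < dim_row (ksum G m m n (\<lambda>l. C * U l) L)" "j < dim_col (ksum G m m n (\<lambda>l. C * U l) L)"
  then have ij: "i < m * n" "j < m * n" by simp_all
  note dm = divmod_less[OF ij(1)] divmod_less[OF ij(2)]
  have "(kron C (1\<^sub>m n) * ksum G m m n U L) $$ (i, j) = (\<Sum>k\<in>{0..<m * n}. (C $$ (i div n, k div n) * (if i mod n = k mod n then 1 else 0)) *
      (\<Sum>l\<in>G. U l $$ (k div n, j div n) * L l $$ (k mod n, j mod n)))"
    using ij divmod_less by (subst mult_index) (auto simp: kron_index ksum_index intro!: sum.cong)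
  also have "\<dots> = (\<Sum>s\<in>{0..<m}. \<Sum>a\<in>{0..<n}. (C $$ (i div n, s) * (if i mod n = a then 1 else 0)) *
      (\<Sum>l\<in>G. U l $$ (s, j div n) * L l $$ (a, j mod n)))"
    by (rule sum_divmod)
  also have "\<dots> = (\<Sum>s\<in>{0..<m}. C $$ (i div n, s) * (\<Sum>l\<in>G. U l $$ (s, j div n) * L l $$ (i mod n, j mod n)))"
    using dm by (intro sum.cong refl) (simp add: if_distrib[of "\<lambda>x. _ * x"] if_distrib[of "\<lambda>x. x * _"] cong: if_cong)
  also have "\<dots> = (\<Sum>l\<in>G. \<Sum>s\<in>{0..<m}. C $$ (i div n, s) * U l $$ (s, j div n) * L l $$ (i mod n, j mod n))"
    by (subst sum.swap) (simp add: sum_distrib_left mult.assoc)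
  also have "\<dots> = ksum G m m n (\<lambda>l. C * U l) L $$ (i, j)"
    using ij dm by (simp add: ksum_index scalar_prod_def sum_distrib_right)
  finally show "(kron C (1\<^sub>m n) * ksum G m m n U L) $$ (i, j) = ksum G m m n (\<lambda>l. C * U l) L $$ (i, j)" .
qed (use C in simp_all)

lemma infinite_field_poly_nonzero:
  fixes p q :: "'a :: field_char_0 poly"
  assumes "p \<noteq> 0" "q \<noteq> 0"
  obtains x where "poly p x \<noteq> 0" "poly q x \<noteq> 0"
proof -
  have "p * q \<noteq> 0" using assms by simp
  then have "finite {x. poly (p * q) x = 0}" by (rule poly_roots_finite)
  then have "{x. poly (p * q) x = 0} \<noteq> UNIV" using infinite_UNIV_char_0 by metis
  then show thesis using that by auto
qed

text \<open>A homogeneous pencil that is nonsingular somewhere is nonsingular at a point at which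
  the variable \<open>None\<close> takes the value \<open>1\<close>: make that value invertible, and divide by it.\<close>

lemma dehomogenize:
  fixes L :: "'x option => 'k :: field_char_0 mat" and U :: "'x option => 'k mat"
  assumes fin: "finite (UNIV :: 'x option set)" and L: "\<And>l. L l \<in> carrier_mat n n" and U: "\<And>l. U l \<in> carrier_mat m m"
    and det: "det (ksum UNIV m m n U L) \<noteq> 0"
  obtains A where "\<And>x. A x \<in> carrier_mat m m" "det (ksum UNIV m m n (case_option (1\<^sub>m m) A) L) \<noteq> 0"
proof -
  note [simp] = carrier_matD[OF L] carrier_matD[OF U]
  let ?E = "\<lambda>l :: 'x option. if l = None then 1\<^sub>m m else 0\<^sub>m m m :: 'k mat"
  let ?U = "\<lambda>t. U(None := U None + t \<cdot>\<^sub>m 1\<^sub>m m)"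
  have line: "ksum UNIV m m n (?U t) L = ksum UNIV m m n U L + t \<cdot>\<^sub>m ksum UNIV m m n ?E L" for t
  proof (rule eq_matI)
    fix i j assume "i < dim_row (ksum UNIV m m n U L + t \<cdot>\<^sub>m ksum UNIV m m n ?E L)" "j < dim_col (ksum UNIV m m n U L + t \<cdot>\<^sub>m ksum UNIV m m n ?E L)"
    then have ij: "i < m * n" "j < m * n" by simp_all
    note dm = divmod_less[OF ij(1)] divmod_less[OF ij(2)]
    have "?U t l $$ (i div n, j div n) = U l $$ (i div n, j div n) + t * ?E l $$ (i div n, j div n)" for l
      using dm by auto
    then show "ksum UNIV m m n (?U t) L $$ (i, j) = (ksum UNIV m m n U L + t \<cdot>\<^sub>m ksum UNIV m m n ?E L) $$ (i, j)"
      using ij dm by (simp add: ksum_index distrib_right sum.distrib sum_distrib_left mult.assoc)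
  qed simp_all
  obtain p where p: "\<And>t. det (ksum UNIV m m n U L + t \<cdot>\<^sub>m ksum UNIV m m n ?E L) = poly p t"
    by (rule det_line_poly[of "ksum UNIV m m n U L" "m * n" "ksum UNIV m m n ?E L"]) simp_all
  have "poly p 0 = det (ksum UNIV m m n U L)"
    unfolding p[symmetric] by (rule arg_cong[of _ _ det]) (auto intro!: eq_matI)
  then have p0: "p \<noteq> 0" using det by auto
  obtain q where q: "\<And>t. det (1\<^sub>m m + t \<cdot>\<^sub>m U None) = poly q t"
    by (rule det_line_poly[of "1\<^sub>m m" m "U None"]) (simp_all add: U)
  have "poly q 0 = det (1\<^sub>m m :: 'k mat)"
    unfolding q[symmetric] by (rule arg_cong[of _ _ det]) (auto intro!: eq_matI)
  then have "q \<noteq> 0" by auto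
  then obtain t where t: "poly q t \<noteq> 0" "poly [:0, 1:] t \<noteq> 0" using infinite_field_poly_nonzero[of q "[:0, 1:]"] by auto
  obtain s where s: "\<And>t. det (U None + t \<cdot>\<^sub>m 1\<^sub>m m) = poly s t"
    by (rule det_line_poly[of "U None" m "1\<^sub>m m"]) (simp_all add: U)
  have "U None + (1 / t) \<cdot>\<^sub>m 1\<^sub>m m = (1 / t) \<cdot>\<^sub>m (1\<^sub>m m + t \<cdot>\<^sub>m U None)"
    using t by (intro eq_matI) (auto simp: field_simps)
  then have "poly s (1 / t) = (1 / t) ^ m * poly q t"
    by (simp add: s[symmetric] q[symmetric])
  then have "poly s (1 / t) \<noteq> 0" using t by simp
  then have "s \<noteq> 0" by auto
  with p0 obtain t where t: "poly p t \<noteq> 0" "poly s t \<noteq> 0" using infinite_field_poly_nonzero[of p s] by blast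
  have c: "U None + t \<cdot>\<^sub>m 1\<^sub>m m \<in> carrier_mat m m" by (auto intro!: carrier_matI)
  have "det (U None + t \<cdot>\<^sub>m 1\<^sub>m m) \<noteq> 0" using t(2) by (simp add: s)
  from det_nonzero_inverse[OF c this]
  obtain V where V: "V \<in> carrier_mat m m" "(U None + t \<cdot>\<^sub>m 1\<^sub>m m) * V = 1\<^sub>m m" "V * (U None + t \<cdot>\<^sub>m 1\<^sub>m m) = 1\<^sub>m m" by blast
  define A where "A = (\<lambda>x. V * U (Some x))"
  have cU: "?U t l \<in> carrier_mat m m" for l using U c by auto
  have "kron V (1\<^sub>m n) * ksum UNIV m m n (?U t) L = ksum UNIV m m n (\<lambda>l. V * ?U t l) L"
    by (rule ksum_kron[OF V(1) cU])
  also have "(\<lambda>l. V * ?U t l) = case_option (1\<^sub>m m) A"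
    using V(3) by (auto simp: A_def fun_eq_iff split: option.splits)
  finally have eq: "ksum UNIV m m n (case_option (1\<^sub>m m) A) L = kron V (1\<^sub>m n) * ksum UNIV m m n (?U t) L" ..
  have "kron V (1\<^sub>m n) * kron (U None + t \<cdot>\<^sub>m 1\<^sub>m m) (1\<^sub>m n) = 1\<^sub>m (m * n)"
    using V by (subst kron_mult) (auto simp: kron_one)
  then have "det (kron V (1\<^sub>m n)) \<noteq> 0"
    using V(1) by (intro inverse_det_nonzero[of _ "m * n" "kron (U None + t \<cdot>\<^sub>m 1\<^sub>m m) (1\<^sub>m n)"]) (auto intro!: carrier_matI)
  moreover have "det (ksum UNIV m m n (?U t) L) \<noteq> 0" using t(1) by (simp add: line p)
  ultimately have "det (ksum UNIV m m n (case_option (1\<^sub>m m) A) L) \<noteq> 0"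
    unfolding eq using V(1) by (subst det_mult[of _ "m * n"]) (auto intro!: carrier_matI)
  moreover have "A x \<in> carrier_mat m m" for x using V(1) U by (auto simp: A_def)
  ultimately show thesis using that by blast
qed

text \<open>The ranks of a pencil at points of size \<open>2\<^sup>e\<close> are multiples of \<open>2\<^sup>e\<close>, so that the quotient attains its
  maximum at some point. If the maximum is below the size of the pencil, this point of maximal rank yields subspaces
  between which all coefficients vanish.\<close>

lemma singular_pencil_shrinks:
  fixes L :: "'l => 'k :: field_char_0 mat"
  assumes G: "finite G" and L: "\<And>l. L l \<in> carrier_mat n n"
    and sing: "\<And>e U. (\<And>l. U l \<in> carrier_mat (2 ^ e) (2 ^ e)) ==> det (ksum G (2 ^ e) (2 ^ e) n U L) = 0"
  obtains v w P0 P0' Q0 Q0' where "P0 \<in> carrier_mat v n" "P0' \<in> carrier_mat n v" "P0 * P0' = 1\<^sub>m v"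
    "Q0 \<in> carrier_mat n w" "Q0' \<in> carrier_mat w n" "Q0' * Q0 = 1\<^sub>m w"
    "\<And>l. l \<in> G ==> P0 * (L l * Q0) = 0\<^sub>m v w" "n < v + w"
proof -
  define R where "R = (\<lambda>r. \<exists>e U. (\<forall>l. U l \<in> carrier_mat (2 ^ e) (2 ^ e)) \<and> rank_ge (ksum G (2 ^ e) (2 ^ e) n U L) (r * 2 ^ e))"
  have bound: "r < n" if "R r" for r
  proof (rule ccontr)
    assume "\<not> r < n"
    from that obtain e U where U: "\<And>l. U l \<in> carrier_mat (2 ^ e) (2 ^ e)" and rank: "rank_ge (ksum G (2 ^ e) (2 ^ e) n U L) (r * 2 ^ e)"
      by (auto simp: R_def)
    have "n * 2 ^ e \<le> r * 2 ^ e" using \<open>\<not> r < n\<close> by simp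
    then have "rank_ge (ksum G (2 ^ e) (2 ^ e) n U L) (2 ^ e * n)"
      using rank_ge_mono[OF rank] by (simp add: mult.commute)
    then have "det (ksum G (2 ^ e) (2 ^ e) n U L) \<noteq> 0" unfolding det_rank_full[OF ksum_carrier] .
    moreover have "det (ksum G (2 ^ e) (2 ^ e) n U L) = 0" by (rule sing) (rule U)
    ultimately show False by simp
  qed
  have "R 0" unfolding R_def
    by (intro exI[of _ "0::nat"] exI[of _ "\<lambda>_. 0\<^sub>m 1 1"]) (auto intro!: rank_geI[of "0\<^sub>m 0 n" 0 n _ n "0\<^sub>m n 0"] carrier_matI)
  define r where "r = (GREATEST r. R r)"
  have "R r" unfolding r_def by (rule GreatestI_nat[of R 0 n]) (use bound \<open>R 0\<close> in \<open>auto intro: less_imp_le\<close>)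
  have max: "s \<le> r" if "R s" for s
    unfolding r_def by (rule Greatest_le_nat[of R s n]) (use bound that in \<open>auto intro: less_imp_le\<close>)
  have maxe: "s \<le> r * 2 ^ e" if U: "\<And>l. U l \<in> carrier_mat (2 ^ e) (2 ^ e)" and rk: "rank_ge (ksum G (2 ^ e) (2 ^ e) n U L) s" for U e s
  proof -
    obtain r' U' where "\<And>l. U' l \<in> carrier_mat (2 ^ e) (2 ^ e)" "s \<le> r' * 2 ^ e" "rank_ge (ksum G (2 ^ e) (2 ^ e) n U' L) (r' * 2 ^ e)"
      by (rule pencil_rank_divisible[where ?U = U, OF G L U rk]) blast
    then have "R r'" unfolding R_def by blast
    then have "r' * 2 ^ e \<le> r * 2 ^ e" using max by simp
    with \<open>s \<le> r' * 2 ^ e\<close> show ?thesis by (rule order.trans)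
  qed
  from \<open>R r\<close> obtain e a0 where a0: "\<And>l. a0 l \<in> carrier_mat (2 ^ e) (2 ^ e)"
    and rank: "rank_ge (ksum G (2 ^ e) (2 ^ e) n a0 L) (r * 2 ^ e)" by (auto simp: R_def)
  obtain r' P Q where PQ: "P \<in> carrier_mat r' (2 ^ e * n)" "Q \<in> carrier_mat (2 ^ e * n) r'"
    "P * ksum G (2 ^ e) (2 ^ e) n a0 L * Q = 1\<^sub>m r'"
    "ksum G (2 ^ e) (2 ^ e) n a0 L * Q * P * ksum G (2 ^ e) (2 ^ e) n a0 L = ksum G (2 ^ e) (2 ^ e) n a0 L"
    "\<And>s. rank_ge (ksum G (2 ^ e) (2 ^ e) n a0 L) s ==> s \<le> r'"
    by (rule max_rank_obtain[OF ksum_carrier]) blast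
  have "rank_ge (ksum G (2 ^ e) (2 ^ e) n a0 L) r'" using PQ by (intro rank_geI[OF PQ(1) ksum_carrier PQ(2)]) auto
  then have "r' \<le> r * 2 ^ e" by (rule maxe[of a0, OF a0])
  with PQ(5)[OF rank] have r': "r' = r * 2 ^ e" by (rule order.antisym[rotated])
  interpret max_rank_point G L n "2 ^ e" r' a0 P Q
  proof
    fix f and u :: "'l => 'k mat" assume u: "\<And>l. u l \<in> carrier_mat (2 ^ f * 2 ^ e) (2 ^ f * 2 ^ e)"
    show "\<not> rank_ge (ksum G (2 ^ f * 2 ^ e) (2 ^ f * 2 ^ e) n u L) (2 ^ f * r' + 1)"
    proof
      assume "rank_ge (ksum G (2 ^ f * 2 ^ e) (2 ^ f * 2 ^ e) n u L) (2 ^ f * r' + 1)"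
      then have "2 ^ f * r' + 1 \<le> r * 2 ^ (f + e)" using maxe[of u "f + e"] u by (simp add: power_add)
      also have "r * 2 ^ (f + e) = 2 ^ f * r'" unfolding r' by (simp add: power_add)
      finally show False by simp
    qed
  qed (use a0 PQ in auto)
  have "r' < 2 ^ e * n" unfolding r' using bound[OF \<open>R r\<close>] by simp
  show thesis by (rule shrunk_subspace[OF L G \<open>r' < 2 ^ e * n\<close>]) (rule that)
qed

text \<open>Consequently a linear matrix that is singular at all matrix tuples is not full: it vanishes on
  a rectangle that is too large, after a change of bases over the field.\<close>

lemma singular_linear_not_full:
  fixes L :: "('x :: finite, 'k :: field_char_0) nc_poly mat"
  assumes L: "L \<in> carrier_mat n n" and lin: "linear_mat L"
    and sing: "\<And>m A. m > 0 ==> (\<And>x. A x \<in> carrier_mat m m) ==> det (mev m A L) = 0"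
  obtains Y Z where "Y \<in> carrier_mat n (n - 1)" "Z \<in> carrier_mat (n - 1) n" "L = Y * Z"
proof -
  note [simp] = carrier_matD[OF L]
  define wd where "wd = case_option (NC_Word []) (\<lambda>x :: 'x. NC_Word [x])"
  have inj: "inj wd" by (auto simp: inj_on_def wd_def split: option.splits)
  have wd: "w \<in> range wd" if len: "length (letters w) \<le> 1" for w
  proof -
    obtain xs where w: "w = NC_Word xs" by (cases w)
    then consider "xs = []" | x where "xs = [x]" using len by (cases xs) auto
    then show ?thesis unfolding w wd_def by cases (auto intro: range_eqI[of _ _ None] range_eqI[of _ _ "Some _"])
  qed
  define coef where "coef = (\<lambda>w. map_mat (\<lambda>p. Poly_Mapping.lookup p w) L)"
  have coef [simp]: "coef w \<in> carrier_mat n n" "dim_row (coef w) = n" "dim_col (coef w) = n" for w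
    by (simp_all add: coef_def L)
  have zero: "coef w = 0\<^sub>m n n" if "w \<notin> range wd" for w
  proof (rule eq_matI)
    fix i j assume "i < dim_row (0\<^sub>m n n)" "j < dim_col (0\<^sub>m n n)"
    then have ij: "i < n" "j < n" by simp_all
    have "w \<notin> Poly_Mapping.keys (L $$ (i, j))" using that wd lin ij by (auto simp: linear_mat_def)
    then show "coef w $$ (i, j) = 0\<^sub>m n n $$ (i, j)" using ij by (simp add: coef_def in_keys_iff)
  qed simp_all
  define Lc where "Lc = (\<lambda>l. coef (wd l))"
  have Lc: "Lc l \<in> carrier_mat n n" for l by (simp add: Lc_def)
  have ev: "mev m A L = ksum UNIV n n m Lc (case_option (1\<^sub>m m) A)" if A: "\<And>x. A x \<in> carrier_mat m m" for m and A :: "'x => 'k mat"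
  proof (rule eq_matI)
    fix i j assume "i < dim_row (ksum UNIV n n m Lc (case_option (1\<^sub>m m) A))" "j < dim_col (ksum UNIV n n m Lc (case_option (1\<^sub>m m) A))"
    then have ij: "i < n * m" "j < n * m" by simp_all
    note dm = divmod_less[OF ij(1)] divmod_less[OF ij(2)]
    have "Poly_Mapping.keys (L $$ (i div m, j div m)) \<subseteq> range wd"
      using lin dm wd by (auto simp: linear_mat_def)
    then have "mev m A L $$ (i, j) = (\<Sum>w\<in>range wd. Poly_Mapping.lookup (L $$ (i div m, j div m)) w * nc_word_eval m A w $$ (i mod m, j mod m))"
      using ij dm by (simp add: mev_index nc_poly_eval_index[OF A])
    also have "\<dots> = (\<Sum>l\<in>UNIV. Poly_Mapping.lookup (L $$ (i div m, j div m)) (wd l) * nc_word_eval m A (wd l) $$ (i mod m, j mod m))"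
      using inj by (subst sum.reindex) auto
    also have "\<dots> = (\<Sum>l\<in>UNIV. Lc l $$ (i div m, j div m) * case_option (1\<^sub>m m) A l $$ (i mod m, j mod m))"
      using dm nc_word_eval_simps[where A = A and n = m, OF A] by (intro sum.cong) (auto simp: Lc_def coef_def wd_def zero_nc_word_def split: option.splits)
    also have "\<dots> = ksum UNIV n n m Lc (case_option (1\<^sub>m m) A) $$ (i, j)" using ij by (simp add: ksum_index)
    finally show "mev m A L $$ (i, j) = ksum UNIV n n m Lc (case_option (1\<^sub>m m) A) $$ (i, j)" .
  qed simp_all
  have sing0: "det (ksum UNIV (2 ^ e) (2 ^ e) n U Lc) = 0" if U: "\<And>l. U l \<in> carrier_mat (2 ^ e) (2 ^ e)" for e U
  proof (rule ccontr)
    assume "det (ksum UNIV (2 ^ e) (2 ^ e) n U Lc) \<noteq> 0"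
    then obtain A where A: "\<And>x. A x \<in> carrier_mat (2 ^ e) (2 ^ e)"
      and ns: "det (ksum UNIV (2 ^ e) (2 ^ e) n (case_option (1\<^sub>m (2 ^ e)) A) Lc) \<noteq> 0"
      using dehomogenize[where ?L = Lc and ?U = U, OF _ Lc U] by auto
    from ns have "rank_ge (ksum UNIV (2 ^ e) (2 ^ e) n (case_option (1\<^sub>m (2 ^ e)) A) Lc) (2 ^ e * n)"
      unfolding det_rank_full[OF ksum_carrier] .
    from ksum_swap_rank[OF this] have "rank_ge (mev (2 ^ e) A L) (n * 2 ^ e)" by (simp add: ev[OF A] mult.commute)
    moreover have "mev (2 ^ e) A L \<in> carrier_mat (n * 2 ^ e) (n * 2 ^ e)" by (intro carrier_matI) simp_all
    ultimately have "det (mev (2 ^ e) A L) \<noteq> 0" using det_rank_full by blast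
    then show False using sing[of "2 ^ e" A] A by simp
  qed
  obtain v w P0 P0' Q0 Q0' where P0: "P0 \<in> carrier_mat v n" "P0' \<in> carrier_mat n v" "P0 * P0' = 1\<^sub>m v"
    and Q0: "Q0 \<in> carrier_mat n w" "Q0' \<in> carrier_mat w n" "Q0' * Q0 = 1\<^sub>m w"
    and vanish: "\<And>l. P0 * (Lc l * Q0) = 0\<^sub>m v w" and vw: "n < v + w"
    apply (rule singular_pencil_shrinks[of UNIV Lc n])
        apply (rule finite)
       apply (rule Lc)
      apply (rule sing0, assumption)
    apply (rule_tac v=v and w=w and ?P0.0=P0 and P0'=P0' and ?Q0.0=Q0 and Q0'=Q0' in that)
           apply (assumption | simp)+
    done
  note [simp] = carrier_matD[OF P0(1)] carrier_matD[OF P0(2)] carrier_matD[OF Q0(1)] carrier_matD[OF Q0(2)]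
  obtain F F' where F: "v \<le> n" "F \<in> carrier_mat n (n - v)" "F' \<in> carrier_mat (n - v) n" "F * F' = 1\<^sub>m n - P0' * P0"
    by (rule complement_basis[OF P0(2,1,3)])
  obtain H H' where H: "w \<le> n" "H \<in> carrier_mat n (n - w)" "H' \<in> carrier_mat (n - w) n" "H * H' = 1\<^sub>m n - Q0 * Q0'"
    by (rule complement_basis[OF Q0])
  note [simp] = carrier_matD[OF F(2)] carrier_matD[OF F(3)] carrier_matD[OF H(2)] carrier_matD[OF H(3)]
  define cst where "cst = (\<lambda>c :: 'k. Poly_Mapping.single (0 :: 'x nc_word) c)"
  interpret cst: semiring_hom cst by unfold_locales (simp_all add: cst_def single_add mult_single)
  define cm where "cm = map_mat cst"
  have [simp]: "dim_row (cm M) = dim_row M" "dim_col (cm M) = dim_col M" for M by (simp_all add: cm_def)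
  have cm_mult: "cm (M * N) = cm M * cm N" if "dim_col M = dim_row N" for M N
    unfolding cm_def using that by (intro cst.mat_hom_mult[of _ "dim_row M" "dim_col M" _ "dim_col N"]) auto
  have cm_one: "cm (1\<^sub>m k) = 1\<^sub>m k" for k unfolding cm_def by (rule cst.mat_hom_one)
  have cm_diff: "cm (M - N) = cm M - cm N" if "dim_row M = dim_row N" "dim_col M = dim_col N" for M N
    using that by (intro eq_matI) (auto simp: cm_def cst_def single_diff)
  have FF: "cm F * cm F' = 1\<^sub>m n - cm P0' * cm P0"
    using arg_cong[OF F(4), of cm] by (simp add: cm_mult cm_diff cm_one)
  have HH: "cm H * cm H' = 1\<^sub>m n - cm Q0 * cm Q0'"
    using arg_cong[OF H(4), of cm] by (simp add: cm_mult cm_diff cm_one)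
  have lookup_cst: "Poly_Mapping.lookup (cst c * p) u = c * Poly_Mapping.lookup p u"
    "Poly_Mapping.lookup (p * cst c) u = Poly_Mapping.lookup p u * c" for c p u
  proof -
    show "Poly_Mapping.lookup (cst c * p) u = c * Poly_Mapping.lookup p u"
      by (induction p rule: nc_poly_induct) (auto simp: cst_def distrib_left lookup_add mult_single lookup_single when_def)
    show "Poly_Mapping.lookup (p * cst c) u = Poly_Mapping.lookup p u * c"
      by (induction p rule: nc_poly_induct) (auto simp: cst_def distrib_right lookup_add mult_single lookup_single when_def)
  qed
  have PLQ: "cm P0 * (L * cm Q0) = 0\<^sub>m v w"
  proof (rule eq_matI)
    fix i j assume "i < dim_row (0\<^sub>m v w)" "j < dim_col (0\<^sub>m v w)"
    then have ij: "i < v" "j < w" by simp_all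
    have "Poly_Mapping.lookup ((cm P0 * (L * cm Q0)) $$ (i, j)) u = (P0 * (coef u * Q0)) $$ (i, j)" for u
      using ij by (simp add: scalar_prod_def cm_def coef_def lookup_sum lookup_cst)
    moreover have "P0 * (coef u * Q0) = 0\<^sub>m v w" for u
    proof (cases "u \<in> range wd")
      case True
      then show ?thesis using vanish by (auto simp: Lc_def)
    qed (simp add: zero)
    ultimately show "(cm P0 * (L * cm Q0)) $$ (i, j) = 0\<^sub>m v w $$ (i, j)"
      using ij by (intro poly_mapping_eqI) simp
  qed simp_all
  define Y where "Y = hstack (hstack (cm F) (cm P0' * (cm P0 * (L * cm H)))) (0\<^sub>m n (v + w - n - 1))"
  define Z where "Z = vstack (vstack (cm F' * L) (cm H')) (0\<^sub>m (v + w - n - 1) n)"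
  have "Y * Z = cm F * (cm F' * L) + cm P0' * (cm P0 * (L * (cm H * cm H')))"
    unfolding Y_def Z_def by (simp add: hstack_vstack mat_assoc)
  also have "cm F * (cm F' * L) = (cm F * cm F') * L" by (simp add: mat_assoc)
  also have "\<dots> = L - cm P0' * (cm P0 * L)" unfolding FF by (simp add: mat_distrib mat_assoc)
  also have "L * (cm H * cm H') = L - L * (cm Q0 * cm Q0')" unfolding HH by (simp add: mat_distrib)
  also have "cm P0 * (L - L * (cm Q0 * cm Q0')) = cm P0 * L"
  proof -
    have "cm P0 * (L * (cm Q0 * cm Q0')) = cm P0 * (L * cm Q0) * cm Q0'" by (simp add: mat_assoc)
    then show ?thesis unfolding PLQ by (simp add: mat_distrib)
  qed
  also have "L - cm P0' * (cm P0 * L) + cm P0' * (cm P0 * L) = L" by (intro eq_matI) auto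
  finally have "L = Y * Z" ..
  moreover have "n - v + (n - w) + (v + w - n - 1) = n - 1" using vw F(1) H(1) by simp
  ultimately show thesis by (intro that[of Y Z]) (auto simp: Y_def Z_def intro!: carrier_matI)
qed

text \<open>A matrix over the free algebra whose values at all tuples of square matrices are singular is
  stably not full. This is where identities between values at matrices
  are turned into identities in the free algebra.\<close>

theorem singular_not_full:
  fixes W :: "('x :: finite, 'k :: field_char_0) nc_poly mat"
  assumes W: "W \<in> carrier_mat p p"
    and sing: "\<And>m A. m > 0 ==> (\<And>x. A x \<in> carrier_mat m m) ==> det (mev m A W) = 0"
  obtains s Y Z where "Y \<in> carrier_mat (p + s) (p + s - 1)" "Z \<in> carrier_mat (p + s - 1) (p + s)"
    "four_block_mat W (0\<^sub>m p s) (0\<^sub>m s p) (1\<^sub>m s) = Y * Z"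
proof -
  obtain s L P P' Q Q' where lin: "linear_mat L" and c: "{L, P, P', Q, Q'} \<subseteq> carrier_mat (p + s) (p + s)"
    and inv: "P * P' = 1\<^sub>m (p + s)" "Q * Q' = 1\<^sub>m (p + s)" and eq: "four_block_mat W (0\<^sub>m p s) (0\<^sub>m s p) (1\<^sub>m s) = P * L * Q"
    by (rule linearize[OF W])
  have [simp]: "dim_row L = p + s" "dim_col L = p + s" "dim_row P = p + s" "dim_col P = p + s"
    "dim_row P' = p + s" "dim_col P' = p + s" "dim_row Q = p + s" "dim_col Q = p + s" "dim_row Q' = p + s" "dim_col Q' = p + s"
    using c by auto
  note [simp] = carrier_matD[OF W]
  have "det (mev m A L) = 0" if m: "m > 0" and A: "\<And>x. A x \<in> carrier_mat m m" for m and A :: "'x => 'k mat"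
  proof (rule ccontr)
    let ?N = "(p + s) * m"
    have carr: "mev m A M \<in> carrier_mat ?N ?N" if "dim_row M = p + s" "dim_col M = p + s" for M
      using that by (auto intro!: carrier_matI)
    assume "det (mev m A L) \<noteq> 0"
    moreover have "det (mev m A P) \<noteq> 0"
      using arg_cong[OF inv(1), of "mev m A"] carr by (intro inverse_det_nonzero[of _ ?N "mev m A P'"]) (auto simp: mev_mult[OF A] mev_one[OF A])
    moreover have "det (mev m A Q) \<noteq> 0"
      using arg_cong[OF inv(2), of "mev m A"] carr by (intro inverse_det_nonzero[of _ ?N "mev m A Q'"]) (auto simp: mev_mult[OF A] mev_one[OF A])
    ultimately have "det (mev m A (P * L * Q)) \<noteq> 0"
      using det_mult[OF carr carr, of P L] det_mult[OF mult_carrier_mat[OF carr carr] carr, of P L Q]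
      by (simp add: mev_mult[OF A])
    then have "det (four_block_mat (mev m A W) (0\<^sub>m (p * m) (s * m)) (0\<^sub>m (s * m) (p * m)) (1\<^sub>m (s * m))) \<noteq> 0"
      unfolding eq[symmetric] by (simp add: mev_four_block mev_one[OF A])
    then have "det (mev m A W) \<noteq> 0"
      by (subst (asm) det_four_block_mat_lower_left_zero[of _ "p * m" _ "s * m"]) (auto intro!: carrier_matI)
    then show False using sing[of m A] m A by simp
  qed
  from singular_linear_not_full[OF _ lin this, of "p + s"]
  obtain Y Z where YZ: "Y \<in> carrier_mat (p + s) (p + s - 1)" "Z \<in> carrier_mat (p + s - 1) (p + s)" "L = Y * Z"
    using c by auto
  show thesis
    by (rule that[of "P * Y" s "Z * Q"]) (use YZ in \<open>auto simp: eq mat_assoc intro!: carrier_matI\<close>)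
qed


section \<open>Matrices modulo an ideal\<close>

text \<open>The rings of the theorem are rings with a carrier set. Such a ring is the quotient of a full type by
  an ideal \<open>N\<close>, and its matrices are handled as matrices over this type up to congruence modulo \<open>N\<close>,
  which makes the calculus of block matrices available.\<close>

locale matrix_congruence =
  fixes N :: "'s :: ring_1 set"
  assumes zero_N: "0 \<in> N" and add_N: "\<And>a b. a \<in> N ==> b \<in> N ==> a + b \<in> N"
    and mult_N: "\<And>a b. a \<in> N ==> b * a \<in> N" "\<And>a b. a \<in> N ==> a * b \<in> N"
begin

lemma uminus_N: "a \<in> N ==> - a \<in> N" using mult_N(1)[of a "-1"] by simp

lemma diff_N: "a \<in> N ==> b \<in> N ==> a - b \<in> N" using add_N[of a "- b"] uminus_N[of b] by simp

lemma sum_N: "(\<And>i. i \<in> S ==> f i \<in> N) ==> sum f S \<in> N"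
  by (induction S rule: infinite_finite_induct) (auto intro: zero_N add_N)

definition cg :: "'s mat => 's mat => bool" (infix "\<doteq>" 50) where
  "A \<doteq> B \<longleftrightarrow> dim_row A = dim_row B \<and> dim_col A = dim_col B \<and>
     (\<forall>i<dim_row A. \<forall>j<dim_col A. A $$ (i, j) - B $$ (i, j) \<in> N)"

lemma cg_dim: "A \<doteq> B ==> dim_row A = dim_row B" "A \<doteq> B ==> dim_col A = dim_col B"
  by (simp_all add: cg_def)

lemma cg_entry: "A \<doteq> B ==> i < dim_row A ==> j < dim_col A ==> A $$ (i, j) - B $$ (i, j) \<in> N"
  by (simp add: cg_def)

lemma cg_refl [simp, intro]: "A \<doteq> A" by (simp add: cg_def zero_N)

lemma cg_sym: "A \<doteq> B ==> B \<doteq> A"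
  unfolding cg_def using uminus_N[of "A $$ (i, j) - B $$ (i, j)" for i j] by auto

lemma cg_trans [trans]: "A \<doteq> B ==> B \<doteq> C ==> A \<doteq> C"
  unfolding cg_def using add_N[of "A $$ (i, j) - B $$ (i, j)" "B $$ (i, j) - C $$ (i, j)" for i j] by auto

lemma cg_add: "A \<doteq> A' ==> B \<doteq> B' ==> dim_row A = dim_row B ==> dim_col A = dim_col B ==> A + B \<doteq> A' + B'"
  unfolding cg_def using add_N[of "A $$ (i, j) - A' $$ (i, j)" "B $$ (i, j) - B' $$ (i, j)" for i j]
  by (auto simp: algebra_simps)

lemma cg_diff: "A \<doteq> A' ==> B \<doteq> B' ==> dim_row A = dim_row B ==> dim_col A = dim_col B ==> A - B \<doteq> A' - B'"
  unfolding cg_def using diff_N[of "A $$ (i, j) - A' $$ (i, j)" "B $$ (i, j) - B' $$ (i, j)" for i j]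
  by (auto simp: algebra_simps)

lemma cg_mult:
  assumes "A \<doteq> A'" "B \<doteq> B'" "dim_col A = dim_row B"
  shows "A * B \<doteq> A' * B'"
  unfolding cg_def
proof (intro conjI allI impI)
  fix i j assume "i < dim_row (A * B)" "j < dim_col (A * B)"
  then have ij: "i < dim_row A" "j < dim_col B" by simp_all
  let ?f = "\<lambda>k. (A $$ (i, k) - A' $$ (i, k)) * B $$ (k, j) + A' $$ (i, k) * (B $$ (k, j) - B' $$ (k, j))"
  have "?f k \<in> N" if "k < dim_row B" for k
    using cg_entry[OF assms(1), of i k] cg_entry[OF assms(2), of k j] ij that assms(3)
    by (intro add_N mult_N(1) mult_N(2)) auto
  then have "(\<Sum>k\<in>{0..<dim_row B}. ?f k) \<in> N" by (intro sum_N) auto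
  moreover have "(A * B) $$ (i, j) - (A' * B') $$ (i, j) = (\<Sum>k\<in>{0..<dim_row B}. ?f k)"
    using ij assms cg_dim[OF assms(1)] cg_dim[OF assms(2)]
    by (simp add: mult_index algebra_simps sum.distrib sum_subtractf del: index_mult_mat(1))
  ultimately show "(A * B) $$ (i, j) - (A' * B') $$ (i, j) \<in> N" by simp
qed (use assms cg_dim in auto)

lemma cg_mult_left: "B \<doteq> B' ==> dim_col A = dim_row B ==> A * B \<doteq> A * B'"
  and cg_mult_right: "A \<doteq> A' ==> dim_col A = dim_row B ==> A * B \<doteq> A' * B"
  by (simp_all add: cg_mult)

lemma cg_zero_iff: "A \<doteq> 0\<^sub>m (dim_row A) (dim_col A) \<longleftrightarrow> (\<forall>i<dim_row A. \<forall>j<dim_col A. A $$ (i, j) \<in> N)"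
  by (simp add: cg_def)

lemma cg_diff_zero: "A \<doteq> B ==> A - B \<doteq> 0\<^sub>m (dim_row A) (dim_col A)"
  by (auto simp: cg_def)

lemma cg_of_diff: "A - B \<doteq> 0\<^sub>m n m ==> dim_row A = dim_row B ==> dim_col A = dim_col B ==> A \<doteq> B"
  by (auto simp: cg_def)

lemma cg_hstack: "A \<doteq> A' ==> B \<doteq> B' ==> dim_row A = dim_row B ==> hstack A B \<doteq> hstack A' B'"
  unfolding cg_def by auto

lemma cg_vstack: "A \<doteq> A' ==> B \<doteq> B' ==> dim_col A = dim_col B ==> vstack A B \<doteq> vstack A' B'"
  unfolding cg_def by auto

lemma cg_vstackD:
  assumes "vstack A B \<doteq> vstack A' B'" "dim_row A = dim_row A'" "dim_col A = dim_col B" "dim_col A' = dim_col B'"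
  shows "A \<doteq> A'" "B \<doteq> B'"
proof -
  have d: "dim_row B = dim_row B'" "dim_col A = dim_col A'" using assms cg_dim[OF assms(1)] by auto
  show "A \<doteq> A'" unfolding cg_def
  proof (intro conjI allI impI)
    fix i j assume "i < dim_row A" "j < dim_col A"
    then show "A $$ (i, j) - A' $$ (i, j) \<in> N" using cg_entry[OF assms(1), of i j] assms d by simp
  qed (use assms d in auto)
  show "B \<doteq> B'" unfolding cg_def
  proof (intro conjI allI impI)
    fix i j assume "i < dim_row B" "j < dim_col B"
    then show "B $$ (i, j) - B' $$ (i, j) \<in> N" using cg_entry[OF assms(1), of "dim_row A + i" j] assms d by simp
  qed (use assms d in auto)
qed

lemma cg_hstackD:
  assumes "hstack A B \<doteq> hstack A' B'" "dim_col A = dim_col A'" "dim_row A = dim_row B" "dim_row A' = dim_row B'"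
  shows "A \<doteq> A'" "B \<doteq> B'"
proof -
  have d: "dim_col B = dim_col B'" "dim_row A = dim_row A'" using assms cg_dim[OF assms(1)] by auto
  show "A \<doteq> A'" unfolding cg_def
  proof (intro conjI allI impI)
    fix i j assume "i < dim_row A" "j < dim_col A"
    then show "A $$ (i, j) - A' $$ (i, j) \<in> N" using cg_entry[OF assms(1), of i j] assms d by simp
  qed (use assms d in auto)
  show "B \<doteq> B'" unfolding cg_def
  proof (intro conjI allI impI)
    fix i j assume "i < dim_row B" "j < dim_col B"
    then show "B $$ (i, j) - B' $$ (i, j) \<in> N" using cg_entry[OF assms(1), of i "dim_col A + j"] assms d by simp
  qed (use assms d in auto)
qed

text \<open>The inner rank of \<open>A\<close> is the least \<open>t\<close> with \<open>fac A t\<close>.\<close>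

definition fac :: "'s mat => nat => bool" where
  "fac A t \<longleftrightarrow> (\<exists>B C. B \<in> carrier_mat (dim_row A) t \<and> C \<in> carrier_mat t (dim_col A) \<and> A \<doteq> B * C)"

definition full :: "'s mat => bool" where
  "full A \<longleftrightarrow> dim_row A = dim_col A \<and> (\<forall>t. fac A t --> dim_row A \<le> t)"

definition sylvester :: bool where
  "sylvester \<longleftrightarrow> (\<forall>A B. dim_col A = dim_row B --> A * B \<doteq> 0\<^sub>m (dim_row A) (dim_col B) -->
     (\<exists>s t. fac A s \<and> fac B t \<and> s + t \<le> dim_col A))"

lemma facI: "B \<in> carrier_mat (dim_row A) t ==> C \<in> carrier_mat t (dim_col A) ==> A \<doteq> B * C ==> fac A t"
  by (auto simp: fac_def)

lemma facE:
  assumes "fac A t"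
  obtains B C where "B \<in> carrier_mat (dim_row A) t" "C \<in> carrier_mat t (dim_col A)" "A \<doteq> B * C"
  using assms by (auto simp: fac_def)

lemma fac_mult_left:
  assumes "fac Z s" "D \<doteq> Y * Z" "dim_col Y = dim_row Z"
  shows "fac D s"
proof -
  from assms(1) obtain B C where B: "B \<in> carrier_mat (dim_row Z) s" and C: "C \<in> carrier_mat s (dim_col Z)" and eq: "Z \<doteq> B * C"
    by (rule facE)
  note [simp] = carrier_matD[OF B] carrier_matD[OF C]
  have d: "dim_row D = dim_row Y" "dim_col D = dim_col Z" using cg_dim[OF assms(2)] by simp_all
  have "D \<doteq> Y * (B * C)" using cg_trans[OF assms(2) cg_mult_left[OF eq assms(3)]] .
  then have "D \<doteq> (Y * B) * C" using assms(3) by (simp add: mat_assoc)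
  then show ?thesis using d by (intro facI[of "Y * B" _ _ C]) (auto intro!: carrier_matI)
qed

lemma fac_mult_right:
  assumes "fac Y s" "D \<doteq> Y * Z" "dim_col Y = dim_row Z"
  shows "fac D s"
proof -
  from assms(1) obtain B C where B: "B \<in> carrier_mat (dim_row Y) s" and C: "C \<in> carrier_mat s (dim_col Y)" and eq: "Y \<doteq> B * C"
    by (rule facE)
  note [simp] = carrier_matD[OF B] carrier_matD[OF C]
  have d: "dim_row D = dim_row Y" "dim_col D = dim_col Z" using cg_dim[OF assms(2)] by simp_all
  have "D \<doteq> (B * C) * Z" using cg_trans[OF assms(2) cg_mult_right[OF eq assms(3)]] .
  then have "D \<doteq> B * (C * Z)" using assms(3) by (simp add: mat_assoc)
  then show ?thesis using d by (intro facI[of B _ _ "C * Z"]) (auto intro!: carrier_matI)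
qed

text \<open>The Sylvester law in the form in which it is used: if \<open>Y\<close> kills \<open>Z\<close> on one side and
  extends to a factorization of a full matrix on the other, then \<open>Z\<close> has small inner rank.\<close>

lemma sylvester_left:
  assumes "sylvester" "full A" "A \<doteq> Y * Z" "dim_col Y = dim_row Z" "dim_row Z' = dim_col Y" "Y * Z' \<doteq> 0\<^sub>m (dim_row Y) (dim_col Z')"
  shows "\<exists>s. dim_row A + s \<le> dim_col Y \<and> fac Z' s"
proof -
  obtain s t where st: "fac Y s" "fac Z' t" "s + t \<le> dim_col Y"
    using assms(1)[unfolded sylvester_def, rule_format, OF assms(5)[symmetric] assms(6)] by blast
  have "dim_row A \<le> s" using fac_mult_right[OF st(1) assms(3,4)] assms(2) by (auto simp: full_def)
  then show ?thesis using st by (intro exI[of _ t]) simp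
qed

lemma sylvester_right:
  assumes "sylvester" "full A" "A \<doteq> Y * Z" "dim_col Y = dim_row Z" "dim_col Y' = dim_row Z" "Y' * Z \<doteq> 0\<^sub>m (dim_row Y') (dim_col Z)"
  shows "\<exists>s. dim_row A + s \<le> dim_col Y \<and> fac Y' s"
proof -
  obtain s t where st: "fac Y' s" "fac Z t" "s + t \<le> dim_col Y'"
    using assms(1)[unfolded sylvester_def, rule_format, OF assms(5,6)] by blast
  have "dim_row A \<le> t" using fac_mult_left[OF st(2) assms(3,4)] assms(2) by (auto simp: full_def)
  then show ?thesis using st assms(4,5) by (intro exI[of _ s]) simp
qed

lemma fac_four_block:
  assumes "fac (four_block_mat A B C D) t"
    and [simp]: "dim_row A = p" "dim_row B = p" "dim_row C = q" "dim_row D = q" "dim_col A = p'" "dim_col C = p'" "dim_col B = q'" "dim_col D = q'"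
  obtains Y1 Y2 Z1 Z2 where "Y1 \<in> carrier_mat p t" "Y2 \<in> carrier_mat q t" "Z1 \<in> carrier_mat t p'" "Z2 \<in> carrier_mat t q'"
    "A \<doteq> Y1 * Z1" "B \<doteq> Y1 * Z2" "C \<doteq> Y2 * Z1" "D \<doteq> Y2 * Z2"
proof -
  from assms(1) obtain Y Z where Y: "Y \<in> carrier_mat (p + q) t" and Z: "Z \<in> carrier_mat t (p' + q')"
    and eq: "four_block_mat A B C D \<doteq> Y * Z" by (rule facE) simp
  note [simp] = carrier_matD[OF Y] carrier_matD[OF Z]
  define Y1 where "Y1 = mat p t (\<lambda>(i, j). Y $$ (i, j))"
  define Y2 where "Y2 = mat q t (\<lambda>(i, j). Y $$ (p + i, j))"
  define Z1 where "Z1 = mat t p' (\<lambda>(i, j). Z $$ (i, j))"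
  define Z2 where "Z2 = mat t q' (\<lambda>(i, j). Z $$ (i, p' + j))"
  have [simp]: "dim_row Y1 = p" "dim_row Y2 = q" "dim_col Y1 = t" "dim_col Y2 = t" "dim_row Z1 = t" "dim_row Z2 = t"
    "dim_col Z1 = p'" "dim_col Z2 = q'"
    by (simp_all add: Y1_def Y2_def Z1_def Z2_def)
  have YZ: "Y = vstack Y1 Y2" "Z = hstack Z1 Z2" unfolding Y1_def Y2_def Z1_def Z2_def by (intro eq_matI; auto)+
  have "Y * Z = vstack (hstack (Y1 * Z1) (Y1 * Z2)) (hstack (Y2 * Z1) (Y2 * Z2))"
    unfolding YZ by (subst vstack_mult) (simp_all add: mult_hstack)
  moreover have "four_block_mat A B C D = vstack (hstack A B) (hstack C D)" by (simp add: vstack_hstack)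
  ultimately have "vstack (hstack A B) (hstack C D) \<doteq> vstack (hstack (Y1 * Z1) (Y1 * Z2)) (hstack (Y2 * Z1) (Y2 * Z2))"
    using eq by simp
  from cg_vstackD[OF this] have "hstack A B \<doteq> hstack (Y1 * Z1) (Y1 * Z2)" "hstack C D \<doteq> hstack (Y2 * Z1) (Y2 * Z2)" by simp_all
  from cg_hstackD[OF this(1)] cg_hstackD[OF this(2)] show thesis
    by (intro that[of Y1 Y2 Z1 Z2]) (auto intro!: carrier_matI)
qed

lemma fac_upper_block:
  assumes "sylvester" "full A" "fac (four_block_mat A B C D) t" "C \<doteq> 0\<^sub>m q p"
    "dim_row A = p" "dim_row B = p" "dim_row D = q" "dim_col B = dim_col D"
  shows "\<exists>s. p + s \<le> t \<and> fac D s"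
proof -
  have d: "dim_row C = q" "dim_col C = p" "dim_col A = p" using cg_dim[OF assms(4)] assms(2,5) by (auto simp: full_def)
  obtain Y1 Y2 Z1 Z2 where c: "Y1 \<in> carrier_mat p t" "Y2 \<in> carrier_mat q t" "Z1 \<in> carrier_mat t p" "Z2 \<in> carrier_mat t (dim_col D)"
    and eq: "A \<doteq> Y1 * Z1" "B \<doteq> Y1 * Z2" "C \<doteq> Y2 * Z1" "D \<doteq> Y2 * Z2"
    by (rule fac_four_block[OF assms(3)]) (use d assms in auto)
  have "\<exists>s. dim_row A + s \<le> dim_col Y1 \<and> fac Y2 s"
    using c cg_trans[OF cg_sym[OF eq(3)] assms(4)] by (intro sylvester_right[OF assms(1,2) eq(1)]) auto
  then obtain s where s: "p + s \<le> t" "fac Y2 s" using c assms(5) by auto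
  from fac_mult_right[OF s(2) eq(4)] s(1) c show ?thesis by (intro exI[of _ s]) auto
qed

lemma fac_corner_block:
  assumes "sylvester" "full A" "fac (four_block_mat D B C A) t" "B \<doteq> 0\<^sub>m q p"
    "dim_row A = p" "dim_row D = q" "dim_col D = dim_col C" "dim_row C = p"
  shows "\<exists>s. p + s \<le> t \<and> fac D s"
proof -
  have d: "dim_row B = q" "dim_col B = p" "dim_col A = p" using cg_dim[OF assms(4)] assms(2,5) by (auto simp: full_def)
  obtain Y1 Y2 Z1 Z2 where c: "Y1 \<in> carrier_mat q t" "Y2 \<in> carrier_mat p t" "Z1 \<in> carrier_mat t (dim_col C)" "Z2 \<in> carrier_mat t p"
    and eq: "D \<doteq> Y1 * Z1" "B \<doteq> Y1 * Z2" "C \<doteq> Y2 * Z1" "A \<doteq> Y2 * Z2"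
    by (rule fac_four_block[OF assms(3)]) (use d assms in auto)
  have "\<exists>s. dim_row A + s \<le> dim_col Y2 \<and> fac Y1 s"
    using c cg_trans[OF cg_sym[OF eq(2)] assms(4)] by (intro sylvester_right[OF assms(1,2) eq(4)]) auto
  then obtain s where s: "p + s \<le> t" "fac Y1 s" using c assms(5) by auto
  from fac_mult_right[OF s(2) eq(1)] s(1) c show ?thesis by (intro exI[of _ s]) auto
qed

lemma full_upper_block:
  assumes "sylvester" "full A" "full D" "C \<doteq> 0\<^sub>m (dim_row D) (dim_row A)" "dim_row B = dim_row A" "dim_col B = dim_row D"
  shows "full (four_block_mat A B C D)"
  unfolding full_def
proof (intro conjI allI impI)
  fix t assume "fac (four_block_mat A B C D) t"
  from fac_upper_block[OF assms(1,2) this assms(4)] assms obtain s where "dim_row A + s \<le> t" "fac D s" by (auto simp: full_def)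
  then show "dim_row (four_block_mat A B C D) \<le> t" using assms(3) by (auto simp: full_def)
qed (use assms in \<open>auto simp: full_def\<close>)

lemma full_one: 
  assumes "sylvester" "1 \<notin> N"
  shows "full (1\<^sub>m n)"
proof -
  have f1: "full (1\<^sub>m 1)"
    unfolding full_def
  proof (intro conjI allI impI)
    fix t assume "fac (1\<^sub>m 1) t"
    then obtain B C where BC: "B \<in> carrier_mat 1 t" "C \<in> carrier_mat t 1" and eq: "1\<^sub>m 1 \<doteq> B * C" by (auto simp: fac_def)
    have "t \<noteq> 0"
    proof
      assume "t = 0"
      then have "(B * C) $$ (0, 0) = 0" using BC by (simp add: scalar_prod_def)
      then show False using cg_entry[OF eq, of 0 0] assms(2) by simp
    qed
    then show "dim_row (1\<^sub>m 1 :: 's mat) \<le> t" by simp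
  qed simp
  show ?thesis
  proof (induction n)
    case (Suc n)
    have "full (four_block_mat (1\<^sub>m n) (0\<^sub>m n 1) (0\<^sub>m 1 n) (1\<^sub>m 1))"
      by (intro full_upper_block assms(1) Suc f1) auto
    also have "four_block_mat (1\<^sub>m n) (0\<^sub>m n 1) (0\<^sub>m 1 n) (1\<^sub>m 1) = 1\<^sub>m (Suc n)" by (intro eq_matI) auto
    finally show ?case .
  qed (simp add: full_def)
qed

section \<open>Free ideal rings and skew fields are Sylvester domains\<close>

definition indep :: "'s mat => bool" where
  "indep H \<longleftrightarrow> (\<forall>x. x \<in> carrier_mat 1 (dim_row H) --> x * H \<doteq> 0\<^sub>m 1 (dim_col H) --> x \<doteq> 0\<^sub>m 1 (dim_row H))"

lemma indep_zero:
  assumes "indep H" "M * H \<doteq> 0\<^sub>m (dim_row M) (dim_col H)" "dim_col M = dim_row H"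
  shows "M \<doteq> 0\<^sub>m (dim_row M) (dim_col M)"
  unfolding cg_zero_iff
proof (intro allI impI)
  fix i j assume ij: "i < dim_row M" "j < dim_col M"
  define x where "x = mat 1 (dim_row H) (\<lambda>(_, j). M $$ (i, j))"
  have x: "x \<in> carrier_mat 1 (dim_row H)" by (simp add: x_def)
  have "x * H \<doteq> 0\<^sub>m 1 (dim_col H)"
    unfolding cg_def
  proof (intro conjI allI impI)
    fix a b assume "a < dim_row (x * H)" "b < dim_col (x * H)"
    then show "(x * H) $$ (a, b) - 0\<^sub>m 1 (dim_col H) $$ (a, b) \<in> N"
      using cg_entry[OF assms(2), of i b] assms(3) ij by (simp add: mult_index x_def del: index_mult_mat(1))
  qed (simp_all add: x_def)
  from assms(1)[unfolded indep_def, rule_format, OF x this] have "x \<doteq> 0\<^sub>m 1 (dim_row H)" .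
  from cg_entry[OF this, of 0 j] show "M $$ (i, j) \<in> N" using ij assms(3) by (simp add: x_def)
qed

lemma indep_cancel:
  assumes "indep H" "M * H \<doteq> M' * H" "dim_col M = dim_row H" "dim_col M' = dim_row H"
  shows "M \<doteq> M'"
proof -
  have d: "dim_row M = dim_row M'" using cg_dim[OF assms(2)] by simp
  have "(M - M') * H = M * H - M' * H" using assms(3,4) d by (simp add: mat_distrib)
  then have "(M - M') * H \<doteq> 0\<^sub>m (dim_row (M - M')) (dim_col H)" using cg_diff_zero[OF assms(2)] d by simp
  from cg_of_diff[OF indep_zero[OF assms(1) this]] assms(3,4) d show ?thesis by simp
qed

text \<open>The rows of \<open>H\<close> are a basis of the left module spanned by the rows of \<open>G\<close>.\<close>

definition row_basis :: "'s mat => 's mat => 's mat => 's mat => bool" where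
  "row_basis G H G' H' \<longleftrightarrow> dim_col H = dim_col G \<and> dim_row G' = dim_row G \<and> dim_col G' = dim_row H \<and>
     dim_row H' = dim_row H \<and> dim_col H' = dim_row G \<and> G \<doteq> G' * H \<and> H \<doteq> H' * G \<and> indep H"

text \<open>If finitely generated left ideals are free, then so are finitely generated submodules of free left modules:
  project to the first coordinate and continue with the kernel of the projection.\<close>

lemma row_basis_exists:
  assumes one: "\<And>G. dim_col G = 1 ==> \<exists>H G' H'. row_basis G H G' H'"
  shows "\<exists>H G' H'. row_basis G H G' H'"
proof (induction "dim_col G" arbitrary: G)
  case 0
  have "row_basis G (0\<^sub>m 0 0) (0\<^sub>m (dim_row G) 0) (0\<^sub>m 0 (dim_row G))"
    using 0 by (auto simp: row_basis_def indep_def cg_def)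
  then show ?case by blast
next
  case (Suc n)
  define q where "q = dim_row G"
  define g where "g = mat q 1 (\<lambda>(i, j). G $$ (i, 0))"
  define G1 where "G1 = mat q n (\<lambda>(i, j). G $$ (i, Suc j))"
  have [simp]: "dim_row g = q" "dim_col g = 1" "dim_row G1 = q" "dim_col G1 = n" by (simp_all add: g_def G1_def)
  have G: "G = hstack g G1" using Suc(2) by (intro eq_matI) (auto simp: g_def G1_def q_def)
  obtain h g' h' where "row_basis g h g' h'" using one[of g] by auto
  then have [simp]: "dim_col h = 1" "dim_row g' = q" "dim_col g' = dim_row h" "dim_row h' = dim_row h" "dim_col h' = q"
    and h: "g \<doteq> g' * h" "h \<doteq> h' * g" "indep h" by (simp_all add: row_basis_def)
  define a where "a = dim_row h"
  have [simp]: "dim_row h = a" by (simp add: a_def)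
  define E where "E = 1\<^sub>m q - g' * h'"
  have [simp]: "dim_row E = q" "dim_col E = q" by (simp_all add: E_def)
  obtain K K' K'' where "row_basis (E * G1) K K' K''" using Suc(1)[of "E * G1"] by auto
  then have [simp]: "dim_col K = n" "dim_row K' = q" "dim_col K' = dim_row K" "dim_row K'' = dim_row K" "dim_col K'' = q"
    and K: "E * G1 \<doteq> K' * K" "K \<doteq> K'' * (E * G1)" "indep K" by (simp_all add: row_basis_def)
  define b where "b = dim_row K"
  have [simp]: "dim_row K = b" by (simp add: b_def)
  have Eg: "E * g \<doteq> 0\<^sub>m q 1"
  proof -
    have "g' * (h' * g) \<doteq> g" using cg_trans[OF cg_mult_left[OF cg_sym[OF h(2)], of g'] cg_sym[OF h(1)]] by simp
    from cg_diff_zero[OF cg_sym[OF this]] show ?thesis by (simp add: E_def mat_distrib mat_assoc)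
  qed
  define H where "H = vstack (hstack h (h' * G1)) (hstack (0\<^sub>m b 1) K)"
  have "G = g' * (h' * G) + E * G"
    unfolding E_def by (intro eq_matI) (auto simp: mat_distrib mat_assoc q_def)
  also have "g' * (h' * G) + E * G = g' * hstack (h' * g) (h' * G1) + hstack (E * g) (E * G1)"
    unfolding G by (simp add: mult_hstack)
  also have "\<dots> \<doteq> g' * hstack h (h' * G1) + hstack (0\<^sub>m q 1) (K' * K)"
    using h(2) Eg K(1) by (intro cg_add cg_mult_left cg_hstack) (auto intro: cg_sym)
  also have "\<dots> = g' * hstack h (h' * G1) + K' * hstack (0\<^sub>m b 1) K" by (simp add: mult_hstack)
  also have "\<dots> = hstack g' K' * H" unfolding H_def by (simp add: hstack_vstack)
  finally have GH: "G \<doteq> hstack g' K' * H" .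
  have "K'' * E * G = hstack (K'' * (E * g)) (K'' * (E * G1))" unfolding G by (simp add: mult_hstack mat_assoc)
  also have "\<dots> \<doteq> hstack (K'' * 0\<^sub>m q 1) K" using Eg K(2) by (intro cg_hstack cg_mult_left) (auto intro: cg_sym)
  also have "K'' * 0\<^sub>m q 1 = 0\<^sub>m b 1" by (intro eq_matI) auto
  finally have KG: "K'' * E * G \<doteq> hstack (0\<^sub>m b 1) K" .
  have "h' * G \<doteq> hstack h (h' * G1)" unfolding G using h(2) by (simp add: mult_hstack cg_hstack cg_sym)
  from cg_vstack[OF this KG] have "vstack h' (K'' * E) * G \<doteq> H" unfolding H_def using G by (simp add: vstack_mult)
  then have HG: "H \<doteq> vstack h' (K'' * E) * G" by (rule cg_sym)
  have "indep H"
    unfolding indep_def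
  proof (intro allI impI)
    fix x assume x: "x \<in> carrier_mat 1 (dim_row H)" and xH: "x * H \<doteq> 0\<^sub>m 1 (dim_col H)"
    note [simp] = carrier_matD[OF x]
    define y where "y = mat 1 a (\<lambda>(i, j). x $$ (i, j))"
    define z where "z = mat 1 b (\<lambda>(i, j). x $$ (i, a + j))"
    have [simp]: "dim_row y = 1" "dim_col y = a" "dim_row z = 1" "dim_col z = b" by (simp_all add: y_def z_def)
    have xyz: "x = hstack y z" by (intro eq_matI) (auto simp: y_def z_def H_def)
    have zz: "z * 0\<^sub>m b 1 = 0\<^sub>m 1 1" by (intro eq_matI) auto
    have "x * H = y * hstack h (h' * G1) + z * hstack (0\<^sub>m b 1) K"
      unfolding xyz H_def by (simp add: hstack_vstack)
    also have "\<dots> = hstack (y * h) (y * (h' * G1) + z * K)"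
      by (simp add: mult_hstack zz) (intro eq_matI; auto)
    finally have e1: "x * H = hstack (y * h) (y * (h' * G1) + z * K)" .
    have e2: "0\<^sub>m 1 (dim_col H) = hstack (0\<^sub>m 1 1) (0\<^sub>m 1 n)" by (simp add: H_def)
    have eq: "hstack (y * h) (y * (h' * G1) + z * K) \<doteq> hstack (0\<^sub>m 1 1) (0\<^sub>m 1 n)"
      using xH unfolding e1 e2 .
    have "y * h \<doteq> 0\<^sub>m (dim_row y) (dim_col h)" using cg_hstackD(1)[OF eq] by simp
    then have y0: "y \<doteq> 0\<^sub>m 1 a" using indep_zero[OF h(3), of y] by simp
    have "z * K = (y * (h' * G1) + z * K) - y * (h' * G1)" by (intro eq_matI) auto
    also have "\<dots> \<doteq> 0\<^sub>m 1 n - 0\<^sub>m 1 a * (h' * G1)"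
      using y0 cg_hstackD(2)[OF eq] by (intro cg_diff cg_mult_right) auto
    also have "0\<^sub>m 1 n - 0\<^sub>m 1 a * (h' * G1) = 0\<^sub>m 1 n" by (intro eq_matI) auto
    finally have "z \<doteq> 0\<^sub>m 1 b" using indep_zero[OF K(3), of z] by simp
    with y0 have "x \<doteq> hstack (0\<^sub>m 1 a) (0\<^sub>m 1 b)" unfolding xyz by (intro cg_hstack) auto
    then show "x \<doteq> 0\<^sub>m 1 (dim_row H)" by (simp add: H_def)
  qed
  then have "row_basis G H (hstack g' K') (vstack h' (K'' * E))"
    using GH HG Suc(2) by (simp add: row_basis_def H_def q_def)
  then show ?case by blast
qed

text \<open>A basis of the rows of \<open>B\<close> and a basis of the relations between these rows together are a basis of the free module.\<close>

lemma row_basis_complement: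
  assumes "\<exists>H G' H'. row_basis B H G' H'" "\<And>E. dim_col E = dim_row B ==> \<exists>H G' H'. row_basis E H G' H'"
  obtains H G' H' E K K' K'' where "row_basis B H G' H'" "row_basis E K K' K''" "E = 1\<^sub>m (dim_row B) - G' * H'"
    "\<forall>x. dim_col x = dim_row B --> x * B \<doteq> 0\<^sub>m (dim_row x) (dim_col B) --> x \<doteq> x * K' * K"
    "vstack H' K * hstack G' K' \<doteq> 1\<^sub>m (dim_row H + dim_row K)" "hstack G' K' * vstack H' K \<doteq> 1\<^sub>m (dim_row B)"
proof -
  define n where "n = dim_row B"
  have [simp]: "dim_row B = n" by (simp add: n_def)
  obtain H G' H' where rb: "row_basis B H G' H'" using assms(1) by blast
  then have [simp]: "dim_col H = dim_col B" "dim_row G' = n" "dim_col G' = dim_row H" "dim_row H' = dim_row H" "dim_col H' = n"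
    and H: "B \<doteq> G' * H" "H \<doteq> H' * B" "indep H" by (simp_all add: row_basis_def)
  define E where "E = 1\<^sub>m n - G' * H'"
  have [simp]: "dim_row E = n" "dim_col E = n" by (simp_all add: E_def)
  obtain K K' K'' where rb2: "row_basis E K K' K''" using assms(2)[of E] by auto
  then have [simp]: "dim_col K = n" "dim_row K' = n" "dim_col K' = dim_row K" "dim_row K'' = dim_row K" "dim_col K'' = n"
    and K: "E \<doteq> K' * K" "K \<doteq> K'' * E" "indep K" by (simp_all add: row_basis_def)
  have xE: "x \<doteq> x * K' * K" if [simp]: "dim_col x = n" and x: "x * B \<doteq> 0\<^sub>m (dim_row x) (dim_col B)" for x
  proof -
    have "(x * G') * H \<doteq> x * B" using cg_mult_left[OF cg_sym[OF H(1)], of x] by (simp add: mat_assoc)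
    from cg_trans[OF this x] have xG: "x * G' \<doteq> 0\<^sub>m (dim_row x) (dim_row H)" using indep_zero[OF H(3), of "x * G'"] by simp
    have "x * E + (x * G') * H' \<doteq> x * (K' * K) + 0\<^sub>m (dim_row x) (dim_row H) * H'"
      using xG K(1) by (intro cg_add cg_mult_left cg_mult_right) auto
    moreover have "x * (K' * K) + 0\<^sub>m (dim_row x) (dim_row H) * H' = x * K' * K" by (simp add: mat_assoc)
    moreover have "x * E + (x * G') * H' = x"
      unfolding E_def by (intro eq_matI) (auto simp: mat_distrib mat_assoc)
    ultimately show ?thesis by simp
  qed
  have HG1: "H' * G' \<doteq> 1\<^sub>m (dim_row H)"
  proof (rule indep_cancel[OF H(3)])
    have "H' * G' * H \<doteq> H' * B" using cg_mult_left[OF cg_sym[OF H(1)], of H'] by (simp add: mat_assoc)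
    also have "H' * B \<doteq> 1\<^sub>m (dim_row H) * H" using cg_sym[OF H(2)] by simp
    finally show "H' * G' * H \<doteq> 1\<^sub>m (dim_row H) * H" .
  qed simp_all
  have HE0: "H' * E \<doteq> 0\<^sub>m (dim_row H) n"
  proof -
    have "H' * E = H' - (H' * G') * H'" by (simp add: E_def mat_distrib mat_assoc)
    also have "\<dots> \<doteq> H' - 1\<^sub>m (dim_row H) * H'" using HG1 by (intro cg_diff cg_mult_right) auto
    finally show ?thesis by simp
  qed
  have EG0: "E * G' \<doteq> 0\<^sub>m n (dim_row H)"
  proof -
    have "E * G' = G' - G' * (H' * G')" by (simp add: E_def mat_distrib mat_assoc)
    also have "\<dots> \<doteq> G' - G' * 1\<^sub>m (dim_row H)" using HG1 by (intro cg_diff cg_mult_left) auto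
    finally show ?thesis by simp
  qed
  have KG0: "K * G' \<doteq> 0\<^sub>m (dim_row K) (dim_row H)"
  proof -
    have "K * G' \<doteq> K'' * E * G'" using K(2) by (intro cg_mult_right) auto
    also have "K'' * E * G' = K'' * (E * G')" by (simp add: mat_assoc)
    also have "\<dots> \<doteq> K'' * 0\<^sub>m n (dim_row H)" using EG0 by (intro cg_mult_left) auto
    also have "\<dots> = 0\<^sub>m (dim_row K) (dim_row H)" by (intro eq_matI) auto
    finally show ?thesis .
  qed
  have HK0: "H' * K' \<doteq> 0\<^sub>m (dim_row H) (dim_row K)"
  proof -
    have "H' * K' * K \<doteq> H' * E" using cg_mult_left[OF cg_sym[OF K(1)], of H'] by (simp add: mat_assoc)
    from cg_trans[OF this HE0] show ?thesis using indep_zero[OF K(3), of "H' * K'"] by simp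
  qed
  have KK1: "K * K' \<doteq> 1\<^sub>m (dim_row K)"
  proof (rule indep_cancel[OF K(3)])
    have "K * K' * K \<doteq> K * E" using cg_mult_left[OF cg_sym[OF K(1)], of K] by (simp add: mat_assoc)
    also have "K * E = K - (K * G') * H'" by (simp add: E_def mat_distrib mat_assoc)
    also have "\<dots> \<doteq> K - 0\<^sub>m (dim_row K) (dim_row H) * H'" using KG0 by (intro cg_diff cg_mult_right) auto
    also have "\<dots> = 1\<^sub>m (dim_row K) * K" by (intro eq_matI) auto
    finally show "K * K' * K \<doteq> 1\<^sub>m (dim_row K) * K" .
  qed simp_all
  have "vstack H' K * hstack G' K' = vstack (hstack (H' * G') (H' * K')) (hstack (K * G') (K * K'))"
    by (subst vstack_mult) (simp_all add: mult_hstack)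
  also have "\<dots> \<doteq> vstack (hstack (1\<^sub>m (dim_row H)) (0\<^sub>m (dim_row H) (dim_row K))) (hstack (0\<^sub>m (dim_row K) (dim_row H)) (1\<^sub>m (dim_row K)))"
    using HG1 HK0 KG0 KK1 by (intro cg_vstack cg_hstack) auto
  also have "\<dots> = 1\<^sub>m (dim_row H + dim_row K)" by (intro eq_matI) auto
  finally have inv1: "vstack H' K * hstack G' K' \<doteq> 1\<^sub>m (dim_row H + dim_row K)" .
  have "hstack G' K' * vstack H' K = G' * H' + K' * K" by (simp add: hstack_vstack)
  also have "\<dots> \<doteq> G' * H' + E" using K(1) by (intro cg_add) (auto intro: cg_sym)
  also have "\<dots> = 1\<^sub>m n" unfolding E_def by (intro eq_matI) auto
  finally have inv2: "hstack G' K' * vstack H' K \<doteq> 1\<^sub>m (dim_row B)" by simp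
  show thesis
  proof (rule that[OF rb rb2 _ _ inv1 inv2])
    show "E = 1\<^sub>m (dim_row B) - G' * H'" by (simp add: E_def)
    show "\<forall>x. dim_col x = dim_row B --> x * B \<doteq> 0\<^sub>m (dim_row x) (dim_col B) --> x \<doteq> x * K' * K"
      by (intro allI impI xE) simp_all
  qed
qed

lemma sylvester_of_bases:
  assumes one: "\<And>G. dim_col G = 1 ==> \<exists>H G' H'. row_basis G H G' H'"
    and rank: "\<And>c n P Q. P \<in> carrier_mat c n ==> Q \<in> carrier_mat n c ==> P * Q \<doteq> 1\<^sub>m c ==> Q * P \<doteq> 1\<^sub>m n ==> c \<le> n"
  shows sylvester
  unfolding sylvester_def
proof (intro allI impI)
  fix A B :: "'s mat" assume d: "dim_col A = dim_row B" and AB: "A * B \<doteq> 0\<^sub>m (dim_row A) (dim_col B)"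
  have ex: "\<exists>H G' H'. row_basis G H G' H'" for G by (rule row_basis_exists[OF one])
  obtain H G' H' E K K' K'' where rb: "row_basis B H G' H'" "row_basis E K K' K''" "E = 1\<^sub>m (dim_row B) - G' * H'"
    and ker: "\<forall>x. dim_col x = dim_row B --> x * B \<doteq> 0\<^sub>m (dim_row x) (dim_col B) --> x \<doteq> x * K' * K"
    and inv: "vstack H' K * hstack G' K' \<doteq> 1\<^sub>m (dim_row H + dim_row K)" "hstack G' K' * vstack H' K \<doteq> 1\<^sub>m (dim_row B)"
    by (rule row_basis_complement[OF ex ex, of B]) (rule that)
  have [simp]: "dim_col H = dim_col B" "dim_row G' = dim_row B" "dim_col G' = dim_row H" "dim_row H' = dim_row H" "dim_col H' = dim_row B"
    "dim_col K = dim_row B" "dim_row K' = dim_row B" "dim_col K' = dim_row K"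
    using rb by (auto simp: row_basis_def)
  have "fac A (dim_row K)" using ker[rule_format, OF d AB] d by (intro facI[of "A * K'" _ _ K]) (auto intro!: carrier_matI)
  moreover have "fac B (dim_row H)" using rb(1) by (intro facI[of G' _ _ H]) (auto simp: row_basis_def intro!: carrier_matI)
  moreover have "dim_row H + dim_row K \<le> dim_row B"
    by (rule rank[OF _ _ inv]) (auto intro!: carrier_matI)
  ultimately show "\<exists>s t. fac A s \<and> fac B t \<and> s + t \<le> dim_col A" using d by (intro exI[of _ "dim_row K"] exI[of _ "dim_row H"]) simp
qed

end


context matrix_congruence
begin

lemma indep_column:
  assumes "dim_col u = 1"
  shows "indep u \<longleftrightarrow> (\<forall>c. (\<Sum>i\<in>{0..<dim_row u}. c i * u $$ (i, 0)) \<in> N --> (\<forall>i<dim_row u. c i \<in> N))"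
proof (intro iffI allI impI)
  fix c i assume u: "indep u" and c: "(\<Sum>i\<in>{0..<dim_row u}. c i * u $$ (i, 0)) \<in> N" and i: "i < dim_row u"
  let ?x = "mat 1 (dim_row u) (\<lambda>(_, i). c i)"
  have "?x * u \<doteq> 0\<^sub>m 1 (dim_col u)" using c assms by (auto simp: cg_def mult_index simp del: index_mult_mat(1))
  with u have "?x \<doteq> 0\<^sub>m 1 (dim_row u)" unfolding indep_def by simp
  from cg_entry[OF this, of 0 i] i show "c i \<in> N" by simp
next
  assume *: "\<forall>c. (\<Sum>i\<in>{0..<dim_row u}. c i * u $$ (i, 0)) \<in> N --> (\<forall>i<dim_row u. c i \<in> N)"
  show "indep u"
    unfolding indep_def
  proof (intro allI impI)
    fix x assume x: "x \<in> carrier_mat 1 (dim_row u)" and eq: "x * u \<doteq> 0\<^sub>m 1 (dim_col u)"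
    have "(\<Sum>i\<in>{0..<dim_row u}. x $$ (0, i) * u $$ (i, 0)) \<in> N"
      using cg_entry[OF eq, of 0 0] x assms by (simp add: mult_index del: index_mult_mat(1))
    then have "\<forall>i<dim_row u. x $$ (0, i) \<in> N" using *[rule_format, of "\<lambda>i. x $$ (0, i)"] by blast
    then show "x \<doteq> 0\<^sub>m 1 (dim_row u)" using x by (auto simp: cg_def)
  qed
qed

text \<open>In a left Ore domain, Gaussian elimination over the common denominators produces a
  nontrivial relation between \<open>n + 1\<close> rows of length \<open>n\<close>.\<close>

lemma ore_relation:
  assumes one: "1 \<notin> N" and dom: "\<And>a b. a * b \<in> N ==> a \<in> N \<or> b \<in> N"
    and ore: "\<And>a b. \<exists>x y. (x \<notin> N \<or> y \<notin> N) \<and> x * a + y * b \<in> N"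
  shows "card S = Suc n ==> \<exists>u. (\<exists>i\<in>S. u i \<notin> N) \<and> (\<forall>j<n. (\<Sum>i\<in>S. u i * p i j) \<in> N)"
proof (induction n arbitrary: S p)
  case 0
  then show ?case using one by (intro exI[of _ "\<lambda>_. 1"]) (auto simp: card_Suc_eq)
next
  case (Suc n)
  then have fin: "finite S" using card.infinite by fastforce
  show ?case
  proof (cases "\<exists>r\<in>S. p r n \<notin> N")
    case True
    then obtain r where r: "r \<in> S" "p r n \<notin> N" by blast
    have "\<forall>i. \<exists>x y. x \<notin> N \<and> x * p i n + y * p r n \<in> N"
    proof
      fix i
      obtain x y where xy: "x \<notin> N \<or> y \<notin> N" "x * p i n + y * p r n \<in> N" using ore by blast
      have "x \<notin> N"
      proof
        assume x: "x \<in> N"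
        from diff_N[OF xy(2) mult_N(2)[OF x, of "p i n"]] have "y * p r n \<in> N" by simp
        with dom r(2) x xy(1) show False by blast
      qed
      with xy(2) show "\<exists>x y. x \<notin> N \<and> x * p i n + y * p r n \<in> N" by blast
    qed
    then obtain x y where xy: "\<And>i. x i \<notin> N" "\<And>i. x i * p i n + y i * p r n \<in> N" by metis
    have card: "card (S - {r}) = Suc n" using Suc(2) r fin by simp
    from Suc(1)[OF card, of "\<lambda>i j. x i * p i j + y i * p r j"]
    obtain u where u: "\<exists>i\<in>S - {r}. u i \<notin> N" "\<And>j. j < n ==> (\<Sum>i\<in>S - {r}. u i * (x i * p i j + y i * p r j)) \<in> N"
      by blast
    define v where "v = (\<lambda>i. if i = r then (\<Sum>i\<in>S - {r}. u i * y i) else u i * x i)"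
    have "(\<Sum>i\<in>S. v i * p i j) = (\<Sum>i\<in>S - {r}. u i * (x i * p i j + y i * p r j))" for j
    proof -
      have "(\<Sum>i\<in>S. v i * p i j) = v r * p r j + (\<Sum>i\<in>S - {r}. v i * p i j)" by (rule sum.remove[OF fin r(1)])
      also have "(\<Sum>i\<in>S - {r}. v i * p i j) = (\<Sum>i\<in>S - {r}. u i * x i * p i j)" by (intro sum.cong) (auto simp: v_def)
      finally show ?thesis by (simp add: v_def sum_distrib_right distrib_left sum.distrib mult.assoc add.commute)
    qed
    moreover have "(\<Sum>i\<in>S - {r}. u i * (x i * p i n + y i * p r n)) \<in> N" by (intro sum_N mult_N(1) xy(2))
    moreover have "\<exists>i\<in>S. v i \<notin> N"
    proof -
      obtain i where i: "i \<in> S - {r}" "u i \<notin> N" using u(1) by blast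
      then have "u i * x i \<notin> N" using dom[of "u i" "x i"] xy(1)[of i] by blast
      with i show ?thesis by (intro bexI[of _ i]) (auto simp: v_def)
    qed
    ultimately show ?thesis using u(2) by (intro exI[of _ v]) (auto simp: less_Suc_eq)
  next
    case False
    obtain r where r: "r \<in> S" using Suc(2) by fastforce
    have card: "card (S - {r}) = Suc n" using Suc(2) r fin by simp
    from Suc(1)[OF card, of p] obtain u where u: "\<exists>i\<in>S - {r}. u i \<notin> N" "\<And>j. j < n ==> (\<Sum>i\<in>S - {r}. u i * p i j) \<in> N"
      by blast
    have "(\<Sum>i\<in>S. (u(r := 0)) i * p i j) = (\<Sum>i\<in>S - {r}. u i * p i j)" for j
      using sum.remove[OF fin r, of "\<lambda>i. (u(r := 0)) i * p i j"] by simp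
    moreover have "(\<Sum>i\<in>S - {r}. u i * p i n) \<in> N" using False by (intro sum_N mult_N(1)) auto
    ultimately show ?thesis using u by (intro exI[of _ "u(r := 0)"]) (auto simp: less_Suc_eq)
  qed
qed

lemma rank_condition_of_ore:
  assumes ore: "1 \<notin> N" "\<And>a b. a * b \<in> N ==> a \<in> N \<or> b \<in> N"
    "\<And>a b. \<exists>x y. (x \<notin> N \<or> y \<notin> N) \<and> x * a + y * b \<in> N"
    and P: "P \<in> carrier_mat c n" and Q: "Q \<in> carrier_mat n c" and PQ: "P * Q \<doteq> 1\<^sub>m c"
  shows "c \<le> n"
proof (rule ccontr)
  assume "\<not> c \<le> n"
  then have nc: "{0..<Suc n} \<subseteq> {0..<c}" by auto
  obtain u where u: "\<exists>i\<in>{0..<Suc n}. u i \<notin> N" "\<And>j. j < n ==> (\<Sum>i\<in>{0..<Suc n}. u i * P $$ (i, j)) \<in> N"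
    using ore_relation[OF ore, of "{0..<Suc n}" n "\<lambda>i j. P $$ (i, j)"] by auto
  note [simp] = carrier_matD[OF P] carrier_matD[OF Q]
  define x where "x = mat 1 c (\<lambda>(_, i). if i < Suc n then u i else 0)"
  have [simp]: "dim_row x = 1" "dim_col x = c" by (simp_all add: x_def)
  have "x * P \<doteq> 0\<^sub>m 1 n"
    unfolding cg_def
  proof (intro conjI allI impI)
    fix i j assume "i < dim_row (x * P)" "j < dim_col (x * P)"
    then have ij: "i = 0" "j < n" by auto
    have "(x * P) $$ (0, j) = (\<Sum>k\<in>{0..<c}. (if k < Suc n then u k else 0) * P $$ (k, j))"
      using ij by (simp add: mult_index x_def del: index_mult_mat(1))
    also have "\<dots> = (\<Sum>k\<in>{0..<Suc n}. u k * P $$ (k, j))" using nc by (intro sum.mono_neutral_cong_right) auto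
    finally show "(x * P) $$ (i, j) - 0\<^sub>m 1 n $$ (i, j) \<in> N" using u(2)[OF ij(2)] ij by simp
  qed simp_all
  from cg_mult_right[OF this, of Q] have x0: "x * (P * Q) \<doteq> 0\<^sub>m 1 c" by (simp add: mat_assoc)
  have "x * (P * Q) \<doteq> x" using cg_mult_left[OF PQ, of x] by (simp add: right_mult_one_mat')
  from cg_trans[OF cg_sym[OF this] x0] have x0': "x \<doteq> 0\<^sub>m 1 c" .
  obtain i where "i < Suc n" "u i \<notin> N" "i < c" using u(1) nc by auto
  then show False using cg_entry[OF x0', of 0 i] by (simp add: x_def)
qed

text \<open>Uniqueness of the rank of left ideals excludes zero divisors. It yields the rank condition for all free modules: two
  independent elements generate free left ideals of any finite rank, and without two independent elements the ring is Ore.\<close>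

context
  assumes one: "1 \<notin> N"
    and bases: "\<And>G. dim_col G = 1 ==> \<exists>H G' H'. row_basis G H G' H'"
    and rank: "\<And>u v P Q. indep u ==> indep v ==> dim_col u = 1 ==> dim_col v = 1 ==> dim_col P = dim_row v ==> dim_col Q = dim_row u ==>
      u \<doteq> P * v ==> v \<doteq> Q * u ==> dim_row u = dim_row v"
begin

lemma domain_of_rank: 
  assumes ab: "a * b \<in> N" 
  shows "a \<in> N \<or> b \<in> N"
proof -
  let ?B = "mat 1 1 (\<lambda>_. b)" and ?a = "mat 1 1 (\<lambda>_. a)"
  have ex: "\<exists>H G' H'. row_basis G H G' H'" for G by (rule row_basis_exists[OF bases])
  obtain H G' H' E K K' K'' where rb: "row_basis ?B H G' H'" "row_basis E K K' K''" "E = 1\<^sub>m (dim_row ?B) - G' * H'"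
    and ker: "\<forall>x. dim_col x = dim_row ?B --> x * ?B \<doteq> 0\<^sub>m (dim_row x) (dim_col ?B) --> x \<doteq> x * K' * K"
    and inv: "vstack H' K * hstack G' K' \<doteq> 1\<^sub>m (dim_row H + dim_row K)" "hstack G' K' * vstack H' K \<doteq> 1\<^sub>m (dim_row ?B)"
    by (rule row_basis_complement[OF ex ex, of ?B]) (rule that)
  have [simp]: "dim_col H = 1" "dim_row G' = 1" "dim_col G' = dim_row H" "dim_row H' = dim_row H" "dim_col H' = 1"
    "dim_col K = 1" "dim_row K' = 1" "dim_col K' = dim_row K"
    using rb by (auto simp: row_basis_def)
  have u: "indep (vstack H' K)"
    unfolding indep_def
  proof (intro allI impI)
    fix x assume x: "x \<in> carrier_mat 1 (dim_row (vstack H' K))" and 0: "x * vstack H' K \<doteq> 0\<^sub>m 1 (dim_col (vstack H' K))"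
    note [simp] = carrier_matD[OF x]
    from cg_mult_right[OF 0, of "hstack G' K'"] have x0: "x * (vstack H' K * hstack G' K') \<doteq> 0\<^sub>m 1 (dim_row H + dim_row K)"
      by (simp add: mat_assoc)
    have "x * (vstack H' K * hstack G' K') \<doteq> x"
      using cg_mult_left[OF inv(1), of x] by (simp add: right_mult_one_mat')
    from cg_trans[OF cg_sym[OF this] x0] show "x \<doteq> 0\<^sub>m 1 (dim_row (vstack H' K))" by simp
  qed
  have v: "indep (1\<^sub>m 1)" by (auto simp: indep_def right_mult_one_mat')
  have "dim_row (vstack H' K) = dim_row (1\<^sub>m 1 :: 's mat)"
    by (rule rank[OF u v, of "vstack H' K" "hstack G' K'"]) (use cg_sym[OF inv(2)] in \<open>simp_all add: right_mult_one_mat'\<close>)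
  then consider "dim_row H = 0" | "dim_row K = 0" by fastforce
  then show ?thesis
  proof cases
    case 1
    have "?B \<doteq> G' * H" using rb(1) by (simp add: row_basis_def)
    from cg_entry[OF this, of 0 0] 1 show ?thesis by (simp add: mult_index del: index_mult_mat(1))
  next
    case 2
    have "?a * ?B \<doteq> 0\<^sub>m 1 1" using ab by (simp add: cg_def mult_index del: index_mult_mat(1))
    then have "?a \<doteq> ?a * K' * K" using ker by simp
    from cg_entry[OF this, of 0 0] 2 show ?thesis by (simp add: mult_index del: index_mult_mat(1))
  qed
qed

lemma rank_condition_of_rank:
  assumes P: "P \<in> carrier_mat c n" and Q: "Q \<in> carrier_mat n c" and PQ: "P * Q \<doteq> 1\<^sub>m c" and QP: "Q * P \<doteq> 1\<^sub>m n"
  shows "c \<le> n"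
proof (cases "\<forall>a b. \<exists>x y. (x \<notin> N \<or> y \<notin> N) \<and> x * a + y * b \<in> N")
  case True
  then show ?thesis using rank_condition_of_ore[OF one domain_of_rank _ P Q PQ] by blast
next
  case False
  then obtain a b where ab: "\<And>x y. x * a + y * b \<in> N ==> x \<in> N \<and> y \<in> N" by blast
  note [simp] = carrier_matD[OF P] carrier_matD[OF Q]
  have powers: "(\<Sum>i\<in>{0..<m}. x i * (a * b ^ i)) \<in> N ==> \<forall>i<m. x i \<in> N" for m x
  proof (induction m arbitrary: x)
    case (Suc m)
    have "(\<Sum>i\<in>{0..<Suc m}. x i * (a * b ^ i)) = x 0 * a + (\<Sum>i\<in>{0..<m}. x (Suc i) * (a * b ^ i)) * b"
      by (simp add: sum.atLeast0_lessThan_Suc_shift sum_distrib_right mult.assoc power_Suc2 del: power_Suc sum.op_ivl_Suc)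
    with Suc(2) ab have "x 0 \<in> N" "(\<Sum>i\<in>{0..<m}. x (Suc i) * (a * b ^ i)) \<in> N" by metis+
    with Suc(1)[of "\<lambda>i. x (Suc i)"] show ?case by (auto simp: less_Suc_eq_0_disj)
  qed simp
  define v where "v = mat n 1 (\<lambda>(i, _). a * b ^ i)"
  have [simp]: "dim_row v = n" "dim_col v = 1" by (simp_all add: v_def)
  have v: "indep v" using powers[where m = n] by (subst indep_column) (auto simp: v_def)
  have Pv: "indep (P * v)"
    unfolding indep_def
  proof (intro allI impI)
    fix x assume x: "x \<in> carrier_mat 1 (dim_row (P * v))" and 0: "x * (P * v) \<doteq> 0\<^sub>m 1 (dim_col (P * v))"
    note [simp] = carrier_matD[OF x]
    have "x * P \<doteq> 0\<^sub>m 1 n" using indep_zero[OF v, of "x * P"] 0 by (simp add: mat_assoc)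
    from cg_mult_right[OF this, of Q] have x0: "x * (P * Q) \<doteq> 0\<^sub>m 1 c" by (simp add: mat_assoc)
    have "x * (P * Q) \<doteq> x" using cg_mult_left[OF PQ, of x] by (simp add: right_mult_one_mat')
    from cg_trans[OF cg_sym[OF this] x0] show "x \<doteq> 0\<^sub>m 1 (dim_row (P * v))" by simp
  qed
  have "v \<doteq> Q * (P * v)" using cg_mult_right[OF cg_sym[OF QP], of v] by (simp add: mat_assoc)
  from rank[OF Pv v, of P Q] this show ?thesis by simp
qed

lemma sylvester_of_rank: sylvester
  by (rule sylvester_of_bases[OF bases rank_condition_of_rank])

end

end

text \<open>A ring with a carrier set as the image of a full type. The kernel of the presentation is the ideal
  modulo which its matrices are represented.\<close>

locale ring_presentation = R: ring R for R (structure) +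
  fixes e :: "'s :: ring_1 => 'a"
  assumes e_add: "\<And>a b. e (a + b) = e a \<oplus> e b" and e_mult: "\<And>a b. e (a * b) = e a \<otimes> e b"
    and e_one: "e 1 = \<one>" and range_e: "range e = carrier R"
begin

lemma e_closed [simp]: "e a \<in> carrier R" using range_e by blast

lemma e_zero: "e 0 = \<zero>"
  using e_add[of 0 0] R.add.l_cancel_one[of "e 0" "e 0"] by simp

lemma e_diff_iff: "e (a - b) = \<zero> \<longleftrightarrow> e a = e b"
proof -
  have "e a = e (a - b) \<oplus> e b" using e_add[of "a - b" b] by simp
  then show ?thesis by (metis R.add.l_cancel_one' R.add.m_comm e_closed R.l_zero R.add.right_cancel R.zero_closed)
qed

definition kernel :: "'s set" where "kernel = {a. e a = \<zero>}"

sublocale matrix_congruence kernel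
  by unfold_locales (auto simp: kernel_def e_zero e_add e_mult)

notation cg (infix "\<doteq>" 50)

lemma kernel_iff: "a - b \<in> kernel \<longleftrightarrow> e a = e b" by (simp add: kernel_def e_diff_iff)

lemma kernel_iff0: "a \<in> kernel \<longleftrightarrow> e a = \<zero>" by (simp add: kernel_def)

lemma e_sum: "finite S ==> e (sum f S) = (\<Oplus>i\<in>S. e (f i))"
  by (induction S rule: finite_induct) (simp_all add: e_zero e_add)

definition s :: "'a => 's" where "s x = (SOME a. e a = x)"

lemma e_s: "x \<in> carrier R ==> e (s x) = x"
  unfolding s_def by (rule someI_ex) (metis range_e rangeE)

lemma fac_iff:
  assumes [simp]: "dim_row A = m" "dim_col A = n"
  shows "fac A t \<longleftrightarrow> (\<exists>B C. ring_matrix R m t B \<and> ring_matrix R t n C \<and>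
     (\<forall>i<m. \<forall>j<n. e (A $$ (i, j)) = ring_matrix_mult R t B C i j))"
proof
  assume "fac A t"
  then obtain B C where BC: "B \<in> carrier_mat m t" "C \<in> carrier_mat t n" and eq: "A \<doteq> B * C" by (auto elim: facE)
  have "e (A $$ (i, j)) = ring_matrix_mult R t (\<lambda>i j. e (B $$ (i, j))) (\<lambda>i j. e (C $$ (i, j))) i j" if "i < m" "j < n" for i j
    using cg_entry[OF eq, of i j] that BC
    by (simp add: kernel_iff mult_index e_sum e_mult ring_matrix_mult_def atLeast0LessThan del: index_mult_mat(1))
  then show "\<exists>B C. ring_matrix R m t B \<and> ring_matrix R t n C \<and> (\<forall>i<m. \<forall>j<n. e (A $$ (i, j)) = ring_matrix_mult R t B C i j)"
    by (intro exI[of _ "\<lambda>i j. e (B $$ (i, j))"] exI[of _ "\<lambda>i j. e (C $$ (i, j))"]) (auto simp: ring_matrix_def)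
next
  assume "\<exists>B C. ring_matrix R m t B \<and> ring_matrix R t n C \<and> (\<forall>i<m. \<forall>j<n. e (A $$ (i, j)) = ring_matrix_mult R t B C i j)"
  then obtain B C where BC: "ring_matrix R m t B" "ring_matrix R t n C"
    and eq: "\<And>i j. i < m ==> j < n ==> e (A $$ (i, j)) = ring_matrix_mult R t B C i j" by blast
  let ?B = "mat m t (\<lambda>(i, j). s (B i j))" and ?C = "mat t n (\<lambda>(i, j). s (C i j))"
  have "A \<doteq> ?B * ?C"
    unfolding cg_def
  proof (intro conjI allI impI)
    fix i j assume "i < dim_row A" "j < dim_col A"
    then have ij: "i < m" "j < n" by simp_all
    have "(\<Oplus>l\<in>{..<t}. e (s (B i l)) \<otimes> e (s (C l j))) = (\<Oplus>l\<in>{..<t}. B i l \<otimes> C l j)"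
      using BC ij by (intro R.finsum_cong') (auto simp: ring_matrix_def e_s)
    then show "A $$ (i, j) - (?B * ?C) $$ (i, j) \<in> kernel"
      using ij by (simp add: kernel_iff eq ring_matrix_mult_def mult_index e_sum e_mult atLeast0LessThan del: index_mult_mat(1))
  qed simp_all
  then show "fac A t" by (intro facI[of ?B _ _ ?C]) auto
qed

lemma inner_rank_fac:
  assumes "dim_row A = m" "dim_col A = n" "\<And>i j. i < m ==> j < n ==> a i j = e (A $$ (i, j))"
  shows "fac A (inner_rank R m n a)"
proof -
  have "fac A n" using assms by (intro facI[of A _ _ "1\<^sub>m n"]) (auto simp: right_mult_one_mat')
  then have "fac A (LEAST t. fac A t)" by (rule LeastI)
  moreover have "(LEAST t. fac A t) = inner_rank R m n a"
    unfolding inner_rank_def fac_iff[OF assms(1,2)] using assms(3) by (intro arg_cong[of _ _ Least]) (auto intro!: ext)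
  ultimately show ?thesis by simp
qed

lemma sylvester_domain_sylvester:
  assumes "sylvester_domain R"
  shows "1 \<notin> kernel" "sylvester"
proof -
  show "1 \<notin> kernel" using assms by (simp add: sylvester_domain_def kernel_iff0 e_one)
  show sylvester
    unfolding sylvester_def
  proof (intro allI impI)
    fix A B :: "'s mat" assume d: "dim_col A = dim_row B" and AB: "A * B \<doteq> 0\<^sub>m (dim_row A) (dim_col B)"
    let ?A = "\<lambda>i j. e (A $$ (i, j))" and ?B = "\<lambda>i j. e (B $$ (i, j))"
    have "ring_matrix_mult R (dim_row B) ?A ?B i j = \<zero>" if "i < dim_row A" "j < dim_col B" for i j
      using cg_entry[OF AB, of i j] that d
      by (simp add: kernel_iff0 mult_index e_sum e_mult ring_matrix_mult_def atLeast0LessThan del: index_mult_mat(1))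
    then have "inner_rank R (dim_row A) (dim_row B) ?A + inner_rank R (dim_row B) (dim_col B) ?B \<le> dim_row B"
      using assms unfolding sylvester_domain_def by (auto simp: ring_matrix_def)
    moreover have "fac A (inner_rank R (dim_row A) (dim_row B) ?A)" "fac B (inner_rank R (dim_row B) (dim_col B) ?B)"
      using d by (intro inner_rank_fac; simp)+
    ultimately show "\<exists>s t. fac A s \<and> fac B t \<and> s + t \<le> dim_col A" using d by auto
  qed
qed

lemma skew_field_sylvester:
  assumes "skew_field R"
  shows "1 \<notin> kernel" "sylvester"
proof -
  have units: "Units R = carrier R - {\<zero>}" using assms by (simp add: skew_field_def)
  have inv: "\<exists>b. b * a - 1 \<in> kernel" if "a \<notin> kernel" for a
  proof -
    have "e a \<in> Units R" using that by (simp add: units kernel_iff0)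
    then obtain y where "y \<in> carrier R" "y \<otimes> e a = \<one>" by (auto simp: Units_def)
    then show ?thesis by (intro exI[of _ "s y"]) (simp add: kernel_iff e_mult e_s e_one)
  qed
  show one: "1 \<notin> kernel"
    using R.Units_one_closed by (simp add: units kernel_iff0 e_one)
  have dom: "a \<in> kernel \<or> b \<in> kernel" if "a * b \<in> kernel" for a b
  proof (cases "a \<in> kernel")
    case False
    then obtain c where c: "c * a - 1 \<in> kernel" using inv by blast
    have "b = c * (a * b) - (c * a - 1) * b" by (simp add: algebra_simps)
    also have "\<dots> \<in> kernel" by (intro diff_N mult_N(1)[OF that] mult_N(2)[OF c])
    finally show ?thesis ..
  qed simp
  have ore: "\<exists>x y. (x \<notin> kernel \<or> y \<notin> kernel) \<and> x * a + y * b \<in> kernel" for a b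
  proof (cases "a \<in> kernel")
    case True
    then show ?thesis using one by (intro exI[of _ 1] exI[of _ 0]) simp
  next
    case False
    then obtain c where c: "c * a - 1 \<in> kernel" using inv by blast
    have "b * (c * a - 1) \<in> kernel" by (rule mult_N(1)[OF c])
    then show ?thesis using one uminus_N[of "-1"]
      by (intro exI[of _ "b * c"] exI[of _ "-1"]) (auto simp: algebra_simps)
  qed
  show sylvester
  proof (rule sylvester_of_bases)
    fix G :: "'s mat" assume G: "dim_col G = 1"
    show "\<exists>H G' H'. row_basis G H G' H'"
    proof (cases "\<exists>i<dim_row G. G $$ (i, 0) \<notin> kernel")
      case True
      then obtain i b where i: "i < dim_row G" "b * G $$ (i, 0) - 1 \<in> kernel" using inv by blast
      let ?H' = "mat 1 (dim_row G) (\<lambda>(_, j). if j = i then b else 0)"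
      have "(?H' * G) $$ (0, 0) = b * G $$ (i, 0)"
        using i G by (simp add: mult_index if_distrib[of "\<lambda>x. x * _"] cong: if_cong del: index_mult_mat(1))
      then have "1\<^sub>m 1 \<doteq> ?H' * G" using uminus_N[OF i(2)] G by (simp add: cg_def del: index_mult_mat(1))
      moreover have "G * 1\<^sub>m 1 = G" using right_mult_one_mat'[of G] G by simp
      ultimately have "row_basis G (1\<^sub>m 1) G ?H'"
        using G by (auto simp: row_basis_def indep_def right_mult_one_mat')
      then show ?thesis by blast
    next
      case False
      have "row_basis G (0\<^sub>m 0 1) (0\<^sub>m (dim_row G) 0) (0\<^sub>m 0 (dim_row G))"
        using G False by (auto simp: row_basis_def indep_def cg_def mult_index simp del: index_mult_mat(1))
      then show ?thesis by blast
    qed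
  qed (rule rank_condition_of_ore[OF one dom ore])
qed

definition column_ideal :: "'s mat => 'a set" where
  "column_ideal u = range (\<lambda>c. e (\<Sum>i\<in>{0..<dim_row u}. c i * u $$ (i, 0)))"

lemma column_ideal_carrier: "column_ideal u \<subseteq> carrier R" by (auto simp: column_ideal_def)

lemma left_ideal_column_ideal: "left_ideal R (column_ideal u)"
proof -
  let ?f = "\<lambda>c. \<Sum>i\<in>{0..<dim_row u}. c i * u $$ (i, 0)"
  have mem: "e (?f c) \<in> column_ideal u" for c unfolding column_ideal_def by (rule rangeI)
  have ex: "\<exists>c. x = e (?f c)" if "x \<in> column_ideal u" for x using that by (auto simp: column_ideal_def)
  have add: "x \<oplus> y \<in> column_ideal u" if xy: "x \<in> column_ideal u" "y \<in> column_ideal u" for x y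
  proof -
    obtain c d where "x = e (?f c)" "y = e (?f d)" using ex[OF xy(1)] ex[OF xy(2)] by blast
    then have "x \<oplus> y = e (?f (\<lambda>i. c i + d i))" by (simp add: sum.distrib distrib_right flip: e_add)
    then show ?thesis using mem by simp
  qed
  have mult: "a \<otimes> x \<in> column_ideal u" if x: "x \<in> column_ideal u" and a: "a \<in> carrier R" for a x
  proof -
    obtain c where x: "x = e (?f c)" using ex[OF x] by blast
    have "?f (\<lambda>i. s a * c i) = s a * ?f c" by (simp add: sum_distrib_left mult.assoc)
    then have "a \<otimes> x = e (?f (\<lambda>i. s a * c i))" using a x by (simp add: e_mult e_s)
    then show ?thesis using mem by simp
  qed
  have zero: "\<zero> \<in> column_ideal u" using mem[of "\<lambda>_. 0"] by (simp add: e_zero)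
  have neg: "\<ominus> x \<in> column_ideal u" if "x \<in> column_ideal u" for x
    using mult[OF that, of "\<ominus> \<one>"] subsetD[OF column_ideal_carrier that] by (simp add: R.l_minus)
  show ?thesis
    unfolding left_ideal_def
    using add mult zero neg subsetD[OF column_ideal_carrier[of u]]
    by (auto intro!: additive_subgroup.intro subgroup.intro simp: a_inv_def[symmetric])
qed

lemma left_basis_finsum:
  assumes "finite F" "F \<subseteq> carrier R" "c \<in> F \<rightarrow> carrier R"
  shows "(\<Oplus>b\<in>F. c b \<otimes> b) = e (\<Sum>b\<in>F. s (c b) * s b)"
proof -
  have "(\<Oplus>b\<in>F. c b \<otimes> b) = (\<Oplus>b\<in>F. e (s (c b) * s b))"
    using assms by (intro R.finsum_cong') (auto simp: e_mult e_s Pi_iff subset_iff)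
  then show ?thesis using assms(1) by (simp add: e_sum)
qed

lemma left_basis_iff:
  assumes L: "L \<subseteq> carrier R"
  shows "left_basis R L B \<longleftrightarrow> B \<subseteq> L \<and> (\<forall>x\<in>L. \<exists>F c. finite F \<and> F \<subseteq> B \<and> x = e (\<Sum>b\<in>F. c b * s b)) \<and>
     (\<forall>F c. finite F \<and> F \<subseteq> B \<and> (\<Sum>b\<in>F. c b * s b) \<in> kernel --> (\<forall>b\<in>F. c b \<in> kernel))"
proof (cases "B \<subseteq> L")
  case True
  have eq: "e (\<Sum>b\<in>F. c b * s b) = (\<Oplus>b\<in>F. e (c b) \<otimes> b)" if "finite F" "F \<subseteq> B" for F c
  proof -
    have "e (\<Sum>b\<in>F. c b * s b) = (\<Oplus>b\<in>F. e (c b) \<otimes> e (s b))" using that by (simp add: e_sum e_mult)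
    also have "\<dots> = (\<Oplus>b\<in>F. e (c b) \<otimes> b)" using that True L by (intro R.finsum_cong') (auto simp: e_s subset_iff)
    finally show ?thesis .
  qed
  have eq2: "(\<Oplus>b\<in>F. c b \<otimes> b) = e (\<Sum>b\<in>F. s (c b) * s b)" if "finite F" "F \<subseteq> B" "c \<in> F \<rightarrow> carrier R" for F c
    using that True L by (intro left_basis_finsum) auto
  have gen: "(\<exists>F c. finite F \<and> F \<subseteq> B \<and> c \<in> F \<rightarrow> carrier R \<and> x = (\<Oplus>b\<in>F. c b \<otimes> b)) \<longleftrightarrow>
    (\<exists>F c. finite F \<and> F \<subseteq> B \<and> x = e (\<Sum>b\<in>F. c b * s b))" for x
  proof (intro iffI; elim exE conjE)
    fix F c assume "finite F" "F \<subseteq> B" "c \<in> F \<rightarrow> carrier R" "x = (\<Oplus>b\<in>F. c b \<otimes> b)"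
    then show "\<exists>F c. finite F \<and> F \<subseteq> B \<and> x = e (\<Sum>b\<in>F. c b * s b)"
      by (intro exI[of _ F] exI[of _ "\<lambda>b. s (c b)"] conjI) (simp_all add: eq2)
  next
    fix F c assume "finite F" "F \<subseteq> B" "x = e (\<Sum>b\<in>F. c b * s b)"
    then show "\<exists>F c. finite F \<and> F \<subseteq> B \<and> c \<in> F \<rightarrow> carrier R \<and> x = (\<Oplus>b\<in>F. c b \<otimes> b)"
      by (intro exI[of _ F] exI[of _ "\<lambda>b. e (c b)"] conjI) (simp_all add: eq)
  qed
  have ind: "(\<forall>F c. finite F \<and> F \<subseteq> B \<and> c \<in> F \<rightarrow> carrier R \<and> (\<Oplus>b\<in>F. c b \<otimes> b) = \<zero> --> (\<forall>b\<in>F. c b = \<zero>)) \<longleftrightarrow>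
     (\<forall>F c. finite F \<and> F \<subseteq> B \<and> (\<Sum>b\<in>F. c b * s b) \<in> kernel --> (\<forall>b\<in>F. c b \<in> kernel))" (is "?l \<longleftrightarrow> ?r")
  proof (intro iffI allI impI ballI; elim conjE)
    fix F c b assume l: ?l and F: "finite F" "F \<subseteq> B" "(\<Sum>b\<in>F. c b * s b) \<in> kernel" "b \<in> F"
    have "(\<lambda>b. e (c b)) \<in> F \<rightarrow> carrier R" "(\<Oplus>b\<in>F. e (c b) \<otimes> b) = \<zero>" using F eq[OF F(1,2), of c] by (simp_all add: kernel_iff0)
    then have "\<forall>b\<in>F. e (c b) = \<zero>"
      using F(1,2) by (intro mp[OF spec[OF spec[OF l, of F], of "\<lambda>b. e (c b)"]] conjI)
    with F(4) show "c b \<in> kernel" by (simp add: kernel_iff0)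
  next
    fix F c b assume r: ?r and F: "finite F" "F \<subseteq> B" "c \<in> F \<rightarrow> carrier R" "(\<Oplus>b\<in>F. c b \<otimes> b) = \<zero>" "b \<in> F"
    have "(\<Sum>b\<in>F. s (c b) * s b) \<in> kernel" using F by (simp add: kernel_iff0 eq2)
    then have "\<forall>b\<in>F. s (c b) \<in> kernel"
      using F(1,2) by (intro mp[OF spec[OF spec[OF r, of F], of "\<lambda>b. s (c b)"]] conjI)
    with F(3,5) show "c b = \<zero>" by (simp add: kernel_iff0 e_s Pi_iff)
  qed
  show ?thesis unfolding left_basis_def gen ind by blast
qed (auto simp: left_basis_def)

text \<open>Independent columns of matrices are the finite bases of left ideals; this translates the uniqueness of ranks.\<close>

lemma column_basis:
  assumes one: "1 \<notin> kernel" and u: "indep u" "dim_col u = 1"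
  shows "\<exists>B. left_basis R (column_ideal u) B \<and> finite B \<and> card B = dim_row u"
proof -
  define a where "a = dim_row u"
  define f where "f = (\<lambda>i. e (u $$ (i, 0)))"
  have ind: "\<forall>i<a. c i \<in> kernel" if "(\<Sum>i\<in>{0..<a}. c i * u $$ (i, 0)) \<in> kernel" for c
    using u(1) that unfolding indep_column[OF u(2)] a_def by blast
  have inj: "inj_on f {0..<a}"
  proof (rule inj_onI, rule ccontr)
    fix i j assume ij: "i \<in> {0..<a}" "j \<in> {0..<a}" "f i = f j" "i \<noteq> j"
    let ?c = "\<lambda>k. if k = i then 1 else if k = j then -1 else 0"
    have "(\<Sum>k\<in>{0..<a}. ?c k * u $$ (k, 0)) = (\<Sum>k\<in>{i, j}. ?c k * u $$ (k, 0))"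
      using ij by (intro sum.mono_neutral_right) auto
    also have "\<dots> = u $$ (i, 0) - u $$ (j, 0)" using ij by simp
    also have "\<dots> \<in> kernel" using ij by (simp add: kernel_iff f_def)
    finally have "\<forall>k<a. ?c k \<in> kernel" by (rule ind)
    with ij(1) one show False by auto
  qed
  have "left_basis R (column_ideal u) (f ` {0..<a})"
    unfolding left_basis_iff[OF column_ideal_carrier]
  proof (intro conjI ballI allI impI)
    show "f ` {0..<a} \<subseteq> column_ideal u"
    proof (rule image_subsetI)
      fix i assume i: "i \<in> {0..<a}"
      have "f i = e (\<Sum>j\<in>{0..<dim_row u}. (if j = i then 1 else 0) * u $$ (j, 0))"
        using i by (simp add: f_def a_def if_distrib[of "\<lambda>x. x * _"] cong: if_cong)
      then show "f i \<in> column_ideal u" unfolding column_ideal_def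
        by (rule range_eqI[where x = "\<lambda>j. if j = i then 1 else 0"])
    qed
  next
    fix x assume "x \<in> column_ideal u"
    then obtain c where x: "x = e (\<Sum>i\<in>{0..<a}. c i * u $$ (i, 0))" by (auto simp: column_ideal_def a_def)
    let ?c = "\<lambda>b. c (the_inv_into {0..<a} f b)"
    have "(\<Sum>b\<in>f ` {0..<a}. ?c b * s b) = (\<Sum>i\<in>{0..<a}. c i * s (f i))"
      using inj by (simp add: sum.reindex the_inv_into_f_f)
    moreover have "e (\<Sum>i\<in>{0..<a}. c i * s (f i)) = x"
      unfolding x by (simp add: e_sum e_mult e_s f_def)
    ultimately show "\<exists>F c. finite F \<and> F \<subseteq> f ` {0..<a} \<and> x = e (\<Sum>b\<in>F. c b * s b)"
      by (intro exI[of _ "f ` {0..<a}"] exI[of _ ?c]) simp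
  next
    fix F c b assume F: "finite F \<and> F \<subseteq> f ` {0..<a} \<and> (\<Sum>b\<in>F. c b * s b) \<in> kernel" and b: "b \<in> F"
    let ?c = "\<lambda>i. if f i \<in> F then c (f i) else 0"
    have "e (\<Sum>i\<in>{0..<a}. ?c i * u $$ (i, 0)) = e (\<Sum>i\<in>{0..<a}. ?c i * s (f i))"
      by (simp add: e_sum e_mult e_s f_def)
    also have "(\<Sum>i\<in>{0..<a}. ?c i * s (f i)) = (\<Sum>b\<in>f ` {0..<a}. (if b \<in> F then c b else 0) * s b)"
      using inj by (simp add: sum.reindex)
    also have "\<dots> = (\<Sum>b\<in>F. c b * s b)" using F by (intro sum.mono_neutral_cong_right) auto
    also have "e \<dots> = \<zero>" using F by (simp add: kernel_iff0)
    finally have "\<forall>i<a. ?c i \<in> kernel" by (intro ind) (simp add: kernel_iff0)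
    moreover from F b obtain i where "i < a" "b = f i" by auto
    ultimately show "c b \<in> kernel" using b by auto
  qed
  moreover have "card (f ` {0..<a}) = dim_row u" using card_image[OF inj] by (simp add: a_def)
  ultimately show ?thesis by (intro exI[of _ "f ` {0..<a}"]) simp
qed

lemma column_ideal_mult:
  assumes "v \<doteq> P * u" "dim_col P = dim_row u" "dim_col u = 1"
  shows "column_ideal v \<subseteq> column_ideal u"
proof
  fix x assume "x \<in> column_ideal v"
  then obtain c where x: "x = e (\<Sum>i\<in>{0..<dim_row v}. c i * v $$ (i, 0))" by (auto simp: column_ideal_def)
  have d: "dim_row v = dim_row P" "dim_col v = 1" using cg_dim[OF assms(1)] assms(3) by simp_all
  have A1: "e (\<Sum>i\<in>{0..<dim_row v}. c i * v $$ (i, 0)) = e (\<Sum>i\<in>{0..<dim_row v}. c i * (P * u) $$ (i, 0))"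
  proof -
    have "e (v $$ (i, 0)) = e ((P * u) $$ (i, 0))" if "i < dim_row v" for i
      using cg_entry[OF assms(1), of i 0] that d by (simp add: kernel_iff del: index_mult_mat(1))
    then have "e (c i * v $$ (i, 0)) = e (c i * (P * u) $$ (i, 0))" if "i < dim_row v" for i
      using that by (simp only: e_mult)
    then show ?thesis unfolding e_sum[OF finite_atLeastLessThan] by (intro R.finsum_cong') auto
  qed
  have A2: "(\<Sum>i\<in>{0..<dim_row v}. c i * (P * u) $$ (i, 0)) = (\<Sum>i\<in>{0..<dim_row v}. \<Sum>k\<in>{0..<dim_row u}. c i * P $$ (i, k) * u $$ (k, 0))"
    using d assms(2,3) by (simp add: mult_index sum_distrib_left mult.assoc del: index_mult_mat(1))
  have A3: "(\<Sum>i\<in>{0..<dim_row v}. \<Sum>k\<in>{0..<dim_row u}. c i * P $$ (i, k) * u $$ (k, 0)) = (\<Sum>k\<in>{0..<dim_row u}. (\<Sum>i\<in>{0..<dim_row v}. c i * P $$ (i, k)) * u $$ (k, 0))"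
    by (subst sum.swap) (simp add: sum_distrib_right)
  from A1 show "x \<in> column_ideal u" unfolding x A2 A3 column_ideal_def
    by (rule range_eqI[where x = "\<lambda>k. \<Sum>i\<in>{0..<dim_row v}. c i * P $$ (i, k)"])
qed

lemma left_fir_sylvester:
  assumes fir: "left_fir R"
  shows "1 \<notin> kernel" "sylvester"
proof -
  have basis: "(\<exists>B. left_basis R L B) \<and> (\<forall>B B'. left_basis R L B \<and> left_basis R L B' --> B \<approx> B')"
    if L: "left_ideal R L" for L
    using fir[unfolded left_fir_def, THEN spec[of _ L]] L by (rule mp)
  have basis_ex: "\<exists>B. left_basis R L B" if "left_ideal R L" for L using basis[OF that] by (rule conjunct1)
  have basis_eq: "B \<approx> B'" if L: "left_ideal R L" and B: "left_basis R L B" "left_basis R L B'" for L B B'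
  proof -
    from basis[OF L] have "\<forall>B B'. left_basis R L B \<and> left_basis R L B' --> B \<approx> B'" by (rule conjunct2)
    from mp[OF spec[OF spec[OF this, of B], of B'] conjI[OF B]] show ?thesis .
  qed
  show one: "1 \<notin> kernel"
  proof
    assume "1 \<in> kernel"
    then have "a \<in> kernel" for a using mult_N(2)[of 1 a] by simp
    then have triv: "carrier R = {\<zero>}" using range_e by (auto simp: kernel_iff0)
    have "left_ideal R {\<zero>}"
      unfolding left_ideal_def by (auto intro!: additive_subgroup.intro subgroup.intro simp: a_inv_def[symmetric])
    note L = this
    have "left_basis R {\<zero>} B" if B: "B \<subseteq> {\<zero>}" for B
      unfolding left_basis_def
    proof (intro conjI ballI allI impI)
      fix x assume "x \<in> {\<zero>}"
      then show "\<exists>F c. finite F \<and> F \<subseteq> B \<and> c \<in> F \<rightarrow> carrier R \<and> x = (\<Oplus>b\<in>F. c b \<otimes> b)"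
        by (intro exI[of _ "{}"]) simp
    next
      fix F c b assume "finite F \<and> F \<subseteq> B \<and> c \<in> F \<rightarrow> carrier R \<and> (\<Oplus>b\<in>F. c b \<otimes> b) = \<zero>" "b \<in> F"
      then have "c b \<in> carrier R" by (simp add: Pi_iff)
      then show "c b = \<zero>" by (simp add: triv)
    qed (rule B)
    then have "left_basis R {\<zero>} {}" "left_basis R {\<zero>} {\<zero>}" by simp_all
    from basis_eq[OF L this] have "({} :: 'a set) \<approx> {\<zero>}" .
    then show False by (simp add: eqpoll_def bij_betw_def)
  qed
  show sylvester
  proof (rule sylvester_of_rank[OF one])
    fix u v P Q :: "'s mat"
    assume u: "indep u" "dim_col u = 1" and v: "indep v" "dim_col v = 1" and d: "dim_col P = dim_row v" "dim_col Q = dim_row u"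
      and eq: "u \<doteq> P * v" "v \<doteq> Q * u"
    have uv: "column_ideal u = column_ideal v"
      using column_ideal_mult[OF eq(1) d(1) v(2)] column_ideal_mult[OF eq(2) d(2) u(2)] by blast
    obtain B where B: "left_basis R (column_ideal u) B" "finite B" "card B = dim_row u"
      using column_basis[OF one u] by blast
    obtain B' where B': "left_basis R (column_ideal v) B'" "finite B'" "card B' = dim_row v"
      using column_basis[OF one v] by blast
    have "B \<approx> B'" by (rule basis_eq[OF left_ideal_column_ideal[of v] B(1)[unfolded uv] B'(1)])
    then have "card B = card B'" using eqpoll_iff_card[OF B(2) B'(2)] by simp
    then show "dim_row u = dim_row v" using B(3) B'(3) by simp
  next
    fix G :: "'s mat" assume G: "dim_col G = 1"
    define q where "q = dim_row G"
    let ?L = "column_ideal G"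
    obtain B where "left_basis R ?L B" using basis_ex[OF left_ideal_column_ideal[of G]] by blast
    then have BL: "B \<subseteq> ?L" and gen: "\<And>x. x \<in> ?L ==> \<exists>F c. finite F \<and> F \<subseteq> B \<and> x = e (\<Sum>b\<in>F. c b * s b)"
      and ind: "\<And>F c b. finite F ==> F \<subseteq> B ==> (\<Sum>b\<in>F. c b * s b) \<in> kernel ==> b \<in> F ==> c b \<in> kernel"
      unfolding left_basis_iff[OF column_ideal_carrier] by blast+
    have GL: "e (G $$ (i, 0)) \<in> ?L" if "i < q" for i
    proof -
      have "e (G $$ (i, 0)) = e (\<Sum>j\<in>{0..<dim_row G}. (if j = i then 1 else 0) * G $$ (j, 0))"
        using that by (simp add: q_def if_distrib[of "\<lambda>x. x * _"] cong: if_cong)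
      then show ?thesis unfolding column_ideal_def
        by (rule range_eqI[where x = "\<lambda>j. if j = i then 1 else 0"])
    qed
    have "\<forall>i. \<exists>F c. i < q --> finite F \<and> F \<subseteq> B \<and> e (G $$ (i, 0)) = e (\<Sum>b\<in>F. c b * s b)"
    proof
      fix i
      show "\<exists>F c. i < q --> finite F \<and> F \<subseteq> B \<and> e (G $$ (i, 0)) = e (\<Sum>b\<in>F. c b * s b)"
      proof (cases "i < q")
        case True
        from gen[OF GL[OF this]] show ?thesis by (elim exE) (rule exI, rule exI, rule impI)
      qed simp
    qed
    then obtain F c where Fc: "\<And>i. i < q ==> finite (F i) \<and> F i \<subseteq> B \<and> e (G $$ (i, 0)) = e (\<Sum>b\<in>F i. c i b * s b)" by metis
    define S where "S = (\<Union>i<q. F i)"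
    have S: "finite S" "S \<subseteq> B" using Fc by (auto simp: S_def)
    obtain fs where fs: "set fs = S" "distinct fs" using finite_distinct_list[OF S(1)] by blast
    define a where "a = length fs"
    have bij: "bij_betw (\<lambda>j. fs ! j) {0..<a} S" using bij_betw_nth[OF fs(2), of "{0..<a}" S] fs(1) by (auto simp: a_def atLeast0LessThan)
    define H where "H = mat a 1 (\<lambda>(j, _). s (fs ! j))"
    define G' where "G' = mat q a (\<lambda>(i, j). if fs ! j \<in> F i then c i (fs ! j) else 0)"
    have "\<forall>j. \<exists>d. j < a --> fs ! j = e (\<Sum>i\<in>{0..<q}. d i * G $$ (i, 0))"
      
    proof (intro allI)
      fix j
      show "\<exists>d. j < a --> fs ! j = e (\<Sum>i\<in>{0..<q}. d i * G $$ (i, 0))"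
      proof (cases "j < a")
        case True
        then have "fs ! j \<in> set fs" by (simp add: a_def)
        then have "fs ! j \<in> ?L" using BL S(2) fs(1) by blast
        then show ?thesis by (auto simp: column_ideal_def q_def)
      qed simp
    qed
    then obtain d where d: "\<And>j. j < a ==> fs ! j = e (\<Sum>i\<in>{0..<q}. d j i * G $$ (i, 0))" by metis
    define H' where "H' = mat a q (\<lambda>(j, i). d j i)"
    have sum_fs: "(\<Sum>j\<in>{0..<a}. h (fs ! j) * s (fs ! j)) = (\<Sum>b\<in>S. h b * s b)" for h
      using sum.reindex_bij_betw[OF bij, of "\<lambda>b. h b * s b"] by simp
    have [simp]: "dim_row G = q" by (simp add: q_def)
    have "G \<doteq> G' * H"
      unfolding cg_def
    proof (intro conjI allI impI)
      fix i j assume "i < dim_row G" "j < dim_col G"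
      then have ij: "i < q" "j = 0" using G by auto
      have "(G' * H) $$ (i, 0) = (\<Sum>j\<in>{0..<a}. (if fs ! j \<in> F i then c i (fs ! j) else 0) * s (fs ! j))"
        using ij by (simp add: mult_index G'_def H_def del: index_mult_mat(1))
      also have "\<dots> = (\<Sum>b\<in>S. (if b \<in> F i then c i b else 0) * s b)" by (rule sum_fs)
      also have "\<dots> = (\<Sum>b\<in>F i. c i b * s b)" using ij S by (intro sum.mono_neutral_cong_right) (auto simp: S_def)
      finally show "G $$ (i, j) - (G' * H) $$ (i, j) \<in> kernel" using Fc[OF ij(1)] ij(2) by (simp add: kernel_iff del: index_mult_mat(1))
    qed (simp_all add: G'_def H_def G)
    moreover have "H \<doteq> H' * G"
      unfolding cg_def
    proof (intro conjI allI impI)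
      fix i j assume "i < dim_row H" "j < dim_col H"
      then have ij: "i < a" "j = 0" by (auto simp: H_def)
      have "fs ! i \<in> carrier R" using d[OF ij(1)] by simp
      then show "H $$ (i, j) - (H' * G) $$ (i, j) \<in> kernel"
        using ij G d[OF ij(1)] by (simp add: kernel_iff mult_index H_def H'_def e_s del: index_mult_mat(1))
    qed (simp_all add: H'_def H_def G)
    moreover have "indep H"
    proof (subst indep_column; (intro allI impI)?)
      fix x i assume 0: "(\<Sum>i\<in>{0..<dim_row H}. x i * H $$ (i, 0)) \<in> kernel" and i: "i < dim_row H"
      let ?x = "\<lambda>b. x (the_inv_into {0..<a} (\<lambda>j. fs ! j) b)"
      have inv: "?x (fs ! j) = x j" if "j < a" for j
        using the_inv_into_f_f[OF bij_betw_imp_inj_on[OF bij], of j] that by simp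
      have "(\<Sum>i\<in>{0..<dim_row H}. x i * H $$ (i, 0)) = (\<Sum>j\<in>{0..<a}. ?x (fs ! j) * s (fs ! j))"
        by (intro sum.cong) (auto simp: inv H_def)
      also have "\<dots> = (\<Sum>b\<in>S. ?x b * s b)" by (rule sum_fs)
      finally have "(\<Sum>b\<in>S. ?x b * s b) \<in> kernel" using 0 by simp
      from ind[OF S this, of "fs ! i"] i show "x i \<in> kernel" using inv[of i] fs(1) nth_mem[of i fs] by (simp add: H_def a_def)
    qed (simp add: H_def)
    ultimately have "row_basis G H G' H'" using G by (simp add: row_basis_def H_def G'_def H'_def)
    then show "\<exists>H G' H'. row_basis G H G' H'" by blast
  qed
qed

end


section \<open>Domains of rational expressions\<close>

definition point :: "nat => ('x => 'k :: field mat) => bool" where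
  "point n A \<longleftrightarrow> 0 < n \<and> (\<forall>x. A x \<in> carrier_mat n n)"

lemma pointD: "point n A ==> A x \<in> carrier_mat n n" "point n A ==> 0 < n"
  by (simp_all add: point_def)

lemma point_dim: "point n A ==> dim_row (A x) = n" "point n A ==> dim_col (A x) = n"
  using pointD(1)[of n A x] by auto

definition blow :: "nat => ('x => 'k :: field mat) => 'x => 'k mat" where
  "blow m A = (\<lambda>x. kron (A x) (1\<^sub>m m))"

definition line :: "('x => 'k :: field mat) => ('x => 'k mat) => 'k => 'x => 'k mat" where
  "line A B t = (\<lambda>x. A x + t \<cdot>\<^sub>m (B x - A x))"

lemma point_blow:
  assumes "point n A" "0 < m"
  shows "point (n * m) (blow m A)"
  using assms(2) point_dim[OF assms(1)] pointD(2)[OF assms(1)] by (auto simp: blow_def point_def intro!: carrier_matI)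

lemma point_line:
  assumes "point n A" "point n B"
  shows "point n (line A B t)"
  using point_dim[OF assms(1)] point_dim[OF assms(2)] pointD(2)[OF assms(1)] by (auto simp: line_def point_def intro!: carrier_matI)

lemma line_0: "point n A ==> point n B ==> line A B 0 = A"
  by (auto simp: line_def fun_eq_iff point_dim intro!: eq_matI)

lemma line_swap: "point n A ==> point n B ==> line B A (1 - t) = line A B t"
  by (auto simp: line_def fun_eq_iff algebra_simps point_dim intro!: eq_matI)

text \<open>A substitute for nonempty Zariski open sets across all matrix sizes: points of different sizes are brought to the same size
  by direct sums with themselves, and then joined by a line. Hence any finitely many generic conditions can be met simultaneously.\<close>

definition generic :: "(nat => ('x => 'k :: field mat) => bool) => bool" where
  "generic U \<longleftrightarrow> (\<exists>n A. point n A \<and> U n A) \<and>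
     (\<forall>n A m. point n A --> U n A --> 0 < m --> U (n * m) (blow m A)) \<and>
     (\<forall>n A B. point n A --> point n B --> U n A --> finite {t. \<not> U n (line A B t)})"

lemma genericI:
  assumes "point n A" "U n A" "\<And>n A m. point n A ==> U n A ==> 0 < m ==> U (n * m) (blow m A)"
    "\<And>n A B. point n A ==> point n B ==> U n A ==> finite {t. \<not> U n (line A B t)}"
  shows "generic U"
  unfolding generic_def using assms(1,2) by (intro conjI allI impI exI[of _ n] exI[of _ A] assms(3,4))

lemma generic_blow: "generic U ==> point n A ==> U n A ==> 0 < m ==> U (n * m) (blow m A)"
  by (simp add: generic_def)

lemma generic_line: "generic U ==> point n A ==> point n B ==> U n A ==> finite {t. \<not> U n (line A B t)}"
  by (simp add: generic_def)

lemma generic_line_end: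
  assumes U: "generic U" and A: "point n A" and B: "point n B" "U n B"
  shows "finite {t. \<not> U n (line A B t)}"
proof (rule finite_subset)
  show "finite ((\<lambda>t. 1 - t) ` {t. \<not> U n (line B A t)})" by (intro finite_imageI generic_line[OF U B(1) A B(2)])
  show "{t. \<not> U n (line A B t)} \<subseteq> (\<lambda>t. 1 - t) ` {t. \<not> U n (line B A t)}"
  proof
    fix t assume "t \<in> {t. \<not> U n (line A B t)}"
    then have "1 - t \<in> {t. \<not> U n (line B A t)}" by (simp add: line_swap[OF A B(1)])
    then have "1 - (1 - t) \<in> (\<lambda>t. 1 - t) ` {t. \<not> U n (line B A t)}" by (rule imageI)
    then show "t \<in> (\<lambda>t. 1 - t) ` {t. \<not> U n (line B A t)}" by simp
  qed
qed

lemma generic_obtains: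
  assumes "generic U"
  obtains n A where "point n A" "U n A"
  using assms unfolding generic_def by blast

lemma generic_conj:
  fixes U U' :: "nat => ('x => 'k :: field_char_0 mat) => bool"
  assumes U: "generic U" and U': "generic U'"
  shows "generic (\<lambda>n A. U n A \<and> U' n A)"
proof -
  obtain n A where A: "point n A" "U n A" using U by (rule generic_obtains)
  obtain n' A' where A': "point n' A'" "U' n' A'" using U' by (rule generic_obtains)
  let ?B = "blow n' A" and ?B' = "blow n A'"
  have B: "point (n * n') ?B" "U (n * n') ?B"
    using point_blow[OF A(1)] generic_blow[OF U A] pointD(2)[OF A'(1)] by auto
  have B': "point (n * n') ?B'" "U' (n * n') ?B'"
    using point_blow[OF A'(1), of n] generic_blow[OF U' A', of n] pointD(2)[OF A(1)] unfolding mult.commute[of n' n] by auto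
  have "finite {t. \<not> U (n * n') (line ?B ?B' t)}" by (rule generic_line[OF U B(1) B'(1) B(2)])
  moreover have "finite {t. \<not> U' (n * n') (line ?B ?B' t)}" by (rule generic_line_end[OF U' B(1) B'])
  ultimately have "finite ({t. \<not> U (n * n') (line ?B ?B' t)} \<union> {t. \<not> U' (n * n') (line ?B ?B' t)})" by simp
  then obtain t where "t \<notin> {t. \<not> U (n * n') (line ?B ?B' t)} \<union> {t. \<not> U' (n * n') (line ?B ?B' t)}"
    using infinite_UNIV_char_0 ex_new_if_finite by metis
  then have t: "U (n * n') (line ?B ?B' t)" "U' (n * n') (line ?B ?B' t)" by auto
  show ?thesis
  proof (rule genericI[OF point_line[OF B(1) B'(1)]])
    show "U (n * n') (line ?B ?B' t) \<and> U' (n * n') (line ?B ?B' t)" using t by simp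
  next
    fix n m :: nat and A :: "'x => 'k mat" assume "point n A" "U n A \<and> U' n A" "0 < m"
    then show "U (n * m) (blow m A) \<and> U' (n * m) (blow m A)" using generic_blow[OF U] generic_blow[OF U'] by auto
  next
    fix n and A B :: "'x => 'k mat" assume AB: "point n A" "point n B" "U n A \<and> U' n A"
    have "{t. \<not> (U n (line A B t) \<and> U' n (line A B t))} = {t. \<not> U n (line A B t)} \<union> {t. \<not> U' n (line A B t)}" by auto
    then show "finite {t. \<not> (U n (line A B t) \<and> U' n (line A B t))}"
      using generic_line[OF U AB(1,2)] generic_line[OF U' AB(1,2)] AB(3) by simp
  qed
qed

lemma generic_ball:
  fixes U :: "'i => nat => ('x => 'k :: field_char_0 mat) => bool"
  assumes "finite S" "generic V" "\<And>i. i \<in> S ==> generic (U i)"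
  shows "generic (\<lambda>n A. V n A \<and> (\<forall>i\<in>S. U i n A))"
  using assms
proof (induction S rule: finite_induct)
  case (insert i S)
  then have "generic (\<lambda>n A. V n A \<and> (\<forall>i\<in>S. U i n A))" "generic (U i)" by auto
  from generic_conj[OF this] have "generic (\<lambda>n A. (V n A \<and> (\<forall>i\<in>S. U i n A)) \<and> U i n A)" .
  also have "(\<lambda>n A. (V n A \<and> (\<forall>i\<in>S. U i n A)) \<and> U i n A) = (\<lambda>n A. V n A \<and> (\<forall>i\<in>insert i S. U i n A))" by auto
  finally show ?case .
qed simp

lemma kron_one_right_mult:
  fixes A B :: "'k :: field mat"
  shows "dim_col A = dim_row B ==> kron (A * B) (1\<^sub>m m) = kron A (1\<^sub>m m) * kron B (1\<^sub>m m)"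
  using kron_mult[of A B "1\<^sub>m m" "1\<^sub>m m"] by simp

lemma kron_add:
  fixes A B :: "'k :: field mat"
  shows "dim_row A = dim_row B ==> dim_col A = dim_col B ==> kron (A + B) C = kron A C + kron B C"
  using divmod_less by (intro eq_matI) (auto simp: kron_index distrib_right)

context
  fixes n :: nat and A :: "'x => 'k :: field mat" and m :: nat
  assumes A: "point n A" and m: "0 < m"
begin

lemma nc_poly_eval_blow: "nc_poly_eval (n * m) (blow m A) p = kron (nc_poly_eval n A p) (1\<^sub>m m)"
proof (induction p rule: nc_poly_induct)
  case (single w c)
  note A' = pointD(1)[OF point_blow[OF A m]] and A1 = pointD(1)[OF A]
  have "nc_word_eval (n * m) (blow m A) (NC_Word xs) = kron (nc_word_eval n A (NC_Word xs)) (1\<^sub>m m)" for xs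
  proof (induction xs)
    case Nil
    show ?case by (simp add: nc_word_eval_def kron_one)
  next
    case (Cons x xs)
    have "nc_word_eval n A (NC_Word (x # xs)) = A x * nc_word_eval n A (NC_Word xs)" by (simp add: nc_word_eval_def)
    moreover have "nc_word_eval (n * m) (blow m A) (NC_Word (x # xs)) = kron (A x) (1\<^sub>m m) * nc_word_eval (n * m) (blow m A) (NC_Word xs)"
      by (simp add: nc_word_eval_def blow_def)
    ultimately show ?case using Cons A1[of x] nc_word_eval_carrier[where A = A and n = n, OF A1, of "NC_Word xs"]
      by (simp add: kron_one_right_mult)
  qed
  then have "nc_word_eval (n * m) (blow m A) w = kron (nc_word_eval n A w) (1\<^sub>m m)" by (cases w) simp
  then show ?case
    using nc_word_eval_carrier[where A = A and n = n, OF A1, of w] divmod_less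
    by (simp add: nc_poly_eval_single[OF A'] nc_poly_eval_single[OF A1]) (intro eq_matI; auto simp: kron_index)
next
  case (add p q)
  then show ?case by (simp add: nc_poly_eval_add[OF pointD(1)[OF A]] nc_poly_eval_add[OF pointD(1)[OF point_blow[OF A m]]] kron_add)
qed (auto intro!: eq_matI simp: kron_index divmod_less nc_poly_eval_def)

lemma mev_blow: "mev (n * m) (blow m A) M = kron (mev n A M) (1\<^sub>m m)"
proof (rule eq_matI)
  fix i j assume "i < dim_row (kron (mev n A M) (1\<^sub>m m))" "j < dim_col (kron (mev n A M) (1\<^sub>m m))"
  then have ij: "i < dim_row M * n * m" "j < dim_col M * n * m" by simp_all
  then have ij': "i < dim_row M * (n * m)" "j < dim_col M * (n * m)" by (simp_all add: mult.assoc)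
  note dm = divmod_less[OF ij(1)] divmod_less[OF ij(2)]
  note dm' = divmod_less[OF dm(1)] divmod_less[OF dm(3)] divmod_less[OF ij'(1)] divmod_less[OF ij'(2)]
  have "k mod (n * m) div m = k div m mod n" "k mod (n * m) mod m = k mod m" "k div (n * m) = k div m div n" for k
    using m by (simp_all add: mod_mult2_eq div_mult2_eq mult.commute[of n m])
  then show "mev (n * m) (blow m A) M $$ (i, j) = kron (mev n A M) (1\<^sub>m m) $$ (i, j)"
    using ij ij' dm dm' by (simp add: mev_index kron_index nc_poly_eval_blow)
qed (simp_all add: mult.assoc)

end

lemma mat_inverse_iff:
  fixes M :: "'k :: field mat"
  assumes M: "M \<in> carrier_mat n n"
  shows "mat_inverse M = Some K \<longleftrightarrow> K \<in> carrier_mat n n \<and> M * K = 1\<^sub>m n"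
proof
  assume K: "K \<in> carrier_mat n n \<and> M * K = 1\<^sub>m n"
  then have KM: "K * M = 1\<^sub>m n" using mat_mult_left_right_inverse[OF M] by blast
  have "mat_inverse M \<noteq> None"
  proof
    assume "mat_inverse M = None"
    from mat_inverse(1)[OF M this, of undefined] K KM M show False
      by (auto simp: Units_def ring_mat_def)
  qed
  then obtain L where L: "mat_inverse M = Some L" by blast
  from mat_inverse(2)[OF M L] have L': "L \<in> carrier_mat n n" "M * L = 1\<^sub>m n" by simp_all
  have "L = (K * M) * L" unfolding KM using L' by simp
  also have "\<dots> = K * (M * L)" using L' K M by (intro assoc_mult_mat) auto
  finally have "L = K" unfolding L'(2) right_mult_one_mat[OF conjunct1[OF K]] .
  then show "mat_inverse M = Some K" using L by simp
qed (use mat_inverse(2)[OF M] in auto)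

lemma mat_inverse_exists_iff:
  fixes M :: "'k :: field mat"
  assumes M: "M \<in> carrier_mat n n"
  shows "mat_inverse M \<noteq> None \<longleftrightarrow> det M \<noteq> 0"
proof
  assume "mat_inverse M \<noteq> None"
  then show "det M \<noteq> 0" using mat_inverse_iff[OF M] inverse_det_nonzero[OF M] by blast
next
  assume "det M \<noteq> 0"
  then obtain B where "B \<in> carrier_mat n n" "M * B = 1\<^sub>m n" by (rule det_nonzero_inverse[OF M])
  then show "mat_inverse M \<noteq> None" using mat_inverse_iff[OF M, of B] by simp
qed

lemma nc_expr_eval_carrier:
  "point n A ==> nc_expr_eval n A a = Some M ==> M \<in> carrier_mat n n"
proof (induction a arbitrary: M)
  case (NC_Inv a)
  then obtain L where "nc_expr_eval n A a = Some L" "mat_inverse L = Some M" by (auto split: option.splits)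
  with NC_Inv show ?case using mat_inverse_iff[of L n M] by auto
qed (auto split: option.splits intro: add_carrier_mat mult_carrier_mat)

lemma nc_expr_eval_blow:
  assumes A: "point n A" and m: "0 < m"
  shows "nc_expr_eval n A a = Some M ==> nc_expr_eval (n * m) (blow m A) a = Some (kron M (1\<^sub>m m))"
proof (induction a arbitrary: M)
  case (NC_Poly p)
  then show ?case by (auto simp: nc_poly_eval_blow[OF A m])
next
  case (NC_Add a b)
  then obtain L K where *: "nc_expr_eval n A a = Some L" "nc_expr_eval n A b = Some K" "M = L + K" by (auto split: option.splits)
  from NC_Add.IH(1)[OF *(1)] NC_Add.IH(2)[OF *(2)] nc_expr_eval_carrier[OF A *(1)] nc_expr_eval_carrier[OF A *(2)]
  show ?case by (simp add: *(3) kron_add)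
next
  case (NC_Mult a b)
  then obtain L K where *: "nc_expr_eval n A a = Some L" "nc_expr_eval n A b = Some K" "M = L * K" by (auto split: option.splits)
  from NC_Mult.IH(1)[OF *(1)] NC_Mult.IH(2)[OF *(2)] nc_expr_eval_carrier[OF A *(1)] nc_expr_eval_carrier[OF A *(2)]
  show ?case by (simp add: *(3) kron_one_right_mult)
next
  case (NC_Inv a)
  then obtain L where *: "nc_expr_eval n A a = Some L" "mat_inverse L = Some M" by (auto split: option.splits)
  have L: "L \<in> carrier_mat n n" by (rule nc_expr_eval_carrier[OF A *(1)])
  from *(2) have M: "M \<in> carrier_mat n n" "L * M = 1\<^sub>m n" unfolding mat_inverse_iff[OF L] by simp_all
  have "mat_inverse (kron L (1\<^sub>m m)) = Some (kron M (1\<^sub>m m))"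
    using L M kron_one_right_mult[of L M m]
    by (subst mat_inverse_iff[of _ "n * m"]) (auto simp: kron_one intro!: carrier_matI)
  then show ?case by (simp add: NC_Inv.IH[OF *(1)])
qed

lemma map_poly_mat:
  fixes M N :: "'k :: field poly mat"
  shows "M \<in> carrier_mat a b ==> N \<in> carrier_mat b c ==> map_mat (\<lambda>f. poly f t) (M * N) = map_mat (\<lambda>f. poly f t) M * map_mat (\<lambda>f. poly f t) N"
    "det (map_mat (\<lambda>f. poly f t) M) = poly (det M) t"
proof -
  interpret comm_ring_hom "\<lambda>f. poly f t" by unfold_locales simp_all
  show "M \<in> carrier_mat a b ==> N \<in> carrier_mat b c ==> map_mat (\<lambda>f. poly f t) (M * N) = map_mat (\<lambda>f. poly f t) M * map_mat (\<lambda>f. poly f t) N"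
    by (rule mat_hom_mult)
  show "det (map_mat (\<lambda>f. poly f t) M) = poly (det M) t" by (rule hom_det)
qed

context
  fixes n :: nat and A B :: "'x => 'k :: field mat"
  assumes A: "point n A" and B: "point n B"
begin

lemma nc_poly_eval_line:
  "\<exists>N\<in>carrier_mat n n. \<forall>t. nc_poly_eval n (line A B t) p = map_mat (\<lambda>f. poly f t) N"
proof (induction p rule: nc_poly_induct)
  case zero
  then show ?case by (intro bexI[of _ "0\<^sub>m n n"]) (auto simp: nc_poly_eval_def intro!: eq_matI)
next
  note L = pointD(1)[OF point_line[OF A B]]
  case (single w c)
  have "\<exists>N\<in>carrier_mat n n. \<forall>t. nc_word_eval n (line A B t) (NC_Word xs) = map_mat (\<lambda>f. poly f t) N" for xs
  proof (induction xs)
    case Nil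
    show ?case by (intro bexI[of _ "1\<^sub>m n"]) (auto simp: nc_word_eval_def intro!: eq_matI)
  next
    case (Cons x xs)
    then obtain N where N: "N \<in> carrier_mat n n" "\<And>t. nc_word_eval n (line A B t) (NC_Word xs) = map_mat (\<lambda>f. poly f t) N" by blast
    define N1 where "N1 = mat n n (\<lambda>ij. [:A x $$ ij, B x $$ ij - A x $$ ij:])"
    have N1: "N1 \<in> carrier_mat n n" "map_mat (\<lambda>f. poly f t) N1 = line A B t x" for t
      using pointD(1)[OF A, of x] pointD(1)[OF B, of x] by (auto simp: N1_def line_def intro!: eq_matI)
    have "nc_word_eval n (line A B t) (NC_Word (x # xs)) = map_mat (\<lambda>f. poly f t) (N1 * N)" for t
      unfolding map_poly_mat(1)[OF N1(1) N(1)] N1(2) N(2)[symmetric] by (simp add: nc_word_eval_def)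
    then show ?case using N1(1) N(1) by (intro bexI[of _ "N1 * N"]) auto
  qed
  from this[of "letters w"] obtain N where N: "N \<in> carrier_mat n n" "\<And>t. nc_word_eval n (line A B t) w = map_mat (\<lambda>f. poly f t) N" by auto
  have "nc_poly_eval n (line A B t) (Poly_Mapping.single w c) = map_mat (\<lambda>f. poly f t) ([:c:] \<cdot>\<^sub>m N)" for t
    unfolding nc_poly_eval_single[OF L] N(2) using N(1) by (intro eq_matI) auto
  then show ?case using N(1) by (intro bexI[of _ "[:c:] \<cdot>\<^sub>m N"]) auto
next
  case (add p q)
  then obtain N N' where N: "N \<in> carrier_mat n n" "\<And>t. nc_poly_eval n (line A B t) p = map_mat (\<lambda>f. poly f t) N"
    and N': "N' \<in> carrier_mat n n" "\<And>t. nc_poly_eval n (line A B t) q = map_mat (\<lambda>f. poly f t) N'" by blast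
  have "nc_poly_eval n (line A B t) (p + q) = map_mat (\<lambda>f. poly f t) (N + N')" for t
    unfolding nc_poly_eval_add[OF pointD(1)[OF point_line[OF A B]]] N(2) N'(2) using N(1) N'(1) by (intro eq_matI) auto
  then show ?case using N(1) N'(1) by (intro bexI[of _ "N + N'"]) auto
qed

text \<open>Cramer's rule keeps the values on a line through a point of the domain in the form of a matrix of polynomials over a common
  denominator \<open>q\<close>, which does not vanish at the point.\<close>

lemma nc_expr_eval_line:
  "nc_expr_eval n A a \<noteq> None ==> \<exists>N q. N \<in> carrier_mat n n \<and> poly q 0 \<noteq> 0 \<and>
    (\<forall>t. poly q t \<noteq> 0 --> (\<exists>M. nc_expr_eval n (line A B t) a = Some M \<and> poly q t \<cdot>\<^sub>m M = map_mat (\<lambda>f. poly f t) N))"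
proof (induction a)
  case (NC_Poly p)
  obtain N where N: "N \<in> carrier_mat n n" "\<And>t. nc_poly_eval n (line A B t) p = map_mat (\<lambda>f. poly f t) N"
    using nc_poly_eval_line by blast
  have "1 \<cdot>\<^sub>m map_mat (\<lambda>f. poly f t) N = map_mat (\<lambda>f. poly f t) N" for t by (intro eq_matI) auto
  then show ?case using N by (intro exI[of _ N] exI[of _ 1]) simp
next
  case (NC_Add a b)
  then have "nc_expr_eval n A a \<noteq> None" "nc_expr_eval n A b \<noteq> None" by (auto split: option.splits)
  with NC_Add.IH obtain N q N' q' where N: "N \<in> carrier_mat n n" "poly q 0 \<noteq> 0"
      "\<And>t. poly q t \<noteq> 0 ==> \<exists>M. nc_expr_eval n (line A B t) a = Some M \<and> poly q t \<cdot>\<^sub>m M = map_mat (\<lambda>f. poly f t) N"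
    and N': "N' \<in> carrier_mat n n" "poly q' 0 \<noteq> 0"
      "\<And>t. poly q' t \<noteq> 0 ==> \<exists>M. nc_expr_eval n (line A B t) b = Some M \<and> poly q' t \<cdot>\<^sub>m M = map_mat (\<lambda>f. poly f t) N'" by metis
  show ?case
  proof (intro exI[of _ "q' \<cdot>\<^sub>m N + q \<cdot>\<^sub>m N'"] exI[of _ "q * q'"] conjI allI impI)
    fix t assume "poly (q * q') t \<noteq> 0"
    then obtain M M' where M: "nc_expr_eval n (line A B t) a = Some M" "poly q t \<cdot>\<^sub>m M = map_mat (\<lambda>f. poly f t) N"
      and M': "nc_expr_eval n (line A B t) b = Some M'" "poly q' t \<cdot>\<^sub>m M' = map_mat (\<lambda>f. poly f t) N'" using N(3)[of t] N'(3)[of t] by auto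
    note c = nc_expr_eval_carrier[OF point_line[OF A B] M(1)] nc_expr_eval_carrier[OF point_line[OF A B] M'(1)]
    have "poly (q * q') t \<cdot>\<^sub>m (M + M') = poly q' t \<cdot>\<^sub>m (poly q t \<cdot>\<^sub>m M) + poly q t \<cdot>\<^sub>m (poly q' t \<cdot>\<^sub>m M')"
      using c by (intro eq_matI) (auto simp: algebra_simps)
    also have "\<dots> = map_mat (\<lambda>f. poly f t) (q' \<cdot>\<^sub>m N + q \<cdot>\<^sub>m N')" unfolding M(2) M'(2) using N(1) N'(1) by (intro eq_matI) auto
    finally show "\<exists>M. nc_expr_eval n (line A B t) (NC_Add a b) = Some M \<and> poly (q * q') t \<cdot>\<^sub>m M = map_mat (\<lambda>f. poly f t) (q' \<cdot>\<^sub>m N + q \<cdot>\<^sub>m N')"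
      using M(1) M'(1) by simp
  qed (use N N' in auto)
next
  case (NC_Mult a b)
  then have "nc_expr_eval n A a \<noteq> None" "nc_expr_eval n A b \<noteq> None" by (auto split: option.splits)
  with NC_Mult.IH obtain N q N' q' where N: "N \<in> carrier_mat n n" "poly q 0 \<noteq> 0"
      "\<And>t. poly q t \<noteq> 0 ==> \<exists>M. nc_expr_eval n (line A B t) a = Some M \<and> poly q t \<cdot>\<^sub>m M = map_mat (\<lambda>f. poly f t) N"
    and N': "N' \<in> carrier_mat n n" "poly q' 0 \<noteq> 0"
      "\<And>t. poly q' t \<noteq> 0 ==> \<exists>M. nc_expr_eval n (line A B t) b = Some M \<and> poly q' t \<cdot>\<^sub>m M = map_mat (\<lambda>f. poly f t) N'" by metis
  show ?case
  proof (intro exI[of _ "N * N'"] exI[of _ "q * q'"] conjI allI impI)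
    fix t assume "poly (q * q') t \<noteq> 0"
    then obtain M M' where M: "nc_expr_eval n (line A B t) a = Some M" "poly q t \<cdot>\<^sub>m M = map_mat (\<lambda>f. poly f t) N"
      and M': "nc_expr_eval n (line A B t) b = Some M'" "poly q' t \<cdot>\<^sub>m M' = map_mat (\<lambda>f. poly f t) N'" using N(3)[of t] N'(3)[of t] by auto
    note c = nc_expr_eval_carrier[OF point_line[OF A B] M(1)] nc_expr_eval_carrier[OF point_line[OF A B] M'(1)]
    have "poly (q * q') t \<cdot>\<^sub>m (M * M') = (poly q t \<cdot>\<^sub>m M) * (poly q' t \<cdot>\<^sub>m M')"
      using c by (intro eq_matI) (auto simp: scalar_prod_def sum_distrib_left mult_ac)
    also have "\<dots> = map_mat (\<lambda>f. poly f t) (N * N')" unfolding M(2) M'(2) by (rule map_poly_mat(1)[OF N(1) N'(1), symmetric])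
    finally show "\<exists>M. nc_expr_eval n (line A B t) (NC_Mult a b) = Some M \<and> poly (q * q') t \<cdot>\<^sub>m M = map_mat (\<lambda>f. poly f t) (N * N')"
      using M(1) M'(1) by simp
  qed (use N N' in auto)
next
  case (NC_Inv a)
  then have "nc_expr_eval n A a \<noteq> None" by (auto split: option.splits)
  with NC_Inv.IH obtain N q where N: "N \<in> carrier_mat n n" "poly q 0 \<noteq> 0"
      "\<And>t. poly q t \<noteq> 0 ==> \<exists>M. nc_expr_eval n (line A B t) a = Some M \<and> poly q t \<cdot>\<^sub>m M = map_mat (\<lambda>f. poly f t) N" by metis
  have det: "poly (det N) t = poly q t ^ n * det M"
    if "nc_expr_eval n (line A B t) a = Some M" "poly q t \<cdot>\<^sub>m M = map_mat (\<lambda>f. poly f t) N" for t M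
  proof -
    have "poly (det N) t = det (poly q t \<cdot>\<^sub>m M)" unfolding that(2) by (rule map_poly_mat(2)[symmetric])
    then show ?thesis using nc_expr_eval_carrier[OF point_line[OF A B] that(1)] by simp
  qed
  show ?case
  proof (intro exI[of _ "(q * q) \<cdot>\<^sub>m adj_mat N"] exI[of _ "q * det N"] conjI allI impI)
    obtain M where M: "nc_expr_eval n (line A B 0) a = Some M" "poly q 0 \<cdot>\<^sub>m M = map_mat (\<lambda>f. poly f 0) N" using N(3)[OF N(2)] by blast
    have "nc_expr_eval n A (NC_Inv a) \<noteq> None" by (rule NC_Inv.prems)
    then have "mat_inverse M \<noteq> None" using M(1) by (simp add: line_0[OF A B])
    then have "det M \<noteq> 0" using mat_inverse_exists_iff nc_expr_eval_carrier[OF point_line[OF A B] M(1)] by blast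
    then show "poly (q * det N) 0 \<noteq> 0" using det[OF M] N(2) by simp
  next
    fix t assume t: "poly (q * det N) t \<noteq> 0"
    then obtain M where M: "nc_expr_eval n (line A B t) a = Some M" "poly q t \<cdot>\<^sub>m M = map_mat (\<lambda>f. poly f t) N" using N(3)[of t] by auto
    have Mc: "M \<in> carrier_mat n n" by (rule nc_expr_eval_carrier[OF point_line[OF A B] M(1)])
    have "det M \<noteq> 0" using det[OF M] t by auto
    then obtain K where K: "mat_inverse M = Some K" using mat_inverse_exists_iff[OF Mc] by blast
    then have K': "K \<in> carrier_mat n n" "M * K = 1\<^sub>m n" unfolding mat_inverse_iff[OF Mc] by simp_all
    let ?P = "map_mat (\<lambda>f. poly f t)"
    have adj: "?P (adj_mat N) \<in> carrier_mat n n" using adj_mat(1)[OF N(1)] by simp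
    have "?P (adj_mat N) * ?P N = ?P (det N \<cdot>\<^sub>m 1\<^sub>m n)"
      using map_poly_mat(1)[OF adj_mat(1)[OF N(1)] N(1), of t] adj_mat(3)[OF N(1)] by simp
    also have "\<dots> = poly (det N) t \<cdot>\<^sub>m 1\<^sub>m n" by (intro eq_matI) auto
    finally have "poly (det N) t \<cdot>\<^sub>m K = ?P (adj_mat N) * ?P N * K"
      using K'(1) mult_smult_assoc_mat[of "1\<^sub>m n" n n K n "poly (det N) t"] by simp
    also have "\<dots> = ?P (adj_mat N) * (poly q t \<cdot>\<^sub>m M) * K" by (simp only: M(2))
    also have "\<dots> = poly q t \<cdot>\<^sub>m (?P (adj_mat N) * (M * K))" 
      by (simp only: mult_smult_distrib[OF adj Mc] mult_smult_assoc_mat[OF mult_carrier_mat[OF adj Mc] K'(1)] assoc_mult_mat[OF adj Mc K'(1)])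
    also have "\<dots> = poly q t \<cdot>\<^sub>m ?P (adj_mat N)" using adj K'(2) by simp
    finally have *: "poly (det N) t \<cdot>\<^sub>m K = poly q t \<cdot>\<^sub>m ?P (adj_mat N)" .
    have "poly (q * det N) t \<cdot>\<^sub>m K = poly q t \<cdot>\<^sub>m (poly (det N) t \<cdot>\<^sub>m K)" by (intro eq_matI) auto
    also have "\<dots> = ?P ((q * q) \<cdot>\<^sub>m adj_mat N)" unfolding * by (intro eq_matI) auto
    finally show "\<exists>M. nc_expr_eval n (line A B t) (NC_Inv a) = Some M \<and> poly (q * det N) t \<cdot>\<^sub>m M = ?P ((q * q) \<cdot>\<^sub>m adj_mat N)"
      using M(1) K by simp
  qed (use adj_mat(1)[OF N(1)] in auto)
qed

lemma mev_line: "\<exists>N\<in>carrier_mat (dim_row M * n) (dim_col M * n). \<forall>t. mev n (line A B t) M = map_mat (\<lambda>f. poly f t) N"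
proof -
  obtain N where N: "\<And>p. N p \<in> carrier_mat n n" "\<And>p t. nc_poly_eval n (line A B t) p = map_mat (\<lambda>f. poly f t) (N p)"
    using nc_poly_eval_line by metis
  let ?N = "mat (dim_row M * n) (dim_col M * n) (\<lambda>(i, j). N (M $$ (i div n, j div n)) $$ (i mod n, j mod n))"
  have [simp]: "dim_row (N p) = n" "dim_col (N p) = n" for p using N(1)[of p] by auto
  have "mev n (line A B t) M = map_mat (\<lambda>f. poly f t) ?N" for t
    using divmod_less by (intro eq_matI) (auto simp: mev_index N(2))
  then show ?thesis by (intro bexI[of _ ?N]) auto
qed

end

definition defined :: "('x, 'k :: field) nc_expr => nat => ('x => 'k mat) => bool" where
  "defined a n A \<longleftrightarrow> nc_expr_eval n A a \<noteq> None"

lemma nc_dom_iff: "(n, A) \<in> nc_dom a \<longleftrightarrow> point n A \<and> defined a n A"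
  by (auto simp: nc_dom_def point_def defined_def)

lemma generic_defined:
  assumes "nc_dom a \<noteq> {}"
  shows "generic (defined a)"
proof -
  obtain n A where A: "point n A" "defined a n A" using assms by (metis equals0I nc_dom_iff surj_pair)
  show ?thesis
  proof (rule genericI[of n A "defined a", OF A])
    fix n m :: nat and A :: "'a => 'b mat" assume "point n A" "defined a n A" "0 < m"
    then show "defined a (n * m) (blow m A)" using nc_expr_eval_blow[of n A m a] by (auto simp: defined_def)
  next
    fix n and A B :: "'a => 'b mat" assume AB: "point n A" "point n B" "defined a n A"
    then obtain N q where q: "poly q 0 \<noteq> 0"
      "\<And>t. poly q t \<noteq> 0 ==> \<exists>M. nc_expr_eval n (line A B t) a = Some M \<and> poly q t \<cdot>\<^sub>m M = map_mat (\<lambda>f. poly f t) N"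
      using nc_expr_eval_line[OF AB(1,2), of a] unfolding defined_def by metis
    from q(1) have "finite {t. poly q t = 0}" by (intro poly_roots_finite) auto
    then show "finite {t. \<not> defined a n (line A B t)}"
      by (rule rev_finite_subset) (use q(2) in \<open>fastforce simp: defined_def\<close>)
  qed
qed

lemma generic_det:
  assumes M: "M \<in> carrier_mat p p" and A: "point n A" "det (mev n A M) \<noteq> 0"
  shows "generic (\<lambda>n A. det (mev n A M) \<noteq> 0)"
proof (rule genericI[of n A "\<lambda>n A. det (mev n A M) \<noteq> 0", OF A])
  note [simp] = carrier_matD[OF M]
  fix n m :: nat and A :: "'a => 'b mat" assume A: "point n A" "det (mev n A M) \<noteq> 0" and m: "0 < m"
  have c: "mev n A M \<in> carrier_mat (p * n) (p * n)" by (auto intro!: carrier_matI)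
  obtain B where B: "B \<in> carrier_mat (p * n) (p * n)" "mev n A M * B = 1\<^sub>m (p * n)" by (rule det_nonzero_inverse[OF c A(2)])
  show "det (mev (n * m) (blow m A) M) \<noteq> 0"
    unfolding mev_blow[OF A(1) m]
    using B c kron_one_right_mult[of "mev n A M" B m]
    by (intro inverse_det_nonzero[of _ "p * n * m" "kron B (1\<^sub>m m)"]) (auto simp: kron_one intro!: carrier_matI)
next
  note [simp] = carrier_matD[OF M]
  fix n and A B :: "'a => 'b mat" assume AB: "point n A" "point n B" and det: "det (mev n A M) \<noteq> 0"
  obtain N where N: "\<And>t. mev n (line A B t) M = map_mat (\<lambda>f. poly f t) N" using mev_line[OF AB, of M] by blast
  have "poly (det N) 0 \<noteq> 0" using det N[of 0] map_poly_mat(2)[of 0 N] by (simp add: line_0[OF AB])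
  then have "finite {t. poly (det N) t = 0}" by (intro poly_roots_finite) auto
  then show "finite {t. \<not> det (mev n (line A B t) M) \<noteq> 0}" by (simp add: N map_poly_mat(2))
qed

text \<open>Density: on a line from the given point to a generic one both values are rational functions of the parameter that agree
  infinitely often, and hence also at the start.\<close>

lemma generic_agree:
  fixes U :: "nat => ('x => 'k :: field_char_0 mat) => bool"
  assumes U: "generic U" and A: "point n A" "defined a n A" "defined b n A"
    and agree: "\<And>n A. point n A ==> U n A ==> defined a n A ==> defined b n A ==> nc_expr_eval n A a = nc_expr_eval n A b"
  shows "nc_expr_eval n A a = nc_expr_eval n A b"
proof -
  obtain n' B' where B': "point n' B'" "U n' B'" using U by (rule generic_obtains)
  obtain M M' where M: "nc_expr_eval n A a = Some M" "nc_expr_eval n A b = Some M'" using A by (auto simp: defined_def)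
  let ?n = "n * n'" and ?A = "blow n' A" and ?B = "blow n B'"
  note n = pointD(2)[OF A(1)] pointD(2)[OF B'(1)]
  have A': "point ?n ?A" by (rule point_blow[OF A(1) n(2)])
  have B: "point ?n ?B" "U ?n ?B"
    using point_blow[OF B'(1) n(1)] generic_blow[OF U B' n(1)] by (simp_all add: mult.commute)
  note ev = nc_expr_eval_blow[OF A(1) n(2) M(1)] nc_expr_eval_blow[OF A(1) n(2) M(2)]
  obtain N q where N: "N \<in> carrier_mat ?n ?n" "poly q 0 \<noteq> 0"
    "\<And>t. poly q t \<noteq> 0 ==> \<exists>M. nc_expr_eval ?n (line ?A ?B t) a = Some M \<and> poly q t \<cdot>\<^sub>m M = map_mat (\<lambda>f. poly f t) N"
    using nc_expr_eval_line[OF A' B(1), of a] ev(1) by auto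
  obtain N' q' where N': "N' \<in> carrier_mat ?n ?n" "poly q' 0 \<noteq> 0"
    "\<And>t. poly q' t \<noteq> 0 ==> \<exists>M. nc_expr_eval ?n (line ?A ?B t) b = Some M \<and> poly q' t \<cdot>\<^sub>m M = map_mat (\<lambda>f. poly f t) N'"
    using nc_expr_eval_line[OF A' B(1), of b] ev(2) by auto
  have finU: "finite {t. \<not> U ?n (line ?A ?B t)}" by (rule generic_line_end[OF U A' B])
  have fin: "finite {t. poly (q * q') t = 0}" using N(2) N'(2) by (intro poly_roots_finite) auto
  have inf: "infinite (UNIV - ({t. \<not> U ?n (line ?A ?B t)} \<union> {t. poly (q * q') t = 0}))"
    using finU fin infinite_UNIV_char_0 by (intro Diff_infinite_finite) auto
  have eq: "q' * N $$ (i, j) = q * N' $$ (i, j)" if ij: "i < ?n" "j < ?n" for i j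
  proof (rule ccontr)
    assume "q' * N $$ (i, j) \<noteq> q * N' $$ (i, j)"
    then have "finite {t. poly (q' * N $$ (i, j) - q * N' $$ (i, j)) t = 0}" by (intro poly_roots_finite) auto
    moreover have "UNIV - ({t. \<not> U ?n (line ?A ?B t)} \<union> {t. poly (q * q') t = 0}) \<subseteq> {t. poly (q' * N $$ (i, j) - q * N' $$ (i, j)) t = 0}"
    proof (intro subsetI CollectI)
      fix t assume "t \<in> UNIV - ({t. \<not> U ?n (line ?A ?B t)} \<union> {t. poly (q * q') t = 0})"
      then have t: "U ?n (line ?A ?B t)" "poly q t \<noteq> 0" "poly q' t \<noteq> 0" by auto
      obtain K where K: "nc_expr_eval ?n (line ?A ?B t) a = Some K" "poly q t \<cdot>\<^sub>m K = map_mat (\<lambda>f. poly f t) N" using N(3)[OF t(2)] by blast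
      obtain K' where K': "nc_expr_eval ?n (line ?A ?B t) b = Some K'" "poly q' t \<cdot>\<^sub>m K' = map_mat (\<lambda>f. poly f t) N'" using N'(3)[OF t(3)] by blast
      have "K = K'" using agree[OF point_line[OF A' B(1)] t(1)] K(1) K'(1) by (simp add: defined_def)
      moreover have "K \<in> carrier_mat ?n ?n" by (rule nc_expr_eval_carrier[OF point_line[OF A' B(1)] K(1)])
      moreover have "(poly q t \<cdot>\<^sub>m K) $$ (i, j) = poly (N $$ (i, j)) t" "(poly q' t \<cdot>\<^sub>m K') $$ (i, j) = poly (N' $$ (i, j)) t"
        unfolding K(2) K'(2) using N(1) N'(1) ij by auto
      ultimately show "poly (q' * N $$ (i, j) - q * N' $$ (i, j)) t = 0" using ij by (simp flip: \<open>_ = poly (N $$ (i, j)) t\<close>)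
    qed
    ultimately show False using inf finite_subset by blast
  qed
  have "kron M (1\<^sub>m n') = kron M' (1\<^sub>m n')"
  proof (rule eq_matI)
    fix i j assume "i < dim_row (kron M' (1\<^sub>m n'))" "j < dim_col (kron M' (1\<^sub>m n'))"
    then have ij: "i < ?n" "j < ?n" using nc_expr_eval_carrier[OF A(1) M(2)] by auto
    have "poly q 0 \<cdot>\<^sub>m kron M (1\<^sub>m n') = map_mat (\<lambda>f. poly f 0) N" "poly q' 0 \<cdot>\<^sub>m kron M' (1\<^sub>m n') = map_mat (\<lambda>f. poly f 0) N'"
      using N(3)[OF N(2)] N'(3)[OF N'(2)] ev by (auto simp: line_0[OF A' B(1)])
    then have "(poly q 0 \<cdot>\<^sub>m kron M (1\<^sub>m n')) $$ (i, j) = poly (N $$ (i, j)) 0" "(poly q' 0 \<cdot>\<^sub>m kron M' (1\<^sub>m n')) $$ (i, j) = poly (N' $$ (i, j)) 0"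
      using N(1) N'(1) ij by auto
    then have *: "poly q 0 * kron M (1\<^sub>m n') $$ (i, j) = poly (N $$ (i, j)) 0" "poly q' 0 * kron M' (1\<^sub>m n') $$ (i, j) = poly (N' $$ (i, j)) 0"
      using ij nc_expr_eval_carrier[OF A(1) M(1)] nc_expr_eval_carrier[OF A(1) M(2)] by auto
    have "poly q' 0 * poly (N $$ (i, j)) 0 = poly q 0 * poly (N' $$ (i, j)) 0" using arg_cong[OF eq[OF ij], of "\<lambda>f. poly f 0"] by simp
    then show "kron M (1\<^sub>m n') $$ (i, j) = kron M' (1\<^sub>m n') $$ (i, j)" using N(2) N'(2) by (simp flip: *)
  qed (use nc_expr_eval_carrier[OF A(1) M(1)] nc_expr_eval_carrier[OF A(1) M(2)] in auto)
  moreover have "L $$ (i, j) = kron L (1\<^sub>m n') $$ (i * n', j * n')" if "i < dim_row L" "j < dim_col L" for L :: "'k mat" and i j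
    using that n(2) by (simp add: kron_index)
  ultimately have "M = M'"
    using nc_expr_eval_carrier[OF A(1) M(1)] nc_expr_eval_carrier[OF A(1) M(2)] by (intro eq_matI) auto
  then show ?thesis using M by simp
qed


section \<open>The ring of rational functions\<close>

lemma defined_simps [simp]:
  "defined (NC_Poly p) n A" "defined (NC_Add a b) n A \<longleftrightarrow> defined a n A \<and> defined b n A"
  "defined (NC_Mult a b) n A \<longleftrightarrow> defined a n A \<and> defined b n A"
  by (auto simp: defined_def split: option.splits)

lemma nc_dom_nonempty_iff:
  fixes a :: "('x, 'k :: field_char_0) nc_expr"
  shows "nc_dom a \<noteq> {} \<longleftrightarrow> generic (defined a)"
  using generic_defined generic_obtains[of "defined a"] nc_dom_iff by (metis empty_iff)

lemma nc_dom_ops: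
  fixes a :: "('x, 'k :: field_char_0) nc_expr"
  shows "nc_dom (NC_Poly p :: ('x, 'k) nc_expr) \<noteq> {}"
    and "nc_dom a \<noteq> {} ==> nc_dom b \<noteq> {} ==> nc_dom (NC_Add a b) \<noteq> {}"
    and "nc_dom a \<noteq> {} ==> nc_dom b \<noteq> {} ==> nc_dom (NC_Mult a b) \<noteq> {}"
proof -
  have "(1, \<lambda>_. 0\<^sub>m 1 1) \<in> nc_dom (NC_Poly p :: ('x, 'k) nc_expr)" by (simp add: nc_dom_iff point_def)
  then show "nc_dom (NC_Poly p :: ('x, 'k) nc_expr) \<noteq> {}" by blast
  assume "nc_dom a \<noteq> {}" "nc_dom b \<noteq> {}"
  note generic_conj[OF this[unfolded nc_dom_nonempty_iff]]
  moreover have "defined (NC_Add a b) = (\<lambda>n A. defined a n A \<and> defined b n A)" "defined (NC_Mult a b) = (\<lambda>n A. defined a n A \<and> defined b n A)"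
    by (intro ext; simp)+
  ultimately show "nc_dom (NC_Add a b) \<noteq> {}" "nc_dom (NC_Mult a b) \<noteq> {}" by (simp_all add: nc_dom_nonempty_iff)
qed

lemma nc_equiv_iff:
  "(a, b) \<in> nc_equiv \<longleftrightarrow> nc_dom a \<noteq> {} \<and> nc_dom b \<noteq> {} \<and>
    (\<forall>n A. point n A --> defined a n A --> defined b n A --> nc_expr_eval n A a = nc_expr_eval n A b)"
  unfolding nc_equiv_def by (auto simp: nc_dom_iff)

lemma equiv_nc_equiv: "equiv {a :: ('x, 'k :: field_char_0) nc_expr. nc_dom a \<noteq> {}} nc_equiv"
proof (rule equivI)
  show "nc_equiv \<subseteq> {a :: ('x, 'k) nc_expr. nc_dom a \<noteq> {}} \<times> {a. nc_dom a \<noteq> {}}" by (auto simp: nc_equiv_iff)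
  show "refl_on {a :: ('x, 'k) nc_expr. nc_dom a \<noteq> {}} nc_equiv" by (auto simp: refl_on_def nc_equiv_iff)
  show "sym (nc_equiv :: (('x, 'k) nc_expr \<times> _) set)" by (rule symI) (auto simp: nc_equiv_iff)
  show "trans (nc_equiv :: (('x, 'k) nc_expr \<times> _) set)"
  proof (rule transI)
    fix a b c :: "('x, 'k) nc_expr" assume ab: "(a, b) \<in> nc_equiv" and bc: "(b, c) \<in> nc_equiv"
    then have b: "generic (defined b)" by (simp add: nc_equiv_iff nc_dom_nonempty_iff)
    show "(a, c) \<in> nc_equiv"
      unfolding nc_equiv_iff
    proof (intro conjI allI impI)
      fix n A assume A: "point n A" "defined a n A" "defined c n A"
      show "nc_expr_eval n A a = nc_expr_eval n A c"
        by (rule generic_agree[OF b A]) (use ab bc in \<open>simp add: nc_equiv_iff\<close>)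
    qed (use ab bc in \<open>simp_all add: nc_equiv_iff\<close>)
  qed
qed

lemma ratfun_eq_iff:
  fixes a b :: "('x, 'k :: field_char_0) nc_expr"
  assumes "nc_dom a \<noteq> {}" "nc_dom b \<noteq> {}"
  shows "ratfun_of a = ratfun_of b \<longleftrightarrow> (a, b) \<in> nc_equiv"
  unfolding ratfun_of_def using assms by (intro eq_equiv_class_iff[OF equiv_nc_equiv]) auto

lemma ratfun_eqI:
  fixes a b :: "('x, 'k :: field_char_0) nc_expr"
  assumes "nc_dom a \<noteq> {}" "nc_dom b \<noteq> {}"
    "\<And>n A. point n A ==> defined a n A ==> defined b n A ==> nc_expr_eval n A a = nc_expr_eval n A b"
  shows "ratfun_of a = ratfun_of b"
  using assms by (simp add: ratfun_eq_iff nc_equiv_iff)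

lemma ratfun_eqD:
  fixes a b :: "('x, 'k :: field_char_0) nc_expr"
  assumes "ratfun_of a = ratfun_of b" "nc_dom a \<noteq> {}" "nc_dom b \<noteq> {}" "point n A" "defined a n A" "defined b n A"
  shows "nc_expr_eval n A a = nc_expr_eval n A b"
  using assms by (simp add: ratfun_eq_iff nc_equiv_iff)

lemma free_skew_field_ops:
  fixes a b :: "('x, 'k :: field_char_0) nc_expr"
  assumes a: "nc_dom a \<noteq> {}" and b: "nc_dom b \<noteq> {}"
  shows "ratfun_of a \<otimes>\<^bsub>free_skew_field\<^esub> ratfun_of b = ratfun_of (NC_Mult a b)"
    and "ratfun_of a \<oplus>\<^bsub>free_skew_field\<^esub> ratfun_of b = ratfun_of (NC_Add a b)"
proof -
  have eq: "ratfun_of (NC_Mult a' b') = ratfun_of (NC_Mult a b)" "ratfun_of (NC_Add a' b') = ratfun_of (NC_Add a b)"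
    if ab: "a' \<in> ratfun_of a" "b' \<in> ratfun_of b" for a' b'
  proof -
    have d: "nc_dom a' \<noteq> {}" "nc_dom b' \<noteq> {}"
      and e: "\<And>n A. point n A ==> defined a n A ==> defined a' n A ==> nc_expr_eval n A a = nc_expr_eval n A a'"
        "\<And>n A. point n A ==> defined b n A ==> defined b' n A ==> nc_expr_eval n A b = nc_expr_eval n A b'"
      using ab by (simp_all add: ratfun_of_def nc_equiv_iff)
    show "ratfun_of (NC_Mult a' b') = ratfun_of (NC_Mult a b)"
      by (rule ratfun_eqI[OF nc_dom_ops(3)[OF d] nc_dom_ops(3)[OF a b]]) (simp add: e)
    show "ratfun_of (NC_Add a' b') = ratfun_of (NC_Add a b)"
      by (rule ratfun_eqI[OF nc_dom_ops(2)[OF d] nc_dom_ops(2)[OF a b]]) (simp add: e)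
  qed
  have "a \<in> ratfun_of a" "b \<in> ratfun_of b" using a b by (simp_all add: ratfun_of_def nc_equiv_iff)
  then have ne: "ratfun_of a \<noteq> {}" "ratfun_of b \<noteq> {}" by blast+
  have "(\<Union>a'\<in>ratfun_of a. \<Union>b'\<in>ratfun_of b. ratfun_of (NC_Mult a' b')) = ratfun_of (NC_Mult a b)"
  proof -
    have "(\<Union>a'\<in>ratfun_of a. \<Union>b'\<in>ratfun_of b. ratfun_of (NC_Mult a' b')) = (\<Union>a'\<in>ratfun_of a. \<Union>b'\<in>ratfun_of b. ratfun_of (NC_Mult a b))"
      by (intro SUP_cong refl eq(1))
    then show ?thesis using ne by simp
  qed
  then show "ratfun_of a \<otimes>\<^bsub>free_skew_field\<^esub> ratfun_of b = ratfun_of (NC_Mult a b)" by (simp add: free_skew_field_def)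
  have "(\<Union>a'\<in>ratfun_of a. \<Union>b'\<in>ratfun_of b. ratfun_of (NC_Add a' b')) = ratfun_of (NC_Add a b)"
  proof -
    have "(\<Union>a'\<in>ratfun_of a. \<Union>b'\<in>ratfun_of b. ratfun_of (NC_Add a' b')) = (\<Union>a'\<in>ratfun_of a. \<Union>b'\<in>ratfun_of b. ratfun_of (NC_Add a b))"
      by (intro SUP_cong refl eq(2))
    then show ?thesis using ne by simp
  qed
  then show "ratfun_of a \<oplus>\<^bsub>free_skew_field\<^esub> ratfun_of b = ratfun_of (NC_Add a b)" by (simp add: free_skew_field_def)
qed

lemma free_skew_field_simps:
  "carrier free_skew_field = {ratfun_of a | a. nc_dom a \<noteq> {}}"
  "\<one>\<^bsub>free_skew_field\<^esub> = ratfun_of (NC_Poly 1)" "\<zero>\<^bsub>free_skew_field\<^esub> = ratfun_of (NC_Poly 0)"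
  by (simp_all add: free_skew_field_def ratfuns_def)

lemma ratfun_carrier: "nc_dom a \<noteq> {} ==> ratfun_of a \<in> carrier free_skew_field"
  unfolding free_skew_field_simps by blast

lemma nc_expr_eval_obtains:
  assumes "point n A" "defined a n A"
  obtains M where "nc_expr_eval n A a = Some M" "dim_row M = n" "dim_col M = n"
  using assms nc_expr_eval_carrier[OF assms(1), of a] by (auto simp: defined_def)

lemma ring_free_skew_field: "ring (free_skew_field :: ('x, 'k :: field_char_0) nc_ratfun ring)"
proof -
  let ?W = "free_skew_field :: ('x, 'k) nc_ratfun ring"
  have rep: "\<exists>a. f = ratfun_of a \<and> nc_dom a \<noteq> {}" if "f \<in> carrier ?W" for f using that by (auto simp: free_skew_field_simps)
  have mem: "ratfun_of a \<in> carrier ?W" if "nc_dom a \<noteq> {}" for a using that by (rule ratfun_carrier)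
  note P = nc_dom_ops(1)
  note p1 = nc_poly_eval_1[OF pointD(1)] and p0 = nc_poly_eval_0[OF pointD(1)]
  show ?thesis
  proof (intro ringI abelian_groupI monoidI)
    fix f g h assume "f \<in> carrier ?W" "g \<in> carrier ?W" "h \<in> carrier ?W"
    then obtain a b c where abc: "f = ratfun_of a" "g = ratfun_of b" "h = ratfun_of c" and d: "nc_dom a \<noteq> {}" "nc_dom b \<noteq> {}" "nc_dom c \<noteq> {}"
      using rep by metis
    note simps = abc free_skew_field_ops d nc_dom_ops
    show "(f \<oplus>\<^bsub>?W\<^esub> g) \<oplus>\<^bsub>?W\<^esub> h = f \<oplus>\<^bsub>?W\<^esub> (g \<oplus>\<^bsub>?W\<^esub> h)"
    proof (simp add: simps, rule ratfun_eqI; (intro nc_dom_ops d)?)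
      fix n and A :: "'x => 'k mat" assume A: "point n A" and "defined (NC_Add (NC_Add a b) c) n A"
      then have D: "defined a n A" "defined b n A" "defined c n A" by simp_all
      show "nc_expr_eval n A (NC_Add (NC_Add a b) c) = nc_expr_eval n A (NC_Add a (NC_Add b c))"
        by (rule nc_expr_eval_obtains[OF A D(1)], rule nc_expr_eval_obtains[OF A D(2)], rule nc_expr_eval_obtains[OF A D(3)])
           (auto simp: add.assoc intro!: eq_matI)
    qed
    show "(f \<otimes>\<^bsub>?W\<^esub> g) \<otimes>\<^bsub>?W\<^esub> h = f \<otimes>\<^bsub>?W\<^esub> (g \<otimes>\<^bsub>?W\<^esub> h)"
    proof (simp add: simps, rule ratfun_eqI; (intro nc_dom_ops d)?)
      fix n and A :: "'x => 'k mat" assume A: "point n A" and "defined (NC_Mult (NC_Mult a b) c) n A"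
      then have D: "defined a n A" "defined b n A" "defined c n A" by simp_all
      show "nc_expr_eval n A (NC_Mult (NC_Mult a b) c) = nc_expr_eval n A (NC_Mult a (NC_Mult b c))"
        by (rule nc_expr_eval_obtains[OF A D(1)], rule nc_expr_eval_obtains[OF A D(2)], rule nc_expr_eval_obtains[OF A D(3)])
           (auto simp: mat_assoc)
    qed
    show "(f \<oplus>\<^bsub>?W\<^esub> g) \<otimes>\<^bsub>?W\<^esub> h = f \<otimes>\<^bsub>?W\<^esub> h \<oplus>\<^bsub>?W\<^esub> g \<otimes>\<^bsub>?W\<^esub> h"
    proof (simp add: simps, rule ratfun_eqI; (intro nc_dom_ops d)?)
      fix n and A :: "'x => 'k mat" assume A: "point n A" and "defined (NC_Mult (NC_Add a b) c) n A"
      then have D: "defined a n A" "defined b n A" "defined c n A" by simp_all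
      show "nc_expr_eval n A (NC_Mult (NC_Add a b) c) = nc_expr_eval n A (NC_Add (NC_Mult a c) (NC_Mult b c))"
        by (rule nc_expr_eval_obtains[OF A D(1)], rule nc_expr_eval_obtains[OF A D(2)], rule nc_expr_eval_obtains[OF A D(3)])
           (auto simp: mat_distrib)
    qed
    show "h \<otimes>\<^bsub>?W\<^esub> (f \<oplus>\<^bsub>?W\<^esub> g) = h \<otimes>\<^bsub>?W\<^esub> f \<oplus>\<^bsub>?W\<^esub> h \<otimes>\<^bsub>?W\<^esub> g"
    proof (simp add: simps, rule ratfun_eqI; (intro nc_dom_ops d)?)
      fix n and A :: "'x => 'k mat" assume A: "point n A" and "defined (NC_Mult c (NC_Add a b)) n A"
      then have D: "defined a n A" "defined b n A" "defined c n A" by simp_all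
      show "nc_expr_eval n A (NC_Mult c (NC_Add a b)) = nc_expr_eval n A (NC_Add (NC_Mult c a) (NC_Mult c b))"
        by (rule nc_expr_eval_obtains[OF A D(1)], rule nc_expr_eval_obtains[OF A D(2)], rule nc_expr_eval_obtains[OF A D(3)])
           (auto simp: mat_distrib)
    qed
  next
    fix f g assume "f \<in> carrier ?W" "g \<in> carrier ?W"
    then obtain a b where abc: "f = ratfun_of a" "g = ratfun_of b" and d: "nc_dom a \<noteq> {}" "nc_dom b \<noteq> {}" using rep by metis
    show "f \<oplus>\<^bsub>?W\<^esub> g \<in> carrier ?W" "f \<otimes>\<^bsub>?W\<^esub> g \<in> carrier ?W"
      by (simp_all add: abc free_skew_field_ops d mem nc_dom_ops)
    show "f \<oplus>\<^bsub>?W\<^esub> g = g \<oplus>\<^bsub>?W\<^esub> f"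
    proof (simp add: abc free_skew_field_ops d, rule ratfun_eqI; (intro nc_dom_ops d)?)
      fix n and A :: "'x => 'k mat" assume A: "point n A" and "defined (NC_Add a b) n A"
      then have D: "defined a n A" "defined b n A" by simp_all
      show "nc_expr_eval n A (NC_Add a b) = nc_expr_eval n A (NC_Add b a)"
        by (rule nc_expr_eval_obtains[OF A D(1)], rule nc_expr_eval_obtains[OF A D(2)]) (auto simp: add.commute intro!: eq_matI)
    qed
  next
    fix f assume "f \<in> carrier ?W"
    then obtain a where abc: "f = ratfun_of a" and d: "nc_dom a \<noteq> {}" using rep by metis
    show "\<one>\<^bsub>?W\<^esub> \<otimes>\<^bsub>?W\<^esub> f = f"
    proof (simp add: abc free_skew_field_simps free_skew_field_ops d P, rule ratfun_eqI; (intro nc_dom_ops d)?)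
      fix n and A :: "'x => 'k mat" assume A: "point n A" and D: "defined a n A"
      show "nc_expr_eval n A (NC_Mult (NC_Poly 1) a) = nc_expr_eval n A a"
        by (rule nc_expr_eval_obtains[OF A D]) (simp add: p1[OF A])
    qed
    show "f \<otimes>\<^bsub>?W\<^esub> \<one>\<^bsub>?W\<^esub> = f"
    proof (simp add: abc free_skew_field_simps free_skew_field_ops d P, rule ratfun_eqI; (intro nc_dom_ops d)?)
      fix n and A :: "'x => 'k mat" assume A: "point n A" and D: "defined a n A"
      show "nc_expr_eval n A (NC_Mult a (NC_Poly 1)) = nc_expr_eval n A a"
        by (rule nc_expr_eval_obtains[OF A D]) (simp add: p1[OF A])
    qed
    show "\<zero>\<^bsub>?W\<^esub> \<oplus>\<^bsub>?W\<^esub> f = f"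
    proof (simp add: abc free_skew_field_simps free_skew_field_ops d P, rule ratfun_eqI; (intro nc_dom_ops d)?)
      fix n and A :: "'x => 'k mat" assume A: "point n A" and D: "defined a n A"
      show "nc_expr_eval n A (NC_Add (NC_Poly 0) a) = nc_expr_eval n A a"
        by (rule nc_expr_eval_obtains[OF A D]) (simp add: p0[OF A])
    qed
    have "ratfun_of (NC_Mult (NC_Poly (-1)) a) \<oplus>\<^bsub>?W\<^esub> f = \<zero>\<^bsub>?W\<^esub>"
    proof (simp add: abc free_skew_field_simps free_skew_field_ops d nc_dom_ops, rule ratfun_eqI; (intro nc_dom_ops d)?)
      fix n and A :: "'x => 'k mat" assume A: "point n A" and "defined (NC_Add (NC_Mult (NC_Poly (-1)) a) a) n A"
      then have D: "defined a n A" by simp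
      show "nc_expr_eval n A (NC_Add (NC_Mult (NC_Poly (-1)) a) a) = nc_expr_eval n A (NC_Poly 0)"
        by (rule nc_expr_eval_obtains[OF A D])
           (simp add: p0[OF A] nc_poly_eval_uminus[OF pointD(1)[OF A]] p1[OF A], intro eq_matI, auto)
    qed
    then show "\<exists>g\<in>carrier ?W. g \<oplus>\<^bsub>?W\<^esub> f = \<zero>\<^bsub>?W\<^esub>" by (rule bexI) (intro mem nc_dom_ops d)
  qed (unfold free_skew_field_simps(2,3), (intro mem P)+)
qed

lemma a_inv_free_skew_field:
  fixes a :: "('x, 'k :: field_char_0) nc_expr"
  assumes d: "nc_dom a \<noteq> {}"
  shows "\<ominus>\<^bsub>free_skew_field\<^esub> ratfun_of a = ratfun_of (NC_Mult (NC_Poly (-1)) a)"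
proof -
  interpret ring "free_skew_field :: ('x, 'k) nc_ratfun ring" by (rule ring_free_skew_field)
  show ?thesis
  proof (rule minus_equality)
    show "ratfun_of (NC_Mult (NC_Poly (-1)) a) \<oplus>\<^bsub>free_skew_field\<^esub> ratfun_of a = \<zero>\<^bsub>free_skew_field\<^esub>"
    proof (simp add: free_skew_field_simps free_skew_field_ops d nc_dom_ops, rule ratfun_eqI; (intro nc_dom_ops d)?)
      fix n and A :: "'x => 'k mat" assume A: "point n A" and "defined (NC_Add (NC_Mult (NC_Poly (-1)) a) a) n A"
      then have D: "defined a n A" by simp
      show "nc_expr_eval n A (NC_Add (NC_Mult (NC_Poly (-1)) a) a) = nc_expr_eval n A (NC_Poly 0)"
        by (rule nc_expr_eval_obtains[OF A D])
           (simp add: nc_poly_eval_0[OF pointD(1)[OF A]] nc_poly_eval_uminus[OF pointD(1)[OF A]] nc_poly_eval_1[OF pointD(1)[OF A]], intro eq_matI, auto)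
    qed
  qed (intro ratfun_carrier nc_dom_ops d)+
qed

lemma nc_poly_ratfun_hom:
  "(\<lambda>p. ratfun_of (NC_Poly p)) \<in> Ring.ring_hom (free_alg V) (free_skew_field :: ('x, 'k :: field_char_0) nc_ratfun ring)"
proof (rule ring_hom_memI)
  fix p q :: "('x, 'k) nc_poly"
  note P = nc_dom_ops(1)
  show "ratfun_of (NC_Poly p) \<in> carrier free_skew_field" by (rule ratfun_carrier[OF P])
  show "ratfun_of (NC_Poly (p \<otimes>\<^bsub>free_alg V\<^esub> q)) = ratfun_of (NC_Poly p) \<otimes>\<^bsub>free_skew_field\<^esub> ratfun_of (NC_Poly q)"
    unfolding free_alg_simps free_skew_field_ops[OF P P]
  proof (rule ratfun_eqI; (intro nc_dom_ops)?)
    fix n and A :: "'x => 'k mat" assume A: "point n A"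
    show "nc_expr_eval n A (NC_Poly (p * q)) = nc_expr_eval n A (NC_Mult (NC_Poly p) (NC_Poly q))"
      by (simp add: nc_poly_eval_mult[OF pointD(1)[OF A]])
  qed
  show "ratfun_of (NC_Poly (p \<oplus>\<^bsub>free_alg V\<^esub> q)) = ratfun_of (NC_Poly p) \<oplus>\<^bsub>free_skew_field\<^esub> ratfun_of (NC_Poly q)"
    unfolding free_alg_simps free_skew_field_ops[OF P P]
  proof (rule ratfun_eqI; (intro nc_dom_ops)?)
    fix n and A :: "'x => 'k mat" assume A: "point n A"
    show "nc_expr_eval n A (NC_Poly (p + q)) = nc_expr_eval n A (NC_Add (NC_Poly p) (NC_Poly q))"
      by (simp add: nc_poly_eval_add[OF pointD(1)[OF A]])
  qed
qed (simp add: free_skew_field_simps)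

lemma ratfuns_le_iff:
  "f \<in> ratfuns_le V h \<longleftrightarrow> (\<exists>a. f = ratfun_of a \<and> nc_dom a \<noteq> {} \<and> nc_expr_vars a \<subseteq> V \<and> nc_expr_height a \<le> h)"
  for f :: "('x, 'k :: field_char_0) nc_ratfun"
proof
  assume f: "f \<in> ratfuns_le V h"
  then obtain b where b: "f = ratfun_of b" "nc_dom b \<noteq> {}" "nc_expr_vars b \<subseteq> V" by (auto simp: ratfuns_le_def ratfuns_def)
  then have "b \<in> f" by (simp add: ratfun_of_def nc_equiv_iff)
  then have "\<exists>a\<in>f. nc_expr_vars a \<subseteq> V \<and> nc_expr_height a = ratfun_height V f"
    unfolding ratfun_height_def
    by (intro LeastI_ex[of "\<lambda>h. \<exists>a\<in>f. nc_expr_vars a \<subseteq> V \<and> nc_expr_height a = h"] exI bexI[of _ b]) (simp_all add: b(3))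
  then obtain a where a: "a \<in> f" "nc_expr_vars a \<subseteq> V" "nc_expr_height a = ratfun_height V f" by blast
  have ba: "(b, a) \<in> nc_equiv" using a(1) b(1) by (simp add: ratfun_of_def)
  then have "nc_dom a \<noteq> {}" by (simp add: nc_equiv_iff)
  moreover have "f = ratfun_of a" unfolding b(1) using ratfun_eq_iff[OF b(2) calculation] ba by simp
  ultimately show "\<exists>a. f = ratfun_of a \<and> nc_dom a \<noteq> {} \<and> nc_expr_vars a \<subseteq> V \<and> nc_expr_height a \<le> h"
    using a f by (auto simp: ratfuns_le_def)
next
  assume "\<exists>a. f = ratfun_of a \<and> nc_dom a \<noteq> {} \<and> nc_expr_vars a \<subseteq> V \<and> nc_expr_height a \<le> h"
  then obtain a where a: "f = ratfun_of a" "nc_dom a \<noteq> {}" "nc_expr_vars a \<subseteq> V" "nc_expr_height a \<le> h" by blast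
  have "a \<in> f" using a by (simp add: ratfun_of_def nc_equiv_iff)
  then have "ratfun_height V f \<le> nc_expr_height a" unfolding ratfun_height_def
    by (intro Least_le[of "\<lambda>h. \<exists>a\<in>f. nc_expr_vars a \<subseteq> V \<and> nc_expr_height a = h"] bexI[of _ a]) (simp_all add: a(3))
  with a show "f \<in> ratfuns_le V h" by (auto simp: ratfuns_le_def ratfuns_def)
qed

lemma subring_ratfuns_le: "subring (ratfuns_le V h) (free_skew_field :: ('x, 'k :: field_char_0) nc_ratfun ring)"
proof -
  interpret ring "free_skew_field :: ('x, 'k) nc_ratfun ring" by (rule ring_free_skew_field)
  have v: "nc_poly_vars (-1 :: ('x, 'k) nc_poly) = {}" by simp
  show ?thesis
  proof (rule subringI)
    show "ratfuns_le V h \<subseteq> carrier (free_skew_field :: ('x, 'k) nc_ratfun ring)"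
      by (auto simp: ratfuns_le_iff free_skew_field_simps)
    show "\<one>\<^bsub>free_skew_field\<^esub> \<in> (ratfuns_le V h :: ('x, 'k) nc_ratfun set)"
      unfolding free_skew_field_simps ratfuns_le_iff by (intro exI[of _ "NC_Poly 1"]) (simp add: nc_dom_ops)
  next
    fix f :: "('x, 'k) nc_ratfun" assume "f \<in> ratfuns_le V h"
    then obtain a where a: "f = ratfun_of a" "nc_dom a \<noteq> {}" "nc_expr_vars a \<subseteq> V" "nc_expr_height a \<le> h" by (auto simp: ratfuns_le_iff)
    then show "\<ominus>\<^bsub>free_skew_field\<^esub> f \<in> ratfuns_le V h"
      unfolding ratfuns_le_iff a(1) a_inv_free_skew_field[OF a(2)]
      by (intro exI[of _ "NC_Mult (NC_Poly (-1)) a"]) (simp add: nc_dom_ops)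
  next
    fix f g :: "('x, 'k) nc_ratfun" assume "f \<in> ratfuns_le V h" "g \<in> ratfuns_le V h"
    then obtain a b where a: "f = ratfun_of a" "nc_dom a \<noteq> {}" "nc_expr_vars a \<subseteq> V" "nc_expr_height a \<le> h"
      and b: "g = ratfun_of b" "nc_dom b \<noteq> {}" "nc_expr_vars b \<subseteq> V" "nc_expr_height b \<le> h" by (auto simp: ratfuns_le_iff)
    show "f \<otimes>\<^bsub>free_skew_field\<^esub> g \<in> ratfuns_le V h"
      unfolding ratfuns_le_iff a(1) b(1) free_skew_field_ops[OF a(2) b(2)]
      using a b by (intro exI[of _ "NC_Mult a b"]) (simp add: nc_dom_ops)
    show "f \<oplus>\<^bsub>free_skew_field\<^esub> g \<in> ratfuns_le V h"
      unfolding ratfuns_le_iff a(1) b(1) free_skew_field_ops[OF a(2) b(2)]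
      using a b by (intro exI[of _ "NC_Add a b"]) (simp add: nc_dom_ops)
  qed
qed

lemma nc_expr_eval_cong:
  assumes "\<And>x. x \<in> V ==> A x = B x"
  shows "nc_expr_vars a \<subseteq> V ==> nc_expr_eval n A a = nc_expr_eval n B a"
proof (induction a)
  case (NC_Poly p)
  have "foldr (\<lambda>x M. A x * M) xs (1\<^sub>m n) = foldr (\<lambda>x M. B x * M) xs (1\<^sub>m n)" if "set xs \<subseteq> V" for xs
    using that assms by (induction xs) auto
  then have "nc_word_eval n A w = nc_word_eval n B w" if "w \<in> Poly_Mapping.keys p" for w
    using that NC_Poly by (auto simp: nc_word_eval_def nc_poly_vars_def)
  then show ?case by (simp add: nc_poly_eval_def)
qed (auto split: option.splits)


section \<open>Realizations\<close>

text \<open>A realization writes the values of an expression as \<open>w - c * M\<^sup>-\<^sup>1 * d\<close> with matrices \<open>M, c, d, w\<close> over the free algebra. The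
  predicate \<open>G\<close> is a condition on \<open>M\<close> to be carried along.\<close>

definition realized_at where
  "realized_at e M c d w n A \<longleftrightarrow> det (mev n A M) \<noteq> 0 \<and>
     (\<exists>Y. Y \<in> carrier_mat (dim_row M * n) n \<and> mev n A M * Y = mev n A d \<and> nc_expr_eval n A e = Some (mev n A w - mev n A c * Y))"

definition realizes where
  "realizes e M c d w \<longleftrightarrow> dim_row M = dim_col M \<and> c \<in> carrier_mat 1 (dim_row M) \<and> d \<in> carrier_mat (dim_row M) 1 \<and> w \<in> carrier_mat 1 1 \<and>
     (\<forall>n A. point n A --> defined e n A --> realized_at e M c d w n A)"

lemma realized_atE:
  assumes "realized_at e M c d w n A"
  obtains Y where "det (mev n A M) \<noteq> 0" "dim_row Y = dim_row M * n" "dim_col Y = n" "mev n A M * Y = mev n A d"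
    "nc_expr_eval n A e = Some (mev n A w - mev n A c * Y)"
  using assms unfolding realized_at_def by (elim conjE exE) (rule that; auto)

lemma realized_atI:
  assumes "det (mev n A M) \<noteq> 0" "dim_row Y = dim_row M * n" "dim_col Y = n" "mev n A M * Y = mev n A d"
    "nc_expr_eval n A e = Some v" "v = mev n A w - mev n A c * Y"
  shows "realized_at e M c d w n A"
  unfolding realized_at_def using assms by (intro conjI exI[of _ Y]) (auto intro!: carrier_matI)

lemma realizesD: "realizes e M c d w ==> point n A ==> defined e n A ==> realized_at e M c d w n A"
  by (simp add: realizes_def)

definition entry_mat :: "'a => 'a mat" where "entry_mat p = mat 1 1 (\<lambda>_. p)"

lemma entry_mat_dim [simp]: "dim_row (entry_mat p) = 1" "dim_col (entry_mat p) = 1"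
  by (simp_all add: entry_mat_def)

lemma mev_entry: "mev n A (entry_mat p) = nc_poly_eval n A p"
  by (rule eq_matI) (auto simp: mev_index entry_mat_def)

lemma realizes_poly: "realizes (NC_Poly p) (0\<^sub>m 0 0) (0\<^sub>m 1 0) (0\<^sub>m 0 1) (entry_mat p)"
  unfolding realizes_def
proof (intro conjI allI impI)
  fix n and A :: "'a => 'b mat"
  show "realized_at (NC_Poly p) (0\<^sub>m 0 0) (0\<^sub>m 1 0) (0\<^sub>m 0 1) (entry_mat p) n A"
    by (rule realized_atI[of _ _ _ "0\<^sub>m 0 n" _ _ "nc_poly_eval n A p"]) (auto simp: mev_entry intro!: eq_matI)
qed (auto intro!: carrier_matI)

lemma det_block_upper:
  "dim_row A = n ==> dim_col A = n ==> dim_row D = m ==> dim_col D = m ==> dim_row B = n ==> dim_col B = m ==>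
   det (four_block_mat A B (0\<^sub>m m n) D) = det A * det (D :: 'k :: field mat)"
  by (rule det_four_block_mat_lower_left_zero[of _ n _ m]) (auto intro!: carrier_matI)

lemma realizes_add:
  assumes 1: "realizes e M c d w" and 2: "realizes e' M' c' d' w'"
  shows "realizes (NC_Add e e') (four_block_mat M (0\<^sub>m (dim_row M) (dim_row M')) (0\<^sub>m (dim_row M') (dim_row M)) M')
    (hstack c c') (vstack d d') (w + w')"
proof -
  have [simp]: "dim_col M = dim_row M" "dim_row c = 1" "dim_col c = dim_row M" "dim_row d = dim_row M" "dim_col d = 1" "dim_row w = 1" "dim_col w = 1"
    "dim_col M' = dim_row M'" "dim_row c' = 1" "dim_col c' = dim_row M'" "dim_row d' = dim_row M'" "dim_col d' = 1" "dim_row w' = 1" "dim_col w' = 1"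
    using assms by (auto simp: realizes_def)
  have ev: "realized_at (NC_Add e e') (four_block_mat M (0\<^sub>m (dim_row M) (dim_row M')) (0\<^sub>m (dim_row M') (dim_row M)) M') (hstack c c') (vstack d d') (w + w') n A" if A: "point n A" and D: "defined (NC_Add e e') n A" for n A
  proof -
  have R: "realized_at e M c d w n A" "realized_at e' M' c' d' w' n A" using realizesD[OF 1 A] realizesD[OF 2 A] D by simp_all
  from R(1) obtain Y where Y: "det (mev n A M) \<noteq> 0" "dim_row Y = dim_row M * n" "dim_col Y = n" "mev n A M * Y = mev n A d"
    "nc_expr_eval n A e = Some (mev n A w - mev n A c * Y)" by (rule realized_atE)
  from R(2) obtain Y' where Y': "det (mev n A M') \<noteq> 0" "dim_row Y' = dim_row M' * n" "dim_col Y' = n" "mev n A M' * Y' = mev n A d'"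
    "nc_expr_eval n A e' = Some (mev n A w' - mev n A c' * Y')" by (rule realized_atE)
  note mev_simps = mev_four_block mev_vstack mev_hstack mev_add[OF pointD(1)[OF A]]
  show ?thesis
  proof (rule realized_atI[where Y = "vstack Y Y'"])
    show "det (mev n A (four_block_mat M (0\<^sub>m (dim_row M) (dim_row M')) (0\<^sub>m (dim_row M') (dim_row M)) M')) \<noteq> 0"
      using Y(1) Y'(1) by (simp add: mev_simps det_block_upper)
    show "mev n A (four_block_mat M (0\<^sub>m (dim_row M) (dim_row M')) (0\<^sub>m (dim_row M') (dim_row M)) M') * vstack Y Y' = mev n A (vstack d d')"
      using Y(2-4) Y'(2-4) by (simp add: mev_simps four_block_mult_vstack)
    show "mev n A w - mev n A c * Y + (mev n A w' - mev n A c' * Y') = mev n A (w + w') - mev n A (hstack c c') * vstack Y Y'"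
      using Y(2,3) Y'(2,3) by (simp add: mev_simps hstack_vstack) (intro eq_matI; simp del: index_mult_mat(1))
  qed (use Y Y' in \<open>auto simp: distrib_right\<close>)
  qed
  show ?thesis unfolding realizes_def by (intro conjI allI impI carrier_matI ev) simp_all
qed

lemma realizes_mult:
  assumes 1: "realizes e M c d w" and 2: "realizes e' M' c' d' w'"
  shows "realizes (NC_Mult e e') (four_block_mat M (d * c') (0\<^sub>m (dim_row M') (dim_row M)) M')
    (hstack c (w * c')) (vstack (d * w') d') (w * w')"
proof -
  have [simp]: "dim_col M = dim_row M" "dim_row c = 1" "dim_col c = dim_row M" "dim_row d = dim_row M" "dim_col d = 1" "dim_row w = 1" "dim_col w = 1"
    "dim_col M' = dim_row M'" "dim_row c' = 1" "dim_col c' = dim_row M'" "dim_row d' = dim_row M'" "dim_col d' = 1" "dim_row w' = 1" "dim_col w' = 1"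
    using assms by (auto simp: realizes_def)
  have ev: "realized_at (NC_Mult e e') (four_block_mat M (d * c') (0\<^sub>m (dim_row M') (dim_row M)) M') (hstack c (w * c')) (vstack (d * w') d') (w * w') n A" if A: "point n A" and D: "defined (NC_Mult e e') n A" for n A
  proof -
  have R: "realized_at e M c d w n A" "realized_at e' M' c' d' w' n A" using realizesD[OF 1 A] realizesD[OF 2 A] D by simp_all
  from R(1) obtain Y where Y: "det (mev n A M) \<noteq> 0" "dim_row Y = dim_row M * n" "dim_col Y = n" "mev n A M * Y = mev n A d"
    "nc_expr_eval n A e = Some (mev n A w - mev n A c * Y)" by (rule realized_atE)
  from R(2) obtain Y' where Y': "det (mev n A M') \<noteq> 0" "dim_row Y' = dim_row M' * n" "dim_col Y' = n" "mev n A M' * Y' = mev n A d'"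
    "nc_expr_eval n A e' = Some (mev n A w' - mev n A c' * Y')" by (rule realized_atE)
  define v' where "v' = mev n A w' - mev n A c' * Y'"
  have [simp]: "dim_row v' = n" "dim_col v' = n" using Y' by (simp_all add: v'_def)
  have w': "mev n A w' = v' + mev n A c' * Y'" unfolding v'_def using Y' by (intro eq_matI) auto
  note mev_simps = mev_four_block mev_vstack mev_hstack mev_mult[OF pointD(1)[OF A]]
  let ?M = "four_block_mat M (d * c') (0\<^sub>m (dim_row M') (dim_row M)) M'"
  show ?thesis
  proof (rule realized_atI[where Y = "vstack (Y * v') Y'"])
    show "det (mev n A ?M) \<noteq> 0"
      using Y(1) Y'(1) by (simp add: mev_simps det_block_upper)
    have "mev n A M * (Y * v') = mev n A d * v'" using Y(2-4) by (simp flip: mat_assoc)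
    then show "mev n A ?M * vstack (Y * v') Y' = mev n A (vstack (d * w') d')"
      using Y(2,3) Y'(2-4) by (simp add: mev_simps four_block_mult_vstack w' mat_distrib mat_assoc)
    show "(mev n A w - mev n A c * Y) * v' = mev n A (w * w') - mev n A (hstack c (w * c')) * vstack (Y * v') Y'"
      using Y(2,3) Y'(2,3) by (simp add: mev_simps hstack_vstack w' mat_distrib mat_assoc) (intro eq_matI; simp del: index_mult_mat(1))
  qed (use Y Y' in \<open>auto simp: distrib_right v'_def\<close>)
  qed
  show ?thesis unfolding realizes_def by (intro conjI allI impI carrier_matI ev) simp_all
qed

text \<open>The determinant of a bordered matrix in terms of its Schur complement.\<close>

lemma schur_det:
  fixes M :: "'k :: field mat"
  assumes M: "M \<in> carrier_mat p p" "det M \<noteq> 0" and d: "d \<in> carrier_mat p q" and c: "c \<in> carrier_mat q p" and w: "w \<in> carrier_mat q q"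
    and Y: "Y \<in> carrier_mat p q" "M * Y = d"
  shows "det (four_block_mat M d c w) = det M * det (w - c * Y)"
proof -
  obtain K where K: "K \<in> carrier_mat p p" "M * K = 1\<^sub>m p" "K * M = 1\<^sub>m p" by (rule det_nonzero_inverse[OF M])
  note [simp] = carrier_matD[OF M(1)] carrier_matD[OF d] carrier_matD[OF c] carrier_matD[OF w] carrier_matD[OF Y(1)] carrier_matD[OF K(1)]
  define x where "x = c * K"
  have [simp]: "dim_row x = q" "dim_col x = p" by (simp_all add: x_def)
  have xM: "x * M = c" unfolding x_def using K(3) by (simp add: mat_assoc)
  then have xd: "x * d = c * Y" unfolding Y(2)[symmetric] by (simp flip: mat_assoc)
  have "c * Y + (w - c * Y) = w" by (intro eq_matI) auto
  then have "four_block_mat M d c w = four_block_mat (1\<^sub>m p) (0\<^sub>m p q) x (1\<^sub>m q) * four_block_mat M d (0\<^sub>m q p) (w - c * Y)"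
    by (subst four_block_mult) (simp_all add: xM xd)
  also have "det \<dots> = det (four_block_mat (1\<^sub>m p) (0\<^sub>m p q) x (1\<^sub>m q)) * det (four_block_mat M d (0\<^sub>m q p) (w - c * Y))"
    by (rule det_mult[of _ "p + q"]) (auto intro!: carrier_matI)
  also have "\<dots> = det M * det (w - c * Y)"
    by (subst det_four_block_mat_upper_right_zero[of _ p _ q]; (subst det_four_block_mat_lower_left_zero[of _ p _ q])?) (auto intro!: carrier_matI)
  finally show ?thesis .
qed

text \<open>The inverse of the Schur complement is a corner of the inverse of the bordered matrix.\<close>

lemma realizes_inv:
  assumes 1: "realizes e M c d w"
  shows "realizes (NC_Inv e) (four_block_mat M d c w) (hstack (0\<^sub>m 1 (dim_row M)) (- 1\<^sub>m 1)) (vstack (0\<^sub>m (dim_row M) 1) (1\<^sub>m 1)) (0\<^sub>m 1 1)"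
proof -
  have [simp]: "dim_col M = dim_row M" "dim_row c = 1" "dim_col c = dim_row M" "dim_row d = dim_row M" "dim_col d = 1" "dim_row w = 1" "dim_col w = 1"
    using assms by (auto simp: realizes_def)
  have ev: "realized_at (NC_Inv e) (four_block_mat M d c w) (hstack (0\<^sub>m 1 (dim_row M)) (- 1\<^sub>m 1)) (vstack (0\<^sub>m (dim_row M) 1) (1\<^sub>m 1)) (0\<^sub>m 1 1) n A" if A: "point n A" and D: "defined (NC_Inv e) n A" for n A
  proof -
  from D obtain V where V: "nc_expr_eval n A (NC_Inv e) = Some V" by (auto simp: defined_def)
  then have "defined e n A" by (auto simp: defined_def split: option.splits)
  then have R: "realized_at e M c d w n A" by (rule realizesD[OF 1 A])
  from R obtain Y where Y: "det (mev n A M) \<noteq> 0" "dim_row Y = dim_row M * n" "dim_col Y = n" "mev n A M * Y = mev n A d"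
    "nc_expr_eval n A e = Some (mev n A w - mev n A c * Y)" by (rule realized_atE)
  define v where "v = mev n A w - mev n A c * Y"
  have v: "v \<in> carrier_mat n n" using Y by (intro carrier_matI) (simp_all add: v_def)
  have "mat_inverse v = Some V" using V Y(5) by (simp add: v_def)
  then have V': "V \<in> carrier_mat n n" "v * V = 1\<^sub>m n" unfolding mat_inverse_iff[OF v] by simp_all
  note [simp] = carrier_matD[OF V'(1)] carrier_matD[OF v]
  have one: "mev n A (- 1\<^sub>m 1) = - 1\<^sub>m n"
  proof (rule eq_matI)
    fix i j assume "i < dim_row (- 1\<^sub>m n :: 'b mat)" "j < dim_col (- 1\<^sub>m n :: 'b mat)"
    then show "mev n A (- 1\<^sub>m 1) $$ (i, j) = (- 1\<^sub>m n) $$ (i, j)"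
      by (simp add: mev_index nc_poly_eval_uminus[OF pointD(1)[OF A]] nc_poly_eval_1[OF pointD(1)[OF A]])
  qed simp_all
  note mev_simps = mev_four_block mev_vstack mev_hstack mev_one[OF pointD(1)[OF A]] one
  let ?M = "four_block_mat M d c w"
  show ?thesis
  proof (rule realized_atI[where Y = "vstack (- (Y * V)) V"])
    have "det (mev n A ?M) = det (mev n A M) * det v"
      unfolding v_def using Y by (simp add: mev_simps) (rule schur_det[of _ "dim_row M * n"], auto intro!: carrier_matI)
    then show "det (mev n A ?M) \<noteq> 0" using Y(1) inverse_det_nonzero[OF v V'] by simp
    have a: "mev n A M * - (Y * V) = - (mev n A d * V)"
      using Y(2-4) by (simp flip: mat_assoc uminus_mult_right_mat)
    have b: "mev n A c * - (Y * V) + mev n A w * V = 1\<^sub>m n"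
    proof -
      have "mev n A c * - (Y * V) = - (mev n A c * Y * V)" using Y(2,3) by (simp add: mat_assoc)
      then have "mev n A c * - (Y * V) + mev n A w * V = v * V"
        unfolding v_def using Y(2,3) by (simp add: mat_distrib) (intro eq_matI; simp del: index_mult_mat(1))
      then show ?thesis using V'(2) by simp
    qed
    have "- (mev n A d * V) + mev n A d * V = 0\<^sub>m (dim_row M * n) n" by (intro eq_matI) (simp_all del: index_mult_mat(1))
    moreover have "- (mev n A c * (Y * V)) + mev n A w * V = 1\<^sub>m n" using b Y(2,3) by simp
    ultimately show "mev n A ?M * vstack (- (Y * V)) V = mev n A (vstack (0\<^sub>m (dim_row M) 1) (1\<^sub>m 1))"
      using Y(2,3) by (simp add: mev_simps four_block_mult_vstack a)
    show "V = mev n A (0\<^sub>m 1 1) - mev n A (hstack (0\<^sub>m 1 (dim_row M)) (- 1\<^sub>m 1)) * vstack (- (Y * V)) V"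
    proof -
      have "- 1\<^sub>m n * V = - V" by simp
      then show ?thesis using Y(2,3) by (simp add: mev_simps hstack_vstack del: One_nat_def) (intro eq_matI; simp)
    qed
  qed (use Y V in \<open>simp_all add: distrib_right\<close>)
  qed
  show ?thesis unfolding realizes_def by (intro conjI allI impI carrier_matI ev) simp_all
qed

lemma realization_exists: "\<exists>M c d w. realizes e M c d w"
proof (induction e)
  case (NC_Poly p)
  show ?case using realizes_poly by (intro exI)
next
  case (NC_Add a b)
  then show ?case using realizes_add by (elim exE) (intro exI)
next
  case (NC_Mult a b)
  then show ?case using realizes_mult by (elim exE) (intro exI)
next
  case (NC_Inv a)
  then show ?case using realizes_inv by (elim exE) (intro exI)
qed

section \<open>Realizations of zero\<close>

context matrix_congruence
begin

lemma cg_four_block: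
  assumes "A \<doteq> A'" "B \<doteq> B'" "C \<doteq> C'" "D \<doteq> D'" "dim_row A = dim_row B" "dim_row C = dim_row D" "dim_col A = dim_col C" "dim_col B = dim_col D"
  shows "four_block_mat A B C D \<doteq> four_block_mat A' B' C' D'"
proof -
  have "vstack (hstack A B) (hstack C D) \<doteq> vstack (hstack A' B') (hstack C' D')"
    using assms by (intro cg_vstack cg_hstack) auto
  then show ?thesis
    using assms(5-8) cg_dim[OF assms(1)] cg_dim[OF assms(2)] cg_dim[OF assms(3)] cg_dim[OF assms(4)] by (simp add: vstack_hstack)
qed

lemma fac_cong: "fac B t ==> A \<doteq> B ==> fac A t"
  unfolding fac_def using cg_dim[of A B] cg_trans[of A B] by auto

lemma fac_mono:
  assumes "fac A s" "s \<le> t"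
  shows "fac A t"
proof -
  from assms(1) obtain B C where B: "B \<in> carrier_mat (dim_row A) s" and C: "C \<in> carrier_mat s (dim_col A)" and eq: "A \<doteq> B * C" by (rule facE)
  note [simp] = carrier_matD[OF B] carrier_matD[OF C]
  have "hstack B (0\<^sub>m (dim_row A) (t - s)) * vstack C (0\<^sub>m (t - s) (dim_col A)) = B * C"
    by (simp add: hstack_vstack)
  then show ?thesis
    using eq assms(2) by (intro facI[of "hstack B (0\<^sub>m (dim_row A) (t - s))" _ _ "vstack C (0\<^sub>m (t - s) (dim_col A))"]) (auto intro!: carrier_matI)
qed

lemma fac_four_blockI:
  assumes "A \<doteq> Y1 * Z1" "B \<doteq> Y1 * Z2" "C \<doteq> Y2 * Z1" "D \<doteq> Y2 * Z2"
    "dim_col Y1 = t" "dim_col Y2 = t" "dim_row Z1 = t" "dim_row Z2 = t"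
  shows "fac (four_block_mat A B C D) t"
proof (rule fac_cong)
  note d = cg_dim[OF assms(1)] cg_dim[OF assms(2)] cg_dim[OF assms(3)] cg_dim[OF assms(4)]
  show "four_block_mat A B C D \<doteq> four_block_mat (Y1 * Z1) (Y1 * Z2) (Y2 * Z1) (Y2 * Z2)"
    using assms d by (intro cg_four_block) auto
  have "four_block_mat (Y1 * Z1) (Y1 * Z2) (Y2 * Z1) (Y2 * Z2) = vstack Y1 Y2 * hstack Z1 Z2"
    using assms(5-8) by (subst vstack_mult) (simp_all add: mult_hstack vstack_hstack)
  then show "fac (four_block_mat (Y1 * Z1) (Y1 * Z2) (Y2 * Z1) (Y2 * Z2)) t"
    using assms(5-8) by (intro facI[of "vstack Y1 Y2" _ _ "hstack Z1 Z2"]) (auto intro!: carrier_matI)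
qed

text \<open>The bordered matrix of a realization of size \<open>N\<close> that represents zero has inner rank \<open>N\<close>. This is inherited by sums with
  other such realizations and by products with arbitrary realizations.\<close>

context
  fixes M d c w M' d' c' w' :: "'s mat" and p p' :: nat
  assumes dims [simp]: "dim_row M = p" "dim_col M = p" "dim_row d = p" "dim_col d = 1" "dim_row c = 1" "dim_col c = p" "dim_row w = 1" "dim_col w = 1"
    "dim_row M' = p'" "dim_col M' = p'" "dim_row d' = p'" "dim_col d' = 1" "dim_row c' = 1" "dim_col c' = p'" "dim_row w' = 1" "dim_col w' = 1"
begin

lemma zero_realization_add:
  assumes "fac (four_block_mat M d c w) p" "fac (four_block_mat M' d' c' w') p'"
  shows "fac (four_block_mat (four_block_mat M (0\<^sub>m p p') (0\<^sub>m p' p) M') (vstack d d') (hstack c c') (w + w')) (p + p')"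
proof -
  obtain P1 P2 Q1 Q2 where P: "P1 \<in> carrier_mat p p" "P2 \<in> carrier_mat 1 p" "Q1 \<in> carrier_mat p p" "Q2 \<in> carrier_mat p 1"
    "M \<doteq> P1 * Q1" "d \<doteq> P1 * Q2" "c \<doteq> P2 * Q1" "w \<doteq> P2 * Q2"
    by (rule fac_four_block[OF assms(1)]) simp_all
  obtain R1 R2 S1 S2 where R: "R1 \<in> carrier_mat p' p'" "R2 \<in> carrier_mat 1 p'" "S1 \<in> carrier_mat p' p'" "S2 \<in> carrier_mat p' 1"
    "M' \<doteq> R1 * S1" "d' \<doteq> R1 * S2" "c' \<doteq> R2 * S1" "w' \<doteq> R2 * S2"
    by (rule fac_four_block[OF assms(2)]) simp_all
  note [simp] = carrier_matD[OF P(1)] carrier_matD[OF P(2)] carrier_matD[OF P(3)] carrier_matD[OF P(4)]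
    carrier_matD[OF R(1)] carrier_matD[OF R(2)] carrier_matD[OF R(3)] carrier_matD[OF R(4)]
  show ?thesis
  proof (rule fac_four_blockI[where ?Y1.0 = "four_block_mat P1 (0\<^sub>m p p') (0\<^sub>m p' p) R1" and ?Z1.0 = "four_block_mat Q1 (0\<^sub>m p p') (0\<^sub>m p' p) S1"
        and ?Y2.0 = "hstack P2 R2" and ?Z2.0 = "vstack Q2 S2"])
    show "four_block_mat M (0\<^sub>m p p') (0\<^sub>m p' p) M' \<doteq> four_block_mat P1 (0\<^sub>m p p') (0\<^sub>m p' p) R1 * four_block_mat Q1 (0\<^sub>m p p') (0\<^sub>m p' p) S1"
      using P(5) R(5) by (subst four_block_mult) (simp_all add: cg_four_block)
    show "vstack d d' \<doteq> four_block_mat P1 (0\<^sub>m p p') (0\<^sub>m p' p) R1 * vstack Q2 S2"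
      using P(6) R(6) by (simp add: four_block_mult_vstack cg_vstack)
    show "hstack c c' \<doteq> hstack P2 R2 * four_block_mat Q1 (0\<^sub>m p p') (0\<^sub>m p' p) S1"
      using P(7) R(7) by (simp add: hstack_mult_four_block cg_hstack)
    show "w + w' \<doteq> hstack P2 R2 * vstack Q2 S2"
      using P(8) R(8) by (simp add: hstack_vstack cg_add)
  qed simp_all
qed

lemma zero_realization_mult_left:
  assumes "fac (four_block_mat M' d' c' w') p'"
  shows "fac (four_block_mat (four_block_mat M (d * c') (0\<^sub>m p' p) M') (vstack (d * w') d') (hstack c (w * c')) (w * w')) (p + p')"
proof -
  obtain R1 R2 S1 S2 where R: "R1 \<in> carrier_mat p' p'" "R2 \<in> carrier_mat 1 p'" "S1 \<in> carrier_mat p' p'" "S2 \<in> carrier_mat p' 1"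
    "M' \<doteq> R1 * S1" "d' \<doteq> R1 * S2" "c' \<doteq> R2 * S1" "w' \<doteq> R2 * S2"
    by (rule fac_four_block[OF assms]) simp_all
  note [simp] = carrier_matD[OF R(1)] carrier_matD[OF R(2)] carrier_matD[OF R(3)] carrier_matD[OF R(4)]
  show ?thesis
  proof (rule fac_four_blockI[where ?Y1.0 = "four_block_mat M (d * R2) (0\<^sub>m p' p) R1" and ?Z1.0 = "four_block_mat (1\<^sub>m p) (0\<^sub>m p p') (0\<^sub>m p' p) S1"
        and ?Y2.0 = "hstack c (w * R2)" and ?Z2.0 = "vstack (0\<^sub>m p 1) S2"])
    show "four_block_mat M (d * c') (0\<^sub>m p' p) M' \<doteq> four_block_mat M (d * R2) (0\<^sub>m p' p) R1 * four_block_mat (1\<^sub>m p) (0\<^sub>m p p') (0\<^sub>m p' p) S1"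
      using R(5) R(7) by (subst four_block_mult) (simp_all add: cg_four_block cg_mult_left mat_assoc)
    show "vstack (d * w') d' \<doteq> four_block_mat M (d * R2) (0\<^sub>m p' p) R1 * vstack (0\<^sub>m p 1) S2"
      using R(6) R(8) by (simp add: four_block_mult_vstack cg_vstack cg_mult_left mat_assoc)
    show "hstack c (w * c') \<doteq> hstack c (w * R2) * four_block_mat (1\<^sub>m p) (0\<^sub>m p p') (0\<^sub>m p' p) S1"
      using R(7) by (simp add: hstack_mult_four_block cg_hstack cg_mult_left mat_assoc)
    show "w * w' \<doteq> hstack c (w * R2) * vstack (0\<^sub>m p 1) S2"
      using R(8) by (simp add: hstack_vstack cg_mult_left mat_assoc)
  qed simp_all
qed

lemma zero_realization_mult_right:
  assumes "fac (four_block_mat M d c w) p"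
  shows "fac (four_block_mat (four_block_mat M (d * c') (0\<^sub>m p' p) M') (vstack (d * w') d') (hstack c (w * c')) (w * w')) (p + p')"
proof -
  obtain P1 P2 Q1 Q2 where P: "P1 \<in> carrier_mat p p" "P2 \<in> carrier_mat 1 p" "Q1 \<in> carrier_mat p p" "Q2 \<in> carrier_mat p 1"
    "M \<doteq> P1 * Q1" "d \<doteq> P1 * Q2" "c \<doteq> P2 * Q1" "w \<doteq> P2 * Q2"
    by (rule fac_four_block[OF assms]) simp_all
  note [simp] = carrier_matD[OF P(1)] carrier_matD[OF P(2)] carrier_matD[OF P(3)] carrier_matD[OF P(4)]
  show ?thesis
  proof (rule fac_four_blockI[where ?Y1.0 = "four_block_mat P1 (0\<^sub>m p p') (0\<^sub>m p' p) (1\<^sub>m p')" and ?Z1.0 = "four_block_mat Q1 (Q2 * c') (0\<^sub>m p' p) M'"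
        and ?Y2.0 = "hstack P2 (0\<^sub>m 1 p')" and ?Z2.0 = "vstack (Q2 * w') d'"])
    have [simp]: "P1 * (Q2 * Z) = P1 * Q2 * Z" "P2 * (Q2 * Z) = P2 * Q2 * Z" if "dim_row Z = 1" for Z
      using that by (simp_all add: mat_assoc)
    show "four_block_mat M (d * c') (0\<^sub>m p' p) M' \<doteq> four_block_mat P1 (0\<^sub>m p p') (0\<^sub>m p' p) (1\<^sub>m p') * four_block_mat Q1 (Q2 * c') (0\<^sub>m p' p) M'"
      using P(5,6) by (subst four_block_mult) (simp_all add: cg_four_block cg_mult_right)
    show "vstack (d * w') d' \<doteq> four_block_mat P1 (0\<^sub>m p p') (0\<^sub>m p' p) (1\<^sub>m p') * vstack (Q2 * w') d'"
      using P(6) by (simp add: four_block_mult_vstack cg_vstack cg_mult_right)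
    show "hstack c (w * c') \<doteq> hstack P2 (0\<^sub>m 1 p') * four_block_mat Q1 (Q2 * c') (0\<^sub>m p' p) M'"
      using P(7,8) by (simp add: hstack_mult_four_block cg_hstack cg_mult_right)
    show "w * w' \<doteq> hstack P2 (0\<^sub>m 1 p') * vstack (Q2 * w') d'"
      using P(8) by (simp add: hstack_vstack cg_mult_right)
  qed simp_all
qed

end

text \<open>Over a Sylvester domain at most one corner makes the bordered matrix of a full matrix degenerate: the value of a
  realization is determined by its matrices.\<close>

lemma zero_realization_unique:
  assumes syl: sylvester and M: "full M" "dim_row M = p"
    and 1: "fac (four_block_mat M d c w) p" and 2: "fac (four_block_mat M d c w') p"
    and [simp]: "dim_row d = p" "dim_col d = 1" "dim_row c = 1" "dim_col c = p" "dim_row w = 1" "dim_col w = 1" "dim_row w' = 1" "dim_col w' = 1"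
  shows "w \<doteq> w'"
proof -
  have [simp]: "dim_row M = p" "dim_col M = p" using M by (simp_all add: full_def)
  obtain P1 P2 Q1 Q2 where P: "P1 \<in> carrier_mat p p" "P2 \<in> carrier_mat 1 p" "Q1 \<in> carrier_mat p p" "Q2 \<in> carrier_mat p 1"
    and PQ: "M \<doteq> P1 * Q1" "d \<doteq> P1 * Q2" "c \<doteq> P2 * Q1" "w \<doteq> P2 * Q2"
    by (rule fac_four_block[OF 1]) simp_all
  obtain R1 R2 S1 S2 where R: "R1 \<in> carrier_mat p p" "R2 \<in> carrier_mat 1 p" "S1 \<in> carrier_mat p p" "S2 \<in> carrier_mat p 1"
    and RS: "M \<doteq> R1 * S1" "d \<doteq> R1 * S2" "c \<doteq> R2 * S1" "w' \<doteq> R2 * S2"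
    by (rule fac_four_block[OF 2]) simp_all
  note [simp] = carrier_matD[OF P(1)] carrier_matD[OF P(2)] carrier_matD[OF P(3)] carrier_matD[OF P(4)]
    carrier_matD[OF R(1)] carrier_matD[OF R(2)] carrier_matD[OF R(3)] carrier_matD[OF R(4)]
  let ?F = "hstack P1 R1" and ?G = "four_block_mat Q1 Q2 (- S1) (- S2)"
  have neg: "R1 * - S1 = - (R1 * S1)" "R1 * - S2 = - (R1 * S2)" by (simp_all)
  have "?F * ?G = hstack (P1 * Q1 - R1 * S1) (P1 * Q2 - R1 * S2)"
    by (simp add: hstack_mult_four_block neg) (intro eq_matI; simp del: index_mult_mat(1))
  also have "\<dots> \<doteq> hstack (0\<^sub>m p p) (0\<^sub>m p 1)"
    using cg_diff_zero[OF cg_trans[OF cg_sym[OF PQ(1)] RS(1)]] cg_diff_zero[OF cg_trans[OF cg_sym[OF PQ(2)] RS(2)]]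
    by (intro cg_hstack) auto
  finally have FG: "?F * ?G \<doteq> 0\<^sub>m p (p + 1)" by simp
  have "M \<doteq> ?F * vstack Q1 (0\<^sub>m p p)" using PQ(1) by (simp add: hstack_vstack)
  from sylvester_left[OF syl M(1) this, of ?G] FG obtain s where s: "s \<le> p" "fac ?G s" by auto
  obtain U1 U2 V1 V2 where U: "U1 \<in> carrier_mat p s" "U2 \<in> carrier_mat p s" "V1 \<in> carrier_mat s p" "V2 \<in> carrier_mat s 1"
    and UV: "Q1 \<doteq> U1 * V1" "Q2 \<doteq> U1 * V2" "- S1 \<doteq> U2 * V1" "- S2 \<doteq> U2 * V2"
    by (rule fac_four_block[OF s(2)]) simp_all
  note [simp] = carrier_matD[OF U(1)] carrier_matD[OF U(2)] carrier_matD[OF U(3)] carrier_matD[OF U(4)]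
  have RU: "R2 * - S1 = - (R2 * S1)" "R2 * - S2 = - (R2 * S2)" by simp_all
  let ?T = "P2 * U1 + R2 * U2"
  have T: "?T * V \<doteq> P2 * Q + R2 * - S" if "Q \<doteq> U1 * V" "- S \<doteq> U2 * V" "dim_row V = s" "dim_row Q = p" "dim_row S = p" for Q S V
  proof -
    have "?T * V = P2 * (U1 * V) + R2 * (U2 * V)" using that(3) by (simp add: mat_distrib mat_assoc)
    also have "\<dots> \<doteq> P2 * Q + R2 * - S" using that cg_dim[OF that(1)] cg_dim[OF that(2)]
      by (intro cg_add cg_mult_left cg_sym[OF that(1)] cg_sym[OF that(2)]) auto
    finally show ?thesis .
  qed
  have "?T * V1 \<doteq> P2 * Q1 + R2 * - S1" by (rule T[OF UV(1,3)]) simp_all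
  also have "P2 * Q1 + R2 * - S1 = P2 * Q1 - R2 * S1" unfolding RU by (intro eq_matI) auto
  also have "\<dots> \<doteq> 0\<^sub>m 1 p" using cg_diff_zero[OF cg_trans[OF cg_sym[OF PQ(3)] RS(3)]] by simp
  finally have TV: "?T * V1 \<doteq> 0\<^sub>m 1 p" .
  have "M \<doteq> (P1 * U1) * V1" using cg_trans[OF PQ(1) cg_mult_left[OF UV(1), of P1]] by (simp add: mat_assoc)
  from sylvester_right[OF syl M(1) this, of ?T] TV obtain u where u: "p + u \<le> s" "fac ?T u" by auto
  have "u = 0" using u(1) s(1) by simp
  with u(2) have "fac ?T 0" by (simp only:)
  then obtain B C where BC: "B \<in> carrier_mat 1 0" "C \<in> carrier_mat 0 s" "?T \<doteq> B * C" by (auto elim: facE)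
  then have "B * C = 0\<^sub>m 1 s" by (intro eq_matI) (auto simp: scalar_prod_def)
  with BC have "?T * V2 \<doteq> 0\<^sub>m 1 s * V2" by (intro cg_mult_right) auto
  also have "0\<^sub>m 1 s * V2 = 0\<^sub>m 1 1" by simp
  finally have 0: "?T * V2 \<doteq> 0\<^sub>m 1 1" .
  have "P2 * Q2 - R2 * S2 = P2 * Q2 + R2 * - S2" unfolding RU by (intro eq_matI) auto
  moreover have "?T * V2 \<doteq> P2 * Q2 + R2 * - S2" by (rule T[OF UV(2,4)]) simp_all
  from cg_trans[OF cg_sym[OF this] 0] have "P2 * Q2 + R2 * - S2 \<doteq> 0\<^sub>m 1 1" .
  ultimately have "P2 * Q2 - R2 * S2 \<doteq> 0\<^sub>m 1 1" by (simp only:)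
  from cg_of_diff[OF this] have "P2 * Q2 \<doteq> R2 * S2" by simp
  from cg_trans[OF cg_trans[OF PQ(4) this] cg_sym[OF RS(4)]] show ?thesis .
qed

end


section \<open>The graph of the resolvent\<close>

text \<open>The elements of the ring generated by the functions of bounded height and the polynomials are represented by expressions in which only
  subexpressions in \<open>V\<close> are inverted. Whether such an expression is defined at a point depends only on the coordinates in \<open>V\<close>.\<close>

primrec tame :: "'x set => nat => ('x, 'k :: zero) nc_expr => bool" where
  "tame V h (NC_Poly p) \<longleftrightarrow> True"
| "tame V h (NC_Add a b) \<longleftrightarrow> tame V h a \<and> tame V h b"
| "tame V h (NC_Mult a b) \<longleftrightarrow> tame V h a \<and> tame V h b"
| "tame V h (NC_Inv a) \<longleftrightarrow> nc_expr_vars a \<subseteq> V \<and> Suc (nc_expr_height a) \<le> h"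

lemma tame_of_vars: "nc_expr_vars a \<subseteq> V ==> nc_expr_height a \<le> h ==> tame V h a"
  by (induction a) auto

lemma tame_defined_cong:
  assumes "\<And>x. x \<in> V ==> A x = B x"
  shows "tame V h a ==> defined a n A \<longleftrightarrow> defined a n B"
proof (induction a)
  case (NC_Inv a)
  then have "nc_expr_eval n A a = nc_expr_eval n B a" using nc_expr_eval_cong[of V A B a n] assms by simp
  then show ?case by (simp add: defined_def)
qed auto

lemma nc_dom_parts:
  "nc_dom (NC_Add a b) \<noteq> {} ==> nc_dom a \<noteq> {}" "nc_dom (NC_Add a b) \<noteq> {} ==> nc_dom b \<noteq> {}"
  "nc_dom (NC_Mult a b) \<noteq> {} ==> nc_dom a \<noteq> {}" "nc_dom (NC_Mult a b) \<noteq> {} ==> nc_dom b \<noteq> {}"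
  unfolding ex_in_conv[symmetric] split_paired_Ex nc_dom_iff defined_simps by blast+

lemma zero_mat_not_invertible:
  assumes "0 < n" "K \<in> carrier_mat n n"
  shows "0\<^sub>m n n * K \<noteq> (1\<^sub>m n :: 'k :: field mat)"
proof
  assume "0\<^sub>m n n * K = (1\<^sub>m n :: 'k mat)"
  from arg_cong[OF this, of "\<lambda>M. M $$ (0, 0)"] show False using assms by (simp add: scalar_prod_def)
qed

lemma ideal_of_closed:
  fixes R (structure)
  assumes "ring R" "J \<subseteq> carrier R" "\<zero> \<in> J" "\<And>x y. x \<in> J ==> y \<in> J ==> x \<oplus> y \<in> J"
    "\<And>x a. x \<in> J ==> a \<in> carrier R ==> a \<otimes> x \<in> J" "\<And>x a. x \<in> J ==> a \<in> carrier R ==> x \<otimes> a \<in> J"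
  shows "ideal J R"
proof -
  interpret ring R by (rule assms(1))
  have neg: "\<ominus> x \<in> J" if "x \<in> J" for x
    using assms(5)[OF that, of "\<ominus> \<one>"] subsetD[OF assms(2) that] by (simp add: l_minus)
  show ?thesis
  proof (rule idealI[OF assms(1)])
    show "subgroup J (add_monoid R)"
      using assms(2-4) neg by (intro subgroup.intro) (auto simp: a_inv_def[symmetric])
  qed (use assms(5,6) in auto)
qed

locale frr_ideal =
  fixes V :: "'x :: finite set" and r :: "'x => ('x, 'k :: field_char_0) nc_ratfun" and I :: "('x, 'k) nc_poly set"
  assumes frr: "frr V r I"
begin

abbreviation "h \<equiv> resolvent_height V r"
abbreviation "W \<equiv> free_skew_field :: ('x, 'k) nc_ratfun ring"
abbreviation "R \<equiv> resolvent_ring V r"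
abbreviation "J \<equiv> resolvent_ideal V r"
abbreviation poly_fun :: "('x, 'k) nc_poly => ('x, 'k) nc_ratfun" where "poly_fun p \<equiv> ratfun_of (NC_Poly p)"

sublocale W: ring W by (rule ring_free_skew_field)
sublocale F: ring "free_alg UNIV :: ('x, 'k) nc_poly ring" by (rule ring_free_alg)
sublocale I: ideal I "free_alg UNIV" using frr by (simp add: frr_def)

definition resolvent :: "'x => ('x, 'k) nc_expr" where
  "resolvent j = (SOME a. r j = ratfun_of a \<and> nc_dom a \<noteq> {} \<and> nc_expr_vars a \<subseteq> V \<and> nc_expr_height a \<le> h)"

lemma resolvent_le: "j \<in> - V ==> r j \<in> ratfuns_le V h"
  using frr unfolding frr_def ratfuns_le_def resolvent_height_def by (auto intro!: Max_ge)

lemma resolvent: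
  assumes "j \<in> - V"
  shows "r j = ratfun_of (resolvent j)" "nc_dom (resolvent j) \<noteq> {}" "nc_expr_vars (resolvent j) \<subseteq> V" "nc_expr_height (resolvent j) \<le> h"
proof -
  have "\<exists>a. r j = ratfun_of a \<and> nc_dom a \<noteq> {} \<and> nc_expr_vars a \<subseteq> V \<and> nc_expr_height a \<le> h"
    using resolvent_le[OF assms] by (simp add: ratfuns_le_iff)
  from someI_ex[OF this]
  show "r j = ratfun_of (resolvent j)" "nc_dom (resolvent j) \<noteq> {}" "nc_expr_vars (resolvent j) \<subseteq> V" "nc_expr_height (resolvent j) \<le> h"
    unfolding resolvent_def[symmetric] by simp_all
qed

abbreviation "generators \<equiv> ratfuns_le V h \<union> range poly_fun"

lemma generators_carrier: "generators \<subseteq> carrier W"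
  using subringE(1)[OF subring_ratfuns_le[of V h]] ratfun_carrier[OF nc_dom_ops(1)] by blast

lemma R_simps: "carrier R = generate_ring W generators" "x \<otimes>\<^bsub>R\<^esub> y = x \<otimes>\<^bsub>W\<^esub> y" "x \<oplus>\<^bsub>R\<^esub> y = x \<oplus>\<^bsub>W\<^esub> y" "\<one>\<^bsub>R\<^esub> = \<one>\<^bsub>W\<^esub>" "\<zero>\<^bsub>R\<^esub> = \<zero>\<^bsub>W\<^esub>"
  by (simp_all add: resolvent_ring_def)

lemma subring_R: "subring (generate_ring W generators) W"
  using W.generate_ring_in_carrier[OF generators_carrier]
  by (intro W.subringI) (auto intro: generate_ring.intros)

sublocale R: ring R
  using W.subring_is_ring[OF subring_R] by (simp add: resolvent_ring_def)

lemma R_carrier: "x \<in> ratfuns_le V h ==> x \<in> carrier R" "poly_fun p \<in> carrier R"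
  unfolding R_simps by (auto intro: generate_ring.incl)

lemma tame_representative:
  assumes "z \<in> carrier R"
  shows "\<exists>e. z = ratfun_of e \<and> nc_dom e \<noteq> {} \<and> tame V h e"
  using assms unfolding R_simps
proof (induction rule: generate_ring.induct)
  case one
  show ?case by (rule exI[of _ "NC_Poly 1"]) (simp add: free_skew_field_simps nc_dom_ops(1))
next
  case (incl z)
  then consider "z \<in> ratfuns_le V h" | p where "z = poly_fun p" by blast
  then show ?case
  proof cases
    case 1
    then obtain a where "z = ratfun_of a" "nc_dom a \<noteq> {}" "nc_expr_vars a \<subseteq> V" "nc_expr_height a \<le> h" by (auto simp: ratfuns_le_iff)
    then show ?thesis by (intro exI[of _ a]) (simp add: tame_of_vars)
  next
    case 2
    then show ?thesis by (intro exI[of _ "NC_Poly p"]) (simp add: nc_dom_ops(1))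
  qed
next
  case (a_inv z)
  then obtain e where "z = ratfun_of e" "nc_dom e \<noteq> {}" "tame V h e" by blast
  then show ?case by (intro exI[of _ "NC_Mult (NC_Poly (-1)) e"]) (simp add: a_inv_free_skew_field nc_dom_ops)
next
  case (eng_add z z')
  then obtain e e' where "z = ratfun_of e" "nc_dom e \<noteq> {}" "tame V h e" "z' = ratfun_of e'" "nc_dom e' \<noteq> {}" "tame V h e'" by blast
  then show ?case by (intro exI[of _ "NC_Add e e'"]) (simp add: free_skew_field_ops nc_dom_ops)
next
  case (eng_mult z z')
  then obtain e e' where "z = ratfun_of e" "nc_dom e \<noteq> {}" "tame V h e" "z' = ratfun_of e'" "nc_dom e' \<noteq> {}" "tame V h e'" by blast
  then show ?case by (intro exI[of _ "NC_Mult e e'"]) (simp add: free_skew_field_ops nc_dom_ops)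
qed

definition graph :: "nat => ('x => 'k mat) => bool" where
  "graph n A \<longleftrightarrow> point n A \<and> (\<forall>j\<in>- V. nc_expr_eval n A (resolvent j) = Some (A j))"

lemma graph_point:
  assumes A: "point n A" and D: "\<And>j. j \<in> - V ==> defined (resolvent j) n A"
  obtains B where "graph n B" "\<And>x. x \<in> V ==> A x = B x"
proof -
  define B where "B = (\<lambda>x. if x \<in> V then A x else the (nc_expr_eval n A (resolvent x)))"
  have ev: "nc_expr_eval n A (resolvent j) = Some (B j)" if "j \<in> - V" for j
    using D[OF that] that by (auto simp: B_def defined_def)
  have AB: "A x = B x" if "x \<in> V" for x using that by (simp add: B_def)
  have "B x \<in> carrier_mat n n" for x
    using pointD(1)[OF A, of x] nc_expr_eval_carrier[OF A ev[of x]] AB[of x] by (cases "x \<in> V") auto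
  then have "point n B" using A by (simp add: point_def)
  moreover have "nc_expr_eval n B (resolvent j) = Some (B j)" if "j \<in> - V" for j
    using nc_expr_eval_cong[where V = V and A = A and B = B, OF AB resolvent(3)[OF that]] ev[OF that] by simp
  ultimately show thesis using AB by (intro that[of B]) (auto simp: graph_def)
qed

lemma generic_graph:
  assumes "generic U"
  obtains n A B where "point n A" "U n A" "graph n B" "\<And>x. x \<in> V ==> A x = B x"
proof -
  have "generic (\<lambda>n A. U n A \<and> (\<forall>j\<in>- V. defined (resolvent j) n A))"
    by (intro generic_ball[of "- V" U "\<lambda>j. defined (resolvent j)"] assms generic_defined resolvent) simp_all
  then obtain n A where A: "point n A" "U n A \<and> (\<forall>j\<in>- V. defined (resolvent j) n A)" by (rule generic_obtains)
  then obtain B where "graph n B" "\<And>x. x \<in> V ==> A x = B x" using graph_point[OF A(1)] by metis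
  with A show thesis by (intro that[of n A B]) simp_all
qed

text \<open>Vanishing is required for one tame representative only, since another one could be undefined on the whole graph.\<close>

definition vanishing :: "('x, 'k) nc_ratfun set" where
  "vanishing = {z \<in> carrier R. \<exists>e. z = ratfun_of e \<and> nc_dom e \<noteq> {} \<and> tame V h e \<and>
     (\<forall>n A. graph n A --> defined e n A --> nc_expr_eval n A e = Some (0\<^sub>m n n))}"

lemma vanishingE:
  assumes "z \<in> vanishing"
  obtains e where "z \<in> carrier R" "z = ratfun_of e" "nc_dom e \<noteq> {}" "tame V h e"
    "\<And>n A. graph n A ==> defined e n A ==> nc_expr_eval n A e = Some (0\<^sub>m n n)"
  using assms unfolding vanishing_def by blast

lemma vanishingI:
  assumes "z \<in> carrier R" "z = ratfun_of e" "nc_dom e \<noteq> {}" "tame V h e"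
    "\<And>n A. graph n A ==> defined e n A ==> nc_expr_eval n A e = Some (0\<^sub>m n n)"
  shows "z \<in> vanishing"
  using assms unfolding vanishing_def by blast

lemma ideal_vanishing: "ideal vanishing R"
proof (rule ideal_of_closed[OF R.ring_axioms])
  show "vanishing \<subseteq> carrier R" by (auto simp: vanishing_def)
  show "\<zero>\<^bsub>R\<^esub> \<in> vanishing"
  proof (rule vanishingI[of _ "NC_Poly 0"])
    fix n A assume "graph n A"
    then have A: "point n A" by (simp add: graph_def)
    show "nc_expr_eval n A (NC_Poly 0) = Some (0\<^sub>m n n)" by (simp add: nc_poly_eval_0[OF pointD(1)[OF A]])
  qed (simp_all add: R_simps(5) free_skew_field_simps nc_dom_ops(1) R_carrier)
next
  fix z z' assume zz: "z \<in> vanishing" "z' \<in> vanishing"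
  obtain e where e: "z \<in> carrier R" "z = ratfun_of e" "nc_dom e \<noteq> {}" "tame V h e"
    "\<And>n A. graph n A ==> defined e n A ==> nc_expr_eval n A e = Some (0\<^sub>m n n)" using zz(1) by (rule vanishingE) blast
  obtain e' where e': "z' \<in> carrier R" "z' = ratfun_of e'" "nc_dom e' \<noteq> {}" "tame V h e'"
    "\<And>n A. graph n A ==> defined e' n A ==> nc_expr_eval n A e' = Some (0\<^sub>m n n)" using zz(2) by (rule vanishingE) blast
  show "z \<oplus>\<^bsub>R\<^esub> z' \<in> vanishing"
  proof (rule vanishingI[of _ "NC_Add e e'"])
    show "z \<oplus>\<^bsub>R\<^esub> z' = ratfun_of (NC_Add e e')" unfolding R_simps e(2) e'(2) by (rule free_skew_field_ops(2)[OF e(3) e'(3)])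
  qed (use e e' in \<open>simp_all add: nc_dom_ops\<close>)
next
  fix z y assume z: "z \<in> vanishing" and y: "y \<in> carrier R"
  obtain e where e: "z \<in> carrier R" "z = ratfun_of e" "nc_dom e \<noteq> {}" "tame V h e"
    "\<And>n A. graph n A ==> defined e n A ==> nc_expr_eval n A e = Some (0\<^sub>m n n)" using z by (rule vanishingE) blast
  obtain u where u: "y = ratfun_of u" "nc_dom u \<noteq> {}" "tame V h u" using tame_representative[OF y] by blast
  show "y \<otimes>\<^bsub>R\<^esub> z \<in> vanishing"
  proof (rule vanishingI[of _ "NC_Mult u e"])
    show "y \<otimes>\<^bsub>R\<^esub> z = ratfun_of (NC_Mult u e)" unfolding R_simps e(2) u(1) by (rule free_skew_field_ops(1)[OF u(2) e(3)])
    fix n A assume A: "graph n A" and D: "defined (NC_Mult u e) n A"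
    then obtain M where "nc_expr_eval n A u = Some M" "dim_row M = n" "dim_col M = n"
      using nc_expr_eval_obtains[of n A u] by (auto simp: graph_def)
    then show "nc_expr_eval n A (NC_Mult u e) = Some (0\<^sub>m n n)" using e(5)[OF A] D by simp
  qed (use e u y in \<open>simp_all add: nc_dom_ops\<close>)
  show "z \<otimes>\<^bsub>R\<^esub> y \<in> vanishing"
  proof (rule vanishingI[of _ "NC_Mult e u"])
    show "z \<otimes>\<^bsub>R\<^esub> y = ratfun_of (NC_Mult e u)" unfolding R_simps e(2) u(1) by (rule free_skew_field_ops(1)[OF e(3) u(2)])
    fix n A assume A: "graph n A" and D: "defined (NC_Mult e u) n A"
    then obtain M where "nc_expr_eval n A u = Some M" "dim_row M = n" "dim_col M = n"
      using nc_expr_eval_obtains[of n A u] by (auto simp: graph_def)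
    then show "nc_expr_eval n A (NC_Mult e u) = Some (0\<^sub>m n n)" using e(5)[OF A] D by simp
  qed (use e u y in \<open>simp_all add: nc_dom_ops\<close>)
qed

lemma relation_representative:
  assumes j: "j \<in> - V"
  shows "poly_fun (nc_var j) \<ominus>\<^bsub>W\<^esub> r j = ratfun_of (NC_Add (NC_Poly (nc_var j)) (NC_Mult (NC_Poly (-1)) (resolvent j)))"
    "poly_fun (nc_var j) \<ominus>\<^bsub>W\<^esub> r j \<in> carrier R"
proof -
  show "poly_fun (nc_var j) \<ominus>\<^bsub>W\<^esub> r j = ratfun_of (NC_Add (NC_Poly (nc_var j)) (NC_Mult (NC_Poly (-1)) (resolvent j)))"
    unfolding a_minus_def resolvent(1)[OF j] a_inv_free_skew_field[OF resolvent(2)[OF j]]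
    by (rule free_skew_field_ops(2)) (intro nc_dom_ops resolvent(2)[OF j])+
  show "poly_fun (nc_var j) \<ominus>\<^bsub>W\<^esub> r j \<in> carrier R"
    unfolding a_minus_def R_simps
    by (intro generate_ring.eng_add generate_ring.a_inv generate_ring.incl) (use resolvent_le[OF j] in auto)
qed

lemma J_vanishing: "J \<subseteq> vanishing"
  unfolding resolvent_ideal_def
proof (rule R.genideal_minimal[OF ideal_vanishing], safe)
  fix j assume "j \<notin> V"
  then have j: "j \<in> - V" by simp
  show "poly_fun (nc_var j) \<ominus>\<^bsub>W\<^esub> r j \<in> vanishing"
  proof (rule vanishingI[OF relation_representative(2,1)[OF j]])
    show "nc_dom (NC_Add (NC_Poly (nc_var j)) (NC_Mult (NC_Poly (-1)) (resolvent j))) \<noteq> {}"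
      by (intro nc_dom_ops resolvent(2)[OF j])
    show "tame V h (NC_Add (NC_Poly (nc_var j)) (NC_Mult (NC_Poly (-1)) (resolvent j)))"
      using resolvent(3,4)[OF j] by (simp add: tame_of_vars)
    fix n A assume "graph n A"
    then have A: "point n A" and ev: "nc_expr_eval n A (resolvent j) = Some (A j)" using j by (auto simp: graph_def)
    note [simp] = point_dim[OF A]
    show "nc_expr_eval n A (NC_Add (NC_Poly (nc_var j)) (NC_Mult (NC_Poly (-1)) (resolvent j))) = Some (0\<^sub>m n n)"
      using ev by (simp add: nc_poly_eval_var[OF pointD(1)[OF A]] nc_poly_eval_uminus[OF pointD(1)[OF A]] nc_poly_eval_1[OF pointD(1)[OF A]])
        (intro eq_matI; simp)
  qed
qed

lemma J_genideal: "J = genideal R (poly_fun ` I)" using frr by (simp add: frr_def)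

lemma I_J: "p \<in> I ==> poly_fun p \<in> J"
  unfolding J_genideal using R.genideal_self[of "poly_fun ` I"] R_carrier(2) by blast

sublocale J: ideal J R
  unfolding J_genideal using R_carrier(2) by (intro R.genideal_ideal) auto

lemma I_vanishing:
  assumes "p \<in> I"
  obtains e where "nc_dom e \<noteq> {}" "tame V h e" "\<And>n A. graph n A ==> defined e n A ==> nc_poly_eval n A p = 0\<^sub>m n n"
proof -
  have "poly_fun p \<in> vanishing" using J_vanishing I_J[OF assms] by blast
  then obtain e where e: "poly_fun p = ratfun_of e" "nc_dom e \<noteq> {}" "tame V h e"
    "\<And>n A. graph n A ==> defined e n A ==> nc_expr_eval n A e = Some (0\<^sub>m n n)" by (rule vanishingE) blast
  have "nc_poly_eval n A p = 0\<^sub>m n n" if A: "graph n A" "defined e n A" for n A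
    using ratfun_eqD[OF e(1) nc_dom_ops(1) e(2) _ _ A(2)] e(4)[OF A] A(1) by (simp add: graph_def)
  then show thesis using e by (intro that[of e])
qed

text \<open>A function in \<open>V\<close> has the same value at a point and at the point of the graph above it.\<close>

lemma J_ratfuns_le:
  assumes "f \<in> J" "f \<in> ratfuns_le V h"
  shows "f = \<zero>\<^bsub>W\<^esub>"
proof -
  from assms(2) obtain b where b: "f = ratfun_of b" "nc_dom b \<noteq> {}" "nc_expr_vars b \<subseteq> V" "nc_expr_height b \<le> h" by (auto simp: ratfuns_le_iff)
  have "f \<in> vanishing" using assms(1) J_vanishing by blast
  then obtain e where e: "f = ratfun_of e" "nc_dom e \<noteq> {}" "tame V h e"
    "\<And>n A. graph n A ==> defined e n A ==> nc_expr_eval n A e = Some (0\<^sub>m n n)" by (rule vanishingE) blast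
  have U: "generic (\<lambda>n A. defined e n A \<and> (\<forall>j\<in>- V. defined (resolvent j) n A))"
    by (intro generic_ball[of "- V" "defined e" "\<lambda>j. defined (resolvent j)"] generic_defined e resolvent) simp_all
  have "ratfun_of b = ratfun_of (NC_Poly 0)"
  proof (rule ratfun_eqI[OF b(2) nc_dom_ops(1)])
    fix n and A :: "'x => 'k mat" assume A: "point n A" "defined b n A" "defined (NC_Poly 0) n A"
    show "nc_expr_eval n A b = nc_expr_eval n A (NC_Poly 0)"
    proof (rule generic_agree[OF U A])
      fix n and A :: "'x => 'k mat" assume A: "point n A" "defined e n A \<and> (\<forall>j\<in>- V. defined (resolvent j) n A)" "defined b n A"
      obtain B where B: "graph n B" "\<And>x. x \<in> V ==> A x = B x" using graph_point[OF A(1)] A(2) by metis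
      have eq: "nc_expr_eval n A b = nc_expr_eval n B b" by (rule nc_expr_eval_cong[of V A B b n, OF B(2) b(3)])
      then have bB: "defined b n B" using A(3) by (simp add: defined_def)
      have eB: "defined e n B" using A(2) tame_defined_cong[of V A B h e n, OF B(2) e(3)] by simp
      have "point n B" using B(1) by (simp add: graph_def)
      then have "nc_expr_eval n B b = nc_expr_eval n B e" using b(1) e(1) by (intro ratfun_eqD[OF _ b(2) e(2) _ bB eB]) simp_all
      then show "nc_expr_eval n A b = nc_expr_eval n A (NC_Poly 0)"
        using e(4)[OF B(1) eB] eq by (simp add: nc_poly_eval_0[OF pointD(1)[OF A(1)]])
    qed
  qed
  then show ?thesis by (simp add: b(1) free_skew_field_simps)
qed

section \<open>The contraction of the resolvent ideal\<close>

text \<open>The target is the quotient of the ring of type \<open>'s\<close> by \<open>N\<close>, and \<open>\<tau>\<close> represents a ring homomorphism into it with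
  kernel \<open>I\<close>. The elements of \<open>J\<close> have realizations that represent zero in the target, and a polynomial with such a
  realization is itself zero there.\<close>

lemma contraction:
  fixes N :: "'s :: ring_1 set" and \<tau> :: "('x, 'k) nc_poly => 's"
  assumes mc: "matrix_congruence N"
    and \<tau>_add: "\<And>p q. \<tau> (p + q) - (\<tau> p + \<tau> q) \<in> N" and \<tau>_mult: "\<And>p q. \<tau> (p * q) - \<tau> p * \<tau> q \<in> N" and \<tau>_one: "\<tau> 1 - 1 \<in> N"
    and ker: "\<And>p. \<tau> p \<in> N \<longleftrightarrow> p \<in> I" and syl: "matrix_congruence.sylvester N" and one: "1 \<notin> N"
    and real_inv: "\<And>b. nc_expr_vars b \<subseteq> V ==> Suc (nc_expr_height b) \<le> h ==> nc_dom (NC_Inv b) \<noteq> {} ==>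
      \<exists>M c d w. realizes (NC_Inv b) M c d w \<and> matrix_congruence.full N (map_mat \<tau> M)"
    and p: "poly_fun p \<in> J"
  shows "p \<in> I"
proof -
  interpret matrix_congruence N by (rule mc)
  note cg_def' = cg_def
  define tm where "tm = map_mat \<tau>"
  have [simp]: "dim_row (tm M) = dim_row M" "dim_col (tm M) = dim_col M" for M by (simp_all add: tm_def)
  have \<tau>_zero: "\<tau> 0 \<in> N" using ker I.zero_closed by simp
  have \<tau>_sum: "\<tau> (sum f S) - (\<Sum>i\<in>S. \<tau> (f i)) \<in> N" if "finite S" for f :: "nat => ('x, 'k) nc_poly" and S
    using that
  proof (induction S rule: finite_induct)
    case (insert x S)
    from add_N[OF \<tau>_add[of "f x" "sum f S"] insert(3)] insert(1,2) show ?case by (simp add: algebra_simps)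
  qed (simp add: \<tau>_zero)
  have tm_zero: "tm (0\<^sub>m a b) \<doteq> 0\<^sub>m a b" for a b by (simp add: cg_def tm_def \<tau>_zero)
  have tm_one: "tm (1\<^sub>m a) \<doteq> 1\<^sub>m a" for a using \<tau>_one by (simp add: cg_def tm_def \<tau>_zero)
  have tm_add: "tm (A + B) \<doteq> tm A + tm B" if "dim_row A = dim_row B" "dim_col A = dim_col B" for A B
    using that \<tau>_add by (simp add: cg_def tm_def)
  have tm_mult: "tm (A * B) \<doteq> tm A * tm B" if d: "dim_col A = dim_row B" for A B
    unfolding cg_def
  proof (intro conjI allI impI)
    fix i j assume "i < dim_row (tm (A * B))" "j < dim_col (tm (A * B))"
    then have ij: "i < dim_row A" "j < dim_col B" by simp_all
    let ?f = "\<lambda>k. A $$ (i, k) * B $$ (k, j)"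
    have "(\<Sum>k\<in>{0..<dim_row B}. \<tau> (?f k) - \<tau> (A $$ (i, k)) * \<tau> (B $$ (k, j))) \<in> N" by (intro sum_N \<tau>_mult)
    from add_N[OF \<tau>_sum[of "{0..<dim_row B}" ?f] this]
    have "\<tau> (\<Sum>k\<in>{0..<dim_row B}. ?f k) - (\<Sum>k\<in>{0..<dim_row B}. \<tau> (A $$ (i, k)) * \<tau> (B $$ (k, j))) \<in> N"
      by (simp add: sum_subtractf)
    then show "tm (A * B) $$ (i, j) - (tm A * tm B) $$ (i, j) \<in> N"
      using ij d by (simp add: mult_index tm_def del: index_mult_mat(1))
  qed (simp_all add: d)
  have tm_four_block: "tm (four_block_mat A B C D) = four_block_mat (tm A) (tm B) (tm C) (tm D)"
    if "dim_row A = dim_row B" "dim_row C = dim_row D" "dim_col A = dim_col C" "dim_col B = dim_col D" for A B C D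
    unfolding tm_def using that by (intro eq_matI) auto
  have tm_stack: "dim_col A = dim_col B ==> tm (vstack A B) = vstack (tm A) (tm B)" "dim_row A = dim_row B ==> tm (hstack A B) = hstack (tm A) (tm B)" for A B
    unfolding tm_def by (intro eq_matI; auto)+
  have full_upper: "full (tm (four_block_mat A B (0\<^sub>m (dim_row D) (dim_row A)) D))"
    if "full (tm A)" "full (tm D)" "dim_row B = dim_row A" "dim_col B = dim_row D" for A B D
  proof -
    have "dim_col A = dim_row A" "dim_col D = dim_row D" using that(1,2) by (simp_all add: full_def)
    then show ?thesis using that by (subst tm_four_block) (auto intro!: full_upper_block[OF syl] simp: tm_zero)
  qed
  have real: "tame V h e ==> nc_dom e \<noteq> {} ==> \<exists>M c d w. realizes e M c d w \<and> full (tm M)" for e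
  proof (induction e)
    case (NC_Poly q)
    have "full (tm (0\<^sub>m 0 0))" by (simp add: full_def)
    with realizes_poly[of q] show ?case by (intro exI conjI)
  next
    case (NC_Add a b)
    then obtain M c d w M' c' d' w' where R: "realizes a M c d w" "full (tm M)" "realizes b M' c' d' w'" "full (tm M')"
      using nc_dom_parts(1,2)[OF NC_Add.prems(2)] by (auto simp del: defined_simps)
    have "full (tm (four_block_mat M (0\<^sub>m (dim_row M) (dim_row M')) (0\<^sub>m (dim_row M') (dim_row M)) M'))"
      by (rule full_upper[OF R(2,4)]) simp_all
    with realizes_add[OF R(1,3)] show ?case by (intro exI conjI)
  next
    case (NC_Mult a b)
    then obtain M c d w M' c' d' w' where R: "realizes a M c d w" "full (tm M)" "realizes b M' c' d' w'" "full (tm M')"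
      using nc_dom_parts(3,4)[OF NC_Mult.prems(2)] by (auto simp del: defined_simps)
    have "full (tm (four_block_mat M (d * c') (0\<^sub>m (dim_row M') (dim_row M)) M'))"
      by (rule full_upper[OF R(2,4)]) (use R(1,3) in \<open>auto simp: realizes_def\<close>)
    with realizes_mult[OF R(1,3)] show ?case by (intro exI conjI)
  next
    case (NC_Inv a)
    then show ?case unfolding tm_def using real_inv[of a] by simp
  qed
  define border where "border M c d w = four_block_mat (tm M) (tm d) (tm c) (tm w)" for M c d w
  define Z where "Z = {z \<in> carrier R. \<exists>e M c d w. z = ratfun_of e \<and> nc_dom e \<noteq> {} \<and> realizes e M c d w \<and> full (tm M) \<and>
    fac (border M c d w) (dim_row M)}"
  have ZI: "z \<in> Z" if "z \<in> carrier R" "z = ratfun_of e" "nc_dom e \<noteq> {}" "realizes e M c d w" "full (tm M)" "fac (border M c d w) (dim_row M)" for z e M c d w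
    unfolding Z_def using that by blast
  have poly_Z: "poly_fun q \<in> Z" if "q \<in> I" for q
  proof (rule ZI[OF R_carrier(2) refl nc_dom_ops(1) realizes_poly])
    have "fac (four_block_mat (tm (0\<^sub>m 0 0)) (tm (0\<^sub>m 0 1)) (tm (0\<^sub>m 1 0)) (tm (entry_mat q))) 0"
      by (rule fac_four_blockI[where ?Y1.0 = "0\<^sub>m 0 0" and ?Y2.0 = "0\<^sub>m 1 0" and ?Z1.0 = "0\<^sub>m 0 0" and ?Z2.0 = "0\<^sub>m 0 1"])
         (use that ker in \<open>auto simp: cg_def tm_def entry_mat_def scalar_prod_def\<close>)
    then show "fac (border (0\<^sub>m 0 0) (0\<^sub>m 1 0) (0\<^sub>m 0 1) (entry_mat q)) (dim_row (0\<^sub>m 0 0 :: ('x, 'k) nc_poly mat))" by (simp add: border_def)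
  qed (simp add: full_def)
  have rdims: "dim_col M = dim_row M" "dim_row c = 1" "dim_col c = dim_row M" "dim_row d = dim_row M" "dim_col d = 1" "dim_row w = 1" "dim_col w = 1"
    if "realizes e M c d w" for e M c d w
    using that by (auto simp: realizes_def)
  have mult_border: "border (four_block_mat M (d * c') (0\<^sub>m (dim_row M') (dim_row M)) M') (hstack c (w * c')) (vstack (d * w') d') (w * w') \<doteq>
      four_block_mat (four_block_mat (tm M) (tm d * tm c') (0\<^sub>m (dim_row M') (dim_row M)) (tm M')) (vstack (tm d * tm w') (tm d'))
        (hstack (tm c) (tm w * tm c')) (tm w * tm w')"
    if "realizes e M c d w" "realizes e' M' c' d' w'" for e M c d w e' M' c' d' w'
    unfolding border_def using rdims[OF that(1)] rdims[OF that(2)]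
    by (simp add: tm_four_block tm_stack del: One_nat_def) (intro cg_four_block cg_hstack cg_vstack tm_mult tm_zero cg_refl; simp)
  have "ideal Z R"
  proof (rule ideal_of_closed[OF R.ring_axioms])
    show "Z \<subseteq> carrier R" by (auto simp: Z_def)
    show "\<zero>\<^bsub>R\<^esub> \<in> Z" using poly_Z[of 0] I.zero_closed by (simp add: R_simps(5) free_skew_field_simps)
  next
    fix z z' assume "z \<in> Z" "z' \<in> Z"
    then obtain e M c d w e' M' c' d' w' where z: "z \<in> carrier R" "z = ratfun_of e" "nc_dom e \<noteq> {}" "realizes e M c d w" "full (tm M)" "fac (border M c d w) (dim_row M)"
      and z': "z' \<in> carrier R" "z' = ratfun_of e'" "nc_dom e' \<noteq> {}" "realizes e' M' c' d' w'" "full (tm M')" "fac (border M' c' d' w') (dim_row M')"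
      unfolding Z_def by blast
    note [simp] = rdims[OF z(4)] rdims[OF z'(4)]
    show "z \<oplus>\<^bsub>R\<^esub> z' \<in> Z"
    proof (rule ZI[OF _ _ nc_dom_ops(2)[OF z(3) z'(3)] realizes_add[OF z(4) z'(4)]])
      show "z \<oplus>\<^bsub>R\<^esub> z' = ratfun_of (NC_Add e e')" unfolding R_simps z(2) z'(2) by (rule free_skew_field_ops(2)[OF z(3) z'(3)])
      show "full (tm (four_block_mat M (0\<^sub>m (dim_row M) (dim_row M')) (0\<^sub>m (dim_row M') (dim_row M)) M'))"
        by (rule full_upper[OF z(5) z'(5)]) simp_all
      have "border (four_block_mat M (0\<^sub>m (dim_row M) (dim_row M')) (0\<^sub>m (dim_row M') (dim_row M)) M') (hstack c c') (vstack d d') (w + w') \<doteq>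
        four_block_mat (four_block_mat (tm M) (0\<^sub>m (dim_row M) (dim_row M')) (0\<^sub>m (dim_row M') (dim_row M)) (tm M')) (vstack (tm d) (tm d'))
        (hstack (tm c) (tm c')) (tm w + tm w')"
        unfolding border_def
        by (simp add: tm_four_block tm_stack del: One_nat_def) (intro cg_four_block cg_hstack cg_vstack tm_add tm_zero cg_refl; simp)
      moreover have "fac (four_block_mat (four_block_mat (tm M) (0\<^sub>m (dim_row M) (dim_row M')) (0\<^sub>m (dim_row M') (dim_row M)) (tm M')) (vstack (tm d) (tm d'))
        (hstack (tm c) (tm c')) (tm w + tm w')) (dim_row M + dim_row M')"
        using z(6) z'(6) unfolding border_def by (intro zero_realization_add) simp_all
      ultimately show "fac (border (four_block_mat M (0\<^sub>m (dim_row M) (dim_row M')) (0\<^sub>m (dim_row M') (dim_row M)) M') (hstack c c') (vstack d d') (w + w'))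
        (dim_row (four_block_mat M (0\<^sub>m (dim_row M) (dim_row M')) (0\<^sub>m (dim_row M') (dim_row M)) M'))"
        using fac_cong by simp
    qed (use z(1) z'(1) in simp)
  next
    fix z y assume "z \<in> Z" and y: "y \<in> carrier R"
    then obtain e M c d w where z: "z \<in> carrier R" "z = ratfun_of e" "nc_dom e \<noteq> {}" "realizes e M c d w" "full (tm M)" "fac (border M c d w) (dim_row M)"
      unfolding Z_def by blast
    obtain u where u: "y = ratfun_of u" "nc_dom u \<noteq> {}" "tame V h u" using tame_representative[OF y] by blast
    obtain M' c' d' w' where R: "realizes u M' c' d' w'" "full (tm M')" using real[OF u(3,2)] by blast
    note [simp] = rdims[OF z(4)] rdims[OF R(1)]
    show "y \<otimes>\<^bsub>R\<^esub> z \<in> Z"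
    proof (rule ZI[OF _ _ nc_dom_ops(3)[OF u(2) z(3)] realizes_mult[OF R(1) z(4)]])
      show "y \<otimes>\<^bsub>R\<^esub> z = ratfun_of (NC_Mult u e)" unfolding R_simps z(2) u(1) by (rule free_skew_field_ops(1)[OF u(2) z(3)])
      show "full (tm (four_block_mat M' (d' * c) (0\<^sub>m (dim_row M) (dim_row M')) M))" by (rule full_upper[OF R(2) z(5)]) simp_all
      have "fac (four_block_mat (four_block_mat (tm M') (tm d' * tm c) (0\<^sub>m (dim_row M) (dim_row M')) (tm M)) (vstack (tm d' * tm w) (tm d))
        (hstack (tm c') (tm w' * tm c)) (tm w' * tm w)) (dim_row M' + dim_row M)"
        using z(6) unfolding border_def by (intro zero_realization_mult_left) simp_all
      from fac_cong[OF this mult_border[OF R(1) z(4)]]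
      show "fac (border (four_block_mat M' (d' * c) (0\<^sub>m (dim_row M) (dim_row M')) M) (hstack c' (w' * c)) (vstack (d' * w) d) (w' * w))
        (dim_row (four_block_mat M' (d' * c) (0\<^sub>m (dim_row M) (dim_row M')) M))" by simp
    qed (use z(1) y in simp)
    show "z \<otimes>\<^bsub>R\<^esub> y \<in> Z"
    proof (rule ZI[OF _ _ nc_dom_ops(3)[OF z(3) u(2)] realizes_mult[OF z(4) R(1)]])
      show "z \<otimes>\<^bsub>R\<^esub> y = ratfun_of (NC_Mult e u)" unfolding R_simps z(2) u(1) by (rule free_skew_field_ops(1)[OF z(3) u(2)])
      show "full (tm (four_block_mat M (d * c') (0\<^sub>m (dim_row M') (dim_row M)) M'))" by (rule full_upper[OF z(5) R(2)]) simp_all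
      have "fac (four_block_mat (four_block_mat (tm M) (tm d * tm c') (0\<^sub>m (dim_row M') (dim_row M)) (tm M')) (vstack (tm d * tm w') (tm d'))
        (hstack (tm c) (tm w * tm c')) (tm w * tm w')) (dim_row M + dim_row M')"
        using z(6) unfolding border_def by (intro zero_realization_mult_right) simp_all
      from fac_cong[OF this mult_border[OF z(4) R(1)]]
      show "fac (border (four_block_mat M (d * c') (0\<^sub>m (dim_row M') (dim_row M)) M') (hstack c (w * c')) (vstack (d * w') d') (w * w'))
        (dim_row (four_block_mat M (d * c') (0\<^sub>m (dim_row M') (dim_row M)) M'))" by simp
    qed (use z(1) y in simp)
  qed
  then have "J \<subseteq> Z" unfolding J_genideal using poly_Z by (intro R.genideal_minimal) auto
  with p have "poly_fun p \<in> Z" by (rule subsetD[rotated])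
  then obtain e M c d w where z: "poly_fun p = ratfun_of e" "nc_dom e \<noteq> {}" "realizes e M c d w" "full (tm M)" "fac (border M c d w) (dim_row M)"
    unfolding Z_def by blast
  note [simp] = rdims[OF z(3)]
  define m where "m = dim_row M"
  define B where "B = four_block_mat M d c (w - entry_mat p)"
  have B: "B \<in> carrier_mat (m + 1) (m + 1)" by (auto simp: B_def m_def intro!: carrier_matI)
  have sing: "det (mev n A B) = 0" if n: "n > 0" and A: "\<And>x. A x \<in> carrier_mat n n" for n and A :: "'x => 'k mat"
  proof (rule ccontr)
    assume det: "det (mev n A B) \<noteq> 0"
    have A: "point n A" using n A by (simp add: point_def)
    from generic_conj[OF generic_det[OF B A det] generic_defined[OF z(2)]]
    obtain n A where A: "point n A" "det (mev n A B) \<noteq> 0 \<and> defined e n A" by (rule generic_obtains)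
    then have R: "realized_at e M c d w n A" using realizesD[OF z(3)] by blast
    from R obtain Y where Y: "det (mev n A M) \<noteq> 0" "dim_row Y = dim_row M * n" "dim_col Y = n" "mev n A M * Y = mev n A d"
      "nc_expr_eval n A e = Some (mev n A w - mev n A c * Y)" by (rule realized_atE)
    have pe: "nc_poly_eval n A p = mev n A w - mev n A c * Y"
      using ratfun_eqD[OF z(1) nc_dom_ops(1) z(2) A(1)] A(2) Y(5) by simp
    have "mev n A (w - entry_mat p) - mev n A c * Y = mev n A w - mev n A c * Y - nc_poly_eval n A p"
      using Y(2,3) by (simp add: mev_diff[OF pointD(1)[OF A(1)]] mev_entry) (intro eq_matI; simp del: index_mult_mat(1))
    also have "\<dots> = 0\<^sub>m n n" unfolding pe using Y(2,3) by (intro eq_matI) (simp_all del: index_mult_mat(1))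
    finally have 0: "mev n A (w - entry_mat p) - mev n A c * Y = 0\<^sub>m n n" .
    have "det (mev n A B) = det (mev n A M) * det (mev n A (w - entry_mat p) - mev n A c * Y)"
      unfolding B_def using Y by (simp add: mev_four_block) (rule schur_det[of _ "dim_row M * n"], auto intro!: carrier_matI)
    then have "det (0\<^sub>m n n :: 'k mat) \<noteq> 0" using A(2) by (simp add: 0)
    then obtain K where "K \<in> carrier_mat n n" "0\<^sub>m n n * K = (1\<^sub>m n :: 'k mat)" by (rule det_nonzero_inverse[OF zero_carrier_mat])
    with zero_mat_not_invertible[OF pointD(2)[OF A(1)]] show False by blast
  qed
  obtain s Y Y' where Y: "Y \<in> carrier_mat (m + 1 + s) (m + 1 + s - 1)" "Y' \<in> carrier_mat (m + 1 + s - 1) (m + 1 + s)"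
    "four_block_mat B (0\<^sub>m (m + 1) s) (0\<^sub>m s (m + 1)) (1\<^sub>m s) = Y * Y'"
    by (rule singular_not_full[OF B sing]) blast+
  note [simp] = carrier_matD[OF B] carrier_matD[OF Y(1)] carrier_matD[OF Y(2)]
  have "four_block_mat (tm B) (0\<^sub>m (m + 1) s) (0\<^sub>m s (m + 1)) (1\<^sub>m s) \<doteq> tm (four_block_mat B (0\<^sub>m (m + 1) s) (0\<^sub>m s (m + 1)) (1\<^sub>m s))"
    by (simp add: tm_four_block del: One_nat_def) (intro cg_four_block cg_refl cg_sym[OF tm_zero] cg_sym[OF tm_one]; simp)
  also have "\<dots> \<doteq> tm Y * tm Y'" unfolding Y(3) by (rule tm_mult) simp
  finally have "fac (four_block_mat (tm B) (0\<^sub>m (m + 1) s) (0\<^sub>m s (m + 1)) (1\<^sub>m s)) (m + s)"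
    by (intro facI[of "tm Y" _ _ "tm Y'"]) (auto intro!: carrier_matI)
  from fac_corner_block[OF syl full_one[OF syl one] this, of "m + 1"]
  obtain s' where s': "s + s' \<le> m + s" "fac (tm B) s'" by auto
  from fac_mono[OF s'(2)] s'(1) have "fac (tm B) m" by simp
  then have "fac (four_block_mat (tm M) (tm d) (tm c) (tm (w - entry_mat p))) m" by (simp add: B_def tm_four_block)
  then have "tm w \<doteq> tm (w - entry_mat p)"
    using z(5) by (intro zero_realization_unique[OF syl z(4), of m "tm d" "tm c"]) (simp_all add: border_def m_def)
  from cg_entry[OF this, of 0 0] have a: "\<tau> (w $$ (0, 0)) - \<tau> (w $$ (0, 0) - p) \<in> N" by (simp add: tm_def entry_mat_def)
  from diff_N[OF a \<tau>_add[of "w $$ (0, 0) - p" p]] have "\<tau> p \<in> N" by simp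
  then show "p \<in> I" by (simp add: ker)
qed

end


section \<open>Faithfulness of the coproduct\<close>

context frr_ideal
begin

lemma matrix_congruence_I: "matrix_congruence I"
proof
  fix a b :: "('x, 'k) nc_poly" assume a: "a \<in> I"
  show "b * a \<in> I" using I.I_l_closed[OF a, of b] by simp
  show "a * b \<in> I" using I.I_r_closed[OF a, of b] by simp
  assume "b \<in> I"
  with a show "a + b \<in> I" using I.a_closed[of a b] by simp
qed (use I.zero_closed in simp)

text \<open>A realization matrix is invertible at a suitable point of the graph, where the elements of \<open>I\<close> vanish. A factorization
  modulo \<open>I\<close> through a smaller size would survive there.\<close>

lemma full_of_graph:
  assumes e: "tame V h e" "nc_dom e \<noteq> {}" and R: "realizes e M c d w"
  shows "matrix_congruence.full I M"
proof -
  interpret matrix_congruence I by (rule matrix_congruence_I)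
  define m where "m = dim_row M"
  have M: "dim_row M = m" "dim_col M = m" using R by (auto simp: realizes_def m_def)
  have "m \<le> t" if fac: "fac M t" for t
  proof -
    obtain B C where B: "B \<in> carrier_mat m t" and C: "C \<in> carrier_mat t m" and eq: "cg M (B * C)"
      by (rule facE[OF fac, unfolded M])
    note [simp] = M carrier_matD[OF B] carrier_matD[OF C]
    let ?D = "M - B * C" and ?S = "{..<m} \<times> {..<m}"
    have "\<forall>ij\<in>?S. \<exists>e'. nc_dom e' \<noteq> {} \<and> tame V h e' \<and> (\<forall>n A. graph n A --> defined e' n A --> nc_poly_eval n A (?D $$ ij) = 0\<^sub>m n n)"
    proof
      fix ij assume "ij \<in> ?S"
      then obtain i j where ij: "ij = (i, j)" "i < m" "j < m" by auto
      have "?D $$ ij \<in> I" using cg_entry[OF eq, of i j] ij by (simp del: index_mult_mat(1))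
      then show "\<exists>e'. nc_dom e' \<noteq> {} \<and> tame V h e' \<and> (\<forall>n A. graph n A --> defined e' n A --> nc_poly_eval n A (?D $$ ij) = 0\<^sub>m n n)"
        by (rule I_vanishing) (intro exI conjI allI impI)
    qed
    then obtain E where E: "\<forall>ij\<in>?S. nc_dom (E ij) \<noteq> {} \<and> tame V h (E ij) \<and> (\<forall>n A. graph n A --> defined (E ij) n A --> nc_poly_eval n A (?D $$ ij) = 0\<^sub>m n n)"
      by (rule bchoice[THEN exE])
    have "generic (\<lambda>n A. defined e n A \<and> (\<forall>ij\<in>?S. defined (E ij) n A))"
    proof (rule generic_ball[of ?S "defined e" "\<lambda>ij. defined (E ij)"])
      show "generic (defined e)" by (rule generic_defined[OF e(2)])
      fix ij assume "ij \<in> ?S"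
      then have "nc_dom (E ij) \<noteq> {}" using bspec[OF E] by blast
      then show "generic (defined (E ij))" by (rule generic_defined)
    qed simp
    then obtain n A A' where A: "point n A" "defined e n A \<and> (\<forall>ij\<in>?S. defined (E ij) n A)" "graph n A'" "\<And>x. x \<in> V ==> A x = A' x"
      by (rule generic_graph) blast
    have A': "point n A'" using A(3) by (simp add: graph_def)
    have e': "defined e n A'" using A(2) tame_defined_cong[of V A A' h e n, OF A(4) e(1)] by simp
    have E0: "nc_poly_eval n A' (?D $$ ij) = 0\<^sub>m n n" if "ij \<in> ?S" for ij
    proof -
      have "defined (E ij) n A'" using A(2) that E tame_defined_cong[of V A A' h "E ij" n, OF A(4)] by blast
      then show ?thesis using E that A(3) by blast
    qed
    have "mev n A' ?D = 0\<^sub>m (m * n) (m * n)"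
    proof (rule eq_matI)
      fix i j assume "i < dim_row (0\<^sub>m (m * n) (m * n) :: 'k mat)" "j < dim_col (0\<^sub>m (m * n) (m * n) :: 'k mat)"
      then have ij: "i < m * n" "j < m * n" by simp_all
      note dm = divmod_less[OF ij(1)] divmod_less[OF ij(2)]
      have "mev n A' ?D $$ (i, j) = nc_poly_eval n A' (?D $$ (i div n, j div n)) $$ (i mod n, j mod n)"
        using ij by (intro mev_index) simp_all
      also have "\<dots> = 0" unfolding E0[of "(i div n, j div n)", OF SigmaI[OF lessThan_iff[THEN iffD2, OF dm(1)] lessThan_iff[THEN iffD2, OF dm(3)]]]
        using dm by simp
      finally show "mev n A' ?D $$ (i, j) = 0\<^sub>m (m * n) (m * n) $$ (i, j)" using ij by simp
    qed simp_all
    moreover have "mev n A' ?D = mev n A' M - mev n A' B * mev n A' C"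
      by (simp add: mev_diff[OF pointD(1)[OF A']] mev_mult[OF pointD(1)[OF A']])
    ultimately have eqM: "mev n A' M = mev n A' B * mev n A' C"
      using mat_diff_eq_0[of "mev n A' M" "mev n A' B * mev n A' C"] by simp
    have det: "det (mev n A' M) \<noteq> 0" using realizesD[OF R A' e'] by (simp add: realized_at_def)
    obtain K where K: "K \<in> carrier_mat (m * n) (m * n)" "mev n A' M * K = 1\<^sub>m (m * n)"
      by (rule det_nonzero_inverse[OF _ det, of "m * n"]) (auto intro!: carrier_matI)
    note [simp] = carrier_matD[OF K(1)]
    have "mev n A' B * (mev n A' C * K) = 1\<^sub>m (m * n)" using K(2) unfolding eqM by (simp add: mat_assoc)
    then have "m * n \<le> t * n"
      by (intro left_inverse_dim_le[of "mev n A' B" _ _ "mev n A' C * K"]) (auto intro!: carrier_matI)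
    then show "m \<le> t" using pointD(2)[OF A'] by simp
  qed
  then show ?thesis by (simp add: full_def M)
qed

text \<open>If \<open>I\<close> is the contraction of the ideal \<open>J\<close>, then the quotient by \<open>J\<close> receives both rings injectively, and hence so does the coproduct.\<close>

lemma faithful_of_contraction:
  assumes contr: "\<And>p. poly_fun p \<in> J ==> p \<in> I"
  shows "faithful_coproduct (free_alg V) (\<lambda>p. I +>\<^bsub>free_alg UNIV\<^esub> p) poly_fun (free_alg UNIV Quot I) (free_skew_field_le V h)"
proof -
  let ?F = "free_alg UNIV :: ('x, 'k) nc_poly ring" and ?T = "R Quot J" and ?K = "free_skew_field_le V h :: ('x, 'k) nc_ratfun ring"
  let ?q = "\<lambda>z. J +>\<^bsub>R\<^esub> z"
  have q: "?q \<in> Ring.ring_hom R ?T" by (rule J.rcos_ring_hom)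
  have T: "ring ?T" by (rule J.quotient_is_ring)
  note W_hom = nc_poly_ratfun_hom[of UNIV]
  have f2: "poly_fun \<in> Ring.ring_hom ?F R"
    using ring_hom_mult[OF W_hom] ring_hom_add[OF W_hom] ring_hom_one[OF W_hom]
    by (intro ring_hom_memI) (simp_all add: R_simps(2-5) R_carrier)
  define k where "k = (\<lambda>p. ?q (poly_fun p))"
  have k: "k \<in> Ring.ring_hom ?F ?T" using ring_hom_trans[OF f2 q] by (simp add: k_def comp_def)
  interpret k: ring_hom_ring ?F ?T k by (rule ring_hom_ringI2[OF ring_free_alg T k])
  have zero_T: "\<zero>\<^bsub>?T\<^esub> = J" by (simp add: FactRing_def)
  have q_iff: "?q z = J \<longleftrightarrow> z \<in> J" if "z \<in> carrier R" for z
    using J.a_rcos_self[OF that] J.a_rcos_const[of z] by auto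
  have ker: "a_kernel ?F ?T k = I"
  proof (intro equalityI subsetI)
    fix p assume "p \<in> a_kernel ?F ?T k"
    then have "?q (poly_fun p) = J" by (simp add: a_kernel_def' zero_T k_def)
    then show "p \<in> I" using q_iff[OF R_carrier(2)] contr by simp
  next
    fix p assume "p \<in> I"
    then have "?q (poly_fun p) = J" using q_iff[OF R_carrier(2)] I_J by simp
    then show "p \<in> a_kernel ?F ?T k" by (simp add: a_kernel_def' zero_T k_def)
  qed
  define g1 where "g1 = (\<lambda>Z. the_elem (k ` Z))"
  have g1: "g1 \<in> Ring.ring_hom (?F Quot I) ?T" using k.the_elem_hom by (simp add: g1_def ker)
  have g1_simp: "g1 (I +>\<^bsub>?F\<^esub> p) = k p" for p using k.the_elem_simp[of p] by (simp add: g1_def ker)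
  have g1_inj: "Z = Z'" if "Z \<in> carrier (?F Quot I)" "Z' \<in> carrier (?F Quot I)" "g1 Z = g1 Z'" for Z Z'
    using k.the_elem_inj[of Z Z'] that by (simp add: g1_def ker)
  have K_carrier: "f \<in> carrier R" "f \<in> carrier W" if "f \<in> carrier ?K" for f
    using that R_carrier(1)[of f] generators_carrier by auto
  have g2: "?q \<in> Ring.ring_hom ?K ?T"
  proof (rule ring_hom_memI)
    fix f g assume fg: "f \<in> carrier ?K" "g \<in> carrier ?K"
    note fg' = K_carrier(1)[OF fg(1)] K_carrier(1)[OF fg(2)]
    show "?q f \<in> carrier ?T" by (rule ring_hom_closed[OF q fg'(1)])
    show "?q (f \<otimes>\<^bsub>?K\<^esub> g) = ?q f \<otimes>\<^bsub>?T\<^esub> ?q g" using ring_hom_mult[OF q fg'] by (simp add: R_simps(2))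
    show "?q (f \<oplus>\<^bsub>?K\<^esub> g) = ?q f \<oplus>\<^bsub>?T\<^esub> ?q g" using ring_hom_add[OF q fg'] by (simp add: R_simps(3))
  next
    show "?q \<one>\<^bsub>?K\<^esub> = \<one>\<^bsub>?T\<^esub>" using ring_hom_one[OF q] by (simp add: R_simps(4))
  qed
  have g2_inj: "f = g" if fg: "f \<in> carrier ?K" "g \<in> carrier ?K" and eq: "?q f = ?q g" for f g
  proof -
    have "f \<in> ?q g" using J.a_rcos_self[OF K_carrier(1)[OF fg(1)]] eq by simp
    then obtain i where i: "i \<in> J" "f = i \<oplus>\<^bsub>W\<^esub> g" unfolding a_r_coset_def' R_simps(3) by blast
    have iW: "i \<in> carrier W"
      using subsetD[OF J.a_subset i(1)] subringE(1)[OF subring_R] by (auto simp: R_simps(1))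
    have "f \<oplus>\<^bsub>W\<^esub> (\<ominus>\<^bsub>W\<^esub> g) \<in> ratfuns_le V h"
      using fg subringE(7)[OF subring_ratfuns_le[of V h], of f "\<ominus>\<^bsub>W\<^esub> g"] subringE(5)[OF subring_ratfuns_le[of V h], of g] by simp
    moreover have "f \<oplus>\<^bsub>W\<^esub> (\<ominus>\<^bsub>W\<^esub> g) = i"
      unfolding i(2) using iW K_carrier(2)[OF fg(2)] by (simp add: W.a_assoc W.r_neg)
    ultimately have "i = \<zero>\<^bsub>W\<^esub>" using J_ratfuns_le[OF i(1)] by simp
    then show "f = g" using i(2) K_carrier(2)[OF fg(2)] by simp
  qed
  have R1: "ring (?F Quot I)" by (rule I.quotient_is_ring)
  have R2: "ring ?K" by (rule W.subring_is_ring[OF subring_ratfuns_le])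
  have f1: "(\<lambda>p. I +>\<^bsub>?F\<^esub> p) \<in> Ring.ring_hom (free_alg V) (?F Quot I)"
    using ring_hom_closed[OF I.rcos_ring_hom] ring_hom_mult[OF I.rcos_ring_hom] ring_hom_add[OF I.rcos_ring_hom] ring_hom_one[OF I.rcos_ring_hom]
    by (intro ring_hom_memI) simp_all
  have f2': "poly_fun \<in> Ring.ring_hom (free_alg V) ?K"
  proof (rule ring_hom_memI)
    fix p assume "p \<in> carrier (free_alg V :: ('x, 'k) nc_poly ring)"
    then have "poly_fun p \<in> ratfuns_le V h" unfolding ratfuns_le_iff by (intro exI[of _ "NC_Poly p"]) (simp add: nc_dom_ops(1))
    then show "poly_fun p \<in> carrier ?K" by simp
  qed (use ring_hom_mult[OF W_hom] ring_hom_add[OF W_hom] ring_hom_one[OF W_hom] in simp_all)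
  have agree: "g1 (I +>\<^bsub>?F\<^esub> s) = ?q (poly_fun s)" for s by (simp add: g1_simp k_def)
  obtain u where u: "\<forall>a\<in>carrier (?F Quot I). u (coproduct_in1 (free_alg V) (\<lambda>p. I +>\<^bsub>?F\<^esub> p) poly_fun (?F Quot I) ?K a) = g1 a"
    "\<forall>b\<in>carrier ?K. u (coproduct_in2 (free_alg V) (\<lambda>p. I +>\<^bsub>?F\<^esub> p) poly_fun (?F Quot I) ?K b) = ?q b"
    using coproduct_universal[OF R1 R2 f1 f2' T g1 g2 agree] by (elim bexE conjE) (rule that)
  show ?thesis
    unfolding faithful_coproduct_def
  proof (intro conjI inj_onI)
    fix x y assume xy: "x \<in> carrier (?F Quot I)" "y \<in> carrier (?F Quot I)"
      "coproduct_in1 (free_alg V) (\<lambda>p. I +>\<^bsub>?F\<^esub> p) poly_fun (?F Quot I) ?K x = coproduct_in1 (free_alg V) (\<lambda>p. I +>\<^bsub>?F\<^esub> p) poly_fun (?F Quot I) ?K y"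
    have "g1 x = g1 y" using bspec[OF u(1) xy(1)] bspec[OF u(1) xy(2)] xy(3) by simp
    then show "x = y" by (rule g1_inj[OF xy(1,2)])
  next
    fix x y assume xy: "x \<in> carrier ?K" "y \<in> carrier ?K"
      "coproduct_in2 (free_alg V) (\<lambda>p. I +>\<^bsub>?F\<^esub> p) poly_fun (?F Quot I) ?K x = coproduct_in2 (free_alg V) (\<lambda>p. I +>\<^bsub>?F\<^esub> p) poly_fun (?F Quot I) ?K y"
    have "?q x = ?q y" using bspec[OF u(2) xy(1)] bspec[OF u(2) xy(2)] xy(3) by simp
    then show "x = y" by (rule g2_inj[OF xy(1,2)])
  qed
qed

lemma quotient_presentation: "ring_presentation (free_alg UNIV Quot I) (\<lambda>p. I +>\<^bsub>free_alg UNIV\<^esub> p)"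
proof -
  interpret Q: ring "free_alg UNIV Quot I" by (rule I.quotient_is_ring)
  show ?thesis
  proof
    fix a b :: "('x, 'k) nc_poly"
    show "I +>\<^bsub>free_alg UNIV\<^esub> (a + b) = (I +>\<^bsub>free_alg UNIV\<^esub> a) \<oplus>\<^bsub>free_alg UNIV Quot I\<^esub> (I +>\<^bsub>free_alg UNIV\<^esub> b)"
      using ring_hom_add[OF I.rcos_ring_hom, of a b] by simp
    show "I +>\<^bsub>free_alg UNIV\<^esub> (a * b) = (I +>\<^bsub>free_alg UNIV\<^esub> a) \<otimes>\<^bsub>free_alg UNIV Quot I\<^esub> (I +>\<^bsub>free_alg UNIV\<^esub> b)"
      using ring_hom_mult[OF I.rcos_ring_hom, of a b] by simp
    show "I +>\<^bsub>free_alg UNIV\<^esub> 1 = \<one>\<^bsub>free_alg UNIV Quot I\<^esub>" using ring_hom_one[OF I.rcos_ring_hom] by simp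
    show "range (\<lambda>p. I +>\<^bsub>free_alg UNIV\<^esub> p) = carrier (free_alg UNIV Quot I)" by (auto simp: FactRing_def A_RCOSETS_def')
  qed
qed

lemma coset_zero_iff: "I +>\<^bsub>free_alg UNIV\<^esub> p = \<zero>\<^bsub>free_alg UNIV Quot I\<^esub> \<longleftrightarrow> p \<in> I"
  using I.a_rcos_self[of p] I.a_rcos_const[of p] by (auto simp: FactRing_def)

text \<open>Both cases supply a Sylvester domain that contains \<open>k\<langle>X\<rangle> / I\<close> and the fullness of the realizations of inverses.\<close>

lemma faithful_of_sylvester:
  assumes "fir (free_alg UNIV Quot I) \<or> sylvester_domain (free_alg UNIV Quot I)"
  shows "faithful_coproduct (free_alg V) (\<lambda>p. I +>\<^bsub>free_alg UNIV\<^esub> p) poly_fun (free_alg UNIV Quot I) (free_skew_field_le V h)"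
proof -
  interpret P: ring_presentation "free_alg UNIV Quot I" "\<lambda>p. I +>\<^bsub>free_alg UNIV\<^esub> p" by (rule quotient_presentation)
  have kernel: "P.kernel = I" by (auto simp: P.kernel_def coset_zero_iff)
  have syl: "1 \<notin> I" "matrix_congruence.sylvester I"
    using assms P.left_fir_sylvester P.sylvester_domain_sylvester unfolding kernel fir_def by blast+
  have map_id: "map_mat (\<lambda>p. p) M = M" for M :: "('x, 'k) nc_poly mat" by (intro eq_matI) auto
  show ?thesis
  proof (rule faithful_of_contraction, rule contraction[OF matrix_congruence_I, where \<tau> = "\<lambda>p. p"])
    fix b :: "('x, 'k) nc_expr" assume b: "nc_expr_vars b \<subseteq> V" "Suc (nc_expr_height b) \<le> h" "nc_dom (NC_Inv b) \<noteq> {}"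
    obtain M c d w where R: "realizes (NC_Inv b) M c d w" using realization_exists by blast
    have "matrix_congruence.full I M" by (rule full_of_graph[OF _ b(3) R]) (simp add: b)
    with R show "\<exists>M c d w. realizes (NC_Inv b) M c d w \<and> matrix_congruence.full I (map_mat (\<lambda>p. p) M)"
      unfolding map_id by (intro exI conjI)
  qed (use I.zero_closed syl in simp_all)
qed

lemma height_0_polynomial:
  "nc_expr_height b = 0 ==> \<exists>p. nc_poly_vars p \<subseteq> nc_expr_vars b \<and> (\<forall>n A. point n A --> nc_expr_eval n A b = Some (nc_poly_eval n A p))"
  for b :: "('x, 'k) nc_expr"
proof (induction b)
  case (NC_Poly q)
  show ?case by (intro exI[of _ q]) simp
next
  case (NC_Add a b)
  then obtain p q where "nc_poly_vars p \<subseteq> nc_expr_vars a" "\<forall>n A. point n A --> nc_expr_eval n A a = Some (nc_poly_eval n A p)"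
    "nc_poly_vars q \<subseteq> nc_expr_vars b" "\<forall>n A. point n A --> nc_expr_eval n A b = Some (nc_poly_eval n A q)" by auto
  moreover have "nc_poly_eval n A (p + q) = nc_poly_eval n A p + nc_poly_eval n A q" if "point n A" for n and A :: "'x => 'k mat"
    by (rule nc_poly_eval_add[OF pointD(1)[OF that]])
  ultimately show ?case using nc_poly_vars_add[of p q] by (intro exI[of _ "p + q"]) auto
next
  case (NC_Mult a b)
  then obtain p q where "nc_poly_vars p \<subseteq> nc_expr_vars a" "\<forall>n A. point n A --> nc_expr_eval n A a = Some (nc_poly_eval n A p)"
    "nc_poly_vars q \<subseteq> nc_expr_vars b" "\<forall>n A. point n A --> nc_expr_eval n A b = Some (nc_poly_eval n A q)" by auto
  moreover have "nc_poly_eval n A (p * q) = nc_poly_eval n A p * nc_poly_eval n A q" if "point n A" for n and A :: "'x => 'k mat"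
    by (rule nc_poly_eval_mult[OF pointD(1)[OF that]])
  ultimately show ?case using nc_poly_vars_mult[of p q] by (intro exI[of _ "p * q"]) auto
qed simp

text \<open>For an inverse of a polynomial the realization of size one is used, which is visibly full.\<close>

lemma realizes_inverse_polynomial:
  fixes b :: "('x, 'k) nc_expr"
  assumes ev: "\<And>n A. point n A ==> nc_expr_eval n A b = Some (nc_poly_eval n A p)"
  shows "realizes (NC_Inv b) (entry_mat p) (entry_mat (-1)) (entry_mat 1) (0\<^sub>m 1 1)"
  unfolding realizes_def
proof (intro conjI allI impI)
  fix n and A :: "'x => 'k mat" assume A: "point n A" and D: "defined (NC_Inv b) n A"
  then obtain K where K: "mat_inverse (nc_poly_eval n A p) = Some K" using ev[OF A] by (auto simp: defined_def)
  then have K': "K \<in> carrier_mat n n" "nc_poly_eval n A p * K = 1\<^sub>m n" unfolding mat_inverse_iff[OF nc_poly_eval_carrier(1)] by simp_all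
  note [simp] = carrier_matD[OF K'(1)]
  show "realized_at (NC_Inv b) (entry_mat p) (entry_mat (-1)) (entry_mat 1) (0\<^sub>m 1 1) n A"
  proof (rule realized_atI[where Y = K and v = K])
    show "det (mev n A (entry_mat p)) \<noteq> 0" unfolding mev_entry by (rule inverse_det_nonzero[OF nc_poly_eval_carrier(1) K'])
    show "mev n A (entry_mat p) * K = mev n A (entry_mat 1)" by (simp add: mev_entry K'(2) nc_poly_eval_1[OF pointD(1)[OF A]])
    have "- 1\<^sub>m n * K = - K" by simp
    then show "K = mev n A (0\<^sub>m 1 1) - mev n A (entry_mat (-1)) * K"
      by (simp add: mev_entry nc_poly_eval_uminus[OF pointD(1)[OF A]] nc_poly_eval_1[OF pointD(1)[OF A]] del: One_nat_def) (intro eq_matI; simp)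
  qed (use ev[OF A] K in simp_all)
qed (auto intro!: carrier_matI)

lemma faithful_of_skew_field:
  fixes D :: "'d ring"
  assumes h1: "h \<le> 1" and D: "skew_field D" and \<phi>: "\<phi> \<in> Ring.ring_hom (free_alg UNIV Quot I) D" "inj_on \<phi> (carrier (free_alg UNIV Quot I))"
  shows "faithful_coproduct (free_alg V) (\<lambda>p. I +>\<^bsub>free_alg UNIV\<^esub> p) poly_fun (free_alg UNIV Quot I) (free_skew_field_le V h)"
proof -
  interpret D: ring D using D by (simp add: skew_field_def)
  define g where "g = (\<lambda>x. if x \<in> carrier D then x else \<zero>\<^bsub>D\<^esub>)"
  have g: "g x \<in> carrier D" for x by (simp add: g_def)
  define e where "e = lift_poly D g"
  have hom: "e \<in> Ring.ring_hom (free_alg UNIV) D" unfolding e_def by (rule lift_poly_hom[where g = g, OF D.ring_axioms g])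
  have var: "e (nc_var x) = x" if "x \<in> carrier D" for x
    unfolding e_def using lift_poly_var[where g = g and x = x, OF D.ring_axioms g] that by (simp add: g_def)
  interpret P: ring_presentation D e
  proof
    fix a b :: "('d, int) nc_poly"
    show "e (a + b) = e a \<oplus>\<^bsub>D\<^esub> e b" using ring_hom_add[OF hom, of a b] by simp
    show "e (a * b) = e a \<otimes>\<^bsub>D\<^esub> e b" using ring_hom_mult[OF hom, of a b] by simp
    show "e 1 = \<one>\<^bsub>D\<^esub>" using ring_hom_one[OF hom] by simp
    show "range e = carrier D"
    proof (intro equalityI subsetI)
      fix x assume "x \<in> carrier D"
      from var[OF this] show "x \<in> range e" by (metis rangeI)
    qed (use ring_hom_closed[OF hom] in auto)
  qed
  interpret Q: ring_presentation "free_alg UNIV Quot I" "\<lambda>p. I +>\<^bsub>free_alg UNIV\<^esub> p" by (rule quotient_presentation)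
  define \<theta> where "\<theta> p = \<phi> (I +>\<^bsub>free_alg UNIV\<^esub> p)" for p
  have \<theta>: "\<theta> p \<in> carrier D" "\<theta> (p + q) = \<theta> p \<oplus>\<^bsub>D\<^esub> \<theta> q" "\<theta> (p * q) = \<theta> p \<otimes>\<^bsub>D\<^esub> \<theta> q" "\<theta> 1 = \<one>\<^bsub>D\<^esub>" for p q
    using ring_hom_closed[OF \<phi>(1)] ring_hom_add[OF \<phi>(1)] ring_hom_mult[OF \<phi>(1)] ring_hom_one[OF \<phi>(1)]
    by (simp_all add: \<theta>_def Q.e_add Q.e_mult Q.e_one)
  have \<theta>_zero: "\<theta> p = \<zero>\<^bsub>D\<^esub> \<longleftrightarrow> p \<in> I" for p
  proof -
    have "\<phi> \<zero>\<^bsub>free_alg UNIV Quot I\<^esub> = \<zero>\<^bsub>D\<^esub>" by (rule ring_hom_zero[OF \<phi>(1) Q.R.ring_axioms D.ring_axioms])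
    then have "\<theta> p = \<zero>\<^bsub>D\<^esub> \<longleftrightarrow> I +>\<^bsub>free_alg UNIV\<^esub> p = \<zero>\<^bsub>free_alg UNIV Quot I\<^esub>"
      using inj_onD[OF \<phi>(2), of "I +>\<^bsub>free_alg UNIV\<^esub> p" "\<zero>\<^bsub>free_alg UNIV Quot I\<^esub>"] Q.e_closed[of p] by (auto simp: \<theta>_def)
    then show ?thesis by (simp add: coset_zero_iff)
  qed
  let ?\<tau> = "\<lambda>p. nc_var (\<theta> p) :: ('d, int) nc_poly"
  have ker: "?\<tau> p \<in> P.kernel \<longleftrightarrow> p \<in> I" for p by (simp add: P.kernel_iff0 var \<theta>(1) \<theta>_zero)
  show ?thesis
  proof (rule faithful_of_contraction, rule contraction[OF P.matrix_congruence_axioms, where \<tau> = ?\<tau>])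
    fix b :: "('x, 'k) nc_expr" assume b: "nc_expr_vars b \<subseteq> V" "Suc (nc_expr_height b) \<le> h" "nc_dom (NC_Inv b) \<noteq> {}"
    then have "nc_expr_height b = 0" using h1 by simp
    then obtain p where p: "nc_poly_vars p \<subseteq> nc_expr_vars b" "\<And>n A. point n A ==> nc_expr_eval n A b = Some (nc_poly_eval n A p)"
      using height_0_polynomial by blast
    note R = realizes_inverse_polynomial[OF p(2)]
    have "p \<noteq> 0"
    proof
      assume 0: "p = 0"
      obtain n A where A: "point n A" "defined (NC_Inv b) n A" by (rule generic_obtains[OF generic_defined[OF b(3)]])
      have "mat_inverse (0\<^sub>m n n :: 'k mat) \<noteq> None"
        using A(2) p(2)[OF A(1)] by (simp add: defined_def 0 nc_poly_eval_0[OF pointD(1)[OF A(1)]])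
      then obtain K where K: "mat_inverse (0\<^sub>m n n :: 'k mat) = Some K" by blast
      then have "K \<in> carrier_mat n n \<and> 0\<^sub>m n n * K = 1\<^sub>m n" unfolding mat_inverse_iff[OF zero_carrier_mat] .
      then show False using zero_mat_not_invertible[OF pointD(2)[OF A(1)]] by blast
    qed
    moreover have "p \<in> carrier (free_alg V)" using p(1) b(1) by auto
    ultimately have "p \<notin> I" using frr unfolding frr_def by blast
    then have pk: "?\<tau> p \<notin> P.kernel" by (simp add: ker)
    have "P.full (map_mat ?\<tau> (entry_mat p))"
      unfolding P.full_def
    proof (intro conjI allI impI)
      fix t assume "P.fac (map_mat ?\<tau> (entry_mat p)) t"
      then obtain B C where BC: "B \<in> carrier_mat 1 t" "C \<in> carrier_mat t 1" and eq: "P.cg (map_mat ?\<tau> (entry_mat p)) (B * C)"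
        by (rule P.facE) simp
      have "t \<noteq> 0"
      proof
        assume "t = 0"
        then have "(B * C) $$ (0, 0) = 0" using BC by (simp add: scalar_prod_def)
        then show False using P.cg_entry[OF eq, of 0 0] pk by (simp add: entry_mat_def del: index_mult_mat(1))
      qed
      then show "dim_row (map_mat ?\<tau> (entry_mat p)) \<le> t" by simp
    qed simp
    with R show "\<exists>M c d w. realizes (NC_Inv b) M c d w \<and> P.full (map_mat ?\<tau> M)" by (intro exI conjI)
  qed (use P.skew_field_sylvester[OF D] ker in \<open>simp_all add: P.kernel_iff P.e_add P.e_mult P.e_one var \<theta>\<close>)
qed

end

theorem proposition2p6:
  fixes V :: "'x::finite set"
    and r :: "'x \<Rightarrow> ('x, 'k::field_char_0) nc_ratfun"
    and I :: "('x, 'k) nc_poly set"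
  assumes "frr V r I"
    and "fir (free_alg UNIV Quot I) \<or> sylvester_domain (free_alg UNIV Quot I) \<or>
      (resolvent_height V r \<le> 1 \<and>
       (\<exists>(D :: 'd ring) \<phi>. skew_field D \<and> \<phi> \<in> Ring.ring_hom (free_alg UNIV Quot I) D \<and>
          inj_on \<phi> (carrier (free_alg UNIV Quot I))))"
  shows "faithful_coproduct (free_alg V)
    (\<lambda>p. I +>\<^bsub>free_alg UNIV\<^esub> p) (\<lambda>p. ratfun_of (NC_Poly p))
    (free_alg UNIV Quot I) (free_skew_field_le V (resolvent_height V r))"
proof -
  interpret frr_ideal V r I by unfold_locales (rule assms(1))
  show ?thesis using assms(2) faithful_of_sylvester faithful_of_skew_field by blast
qed

end
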